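(* Let $\Omega$ be a bounded domain in $\mathbb{R}^3$ of class $\mathcal{C}^{1,1}$. Let $\lambda$ be a Maxwell eigenvalue on $\Omega$ and let $E\in X_N(\operatorname{div}0,\Omega)$ be a corresponding nontrivial eigenvector normalized in $(L^2(\Omega))^3$. Assume that $E\in H^2(\Omega)$ (componentwise). Then $$\lambda=\frac12\int_{\partial\Omega}\left(|\operatorname{curl}E|^2-\lambda|E|^2\right)(x\cdot\nu)\,d\sigma,$$ where $\nu$ is the unit outer normal to $\partial\Omega$.
   Context: A domain is a connected open set. All functions are real-valued. $H_0(\operatorname{curl},\Omega)$ is the closure of $(\mathcal{C}^\infty_c(\Omega))^3$ in $H(\operatorname{curl},\Omega)=\{u\in (L^2(\Omega))^3:\operatorname{curl}u\in (L^2(\Omega))^3\}$ with its graph norm; $H(\operatorname{div},\Omega)=\{u\in (L^2(\Omega))^3:\operatorname{div}u\in L^2(\Omega)\}$; $X_N(\Omega)=H_0(\operatorname{curl},\Omega)\cap H(\operatorname{div},\Omega)$; $X_N(\operatorname{div}0,\Omega)=\{u\in X_N(\Omega):\operatorname{div}u=0\}$. A Maxwell eigenvalue $\lambda\in\mathbb{R}$ with (electric) Maxwell eigenvector $E\in X_N(\operatorname{div}0,\Omega)$, $E\ne0$, is one for which, with $\tau>0$ fixed, $$\int_\Omega\operatorname{curl}E\cdot\operatorname{curl}\varphi\,dx+\tau\int_\Omega\operatorname{div}E\,\operatorname{div}\varphi\,dx=\lambda\int_\Omega E\cdot\varphi\,dx\quad\text{for all }\varphi\in X_N(\Omega)$$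 (the second term vanishes because $\operatorname{div}E=0$); i.e. a weak solution of $\operatorname{curl}\operatorname{curl}E=\lambda E$, $\operatorname{div}E=0$ in $\Omega$, $\nu\times E=0$ on $\partial\Omega$. *)

theory Defs
  imports "HOL-Analysis.Analysis"
begin

definition partial :: "'n::finite \<Rightarrow> (real^'n \<Rightarrow> real) \<Rightarrow> real^'n \<Rightarrow> real" where
  "partial i f x = frechet_derivative f (at x) (axis i 1)"

definition grad :: "(real^'n::finite \<Rightarrow> real) \<Rightarrow> real^'n \<Rightarrow> real^'n" where
  "grad f x = (\<chi> i. partial i f x)"

definition curl :: "(real^3 \<Rightarrow> real^3) \<Rightarrow> real^3 \<Rightarrow> real^3" where
  "curl F x = vector
     [partial 2 (\<lambda>y. F y $ 3) x - partial 3 (\<lambda>y. F y $ 2) x,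
      partial 3 (\<lambda>y. F y $ 1) x - partial 1 (\<lambda>y. F y $ 3) x,
      partial 1 (\<lambda>y. F y $ 2) x - partial 2 (\<lambda>y. F y $ 1) x]"

fun C_k :: "nat \<Rightarrow> (real^'n::finite \<Rightarrow> real) \<Rightarrow> bool" where
  "C_k 0 f \<longleftrightarrow> continuous_on UNIV f"
| "C_k (Suc k) f \<longleftrightarrow> (\<forall>x. f differentiable (at x)) \<and> (\<forall>i. C_k k (partial i f))"

definition smooth :: "(real^'n::finite \<Rightarrow> real) \<Rightarrow> bool" where
  "smooth f \<longleftrightarrow> (\<forall>k. C_k k f)"

definition test_function :: "(real^'n::finite) set \<Rightarrow> (real^'n \<Rightarrow> real) \<Rightarrow> bool" where
  "test_function \<Omega> \<phi> \<longleftrightarrow>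
     smooth \<phi> \<and> compact (closure {x. \<phi> x \<noteq> 0}) \<and> closure {x. \<phi> x \<noteq> 0} \<subseteq> \<Omega>"

definition test_field :: "(real^3) set \<Rightarrow> (real^3 \<Rightarrow> real^3) \<Rightarrow> bool" where
  "test_field \<Omega> \<phi> \<longleftrightarrow> (\<forall>i. test_function \<Omega> (\<lambda>x. \<phi> x $ i))"

text \<open>
  Elements of function spaces are represented by total functions; only their values almost
  everywhere on the underlying measure space matter. The weak operators \<open>weak_partial\<close>,
  \<open>weak_curl\<close> and \<open>weak_div\<close> choose a representative, and are meaningful only for functions
  whose weak derivative exists in L2.
\<close>

definition L2 :: "'a measure \<Rightarrow> ('a \<Rightarrow> 'b::euclidean_space) set" where
  "L2 M = {u. u \<in> borel_measurable M \<and> integrable M (\<lambda>x. (norm (u x))\<^sup>2)}"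

definition has_weak_partial ::
  "(real^'n::finite) set \<Rightarrow> 'n \<Rightarrow> (real^'n \<Rightarrow> real) \<Rightarrow> (real^'n \<Rightarrow> real) \<Rightarrow> bool" where
  "has_weak_partial \<Omega> i u v \<longleftrightarrow>
     (\<forall>\<phi>. test_function \<Omega> \<phi> \<longrightarrow>
        (LINT x|lebesgue_on \<Omega>. u x * partial i \<phi> x) = - (LINT x|lebesgue_on \<Omega>. v x * \<phi> x))"

definition has_weak_curl ::
  "(real^3) set \<Rightarrow> (real^3 \<Rightarrow> real^3) \<Rightarrow> (real^3 \<Rightarrow> real^3) \<Rightarrow> bool" where
  "has_weak_curl \<Omega> u w \<longleftrightarrow>
     (\<forall>\<phi>. test_field \<Omega> \<phi> \<longrightarrow>
        (LINT x|lebesgue_on \<Omega>. u x \<bullet> curl \<phi> x) = (LINT x|lebesgue_on \<Omega>. w x \<bullet> \<phi> x))"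

definition has_weak_div ::
  "(real^3) set \<Rightarrow> (real^3 \<Rightarrow> real^3) \<Rightarrow> (real^3 \<Rightarrow> real) \<Rightarrow> bool" where
  "has_weak_div \<Omega> u d \<longleftrightarrow>
     (\<forall>\<phi>. test_function \<Omega> \<phi> \<longrightarrow>
        (LINT x|lebesgue_on \<Omega>. u x \<bullet> grad \<phi> x) = - (LINT x|lebesgue_on \<Omega>. d x * \<phi> x))"

definition weak_partial ::
  "(real^'n::finite) set \<Rightarrow> 'n \<Rightarrow> (real^'n \<Rightarrow> real) \<Rightarrow> real^'n \<Rightarrow> real" where
  "weak_partial \<Omega> i u = (SOME v. v \<in> L2 (lebesgue_on \<Omega>) \<and> has_weak_partial \<Omega> i u v)"

definition weak_curl :: "(real^3) set \<Rightarrow> (real^3 \<Rightarrow> real^3) \<Rightarrow> real^3 \<Rightarrow> real^3" where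
  "weak_curl \<Omega> u = (SOME w. w \<in> L2 (lebesgue_on \<Omega>) \<and> has_weak_curl \<Omega> u w)"

definition weak_div :: "(real^3) set \<Rightarrow> (real^3 \<Rightarrow> real^3) \<Rightarrow> real^3 \<Rightarrow> real" where
  "weak_div \<Omega> u = (SOME d. d \<in> L2 (lebesgue_on \<Omega>) \<and> has_weak_div \<Omega> u d)"

fun sobolev :: "nat \<Rightarrow> (real^'n::finite) set \<Rightarrow> (real^'n \<Rightarrow> real) set" where
  "sobolev 0 \<Omega> = L2 (lebesgue_on \<Omega>)"
| "sobolev (Suc k) \<Omega> =
     {u \<in> L2 (lebesgue_on \<Omega>). \<forall>i. \<exists>v \<in> sobolev k \<Omega>. has_weak_partial \<Omega> i u v}"

definition H1_norm :: "(real^'n::finite) set \<Rightarrow> (real^'n \<Rightarrow> real) \<Rightarrow> real" where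
  "H1_norm \<Omega> u = sqrt ((LINT x|lebesgue_on \<Omega>. (u x)\<^sup>2)
                       + (\<Sum>i\<in>UNIV. LINT x|lebesgue_on \<Omega>. (weak_partial \<Omega> i u x)\<^sup>2))"

definition H_curl :: "(real^3) set \<Rightarrow> (real^3 \<Rightarrow> real^3) set" where
  "H_curl \<Omega> = {u \<in> L2 (lebesgue_on \<Omega>). \<exists>w \<in> L2 (lebesgue_on \<Omega>). has_weak_curl \<Omega> u w}"

definition H_div :: "(real^3) set \<Rightarrow> (real^3 \<Rightarrow> real^3) set" where
  "H_div \<Omega> = {u \<in> L2 (lebesgue_on \<Omega>). \<exists>d \<in> L2 (lebesgue_on \<Omega>). has_weak_div \<Omega> u d}"

definition H_curl_norm :: "(real^3) set \<Rightarrow> (real^3 \<Rightarrow> real^3) \<Rightarrow> real" where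
  "H_curl_norm \<Omega> u = sqrt ((LINT x|lebesgue_on \<Omega>. (norm (u x))\<^sup>2)
                           + (LINT x|lebesgue_on \<Omega>. (norm (weak_curl \<Omega> u x))\<^sup>2))"

definition H0_curl :: "(real^3) set \<Rightarrow> (real^3 \<Rightarrow> real^3) set" where
  "H0_curl \<Omega> = {u \<in> H_curl \<Omega>.
     \<forall>\<epsilon>>0. \<exists>\<phi>. test_field \<Omega> \<phi> \<and> H_curl_norm \<Omega> (\<lambda>x. u x - \<phi> x) < \<epsilon>}"

definition X_N :: "(real^3) set \<Rightarrow> (real^3 \<Rightarrow> real^3) set" where
  "X_N \<Omega> = H0_curl \<Omega> \<inter> H_div \<Omega>"

definition X_N_div0 :: "(real^3) set \<Rightarrow> (real^3 \<Rightarrow> real^3) set" where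
  "X_N_div0 \<Omega> = {u \<in> X_N \<Omega>. AE x in lebesgue_on \<Omega>. weak_div \<Omega> u x = 0}"

definition maxwell_eigenpair ::
  "real \<Rightarrow> (real^3) set \<Rightarrow> real \<Rightarrow> (real^3 \<Rightarrow> real^3) \<Rightarrow> bool" where
  "maxwell_eigenpair \<tau> \<Omega> lam E \<longleftrightarrow>
     E \<in> X_N_div0 \<Omega> \<and> \<not> (AE x in lebesgue_on \<Omega>. E x = 0) \<and>
     (\<forall>\<phi>\<in>X_N \<Omega>.
        (LINT x|lebesgue_on \<Omega>. weak_curl \<Omega> E x \<bullet> weak_curl \<Omega> \<phi> x)
        + \<tau> * (LINT x|lebesgue_on \<Omega>. weak_div \<Omega> E x * weak_div \<Omega> \<phi> x)
        = lam * (LINT x|lebesgue_on \<Omega>. E x \<bullet> \<phi> x))"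

definition C11_on :: "(real^'n::finite) set \<Rightarrow> (real^'n \<Rightarrow> real) \<Rightarrow> bool" where
  "C11_on S \<gamma> \<longleftrightarrow>
     (\<forall>y\<in>S. \<gamma> differentiable (at y)) \<and> (\<exists>L. L-lipschitz_on S (grad \<gamma>))"

text \<open>The point with coordinates \<open>(y, s)\<close> in the orthonormal frame with origin \<open>p\<close> and axes
  the columns of \<open>Q\<close>.\<close>

definition frame_point :: "real^3^3 \<Rightarrow> real^3 \<Rightarrow> real^2 \<Rightarrow> real \<Rightarrow> real^3" where
  "frame_point Q p y s = p + Q *v vector [y $ 1, y $ 2, s]"

definition cylinder :: "real^3^3 \<Rightarrow> real^3 \<Rightarrow> real \<Rightarrow> real \<Rightarrow> (real^3) set" where
  "cylinder Q p r h = {frame_point Q p y s | y s. y \<in> ball 0 r \<and> \<bar>s\<bar> < h}"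

text \<open>Inside the cylinder, \<open>\<Omega>\<close> is the strict subgraph and its boundary is the graph of \<open>\<gamma>\<close>.\<close>

definition C11_chart ::
  "(real^3) set \<Rightarrow> real^3^3 \<Rightarrow> real^3 \<Rightarrow> real \<Rightarrow> real \<Rightarrow> (real^2 \<Rightarrow> real) \<Rightarrow> bool" where
  "C11_chart \<Omega> Q p r h \<gamma> \<longleftrightarrow>
     orthogonal_matrix Q \<and> 0 < r \<and> 0 < h \<and> C11_on (ball 0 r) \<gamma> \<and>
     (\<forall>y\<in>ball 0 r. \<bar>\<gamma> y\<bar> < h \<and>
        (\<forall>s. \<bar>s\<bar> < h \<longrightarrow>
           (frame_point Q p y s \<in> \<Omega> \<longleftrightarrow> s < \<gamma> y) \<and>
           (frame_point Q p y s \<in> frontier \<Omega> \<longleftrightarrow> s = \<gamma> y)))"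

definition C11_domain :: "(real^3) set \<Rightarrow> bool" where
  "C11_domain \<Omega> \<longleftrightarrow> open \<Omega> \<and> connected \<Omega> \<and>
     (\<forall>x\<in>frontier \<Omega>. \<exists>Q p r h \<gamma>. C11_chart \<Omega> Q p r h \<gamma> \<and> x \<in> cylinder Q p r h)"

text \<open>The surface measure is the Borel measure carried by the boundary which in every chart is
  the surface area of a graph.\<close>

definition is_surface_measure :: "(real^3) set \<Rightarrow> (real^3) measure \<Rightarrow> bool" where
  "is_surface_measure \<Omega> \<sigma> \<longleftrightarrow>
     sets \<sigma> = sets borel \<and> emeasure \<sigma> (- frontier \<Omega>) = 0 \<and>
     (\<forall>Q p r h \<gamma>. C11_chart \<Omega> Q p r h \<gamma> \<longrightarrow>
        (\<forall>A\<in>sets borel. A \<subseteq> cylinder Q p r h \<longrightarrow>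
           emeasure \<sigma> A =
             (\<integral>\<^sup>+ y. ennreal (sqrt (1 + (norm (grad \<gamma> y))\<^sup>2))
                      * indicator A (frame_point Q p y (\<gamma> y)) \<partial>lebesgue_on (ball 0 r))))"

definition surface_measure :: "(real^3) set \<Rightarrow> (real^3) measure" where
  "surface_measure \<Omega> = (THE \<sigma>. is_surface_measure \<Omega> \<sigma>)"

definition graph_normal :: "real^3^3 \<Rightarrow> (real^2 \<Rightarrow> real) \<Rightarrow> real^2 \<Rightarrow> real^3" where
  "graph_normal Q \<gamma> y =
     (1 / sqrt (1 + (norm (grad \<gamma> y))\<^sup>2)) *\<^sub>R
       (Q *v vector [- grad \<gamma> y $ 1, - grad \<gamma> y $ 2, 1])"

definition outer_normal :: "(real^3) set \<Rightarrow> real^3 \<Rightarrow> real^3" where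
  "outer_normal \<Omega> x = (THE n. \<exists>Q p r h \<gamma> y.
     C11_chart \<Omega> Q p r h \<gamma> \<and> y \<in> ball 0 r \<and>
     x = frame_point Q p y (\<gamma> y) \<and> n = graph_normal Q \<gamma> y)"

text \<open>The trace operator from H1 to L2 of the boundary, as the closure of the restriction
  map on functions that are smooth up to the boundary. For bounded \<open>\<Omega>\<close> these are the
  restrictions of smooth functions on the whole space, and they automatically lie in H1 and in
  L2 of the boundary.\<close>

definition has_trace :: "(real^3) set \<Rightarrow> (real^3 \<Rightarrow> real) \<Rightarrow> (real^3 \<Rightarrow> real) \<Rightarrow> bool" where
  "has_trace \<Omega> u g \<longleftrightarrow>
     u \<in> sobolev 1 \<Omega> \<and> g \<in> L2 (surface_measure \<Omega>) \<and>
     (\<exists>f :: nat \<Rightarrow> real^3 \<Rightarrow> real.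
        (\<forall>n. smooth (f n)) \<and>
        (\<lambda>n. H1_norm \<Omega> (\<lambda>x. f n x - u x)) \<longlonglongrightarrow> 0 \<and>
        (\<lambda>n. LINT x|surface_measure \<Omega>. (f n x - g x)\<^sup>2) \<longlonglongrightarrow> 0)"

definition bdry_trace :: "(real^3) set \<Rightarrow> (real^3 \<Rightarrow> real) \<Rightarrow> real^3 \<Rightarrow> real" where
  "bdry_trace \<Omega> u = (SOME g. has_trace \<Omega> u g)"

definition vec_trace :: "(real^3) set \<Rightarrow> (real^3 \<Rightarrow> real^3) \<Rightarrow> real^3 \<Rightarrow> real^3" where
  "vec_trace \<Omega> u x = (\<chi> i. bdry_trace \<Omega> (\<lambda>z. u z $ i) x)"

end

theory Submission
  imports Defs
begin

text \<open>
  With \<open>W = curl E\<close> one has \<open>curl W = \<lambda> E\<close> and \<open>div E = div W = 0\<close>, so the Maxwell stress tensor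
  \<open>T\<^sub>i\<^sub>j = W\<^sub>i W\<^sub>j - \<delta>\<^sub>i\<^sub>j |W|\<^sup>2 / 2 + \<lambda> (E\<^sub>i E\<^sub>j - \<delta>\<^sub>i\<^sub>j |E|\<^sup>2 / 2)\<close> is divergence free. Hence
  \<open>\<partial>\<^sub>j (T\<^sub>i\<^sub>j x\<^sub>i)\<close> is the trace of \<open>T\<close>, whose integral over \<open>\<Omega>\<close> is \<open>- \<lambda>\<close>. On the boundary \<open>\<nu> \<times> E = 0\<close> and
  \<open>W \<bullet> \<nu> = 0\<close>, so that \<open>T\<^sub>i\<^sub>j x\<^sub>i \<nu>\<^sub>j = - (|W|\<^sup>2 - \<lambda> |E|\<^sup>2) (x \<bullet> \<nu>) / 2\<close>.

  In a chart the divergence theorem compares \<open>\<Omega>\<close> with its translates \<open>\<Omega> + t a\<close> as \<open>t \<rightarrow> 0\<close>. It also shows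
  that the surface areas of two charts agree on their overlap, hence that the surface measure exists.
  Traces exist because smooth functions are dense in H1: near the boundary one mollifies with
  a kernel supported in a cone that points out of \<open>\<Omega>\<close>.
\<close>

section \<open>Smooth functions\<close>

text \<open>The surface measure, the outer normal, weak derivatives and traces are defined by
  \<open>THE\<close> or \<open>SOME\<close>, so existence comes first, and uniqueness wherever a
  value must be computed. For traces, Green's formula is proved for every \<open>g\<close> with
  \<open>has_trace\<close>, hence it holds for whatever \<open>bdry_trace\<close> selects.

  The chart function is only of class C^{1,1}, and flattening the boundary would destroy the
  smoothness of test functions. Translating \<Omega> asks of \<gamma> only differentiability and a
  Lipschitz bound.

  Entries of the stress tensor are products of two H1 functions. Green's formula approximates each
  factor separately and carries the coordinate as a smooth weight, so every limit is one of products
  in L2.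

  H2 regularity of E puts W in H1 and so gives it a trace. Membership in H0(curl) extends
  \<open>\<integral> E \<bullet> curl F = \<integral> W \<bullet> F\<close> to all smooth F: F free
  on the boundary yields \<open>\<nu> \<times> E = 0\<close>, and F a gradient yields
  \<open>div W = 0\<close> and \<open>W \<bullet> \<nu> = 0\<close>. Testing the eigenvalue equation
  with E gives \<open>\<integral> |W|^2 = \<lambda>\<close>, so the two halves of the trace of T add
  up to -\<lambda>.\<close>

lemma partial_eq: "(f has_derivative f') (at x) \<Longrightarrow> partial i f x = f' (axis i 1)"
  unfolding partial_def by (metis frechet_derivative_at)

lemma has_derivative_grad:
  fixes f :: "real^'n::finite \<Rightarrow> real"
  assumes "f differentiable (at x)"
  shows "(f has_derivative (\<lambda>v. grad f x \<bullet> v)) (at x)"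
proof -
  have D: "(f has_derivative frechet_derivative f (at x)) (at x)"
    using assms frechet_derivative_works by blast
  then have L: "linear (frechet_derivative f (at x))"
    by (rule has_derivative_linear)
  have "frechet_derivative f (at x) v = grad f x \<bullet> v" for v
  proof -
    have "frechet_derivative f (at x) v = frechet_derivative f (at x) (\<Sum>i\<in>UNIV. v $ i *\<^sub>R axis i 1)"
      by (metis scalar_mult_eq_scaleR basis_expansion)
    also have "\<dots> = (\<Sum>i\<in>UNIV. v $ i * partial i f x)"
      using L by (simp add: linear_sum linear_cmul partial_def)
    finally show ?thesis
      by (simp add: inner_vec_def grad_def mult.commute)
  qed
  then show ?thesis using D by presburger
qed

lemma partial_const [simp]: "partial i (\<lambda>x. c) x = 0"
  by (rule partial_eq[where f' = "\<lambda>_. 0", simplified]) auto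

lemma partial_add:
  assumes "f differentiable (at x)" "g differentiable (at x)"
  shows "partial i (\<lambda>x. f x + g x) x = partial i f x + partial i g x"
proof -
  have "((\<lambda>x. f x + g x) has_derivative
     (\<lambda>v. frechet_derivative f (at x) v + frechet_derivative g (at x) v)) (at x)"
    by (intro has_derivative_add) (use assms frechet_derivative_works in blast)+
  from partial_eq[OF this] show ?thesis by (simp add: partial_def)
qed

lemma partial_mult:
  assumes "f differentiable (at x)" "g differentiable (at x)"
  shows "partial i (\<lambda>x. f x * g x) x = f x * partial i g x + partial i f x * g x"
proof -
  have "((\<lambda>x. f x * g x) has_derivative
     (\<lambda>v. f x * frechet_derivative g (at x) v + frechet_derivative f (at x) v * g x)) (at x)"
    by (intro has_derivative_mult) (use assms frechet_derivative_works in blast)+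
  from partial_eq[OF this] show ?thesis by (simp add: partial_def)
qed

lemma partial_inverse:
  fixes f :: "real^'n::finite \<Rightarrow> real"
  assumes "f differentiable (at x)" "f x \<noteq> 0"
  shows "partial i (\<lambda>x. inverse (f x)) x = - (partial i f x * (inverse (f x) * inverse (f x)))"
proof -
  have "((\<lambda>x. inverse (f x)) has_derivative
     (\<lambda>v. - (inverse (f x) * frechet_derivative f (at x) v * inverse (f x)))) (at x)"
    by (rule Deriv.has_derivative_inverse) (use assms frechet_derivative_works in blast)+
  from partial_eq[OF this] show ?thesis by (simp add: partial_def)
qed

lemma partial_affine:
  fixes f :: "real^'n::finite \<Rightarrow> real"
  assumes "f differentiable (at (c *\<^sub>R x + b))"
  shows "partial i (\<lambda>x. f (c *\<^sub>R x + b)) x = c * partial i f (c *\<^sub>R x + b)"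
proof -
  have "((\<lambda>x. f (c *\<^sub>R x + b)) has_derivative (\<lambda>v. grad f (c *\<^sub>R x + b) \<bullet> (c *\<^sub>R v))) (at x)"
    by (rule has_derivative_compose[of "\<lambda>x. c *\<^sub>R x + b" "\<lambda>v. c *\<^sub>R v" x UNIV f "\<lambda>v. grad f (c *\<^sub>R x + b) \<bullet> v"])
      (auto intro!: derivative_eq_intros has_derivative_grad[OF assms])
  from partial_eq[OF this] show ?thesis by (simp add: grad_def inner_axis)
qed

lemma partial_coord: "partial i (\<lambda>x::real^'n::finite. x $ j) x = (if i = j then 1 else 0)"
proof -
  have "((\<lambda>x::real^'n. x $ j) has_derivative (\<lambda>v. v $ j)) (at x)"
    by (rule bounded_linear.has_derivative[OF bounded_linear_vec_nth]) (rule has_derivative_ident)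
  from partial_eq[OF this] show ?thesis by (simp add: axis_def)
qed

lemma partial_cong_open:
  assumes "open U" "x \<in> U" "\<And>y. y \<in> U \<Longrightarrow> f y = g y"
  shows "partial i f x = partial i g x"
proof -
  have "(f has_derivative D) (at x) \<longleftrightarrow> (g has_derivative D) (at x)" for D
    using has_derivative_transform_within_open[of f D x UNIV U g]
      has_derivative_transform_within_open[of g D x UNIV U f] assms by auto
  then show ?thesis unfolding partial_def frechet_derivative_def by simp
qed

lemma C_k_Suc_imp: "C_k (Suc k) f \<Longrightarrow> C_k k f"
proof (induction k arbitrary: f)
  case 0
  then show ?case
    by (auto intro!: continuous_at_imp_continuous_on differentiable_imp_continuous_within)
next
  case (Suc k)
  then show ?case by (metis C_k.simps(2))
qed

lemma C_k_const [simp]: "C_k k (\<lambda>x. c)"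
proof (induction k arbitrary: c)
  case (Suc k)
  have "partial i (\<lambda>x. c) = (\<lambda>x::real^'a. 0)" for i by (rule ext) simp
  then show ?case using Suc by simp
qed simp

lemma C_k_add: "C_k k f \<Longrightarrow> C_k k g \<Longrightarrow> C_k k (\<lambda>x. f x + g x)"
proof (induction k arbitrary: f g)
  case (Suc k)
  then have "partial i (\<lambda>x. f x + g x) = (\<lambda>x. partial i f x + partial i g x)" for i
    by (intro ext partial_add) auto
  then show ?case using Suc by simp
qed (auto intro: continuous_intros)

lemma C_k_mult: "C_k k f \<Longrightarrow> C_k k g \<Longrightarrow> C_k k (\<lambda>x. f x * g x)"
proof (induction k arbitrary: f g)
  case (Suc k)
  then have "partial i (\<lambda>x. f x * g x) = (\<lambda>x. f x * partial i g x + partial i f x * g x)" for i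
    by (intro ext partial_mult) auto
  moreover have "C_k k f" "C_k k g" using Suc.prems C_k_Suc_imp by blast+
  ultimately show ?case using Suc by (auto intro!: C_k_add)
qed (auto intro: continuous_intros)

lemma C_k_uminus: "C_k k f \<Longrightarrow> C_k k (\<lambda>x. - f x)"
  using C_k_mult[of k "\<lambda>_. - 1" f] by simp

lemma C_k_diff: "C_k k f \<Longrightarrow> C_k k g \<Longrightarrow> C_k k (\<lambda>x. f x - g x)"
  using C_k_add[of k f "\<lambda>x. - g x"] C_k_uminus[of k g] by simp

lemma C_k_inverse: "C_k k f \<Longrightarrow> (\<And>x. f x \<noteq> 0) \<Longrightarrow> C_k k (\<lambda>x. inverse (f x))"
proof (induction k arbitrary: f)
  case (Suc k)
  then have "partial i (\<lambda>x. inverse (f x))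
      = (\<lambda>x. (- 1) * (partial i f x * (inverse (f x) * inverse (f x))))" for i
    by (intro ext) (subst partial_inverse, auto)
  moreover have "C_k k f" using Suc.prems C_k_Suc_imp by blast
  ultimately show ?case using Suc by (auto intro!: C_k_mult C_k_uminus)
qed (auto intro: continuous_intros)

lemma C_k_coord: "C_k k (\<lambda>x. x $ j)"
proof (cases k)
  case 0
  then show ?thesis by (auto intro: continuous_intros)
next
  case (Suc m)
  have "partial i (\<lambda>x::real^'a. x $ j) = (\<lambda>x. if i = j then 1 else 0)" for i
    by (rule ext) (rule partial_coord)
  moreover have "(\<lambda>x::real^'a. x $ j) differentiable (at x)" for x
    by (simp add: bounded_linear_imp_differentiable bounded_linear_vec_nth)
  ultimately show ?thesis using Suc by simp
qed

lemma C_k_affine: "C_k k f \<Longrightarrow> C_k k (\<lambda>x. f (c *\<^sub>R x + b))"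
proof (induction k arbitrary: f)
  case 0
  then show ?case
    by (auto intro!: continuous_on_compose2[of UNIV f] continuous_intros)
next
  case (Suc k)
  then have "partial i (\<lambda>x. f (c *\<^sub>R x + b)) = (\<lambda>x. c * partial i f (c *\<^sub>R x + b))" for i
    by (intro ext partial_affine) auto
  moreover have "(\<lambda>x. f (c *\<^sub>R x + b)) differentiable (at x)" for x
    by (rule differentiable_compose[of f "\<lambda>x. c *\<^sub>R x + b"])
      (use Suc.prems in \<open>auto intro!: derivative_intros\<close>)
  ultimately show ?case using Suc by (auto intro!: C_k_mult)
qed

lemma smooth_const [simp]: "smooth (\<lambda>x. c)"
  and smooth_add: "smooth f \<Longrightarrow> smooth g \<Longrightarrow> smooth (\<lambda>x. f x + g x)"
  and smooth_mult: "smooth f \<Longrightarrow> smooth g \<Longrightarrow> smooth (\<lambda>x. f x * g x)"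
  and smooth_inverse: "smooth f \<Longrightarrow> (\<And>x. f x \<noteq> 0) \<Longrightarrow> smooth (\<lambda>x. inverse (f x))"
  and smooth_coord: "smooth (\<lambda>x. x $ j)"
  and smooth_affine: "smooth f \<Longrightarrow> smooth (\<lambda>x. f (c *\<^sub>R x + b))"
  by (auto simp: smooth_def C_k_add C_k_mult C_k_inverse C_k_coord C_k_affine)

lemma smooth_cmult: "smooth f \<Longrightarrow> smooth (\<lambda>x. c * f x)"
  by (intro smooth_mult smooth_const)

lemma smooth_uminus: "smooth f \<Longrightarrow> smooth (\<lambda>x. - f x)"
  using smooth_cmult[of f "- 1"] by simp

lemma smooth_diff: "smooth f \<Longrightarrow> smooth g \<Longrightarrow> smooth (\<lambda>x. f x - g x)"
  using smooth_add[of f "\<lambda>x. - g x"] smooth_uminus[of g] by simp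

lemma smooth_sum: "(\<And>i. i \<in> I \<Longrightarrow> smooth (f i)) \<Longrightarrow> smooth (\<lambda>x. \<Sum>i\<in>I. f i x)"
  by (induction I rule: infinite_finite_induct) (auto intro: smooth_add)

lemma smooth_prod: "(\<And>i. i \<in> I \<Longrightarrow> smooth (f i)) \<Longrightarrow> smooth (\<lambda>x. \<Prod>i\<in>I. f i x)"
  by (induction I rule: infinite_finite_induct) (auto intro: smooth_mult)

lemma smooth_power: "smooth f \<Longrightarrow> smooth (\<lambda>x. f x ^ n)"
  by (induction n) (auto intro: smooth_mult)

lemma smooth_partial: "smooth f \<Longrightarrow> smooth (partial i f)"
  unfolding smooth_def by (metis C_k.simps(2))

lemma smooth_differentiable: "smooth f \<Longrightarrow> f differentiable (at x)"
  unfolding smooth_def by (metis C_k.simps(2))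

lemma smooth_continuous: "smooth f \<Longrightarrow> continuous_on S f"
  unfolding smooth_def by (metis C_k.simps(1) continuous_on_subset subset_UNIV)

lemma smooth_borel: "smooth f \<Longrightarrow> f \<in> borel_measurable borel"
  by (intro borel_measurable_continuous_onI smooth_continuous)

lemma partial_sum:
  assumes "\<And>j. j \<in> J \<Longrightarrow> smooth (f j)"
  shows "partial i (\<lambda>x. \<Sum>j\<in>J. f j x) x = (\<Sum>j\<in>J. partial i (f j) x)"
  using assms
  by (induction J rule: infinite_finite_induct)
    (auto simp: partial_add smooth_differentiable smooth_sum)

lemma partial_cmult: "smooth f \<Longrightarrow> partial i (\<lambda>x. c * f x) x = c * partial i f x"
  by (subst partial_mult) (auto simp: smooth_differentiable)

lemma partial_uminus: "smooth f \<Longrightarrow> partial i (\<lambda>x. - f x) x = - partial i f x"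
  using partial_cmult[of f i "- 1"] by simp

lemma partial_diff:
  "smooth f \<Longrightarrow> smooth g \<Longrightarrow> partial i (\<lambda>x. f x - g x) x = partial i f x - partial i g x"
  using partial_add[of f x "\<lambda>x. - g x" i] smooth_uminus[of g]
  by (simp add: smooth_differentiable partial_uminus)

text \<open>The derivative of \<open>exp (- 1 / t)\<close> and of its products with powers of \<open>1 / t\<close> stay
  within the span of this family.\<close>

definition flat :: "nat \<Rightarrow> real \<Rightarrow> real" where
  "flat n t = (if 0 < t then inverse t ^ n * exp (- inverse t) else 0)"

lemma power_le_fact_exp:
  fixes x :: real assumes "0 \<le> x" shows "x ^ n \<le> fact n * exp x"
proof -
  have "(\<Sum>k\<in>{n}. x ^ k /\<^sub>R fact k) \<le> (\<Sum>k. x ^ k /\<^sub>R fact k)"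
    using assms by (intro sum_le_suminf summable_exp_generic) auto
  then show ?thesis by (simp add: exp_def field_simps)
qed

text \<open>Quadratic decay at the origin makes the difference quotient at 0 tend to 0 for every n;
  it is the exponential bound at \<open>inverse t\<close> with exponent n + 2.\<close>

lemma flat_le: assumes "0 < t" shows "flat n t \<le> fact (n + 2) * t\<^sup>2"
proof -
  have "inverse t ^ (n + 2) \<le> fact (n + 2) * exp (inverse t)"
    using assms by (intro power_le_fact_exp) simp
  then have "inverse t ^ n * exp (- inverse t) * inverse (t\<^sup>2) \<le> fact (n + 2)"
    using assms by (simp add: exp_minus power_add power_inverse field_simps power2_eq_square)
  then show ?thesis using assms by (simp add: flat_def field_simps)
qed

lemma flat_nonneg: "0 \<le> flat n t"
  by (simp add: flat_def)

lemma flat_has_derivative: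
  "(flat n has_real_derivative (flat (n + 2) t - real n * flat (n + 1) t)) (at t)"
proof -
  consider "t > 0" | "t < 0" | "t = 0" by linarith
  then show ?thesis
  proof cases
    case 1
    have "((\<lambda>t. inverse t ^ n * exp (- inverse t)) has_real_derivative
        (flat (n + 2) t - real n * flat (n + 1) t)) (at t)"
    proof (cases n)
      case 0
      then show ?thesis using 1
        by (auto intro!: derivative_eq_intros simp: flat_def power2_eq_square)
    next
      case (Suc m)
      then show ?thesis using 1
        by (auto intro!: derivative_eq_intros simp: flat_def algebra_simps power2_eq_square)
          (metis power_eq_if One_nat_def)
    qed
    then show ?thesis
      by (rule has_field_derivative_transform_within_open[where S = "{0<..}"])
        (use 1 in \<open>auto simp: flat_def\<close>)
  next
    case 2
    have "((\<lambda>t. 0) has_real_derivative 0) (at t)" by simp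
    then have "(flat n has_real_derivative 0) (at t)"
      by (rule has_field_derivative_transform_within_open[where S = "{..<0}"])
        (use 2 in \<open>auto simp: flat_def\<close>)
    then show ?thesis using 2 by (simp add: flat_def)
  next
    case 3
    have "((\<lambda>h. (flat n (0 + h) - flat n 0) / h) \<longlongrightarrow> 0) (at 0)"
    proof (rule Lim_null_comparison[where g = "\<lambda>h. fact (n + 2) * \<bar>h\<bar>"])
      have "norm ((flat n (0 + h) - flat n 0) / h) \<le> fact (n + 2) * \<bar>h\<bar>" if "h \<noteq> 0" for h
      proof (cases "h > 0")
        case True
        then show ?thesis using flat_le[OF True, of n] flat_nonneg[of n h]
          by (simp add: flat_def[of _ 0] field_simps power2_eq_square)
      next
        case False
        then have "norm ((flat n (0 + h) - flat n 0) / h) = 0" by (simp add: flat_def)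
        moreover have "0 \<le> fact (n + 2) * \<bar>h\<bar>" by (intro mult_nonneg_nonneg fact_ge_zero abs_ge_zero)
        ultimately show ?thesis by linarith
      qed
      then show "\<forall>\<^sub>F h in at 0. norm ((flat n (0 + h) - flat n 0) / h) \<le> fact (n + 2) * \<bar>h\<bar>"
        by (simp add: eventually_at_filter)
      have "((\<lambda>h. fact (n + 2) * \<bar>h\<bar>) \<longlongrightarrow> fact (n + 2) * \<bar>0\<bar>) (at (0::real))"
        by (intro tendsto_intros)
      then show "((\<lambda>h. fact (n + 2) * \<bar>h\<bar>) \<longlongrightarrow> 0) (at (0::real))" by simp
    qed
    then show ?thesis using 3 by (simp add: DERIV_def flat_def[of _ 0])
  qed
qed

lemma C_k_flat: "C_k k (\<lambda>x. flat n (x $ j))"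
proof (induction k arbitrary: n)
  case 0
  have "continuous_on UNIV (flat n)"
    using flat_has_derivative by (auto intro!: continuous_at_imp_continuous_on DERIV_isCont)
  then show ?case
    by (auto intro!: continuous_on_compose2[of UNIV "flat n"] continuous_intros)
next
  case (Suc k)
  have D: "((\<lambda>x. flat n (x $ j)) has_derivative
     (\<lambda>v. (flat (n + 2) (x $ j) - real n * flat (n + 1) (x $ j)) * v $ j)) (at x)" for x :: "real^'a"
    by (rule has_derivative_compose[OF bounded_linear.has_derivative[OF bounded_linear_vec_nth has_derivative_ident]
          flat_has_derivative[unfolded has_field_derivative_def]])
  have "partial i (\<lambda>x. flat n (x $ j))
     = (\<lambda>x. axis i 1 $ j * flat (n + 2) (x $ j) + (- axis i 1 $ j * real n) * flat (n + 1) (x $ j))" for i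
    by (rule ext) (simp add: partial_eq[OF D] algebra_simps)
  moreover have "(\<lambda>x. flat n (x $ j)) differentiable (at x)" for x :: "real^'a"
    using D differentiable_def by blast
  ultimately show ?case
    using Suc by (auto intro!: C_k_diff C_k_mult simp del: add_2_eq_Suc')
qed

section \<open>Cutoff functions\<close>

definition step :: "real \<Rightarrow> real" where
  "step t = flat 0 t * inverse (flat 0 t + flat 0 (1 - t))"

lemma flat_sum_pos: "flat 0 t + flat 0 (1 - t) > 0"
  by (cases "t > 0"; cases "t < 1") (auto simp: flat_def intro!: add_pos_pos)

lemma step_bounds: "0 \<le> step t" "step t \<le> 1"
  using flat_sum_pos[of t] flat_nonneg[of 0 t] flat_nonneg[of 0 "1 - t"]
  by (auto simp: step_def field_simps)

lemma step_eq_0: "t \<le> 0 \<Longrightarrow> step t = 0" and step_eq_1: "1 \<le> t \<Longrightarrow> step t = 1"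
  by (auto simp: step_def flat_def)

lemma smooth_step: "smooth (\<lambda>x. step (x $ j))"
proof -
  have 1: "smooth (\<lambda>x::real^'a. flat 0 (x $ j))" by (simp add: smooth_def C_k_flat)
  have "smooth (\<lambda>x::real^'a. flat 0 (((- 1) *\<^sub>R x + axis j 1) $ j))"
    using smooth_affine[OF 1, of "- 1" "axis j 1"] .
  then have "smooth (\<lambda>x::real^'a. flat 0 (1 - x $ j))" by simp
  moreover have "flat 0 t + flat 0 (1 - t) \<noteq> 0" for t using flat_sum_pos[of t] by simp
  ultimately show ?thesis
    unfolding step_def using 1 by (intro smooth_mult smooth_inverse smooth_add)
qed

text \<open>A product over the coordinates, because coordinates are smooth everywhere while the norm
  is not. The factors of one coordinate equal 1 up to distance d and vanish from distance 2 d
  on.\<close>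

definition plateau :: "real \<Rightarrow> real^'n::finite \<Rightarrow> real^'n \<Rightarrow> real" where
  "plateau d z x = (\<Prod>i\<in>UNIV. step (2 + (x $ i - z $ i) / d) * step (2 - (x $ i - z $ i) / d))"

lemma smooth_plateau: "smooth (plateau d z)"
proof -
  have "smooth (\<lambda>x. step (((c / d) *\<^sub>R x + (\<chi> i. 2 - c * z $ i / d)) $ i))" for i c
    by (rule smooth_affine[OF smooth_step])
  from this[of 1] this[of "- 1"] show ?thesis
    unfolding plateau_def
    by (intro smooth_prod smooth_mult) (simp_all add: algebra_simps diff_divide_distrib)
qed

lemma plateau_bounds: "0 \<le> plateau d z x" "plateau d z x \<le> 1"
  unfolding plateau_def
  by (auto intro!: prod_nonneg prod_le_1 mult_nonneg_nonneg mult_le_one simp: step_bounds)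

lemma plateau_eq_1:
  assumes "\<And>i. \<bar>x $ i - z $ i\<bar> \<le> d" "d > 0" shows "plateau d z x = 1"
proof -
  have "\<bar>(x $ i - z $ i) / d\<bar> \<le> 1" for i using assms(1)[of i] assms(2) by simp
  then have "2 + (x $ i - z $ i) / d \<ge> 1" "2 - (x $ i - z $ i) / d \<ge> 1" for i
    by (smt (verit, best))+
  then show ?thesis unfolding plateau_def by (simp add: step_eq_1)
qed

text \<open>The support lies in a cube of half side \<open>2 * d\<close>; bounding the norm by the
  sum of the coordinates produces the factor \<open>CARD('n)\<close>.\<close>

lemma plateau_support:
  fixes z :: "real^'n::finite"
  assumes "d > 0" shows "{x. plateau d z x \<noteq> 0} \<subseteq> cball z (2 * d * real CARD('n))"
proof
  fix x :: "real^'n" assume "x \<in> {x. plateau d z x \<noteq> 0}"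
  then have *: "step (2 + (x $ i - z $ i) / d) \<noteq> 0" "step (2 - (x $ i - z $ i) / d) \<noteq> 0" for i
    by (auto simp: plateau_def)
  have "\<bar>(z - x) $ i\<bar> \<le> 2 * d" for i
  proof -
    have "2 + (x $ i - z $ i) / d > 0" "2 - (x $ i - z $ i) / d > 0"
      using *[of i] by (meson not_le step_eq_0)+
    then have "- (2 * d) < x $ i - z $ i" "x $ i - z $ i < 2 * d"
      using assms by (simp_all add: field_simps)
    then show ?thesis by simp
  qed
  then have "norm (z - x) \<le> (\<Sum>i\<in>(UNIV::'n set). 2 * d)"
    by (intro order_trans[OF norm_le_l1_cart] sum_mono)
  then show "x \<in> cball z (2 * d * real CARD('n))"
    by (simp add: dist_norm mult.commute)
qed

section \<open>Test functions\<close>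

lemma test_function_smooth: "test_function U f \<Longrightarrow> smooth f"
  by (simp add: test_function_def)

lemma test_function_mono: "test_function U f \<Longrightarrow> U \<subseteq> V \<Longrightarrow> test_function V f"
  by (auto simp: test_function_def)

lemma test_function_outside: "test_function U f \<Longrightarrow> x \<notin> U \<Longrightarrow> f x = 0"
  using closure_subset[of "{x. f x \<noteq> 0}"] by (auto simp: test_function_def)

lemma test_functionI:
  assumes "smooth f" "compact C" "C \<subseteq> U" "\<And>x. x \<notin> C \<Longrightarrow> f x = 0"
  shows "test_function U f"
proof -
  have "{x. f x \<noteq> 0} \<subseteq> C" using assms(4) by blast
  then have "closure {x. f x \<noteq> 0} \<subseteq> C"
    by (simp add: assms(2) closure_minimal compact_imp_closed)
  moreover from this have "compact (closure {x. f x \<noteq> 0})"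
    by (meson assms(2) bounded_subset closed_closure compact_eq_bounded_closed)
  ultimately show ?thesis using assms by (auto simp: test_function_def)
qed

lemma test_functionE:
  assumes "test_function U f"
  obtains C where "compact C" "C \<subseteq> U" "\<And>x. x \<notin> C \<Longrightarrow> f x = 0" "\<And>i x. x \<notin> C \<Longrightarrow> partial i f x = 0"
proof (rule that[of "closure {x. f x \<noteq> 0}"])
  show "partial i f x = 0" if "x \<notin> closure {x. f x \<noteq> 0}" for i x
  proof -
    have "partial i f x = partial i (\<lambda>x. 0) x"
      by (rule partial_cong_open[of "- closure {x. f x \<noteq> 0}"])
        (use that closure_subset[of "{x. f x \<noteq> 0}"] in auto)
    then show ?thesis by simp
  qed
qed (use assms closure_subset[of "{x. f x \<noteq> 0}"] in \<open>auto simp: test_function_def\<close>)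

lemma test_function_partial:
  assumes "test_function U f" shows "test_function U (partial i f)"
proof -
  obtain C where C: "compact C" "C \<subseteq> U" "\<And>i x. x \<notin> C \<Longrightarrow> partial i f x = 0"
    by (rule test_functionE[OF assms]) (rule that)
  show ?thesis
    by (rule test_functionI[OF smooth_partial[OF test_function_smooth[OF assms]] C])
qed

lemma test_function_mult:
  assumes "test_function U f" "smooth g"
  shows "test_function U (\<lambda>x. f x * g x)" "test_function U (\<lambda>x. g x * f x)"
proof -
  obtain C where C: "compact C" "C \<subseteq> U" "\<And>x. x \<notin> C \<Longrightarrow> f x = 0" by (rule test_functionE[OF assms(1)]) (rule that)
  show "test_function U (\<lambda>x. f x * g x)" "test_function U (\<lambda>x. g x * f x)"
    using C assms by (auto intro!: test_functionI[of _ C] smooth_mult test_function_smooth[OF assms(1)])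
qed

lemma test_function_add:
  assumes "test_function U f" "test_function U g" shows "test_function U (\<lambda>x. f x + g x)"
proof -
  obtain C where C: "compact C" "C \<subseteq> U" "\<And>x. x \<notin> C \<Longrightarrow> f x = 0" by (rule test_functionE[OF assms(1)]) (rule that)
  obtain D where D: "compact D" "D \<subseteq> U" "\<And>x. x \<notin> D \<Longrightarrow> g x = 0" by (rule test_functionE[OF assms(2)]) (rule that)
  show ?thesis
    by (rule test_functionI[of _ "C \<union> D"])
      (use assms C D in \<open>auto intro!: smooth_add test_function_smooth[OF assms(1)] test_function_smooth[OF assms(2)]\<close>)
qed

lemma test_function_zero [simp]: "test_function U (\<lambda>x. 0)"
  by (rule test_functionI[of _ "{}"]) auto

lemma test_function_sum:
  "(\<And>i. i \<in> I \<Longrightarrow> test_function U (f i)) \<Longrightarrow> test_function U (\<lambda>x. \<Sum>i\<in>I. f i x)"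
  by (induction I rule: infinite_finite_induct) (auto intro: test_function_add)

lemma test_function_bounded:
  assumes "test_function U f" obtains B where "0 \<le> B" "\<And>x. \<bar>f x\<bar> \<le> B"
proof -
  obtain C where C: "compact C" "\<And>x. x \<notin> C \<Longrightarrow> f x = 0" by (rule test_functionE[OF assms]) (rule that)
  have "compact (f ` C)"
    by (intro compact_continuous_image smooth_continuous test_function_smooth[OF assms] C)
  then obtain B where "\<forall>y\<in>f ` C. norm y \<le> B" using compact_imp_bounded bounded_iff by metis
  then have "\<bar>f x\<bar> \<le> max 0 B" for x using C(2)[of x] by (cases "x \<in> C") auto
  then show ?thesis using that[of "max 0 B"] by auto
qed

lemma test_function_lipschitz:
  assumes "test_function U f"
  obtains L where "0 \<le> L" "\<And>x y. \<bar>f x - f y\<bar> \<le> L * norm (x - y)"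
proof -
  have "\<exists>B. 0 \<le> B \<and> (\<forall>x. \<bar>partial i f x\<bar> \<le> B)" for i
    by (rule test_function_bounded[OF test_function_partial[OF assms, of i]]) blast
  then obtain B where B: "\<And>i. 0 \<le> B i" "\<And>i x. \<bar>partial i f x\<bar> \<le> B i" by metis
  have gb: "norm (grad f x) \<le> sum B UNIV" for x
    by (intro order_trans[OF norm_le_l1_cart] sum_mono) (simp add: grad_def B)
  then have on: "onorm (\<lambda>v. grad f x \<bullet> v) \<le> sum B UNIV" for x
  proof (intro onorm_le)
    fix v
    have "norm (grad f x \<bullet> v) \<le> norm (grad f x) * norm v" by (simp add: Cauchy_Schwarz_ineq2)
    also have "\<dots> \<le> sum B UNIV * norm v" by (rule mult_right_mono[OF gb norm_ge_zero])
    finally show "norm (grad f x \<bullet> v) \<le> sum B UNIV * norm v" .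
  qed
  have "norm (f x - f y) \<le> sum B UNIV * norm (x - y)" for x y
    by (rule differentiable_bound[OF convex_UNIV _ on])
      (auto intro!: has_derivative_grad smooth_differentiable test_function_smooth[OF assms])
  then show ?thesis using that[of "sum B UNIV"] B(1) by (auto intro: sum_nonneg)
qed

section \<open>Partitions of unity\<close>

lemma plateau_in_open:
  fixes z :: "real^'n::finite"
  assumes "open U" "z \<in> U"
  obtains d where "d > 0" "test_function U (plateau d z)"
proof -
  obtain e where e: "e > 0" "cball z e \<subseteq> U" using assms open_contains_cball by blast
  define d where "d = e / (2 * real CARD('n))"
  have d: "d > 0" "2 * d * real CARD('n) = e" using e by (auto simp: d_def)
  have "test_function U (plateau d z)"
    by (rule test_functionI[of _ "cball z e"])
      (use e d plateau_support[of d z] in \<open>auto simp: smooth_plateau\<close>)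
  then show ?thesis using that d by blast
qed

text \<open>Each new member is \<open>\<theta> w\<close> times the product of all earlier
  \<open>1 - \<theta> z\<close>, so the sums telescope. This replaces the division by a sum of
  cutoffs.\<close>

lemma telescoping_partition:
  assumes "finite X" "\<And>z. z \<in> X \<Longrightarrow> test_function (U z) (\<theta> z)"
    "\<And>z x. 0 \<le> \<theta> z x \<and> \<theta> z x \<le> (1::real)"
  shows "\<exists>\<psi>. (\<forall>z\<in>X. test_function (U z) (\<psi> z)) \<and> (\<forall>z x. 0 \<le> \<psi> z x \<and> \<psi> z x \<le> 1)
     \<and> (\<forall>x. (\<Sum>z\<in>X. \<psi> z x) = 1 - (\<Prod>z\<in>X. 1 - \<theta> z x))"
  using assms(1,2)
proof (induction X rule: finite_induct)
  case empty
  show ?case by (intro exI[of _ "\<lambda>_ _. 0"]) simp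
next
  case (insert w X)
  then obtain \<psi> where \<psi>: "\<forall>z\<in>X. test_function (U z) (\<psi> z)" "\<forall>z x. 0 \<le> \<psi> z x \<and> \<psi> z x \<le> 1"
    "\<forall>x. (\<Sum>z\<in>X. \<psi> z x) = 1 - (\<Prod>z\<in>X. 1 - \<theta> z x)" by blast
  define \<eta> where "\<eta> x = \<theta> w x * (\<Prod>z\<in>X. 1 - \<theta> z x)" for x
  have "test_function (U w) \<eta>"
    unfolding \<eta>_def
    by (intro test_function_mult smooth_prod smooth_diff smooth_const)
      (use insert.prems test_function_smooth in blast)+
  moreover have p: "0 \<le> (\<Prod>z\<in>X. 1 - \<theta> z x)" "(\<Prod>z\<in>X. 1 - \<theta> z x) \<le> 1" for x
    using assms(3) by (auto intro!: prod_nonneg prod_le_1)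
  then have "0 \<le> \<eta> x \<and> \<eta> x \<le> 1" for x
    using assms(3)[of w x] p[of x] unfolding \<eta>_def by (auto intro: mult_nonneg_nonneg mult_le_one)
  moreover have "(\<Sum>z\<in>X. (if z = w then \<eta> else \<psi> z) x) = (\<Sum>z\<in>X. \<psi> z x)" for x
    by (rule sum.cong) (use insert in auto)
  ultimately show ?case
    using \<psi> insert
    by (intro exI[of _ "\<lambda>z. if z = w then \<eta> else \<psi> z"]) (auto simp: \<eta>_def algebra_simps)
qed

text \<open>On the balls where some plateau equals 1 the telescoped product vanishes. The sum is
  thus 1 on an open neighbourhood of \<open>K\<close>, not only on \<open>K\<close>, and its partial
  derivatives vanish there.\<close>

lemma smooth_partition:
  fixes K :: "(real^'n::finite) set"
  assumes "compact K" "\<And>z. z \<in> K \<Longrightarrow> open (U z) \<and> z \<in> U z"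
  obtains X V \<psi> where "finite X" "X \<subseteq> K" "\<And>z. z \<in> X \<Longrightarrow> test_function (U z) (\<psi> z)"
    "\<And>z x. 0 \<le> \<psi> z x \<and> \<psi> z x \<le> 1" "\<And>x. (\<Sum>z\<in>X. \<psi> z x) \<le> 1" "open V" "K \<subseteq> V" "\<And>x. x \<in> V \<Longrightarrow> (\<Sum>z\<in>X. \<psi> z x) = 1"
proof -
  have "\<forall>z\<in>K. \<exists>d>0. test_function (U z) (plateau d z)"
    using assms(2) by (metis plateau_in_open)
  then obtain d where d: "\<And>z. z \<in> K \<Longrightarrow> d z > 0 \<and> test_function (U z) (plateau (d z) z)"
    by (metis (no_types))
  have "K \<subseteq> (\<Union>z\<in>K. ball z (d z))" using d by auto
  then obtain X where X: "X \<subseteq> K" "finite X" "K \<subseteq> (\<Union>z\<in>X. ball z (d z))"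
    by (rule compactE_image[OF assms(1) open_ball]) (rule that)
  have tf: "test_function (U z) (plateau (d z) z)" if "z \<in> X" for z using d X(1) that by blast
  have b: "0 \<le> plateau (d z) z x \<and> plateau (d z) z x \<le> 1" for z x by (simp add: plateau_bounds)
  obtain \<psi> where \<psi>: "\<forall>z\<in>X. test_function (U z) (\<psi> z)" "\<forall>z x. 0 \<le> \<psi> z x \<and> \<psi> z x \<le> 1"
    "\<forall>x. (\<Sum>z\<in>X. \<psi> z x) = 1 - (\<Prod>z\<in>X. 1 - plateau (d z) z x)"
    using telescoping_partition[of X U "\<lambda>z. plateau (d z) z", OF X(2) tf b] by blast
  have "(\<Sum>z\<in>X. \<psi> z x) = 1" if x: "x \<in> (\<Union>z\<in>X. ball z (d z))" for x
  proof -
    obtain z where z: "z \<in> X" "dist z x < d z" using x by auto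
    have "\<bar>x $ i - z $ i\<bar> \<le> d z" for i
      using z(2) component_le_norm_cart[of "x - z" i] by (simp add: dist_norm norm_minus_commute)
    then have "plateau (d z) z x = 1" using d X(1) z(1) by (intro plateau_eq_1) auto
    then have "(\<Prod>z\<in>X. 1 - plateau (d z) z x) = 0" using z(1) X(2) by (intro prod_zero) auto
    then show ?thesis using \<psi>(3) by simp
  qed
  moreover have "(\<Sum>z\<in>X. \<psi> z x) \<le> 1" for x
    using \<psi>(3) plateau_bounds by (auto intro!: prod_nonneg)
  ultimately show ?thesis using that[of X \<psi> "\<Union>z\<in>X. ball z (d z)"] X \<psi> by blast
qed

lemma smooth_Urysohn:
  fixes K :: "(real^'n::finite) set"
  assumes "compact K" "open U" "K \<subseteq> U"
  obtains \<theta> where "test_function U \<theta>" "\<And>x. 0 \<le> \<theta> x" "\<And>x. \<theta> x \<le> 1" "\<And>x. x \<in> K \<Longrightarrow> \<theta> x = 1"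
proof -
  have prem: "open U \<and> z \<in> U" if "z \<in> K" for z using assms that by blast
  show ?thesis
  proof (rule smooth_partition[OF assms(1), of "\<lambda>_. U", OF prem])
    fix X V and \<psi> :: "real^'n \<Rightarrow> real^'n \<Rightarrow> real"
    assume "finite X" "\<And>z. z \<in> X \<Longrightarrow> test_function U (\<psi> z)" "\<And>z x. 0 \<le> \<psi> z x \<and> \<psi> z x \<le> 1"
      "\<And>x. (\<Sum>z\<in>X. \<psi> z x) \<le> 1" "K \<subseteq> V" "\<And>x. x \<in> V \<Longrightarrow> (\<Sum>z\<in>X. \<psi> z x) = 1"
    then show ?thesis
      by (intro that[of "\<lambda>x. \<Sum>z\<in>X. \<psi> z x"]) (auto intro!: test_function_sum sum_nonneg)
  qed
qed

text \<open>Cutoffs equal to 1 on an exhausting sequence of compact sets. By dominated convergence,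
  identities tested with smooth functions become identities on open sets.\<close>

lemma test_function_exhaustion:
  fixes U :: "(real^'n::finite) set"
  assumes "open U"
  obtains \<theta> :: "nat \<Rightarrow> real^'n \<Rightarrow> real" where "\<And>n. test_function U (\<theta> n)"
    "\<And>n x. 0 \<le> \<theta> n x" "\<And>n x. \<theta> n x \<le> 1" "\<And>x. (\<lambda>n. \<theta> n x) \<longlonglongrightarrow> indicator U x"
proof -
  show ?thesis
  proof (rule open_Union_compact_subsets[OF assms])
    fix C :: "nat \<Rightarrow> (real^'n) set"
    assume C: "\<And>n. compact (C n)" "\<And>n. C n \<subseteq> U"
      "\<And>K. compact K \<Longrightarrow> K \<subseteq> U \<Longrightarrow> \<exists>N. \<forall>n\<ge>N. K \<subseteq> C n"
    have "\<exists>\<theta>. test_function U \<theta> \<and> (\<forall>x. 0 \<le> \<theta> x \<and> \<theta> x \<le> 1) \<and> (\<forall>x\<in>C n. \<theta> x = 1)" for n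
      by (rule smooth_Urysohn[OF C(1) assms C(2)]) blast
    then obtain \<theta> where \<theta>: "\<And>n. test_function U (\<theta> n)" "\<And>n x. 0 \<le> \<theta> n x \<and> \<theta> n x \<le> 1"
      "\<And>n x. x \<in> C n \<Longrightarrow> \<theta> n x = 1" by metis
    have "(\<lambda>n. \<theta> n x) \<longlonglongrightarrow> indicator U x" for x
    proof (cases "x \<in> U")
      case True
      then obtain N where "\<forall>n\<ge>N. {x} \<subseteq> C n" using C(3)[of "{x}"] by auto
      then show ?thesis using True \<theta>(3)
        by (intro tendsto_eventually) (auto simp: eventually_sequentially)
    next
      case False
      then have "\<theta> n x = 0" for n using test_function_outside[OF \<theta>(1)] by blast
      then show ?thesis using False by simp
    qed
    then show ?thesis using that[of \<theta>] \<theta> by blast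
  qed
qed

section \<open>Square integrable functions\<close>

lemma L2_real_iff: "u \<in> L2 M \<longleftrightarrow> u \<in> borel_measurable M \<and> integrable M (\<lambda>x. (u x)\<^sup>2)"
  for u :: "'a \<Rightarrow> real"
  by (simp add: L2_def)

lemma L2_measurable: "u \<in> L2 M \<Longrightarrow> u \<in> borel_measurable M"
  by (simp add: L2_def)

lemma L2_mult_integrable:
  fixes u v :: "'a \<Rightarrow> real"
  assumes "u \<in> L2 M" "v \<in> L2 M" shows "integrable M (\<lambda>x. u x * v x)"
proof (rule Bochner_Integration.integrable_bound[of M "\<lambda>x. (u x)\<^sup>2 + (v x)\<^sup>2"])
  show "AE x in M. norm (u x * v x) \<le> norm ((u x)\<^sup>2 + (v x)\<^sup>2)"
  proof (intro AE_I2)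
    fix x
    have "0 \<le> (\<bar>u x\<bar> - \<bar>v x\<bar>)\<^sup>2" by simp
    then have "2 * (\<bar>u x\<bar> * \<bar>v x\<bar>) \<le> (u x)\<^sup>2 + (v x)\<^sup>2" by (simp add: power2_diff)
    moreover have "0 \<le> \<bar>u x\<bar> * \<bar>v x\<bar>" by simp
    ultimately have "\<bar>u x\<bar> * \<bar>v x\<bar> \<le> (u x)\<^sup>2 + (v x)\<^sup>2" by linarith
    then show "norm (u x * v x) \<le> norm ((u x)\<^sup>2 + (v x)\<^sup>2)"
      by (simp add: abs_mult)
  qed
qed (use assms in \<open>auto simp: L2_real_iff\<close>)

lemma L2_cmult: "u \<in> L2 M \<Longrightarrow> (\<lambda>x. c * u x) \<in> L2 M" for u :: "'a \<Rightarrow> real"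
  by (auto simp: L2_real_iff power_mult_distrib)

lemma L2_add:
  fixes u v :: "'a \<Rightarrow> real"
  assumes "u \<in> L2 M" "v \<in> L2 M" shows "(\<lambda>x. u x + v x) \<in> L2 M"
  using assms L2_mult_integrable[OF L2_cmult[OF assms(1)] assms(2), of 2]
  by (auto simp: L2_real_iff power2_sum)

lemma L2_uminus: "u \<in> L2 M \<Longrightarrow> (\<lambda>x. - u x) \<in> L2 M" for u :: "'a \<Rightarrow> real"
  using L2_cmult[of u M "- 1"] by simp

lemma L2_diff: "u \<in> L2 M \<Longrightarrow> v \<in> L2 M \<Longrightarrow> (\<lambda>x. u x - v x) \<in> L2 M" for u v :: "'a \<Rightarrow> real"
  using L2_add[of u M "\<lambda>x. - v x"] L2_uminus[of v M] by simp

lemma L2_zero [simp]: "(\<lambda>x. 0::real) \<in> L2 M"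
  by (simp add: L2_real_iff)

lemma L2_sum: "(\<And>i. i \<in> I \<Longrightarrow> u i \<in> L2 M) \<Longrightarrow> (\<lambda>x. \<Sum>i\<in>I. u i x) \<in> L2 M"
  for u :: "'b \<Rightarrow> 'a \<Rightarrow> real"
  by (induction I rule: infinite_finite_induct) (auto intro: L2_add)

lemma L2_dominated:
  fixes u :: "'a \<Rightarrow> real"
  assumes "v \<in> L2 M" "u \<in> borel_measurable M" "\<And>x. x \<in> space M \<Longrightarrow> \<bar>u x\<bar> \<le> \<bar>v x :: real\<bar>"
  shows "u \<in> L2 M"
proof -
  have "integrable M (\<lambda>x. (u x)\<^sup>2)"
    by (rule Bochner_Integration.integrable_bound[of M "\<lambda>x. (v x)\<^sup>2"])
      (use assms in \<open>auto simp: L2_real_iff abs_le_square_iff\<close>)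
  then show ?thesis using assms by (simp add: L2_real_iff)
qed

lemma L2_mult_bounded:
  fixes u :: "'a \<Rightarrow> real"
  assumes "u \<in> L2 M" "f \<in> borel_measurable M" "\<And>x. x \<in> space M \<Longrightarrow> \<bar>f x\<bar> \<le> B"
  shows "(\<lambda>x. f x * u x) \<in> L2 M"
proof (rule L2_dominated[OF L2_cmult[OF assms(1), of B]])
  show "\<bar>f x * u x\<bar> \<le> \<bar>B * u x\<bar>" if "x \<in> space M" for x
    using assms(3)[OF that] by (simp add: abs_mult mult_right_mono)
qed (use assms in \<open>auto simp: L2_real_iff\<close>)

lemma L2_cong_AE:
  fixes u v :: "'a \<Rightarrow> real"
  assumes "u \<in> L2 M" "v \<in> borel_measurable M" "AE x in M. u x = v x"
  shows "v \<in> L2 M"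
proof -
  have "integrable M (\<lambda>x. (v x)\<^sup>2)"
    by (rule Bochner_Integration.integrable_cong_AE_imp[of M "\<lambda>x. (u x)\<^sup>2"])
      (use assms in \<open>auto simp: L2_real_iff\<close>)
  then show ?thesis using assms by (simp add: L2_real_iff)
qed

lemma L2_integrable:
  fixes u :: "'a \<Rightarrow> real"
  assumes "finite_measure M" "u \<in> L2 M" shows "integrable M u"
proof -
  have "(\<lambda>x. 1::real) \<in> L2 M"
    using assms(1) by (simp add: L2_real_iff finite_measure.integrable_const)
  from L2_mult_integrable[OF assms(2) this] show ?thesis by simp
qed

lemma L2_norm_sum_le:
  fixes u :: "'i \<Rightarrow> 'a \<Rightarrow> real"
  assumes "finite I" "\<And>i. i \<in> I \<Longrightarrow> u i \<in> L2 M"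
  shows "(LINT x|M. (\<Sum>i\<in>I. u i x)\<^sup>2) \<le> real (card I) * (\<Sum>i\<in>I. LINT x|M. (u i x)\<^sup>2)"
proof -
  have "(LINT x|M. (\<Sum>i\<in>I. u i x)\<^sup>2) \<le> (LINT x|M. real (card I) * (\<Sum>i\<in>I. (u i x)\<^sup>2))"
  proof (rule integral_mono)
    show "integrable M (\<lambda>x. (\<Sum>i\<in>I. u i x)\<^sup>2)" using L2_sum[of I u M] assms by (simp add: L2_real_iff)
    show "integrable M (\<lambda>x. real (card I) * (\<Sum>i\<in>I. (u i x)\<^sup>2))"
      using assms by (auto simp: L2_real_iff)
    show "(\<Sum>i\<in>I. u i x)\<^sup>2 \<le> real (card I) * (\<Sum>i\<in>I. (u i x)\<^sup>2)" for x
      using sum_squared_le_sum_of_squares[of "\<lambda>i. u i x" I] assms(1) by (simp add: mult.commute)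
  qed
  also have "\<dots> = real (card I) * (\<Sum>i\<in>I. LINT x|M. (u i x)\<^sup>2)"
    using assms by (auto simp: L2_real_iff intro!: Bochner_Integration.integral_sum)
  finally show ?thesis .
qed

lemma L2_norm_add_le:
  fixes u v :: "'a \<Rightarrow> real"
  assumes "u \<in> L2 M" "v \<in> L2 M"
  shows "(LINT x|M. (u x + v x)\<^sup>2) \<le> 2 * (LINT x|M. (u x)\<^sup>2) + 2 * (LINT x|M. (v x)\<^sup>2)"
  using L2_norm_sum_le[of UNIV "\<lambda>b. if b then u else v" M] assms
  by (simp add: UNIV_bool algebra_simps)

lemma L2_Cauchy_Schwarz:
  fixes u v :: "'a \<Rightarrow> real"
  assumes "u \<in> L2 M" "v \<in> L2 M"
  shows "\<bar>LINT x|M. u x * v x\<bar> \<le> sqrt (LINT x|M. (u x)\<^sup>2) * sqrt (LINT x|M. (v x)\<^sup>2)"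
proof -
  define a b c where "a = (LINT x|M. (u x)\<^sup>2)" and "b = (LINT x|M. u x * v x)" and "c = (LINT x|M. (v x)\<^sup>2)"
  have int: "integrable M (\<lambda>x. (u x)\<^sup>2)" "integrable M (\<lambda>x. (v x)\<^sup>2)" "integrable M (\<lambda>x. u x * v x)"
    using assms L2_mult_integrable by (auto simp: L2_real_iff)
  have q: "0 \<le> s\<^sup>2 * a + 2 * (s * t) * b + t\<^sup>2 * c" for s t
  proof -
    have "0 \<le> (LINT x|M. (s * u x + t * v x)\<^sup>2)" by simp
    also have "\<dots> = (LINT x|M. s\<^sup>2 * (u x)\<^sup>2 + 2 * (s * t) * (u x * v x) + t\<^sup>2 * (v x)\<^sup>2)"
      by (rule Bochner_Integration.integral_cong) (auto simp: power2_eq_square algebra_simps)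
    also have "\<dots> = s\<^sup>2 * a + 2 * (s * t) * b + t\<^sup>2 * c" using int by (simp add: a_def b_def c_def)
    finally show ?thesis .
  qed
  have nn: "a \<ge> 0" "c \<ge> 0" by (simp_all add: a_def c_def)
  have "b\<^sup>2 \<le> a * c"
  proof (cases "c = 0")
    case True
    have "b = 0"
    proof (rule ccontr)
      assume "b \<noteq> 0"
      \<comment> \<open>For c = 0 the quadratic form takes the value a - (a + 1) = -1 at these
        arguments.\<close>
      then show False using q[of 1 "- (a + 1) / (2 * b)"] True nn by (simp add: field_simps)
    qed
    then show ?thesis using nn by simp
  next
    case False
    \<comment> \<open>At s = c and t = -b the form equals c times c a - b^2.\<close>
    then have "0 \<le> c * (c * a - b\<^sup>2)" using q[of c "- b"] by (simp add: power2_eq_square algebra_simps)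
    then show ?thesis using False nn by (simp add: zero_le_mult_iff mult.commute)
  qed
  then have "\<bar>b\<bar> \<le> sqrt (a * c)" by (simp add: real_le_rsqrt)
  then show ?thesis by (simp add: a_def b_def c_def real_sqrt_mult)
qed

lemma L2_mult_tendsto:
  fixes u v :: "'a \<Rightarrow> real"
  assumes L2: "u \<in> L2 M" "v \<in> L2 M" "\<And>n. f n \<in> L2 M" "\<And>n. g n \<in> L2 M"
    and f: "(\<lambda>n. LINT x|M. (f n x - u x)\<^sup>2) \<longlonglongrightarrow> 0"
    and g: "(\<lambda>n. LINT x|M. (g n x - v x)\<^sup>2) \<longlonglongrightarrow> 0"
  shows "(\<lambda>n. LINT x|M. f n x * g n x) \<longlonglongrightarrow> (LINT x|M. u x * v x)"
proof -
  have eq: "(LINT x|M. f n x * g n x) - (LINT x|M. u x * v x) =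
      (LINT x|M. (f n x - u x) * (g n x - v x)) + (LINT x|M. (f n x - u x) * v x)
        + (LINT x|M. u x * (g n x - v x))" for n
  proof -
    have "(LINT x|M. f n x * g n x) - (LINT x|M. u x * v x) = (LINT x|M. f n x * g n x - u x * v x)"
      by (intro Bochner_Integration.integral_diff[symmetric] L2_mult_integrable L2)
    also have "\<dots> = (LINT x|M. (f n x - u x) * (g n x - v x) + (f n x - u x) * v x + u x * (g n x - v x))"
      by (rule Bochner_Integration.integral_cong) (auto simp: algebra_simps)
    also have "\<dots> = (LINT x|M. (f n x - u x) * (g n x - v x)) + (LINT x|M. (f n x - u x) * v x)
        + (LINT x|M. u x * (g n x - v x))"
      by (subst Bochner_Integration.integral_add; (subst Bochner_Integration.integral_add)?;
          intro refl Bochner_Integration.integrable_add L2_mult_integrable L2_diff L2)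
    finally show ?thesis .
  qed
  have "(\<lambda>n. (LINT x|M. f n x * g n x) - (LINT x|M. u x * v x)) \<longlonglongrightarrow> 0"
  proof (rule Lim_null_comparison)
    let ?a = "\<lambda>n. sqrt (LINT x|M. (f n x - u x)\<^sup>2)" and ?b = "\<lambda>n. sqrt (LINT x|M. (g n x - v x)\<^sup>2)"
    let ?u = "sqrt (LINT x|M. (u x)\<^sup>2)" and ?v = "sqrt (LINT x|M. (v x)\<^sup>2)"
    show "\<forall>\<^sub>F n in sequentially. norm ((LINT x|M. f n x * g n x) - (LINT x|M. u x * v x))
        \<le> ?a n * ?b n + ?a n * ?v + ?u * ?b n"
      unfolding eq real_norm_def
      by (intro always_eventually allI order_trans[OF abs_triangle_ineq] add_mono
          L2_Cauchy_Schwarz L2_diff L2)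
    have "?a \<longlonglongrightarrow> 0" "?b \<longlonglongrightarrow> 0" using tendsto_real_sqrt[OF f] tendsto_real_sqrt[OF g] by simp_all
    then show "(\<lambda>n. ?a n * ?b n + ?a n * ?v + ?u * ?b n) \<longlonglongrightarrow> 0"
      by (intro tendsto_add_zero tendsto_mult_zero tendsto_mult_left_zero tendsto_mult_right_zero)
  qed
  then show ?thesis by (simp add: LIM_zero_iff)
qed

section \<open>Lebesgue measure on open sets\<close>

text \<open>The definitions integrate over the completed measure on \<open>S\<close>, whereas
  translations, Fubini and changes of variables are carried out with \<open>lborel\<close>.
  Functions that vanish off \<open>S\<close> pass from one to the other.\<close>

lemma
  fixes f :: "'a::euclidean_space \<Rightarrow> 'b::{banach, second_countable_topology}"
  assumes "S \<in> sets borel" "f \<in> borel_measurable borel" "\<And>x. x \<notin> S \<Longrightarrow> f x = 0"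
  shows integral_lebesgue_on_lborel: "integral\<^sup>L (lebesgue_on S) f = integral\<^sup>L lborel f"
    and integrable_lebesgue_on_lborel: "integrable (lebesgue_on S) f \<longleftrightarrow> integrable lborel f"
proof -
  have [simp]: "(\<lambda>x. indicat_real S x *\<^sub>R f x) = f"
    using assms(3) by (auto simp: indicator_def fun_eq_iff)
  have [measurable]: "f \<in> borel_measurable lborel" using assms by simp
  show "integral\<^sup>L (lebesgue_on S) f = integral\<^sup>L lborel f"
    using assms by (subst integral_restrict_space) (auto simp: integral_completion)
  show "integrable (lebesgue_on S) f \<longleftrightarrow> integrable lborel f"
    using assms by (subst integrable_restrict_space) (auto simp: integrable_completion)
qed

lemma borel_measurable_lebesgue_on:
  "f \<in> borel_measurable borel \<Longrightarrow> f \<in> borel_measurable (lebesgue_on S)"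
  by (intro measurable_restrict_space1 measurable_completion) simp

lemma borel_representative:
  fixes u :: "'a::euclidean_space \<Rightarrow> real"
  assumes "S \<in> sets borel" "u \<in> borel_measurable (lebesgue_on S)"
  obtains g where "g \<in> borel_measurable borel" "\<And>x. x \<notin> S \<Longrightarrow> g x = 0"
    "AE x in lebesgue_on S. u x = g x"
proof -
  have S: "S \<in> sets lebesgue" using assms(1) by simp
  obtain h where h: "h \<in> borel_measurable lborel" "AE x in lborel. (if x \<in> S then u x else 0) = h x"
    using completion_ex_borel_measurable_real[OF borel_measurable_if_I[OF assms(2) S]] by blast
  have "AE x in lebesgue. x \<in> S \<longrightarrow> u x = indicator S x * h x"
    using AE_completion[OF h(2)] by eventually_elim auto
  then have "AE x in lebesgue_on S. u x = indicator S x * h x"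
    using S by (subst AE_restrict_space_iff) auto
  then show ?thesis
    using that[of "\<lambda>x. indicator S x * h x"] h(1) assms(1) by auto
qed

text \<open>Supplies a Borel extension by zero, which can be translated and convolved on the whole
  space.\<close>

lemma L2_representative:
  fixes u :: "'a::euclidean_space \<Rightarrow> real"
  assumes "S \<in> sets borel" "u \<in> L2 (lebesgue_on S)"
  obtains g where "g \<in> L2 lborel" "g \<in> borel_measurable borel" "\<And>x. x \<notin> S \<Longrightarrow> g x = 0"
    "AE x in lebesgue_on S. u x = g x"
proof -
  obtain g where g: "g \<in> borel_measurable borel" "\<And>x. x \<notin> S \<Longrightarrow> g x = 0"
    "AE x in lebesgue_on S. u x = g x"
    using borel_representative[OF assms(1) L2_measurable[OF assms(2)]] by blast
  have "g \<in> L2 (lebesgue_on S)"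
    by (rule L2_cong_AE[OF assms(2) _ g(3)]) (rule borel_measurable_lebesgue_on[OF g(1)])
  then have "g \<in> L2 lborel"
    using integrable_lebesgue_on_lborel[of S "\<lambda>x. (g x)\<^sup>2"] assms(1) g by (auto simp: L2_real_iff)
  then show ?thesis using that g by blast
qed

lemma finite_lebesgue_on: "bounded S \<Longrightarrow> S \<in> sets borel \<Longrightarrow> finite_measure (lebesgue_on S)"
  using emeasure_bounded_finite[of S]
  by (intro finite_measureI) (auto simp: emeasure_restrict_space)

lemma smooth_L2:
  assumes "bounded S" "S \<in> sets borel" "smooth f" shows "f \<in> L2 (lebesgue_on S)"
proof -
  have "compact (f ` closure S)"
    by (intro compact_continuous_image smooth_continuous assms) (simp add: assms compact_closure)
  then obtain B where B: "\<forall>y\<in>f ` closure S. norm y \<le> B" using compact_imp_bounded bounded_iff by metis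
  have "(\<lambda>x. 1::real) \<in> L2 (lebesgue_on S)"
    using finite_lebesgue_on[OF assms(1,2)] by (simp add: L2_real_iff finite_measure.integrable_const)
  from L2_mult_bounded[OF this borel_measurable_lebesgue_on[OF smooth_borel[OF assms(3)]], of B]
  show ?thesis using B closure_subset[of S] by auto
qed

lemma smooth_bounded_on:
  assumes "bounded S" "smooth f" obtains B where "0 \<le> B" "\<And>x. x \<in> S \<Longrightarrow> \<bar>f x\<bar> \<le> B"
proof -
  have "compact (f ` closure S)"
    by (intro compact_continuous_image smooth_continuous assms) (simp add: assms compact_closure)
  then obtain B where B: "\<forall>y\<in>f ` closure S. norm y \<le> B" using compact_imp_bounded bounded_iff by metis
  show ?thesis by (rule that[of "max B 0"]) (use B closure_subset[of S] in \<open>auto simp: max.coboundedI1\<close>)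
qed

lemma L2_mult_smooth:
  fixes u :: "real^'n::finite \<Rightarrow> real"
  assumes "bounded S" "S \<in> sets borel" "u \<in> L2 (lebesgue_on S)" "smooth f"
  shows "(\<lambda>x. f x * u x) \<in> L2 (lebesgue_on S)"
proof -
  obtain B where "\<And>x. x \<in> S \<Longrightarrow> \<bar>f x\<bar> \<le> B" using smooth_bounded_on[OF assms(1,4)] by metis
  then show ?thesis
    by (intro L2_mult_bounded[OF assms(3), of _ B] borel_measurable_lebesgue_on smooth_borel assms) auto
qed

section \<open>Test functions determine measures\<close>

lemma test_function_integrable:
  fixes f :: "real^'n::finite \<Rightarrow> real"
  assumes "sets M = sets borel" "integrable M f" "g \<in> borel_measurable borel" "\<And>x. \<bar>g x\<bar> \<le> B"
  shows "integrable M (\<lambda>x. g x * f x)"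
proof (rule Bochner_Integration.integrable_bound[of M "\<lambda>x. B * f x"])
  show "AE x in M. norm (g x * f x) \<le> norm (B * f x)"
    using assms(4) by (intro AE_I2) (simp add: abs_mult mult_right_mono order.trans[OF _ abs_ge_self])
  show "(\<lambda>x. g x * f x) \<in> borel_measurable M"
    using assms measurable_cong_sets[OF assms(1) refl, of borel] by (auto intro!: borel_measurable_times)
qed (use assms in auto)

text \<open>An exhaustion by test functions gives equality on open sets, and these are an
  intersection stable generator. The densities may change sign, so the induction runs on integrals.
  Two different measures are allowed because the area measures of two charts are to be
  compared.\<close>

lemma test_functions_determine_measure:
  fixes f g :: "real^'n::finite \<Rightarrow> real"
  assumes M: "sets M = sets borel" and N: "sets N = sets borel"
    and f: "integrable M f" and g: "integrable N g" and U: "open U"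
    and eq: "\<And>\<phi>. test_function U \<phi> \<Longrightarrow> (LINT x|M. \<phi> x * f x) = (LINT x|N. \<phi> x * g x)"
    and A: "A \<in> sets borel" "A \<subseteq> U"
  shows "(LINT x|M. indicator A x * f x) = (LINT x|N. indicator A x * g x)"
proof -
  have op: "(LINT x:B|M. f x) = (LINT x:B|N. g x)" if B: "open B" "B \<subseteq> U" for B
  proof -
    obtain \<theta> :: "nat \<Rightarrow> real^'n \<Rightarrow> real" where \<theta>: "\<And>n. test_function B (\<theta> n)"
      "\<And>n x. 0 \<le> \<theta> n x" "\<And>n x. \<theta> n x \<le> 1" "\<And>x. (\<lambda>n. \<theta> n x) \<longlonglongrightarrow> indicator B x"
      using test_function_exhaustion[OF B(1)] by blast
    have lim: "(\<lambda>n. LINT x|L. \<theta> n x * h x) \<longlonglongrightarrow> (LINT x|L. indicator B x * h x)"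
      if L: "sets L = sets borel" "integrable L h" for L and h :: "real^'n \<Rightarrow> real"
    proof (rule integral_dominated_convergence[where w = "\<lambda>x. norm (h x)"])
      have b: "\<theta> n \<in> borel_measurable L" "indicat_real B \<in> borel_measurable L" for n
        using smooth_borel[OF test_function_smooth[OF \<theta>(1)]] B(1)
        by (auto simp: measurable_cong_sets[OF L(1) refl])
      show "(\<lambda>x. \<theta> n x * h x) \<in> borel_measurable L" "(\<lambda>x. indicator B x * h x) \<in> borel_measurable L" for n
        using b L(2) by (auto intro!: borel_measurable_times)
      show "AE x in L. (\<lambda>n. \<theta> n x * h x) \<longlonglongrightarrow> indicator B x * h x"
        using \<theta>(4) by (auto intro!: AE_I2 tendsto_mult)
      show "AE x in L. norm (\<theta> n x * h x) \<le> norm (h x)" for n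
        using \<theta>(2,3) by (intro AE_I2) (simp add: abs_mult mult_left_le_one_le)
    qed (use L in auto)
    have "(\<lambda>n. LINT x|M. \<theta> n x * f x) \<longlonglongrightarrow> (LINT x|N. indicator B x * g x)"
      using lim[OF N g] eq[OF test_function_mono[OF \<theta>(1) B(2)]] by simp
    then show ?thesis
      using LIMSEQ_unique lim[OF M f] by (fastforce simp: set_lebesgue_integral_def)
  qed
  have sM: "set_integrable M B f" "set_integrable N B g" if "B \<in> sets borel" for B
    unfolding set_integrable_def using that M N f g by (auto simp del: real_scaleR_def intro!: integrable_mult_indicator)
  have "sigma_sets UNIV {S. open S} = sets (borel :: (real^'n) measure)"
    by (simp add: borel_def)
  then have As: "A \<in> sigma_sets UNIV {S::(real^'n) set. open S}" using A by simp
  have Is: "Int_stable {S::(real^'n) set. open S}" by (auto simp: Int_stable_def)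
  have "(LINT x:A \<inter> U|M. f x) = (LINT x:A \<inter> U|N. g x)"
    using Is _ As
  proof (induct rule: sigma_sets_induct_disjoint)
    fix B :: "(real^'n) set" assume "B \<in> {S. open S}"
    then show "(LINT x:B \<inter> U|M. f x) = (LINT x:B \<inter> U|N. g x)" using U by (intro op) auto
  next
    fix B :: "(real^'n) set" assume "B \<in> sigma_sets UNIV {S. open S}"
      and IH: "(LINT x:B \<inter> U|M. f x) = (LINT x:B \<inter> U|N. g x)"
    then have B: "B \<in> sets borel" by (simp add: borel_def)
    \<comment> \<open>Complements are taken inside U, on which equality is known since U is open;
      integrability allows the subtraction.\<close>
    have U2: "U = (UNIV - B) \<inter> U \<union> B \<inter> U" by auto
    have sets: "(UNIV - B) \<inter> U \<in> sets borel" "B \<inter> U \<in> sets borel" using B U by auto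
    have dj: "((UNIV - B) \<inter> U) \<inter> (B \<inter> U) = {}" by auto
    have "(LINT x:U|M. f x) = (LINT x:(UNIV - B) \<inter> U|M. f x) + (LINT x:B \<inter> U|M. f x)"
      using set_integral_Un[OF dj sM(1)[OF sets(1)] sM(1)[OF sets(2)]] U2 by simp
    moreover have "(LINT x:U|N. g x) = (LINT x:(UNIV - B) \<inter> U|N. g x) + (LINT x:B \<inter> U|N. g x)"
      using set_integral_Un[OF dj sM(2)[OF sets(1)] sM(2)[OF sets(2)]] U2 by simp
    ultimately show "(LINT x:(UNIV - B) \<inter> U|M. f x) = (LINT x:(UNIV - B) \<inter> U|N. g x)"
      using IH op[OF U] by simp
  next
    fix B :: "nat \<Rightarrow> (real^'n) set"
    assume d: "disjoint_family B" and r: "range B \<subseteq> sigma_sets UNIV {S. open S}"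
      and IH: "\<And>i. (LINT x:B i \<inter> U|M. f x) = (LINT x:B i \<inter> U|N. g x)"
    have "B i \<in> sets borel" for i using r by (auto simp: borel_def)
    then have s: "B i \<inter> U \<in> sets borel" for i using U by auto
    have eqU: "(\<Union>i. B i) \<inter> U = (\<Union>i. B i \<inter> U)" by blast
    have dd: "(B i \<inter> U) \<inter> (B j \<inter> U) = {}" if "i \<noteq> j" for i j
      using d that by (auto simp: disjoint_family_on_def)
    have sU: "(\<Union>i. B i \<inter> U) \<in> sets borel" using s by (intro sets.countable_UN) auto
    have "(LINT x:(\<Union>i. B i \<inter> U)|M. f x) = (\<Sum>i. (LINT x:(B i \<inter> U)|M. f x))"
      by (rule lebesgue_integral_countable_add[OF _ dd sM(1)[OF sU]]) (use s M in \<open>simp_all\<close>)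
    moreover have "(LINT x:(\<Union>i. B i \<inter> U)|N. g x) = (\<Sum>i. (LINT x:(B i \<inter> U)|N. g x))"
      by (rule lebesgue_integral_countable_add[OF _ dd sM(2)[OF sU]]) (use s N in \<open>simp_all\<close>)
    ultimately show "(LINT x:\<Union> (range B) \<inter> U|M. f x) = (LINT x:\<Union> (range B) \<inter> U|N. g x)"
      by (simp only: eqU IH)
  next
    show "(LINT x:{} \<inter> U|M. f x) = (LINT x:{} \<inter> U|N. g x)"
      unfolding set_lebesgue_integral_def by simp
  qed auto
  then show ?thesis using A(2) by (simp add: Int_absorb2 set_lebesgue_integral_def)
qed

text \<open>The integrals over the sets where \<open>f\<close> or \<open>- f\<close> is positive
  vanish, so both sets are null.\<close>

lemma test_functions_zero_AE:
  fixes f :: "real^'n::finite \<Rightarrow> real"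
  assumes M: "sets M = sets borel" and f: "integrable M f" and U: "open U"
    and eq: "\<And>\<phi>. test_function U \<phi> \<Longrightarrow> (LINT x|M. \<phi> x * f x) = 0"
  shows "AE x in M. x \<in> U \<longrightarrow> f x = 0"
proof -
  have fb: "f \<in> borel_measurable borel"
    using f M measurable_cong_sets[OF M refl, of borel] by auto
  have pos: "AE x in M. x \<in> U \<longrightarrow> g x \<le> 0"
    if g: "integrable M g" "g \<in> borel_measurable borel"
      "\<And>\<phi>. test_function U \<phi> \<Longrightarrow> (LINT x|M. \<phi> x * g x) = 0" for g :: "real^'n \<Rightarrow> real"
  proof -
    define A where "A = {x. 0 < g x} \<inter> U"
    have A: "A \<in> sets borel" "A \<subseteq> U" using g(2) U by (auto simp: A_def)
    have "(LINT x|M. indicator A x * g x) = 0"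
      using test_functions_determine_measure[OF M M g(1), of "\<lambda>_. 0" U A] g(3) U A by simp
    moreover have "integrable M (\<lambda>x. indicator A x * g x)"
      by (rule test_function_integrable[OF M g(1), of _ 1]) (use A in \<open>auto simp: indicator_def\<close>)
    ultimately have "AE x in M. indicator A x * g x = 0"
      by (subst (asm) integral_nonneg_eq_0_iff_AE) (auto simp: A_def indicator_def)
    then show ?thesis by eventually_elim (auto simp: A_def indicator_def split: if_splits)
  qed
  have "AE x in M. x \<in> U \<longrightarrow> f x \<le> 0" by (rule pos) (use f fb eq in auto)
  moreover have "AE x in M. x \<in> U \<longrightarrow> - f x \<le> 0" by (rule pos) (use f fb eq in auto)
  ultimately show ?thesis by eventually_elim auto
qed

text \<open>Boundedness of \<open>\<Omega>\<close> makes the square integrable \<open>u\<close>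
  integrable, so the previous lemma applies to its Borel representative.\<close>

lemma fundamental_lemma:
  fixes u :: "real^'n::finite \<Rightarrow> real"
  assumes "bounded \<Omega>" "open \<Omega>" "u \<in> L2 (lebesgue_on \<Omega>)"
    and eq: "\<And>\<phi>. test_function \<Omega> \<phi> \<Longrightarrow> (LINT x|lebesgue_on \<Omega>. u x * \<phi> x) = 0"
  shows "AE x in lebesgue_on \<Omega>. u x = 0"
proof -
  have \<Omega>: "\<Omega> \<in> sets borel" using assms by simp
  obtain g where g: "g \<in> L2 lborel" "g \<in> borel_measurable borel" "\<And>x. x \<notin> \<Omega> \<Longrightarrow> g x = 0"
    "AE x in lebesgue_on \<Omega>. u x = g x"
    using L2_representative[OF \<Omega> assms(3)] by blast
  have um: "u \<in> borel_measurable (lebesgue_on \<Omega>)" using assms L2_measurable by blast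
  have "integrable (lebesgue_on \<Omega>) g"
    by (rule Bochner_Integration.integrable_cong_AE_imp[OF L2_integrable[OF finite_lebesgue_on assms(3)]])
      (use assms(1) \<Omega> g borel_measurable_lebesgue_on in auto)
  then have gi: "integrable lborel g"
    using integrable_lebesgue_on_lborel[OF \<Omega> g(2,3)] by blast
  have "AE x in lborel. x \<in> \<Omega> \<longrightarrow> g x = 0"
  proof (rule test_functions_zero_AE[OF _ gi assms(2)])
    fix \<phi> assume \<phi>: "test_function \<Omega> \<phi>"
    have b: "\<phi> \<in> borel_measurable borel" using \<phi> smooth_borel test_function_smooth by blast
    have "(LINT x|lborel. \<phi> x * g x) = (LINT x|lebesgue_on \<Omega>. \<phi> x * g x)"
      by (rule integral_lebesgue_on_lborel[symmetric]) (use \<Omega> b g in auto)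
    also have "\<dots> = (LINT x|lebesgue_on \<Omega>. u x * \<phi> x)"
    proof (rule integral_cong_AE)
      show "AE x in lebesgue_on \<Omega>. \<phi> x * g x = u x * \<phi> x" using g(4) by eventually_elim simp
    qed (intro borel_measurable_times um borel_measurable_lebesgue_on b g)+
    finally show "(LINT x|lborel. \<phi> x * g x) = 0" using eq[OF \<phi>] by simp
  qed simp
  then have "AE x in lebesgue_on \<Omega>. g x = 0"
    using \<Omega> AE_completion by (subst AE_restrict_space_iff) auto
  then show ?thesis using g(4) by eventually_elim simp
qed

section \<open>Mollification\<close>

lemma lborel_integral_affine:
  fixes f :: "'a::euclidean_space \<Rightarrow> real"
  assumes "f \<in> borel_measurable borel" "c \<noteq> 0"
  shows "(LINT z|lborel. f z) = \<bar>c\<bar> ^ DIM('a) * (LINT w|lborel. f (t + c *\<^sub>R w))"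
proof -
  have [measurable]: "f \<in> borel_measurable borel" by fact
  have "(LINT z|lborel. f z) = (LINT z|density (distr lborel borel (\<lambda>x. t + c *\<^sub>R x)) (\<lambda>_. \<bar>c\<bar> ^ DIM('a)). f z)"
    by (subst lborel_affine[OF assms(2), of t]) simp
  also have "\<dots> = \<bar>c\<bar> ^ DIM('a) * (LINT w|lborel. f (t + c *\<^sub>R w))"
    by (subst integral_density) (auto simp: integral_distr)
  finally show ?thesis .
qed

lemma lborel_integral_shift:
  fixes f :: "'a::euclidean_space \<Rightarrow> real"
  assumes "f \<in> borel_measurable borel"
  shows "(LINT x|lborel. f (x - y)) = (LINT x|lborel. f x)"
  using lborel_integral_affine[OF assms, of 1 "- y"] by simp

lemma lborel_integrable_shift:
  fixes f :: "'a::euclidean_space \<Rightarrow> real"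
  assumes "integrable lborel f" "c \<noteq> 0"
  shows "integrable lborel (\<lambda>w. f (t + c *\<^sub>R w))"
proof -
  have [measurable]: "f \<in> borel_measurable borel" using assms(1) by auto
  have "integrable (density (distr lborel borel (\<lambda>x. t + c *\<^sub>R x)) (\<lambda>_. ennreal (\<bar>c\<bar> ^ DIM('a)))) f"
    using assms(1) by (subst (asm) lborel_affine[OF assms(2), of t]) (simp add: ennreal_power)
  then show ?thesis using assms(2)
    by (subst (asm) integrable_density) (auto simp: integrable_distr_eq integrable_mult_right_iff)
qed

lemma L2_shift:
  fixes g :: "'a::euclidean_space \<Rightarrow> real"
  assumes "g \<in> L2 lborel" "c \<noteq> 0" shows "(\<lambda>w. g (t + c *\<^sub>R w)) \<in> L2 lborel"
  using assms lborel_integrable_shift[of "\<lambda>x. (g x)\<^sup>2" c t] by (auto simp: L2_real_iff)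

lemma test_function_L2: "test_function U f \<Longrightarrow> f \<in> L2 lborel"
proof -
  assume f: "test_function U f"
  obtain C where C: "compact C" "\<And>x. x \<notin> C \<Longrightarrow> f x = 0" by (rule test_functionE[OF f]) (rule that)
  have Cb: "C \<in> sets borel" "bounded C"
    using C(1) by (auto simp: compact_imp_closed compact_imp_bounded)
  have "f \<in> L2 (lebesgue_on C)" by (rule smooth_L2[OF Cb(2,1) test_function_smooth[OF f]])
  then have "integrable lborel (\<lambda>x. (f x)\<^sup>2)"
    using integrable_lebesgue_on_lborel[OF Cb(1), of "\<lambda>x. (f x)\<^sup>2"] C(2)
      smooth_borel[OF test_function_smooth[OF f]] by (auto simp: L2_real_iff)
  then show ?thesis using smooth_borel[OF test_function_smooth[OF f]] by (simp add: L2_real_iff)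
qed

lemma test_function_integrable_lborel: "test_function U f \<Longrightarrow> integrable lborel f"
proof -
  assume f: "test_function U f"
  obtain C where C: "compact C" "\<And>x. x \<notin> C \<Longrightarrow> f x = 0" by (rule test_functionE[OF f]) (rule that)
  have Cb: "C \<in> sets borel" "bounded C"
    using C(1) by (auto simp: compact_imp_closed compact_imp_bounded)
  have "integrable (lebesgue_on C) f"
    by (rule L2_integrable[OF finite_lebesgue_on[OF Cb(2,1)] smooth_L2[OF Cb(2,1) test_function_smooth[OF f]]])
  then show ?thesis
    using integrable_lebesgue_on_lborel[OF Cb(1), of f] C(2)
      smooth_borel[OF test_function_smooth[OF f]] by auto
qed

section \<open>Density of test functions in L2\<close>

definition test_dense :: "(real^'n::finite \<Rightarrow> real) \<Rightarrow> bool" where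
  "test_dense g \<longleftrightarrow> (\<forall>e>0. \<exists>\<phi>. test_function UNIV \<phi> \<and> (LINT x|lborel. (g x - \<phi> x)\<^sup>2) < e)"

lemma test_dense_limit:
  assumes g: "g \<in> L2 lborel"
    and ex: "\<And>e. 0 < e \<Longrightarrow> \<exists>h. h \<in> L2 lborel \<and> test_dense h \<and> (LINT x|lborel. (g x - h x)\<^sup>2) < e"
  shows "test_dense g"
  unfolding test_dense_def
proof (intro allI impI)
  fix e :: real assume "0 < e"
  \<comment> \<open>Two errors below e / 4 suffice because (a + b)^2 is at most 2 a^2 + 2
    b^2.\<close>
  then obtain h where h: "h \<in> L2 lborel" "test_dense h" "(LINT x|lborel. (g x - h x)\<^sup>2) < e / 4"
    using ex[of "e / 4"] by auto
  obtain \<phi> where \<phi>: "test_function UNIV \<phi>" "(LINT x|lborel. (h x - \<phi> x)\<^sup>2) < e / 4"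
    using h(2) \<open>0 < e\<close> unfolding test_dense_def by (meson zero_less_divide_iff zero_less_numeral)
  have "(LINT x|lborel. ((g x - h x) + (h x - \<phi> x))\<^sup>2)
      \<le> 2 * (LINT x|lborel. (g x - h x)\<^sup>2) + 2 * (LINT x|lborel. (h x - \<phi> x)\<^sup>2)"
    by (rule L2_norm_add_le; intro L2_diff g h test_function_L2[OF \<phi>(1)])
  then show "\<exists>\<phi>. test_function UNIV \<phi> \<and> (LINT x|lborel. (g x - \<phi> x)\<^sup>2) < e"
    using h(3) \<phi> by (intro exI[of _ \<phi>]) (simp add: algebra_simps)
qed

lemma test_dense_test: "test_function UNIV g \<Longrightarrow> test_dense g"
  unfolding test_dense_def by (auto intro!: exI[of _ g])

lemma test_dense_lim_seq:
  assumes g: "g \<in> L2 lborel" and h: "\<And>n. h n \<in> L2 lborel" "\<And>n. test_dense (h n)"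
    and le: "\<And>n x. \<bar>h n x\<bar> \<le> \<bar>g x\<bar>" and lim: "\<And>x. (\<lambda>n. h n x) \<longlonglongrightarrow> g x"
  shows "test_dense g"
proof (rule test_dense_limit[OF g])
  fix e :: real assume e: "0 < e"
  have "(\<lambda>n. LINT x|lborel. (g x - h n x)\<^sup>2) \<longlonglongrightarrow> (LINT x|(lborel :: (real^'a) measure). 0)"
  proof (rule integral_dominated_convergence[where w = "\<lambda>x. 4 * (g x)\<^sup>2"])
    show "(\<lambda>x. (g x - h n x)\<^sup>2) \<in> borel_measurable lborel" for n
      by (intro borel_measurable_power L2_measurable[OF L2_diff[OF g h(1)]])
    show "AE x in lborel. (\<lambda>n. (g x - h n x)\<^sup>2) \<longlonglongrightarrow> 0"
    proof (rule AE_I2)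
      fix x
      have "(\<lambda>n. (g x - h n x)\<^sup>2) \<longlonglongrightarrow> (g x - g x)\<^sup>2" by (intro tendsto_intros lim)
      then show "(\<lambda>n. (g x - h n x)\<^sup>2) \<longlonglongrightarrow> 0" by simp
    qed
    show "AE x in lborel. norm ((g x - h n x)\<^sup>2) \<le> 4 * (g x)\<^sup>2" for n
    proof (intro AE_I2)
      fix x
      have "\<bar>g x - h n x\<bar> \<le> \<bar>2 * g x\<bar>" using le[of n x] by linarith
      then have "(g x - h n x)\<^sup>2 \<le> (2 * g x)\<^sup>2" by (rule abs_le_square_iff[THEN iffD1])
      then show "norm ((g x - h n x)\<^sup>2) \<le> 4 * (g x)\<^sup>2" by (simp add: power_mult_distrib)
    qed
  qed (use g in \<open>auto simp: L2_real_iff\<close>)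
  then have "\<forall>\<^sub>F n in sequentially. (LINT x|lborel. (g x - h n x)\<^sup>2) < e"
    using e by (intro order_tendstoD(2)) auto
  then obtain n where "(LINT x|lborel. (g x - h n x)\<^sup>2) < e"
    by (meson eventually_sequentially order_refl)
  then show "\<exists>h. h \<in> L2 lborel \<and> test_dense h \<and> (LINT x|lborel. (g x - h x)\<^sup>2) < e"
    using h by blast
qed

lemma test_dense_open:
  fixes A :: "(real^'n::finite) set"
  assumes "open A" "emeasure lborel A < \<infinity>" shows "test_dense (indicator A)"
proof -
  obtain \<theta> :: "nat \<Rightarrow> real^'n \<Rightarrow> real" where \<theta>: "\<And>n. test_function A (\<theta> n)"
    "\<And>n x. 0 \<le> \<theta> n x" "\<And>n x. \<theta> n x \<le> 1" "\<And>x. (\<lambda>n. \<theta> n x) \<longlonglongrightarrow> indicator A x"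
    using test_function_exhaustion[OF assms(1)] by blast
  show ?thesis
  proof (rule test_dense_lim_seq)
    have "indicat_real A x ^ 2 = indicat_real A x" for x by (simp add: indicator_def)
    then show "indicat_real A \<in> L2 lborel"
      using assms by (auto simp: L2_real_iff)
    show "\<theta> n \<in> L2 lborel" "test_dense (\<theta> n)" for n
      using test_function_L2[OF \<theta>(1)] test_dense_test[OF test_function_mono[OF \<theta>(1)]] by auto
    show "\<bar>\<theta> n x\<bar> \<le> \<bar>indicat_real A x\<bar>" for n x
      using \<theta>(2,3)[of n x] test_function_outside[OF \<theta>(1), of x n] by (auto simp: indicator_def)
  qed (rule \<theta>(4))
qed

text \<open>Outer regularity replaces \<open>A\<close> by an open set of finite measure, whose
  indicator is a monotonically dominated limit of test functions.\<close>

lemma test_dense_indicator: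
  fixes A :: "(real^'n::finite) set"
  assumes A: "A \<in> sets borel" "emeasure lborel A < \<infinity>" shows "test_dense (indicator A)"
proof (rule test_dense_limit)
  have sq: "indicat_real B x ^ 2 = indicat_real B x" for B and x :: "real^'n" by (simp add: indicator_def)
  show "indicat_real A \<in> L2 lborel" using A by (auto simp: L2_real_iff sq)
  fix e :: real assume e: "0 < e"
  obtain T where T: "open T" "A \<subseteq> T" "T - A \<in> lmeasurable" "emeasure lebesgue (T - A) < ennreal e"
    using sets_lebesgue_outer_open[of A e] A e by auto
  have TA: "emeasure lborel (T - A) < ennreal e" using T A by simp
  have "emeasure lborel T = emeasure lborel A + emeasure lborel (T - A)"
    using T A by (subst plus_emeasure) (auto intro!: arg_cong[where f = "emeasure lborel"])
  moreover have "emeasure lborel (T - A) < \<infinity>" using TA ennreal_less_top less_trans by (metis infinity_ennreal_def)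
  ultimately have Tf: "emeasure lborel T < \<infinity>" using A by simp
  have "(LINT x|lborel. (indicat_real A x - indicat_real T x)\<^sup>2) = (LINT x|lborel. indicat_real (T - A) x)"
    using T(2) by (intro Bochner_Integration.integral_cong) (auto simp: indicator_def)
  also have "\<dots> = measure lborel (T - A)" by simp
  also have "\<dots> < e"
  proof -
    have "emeasure lborel (T - A) \<noteq> top" using TA by auto
    from emeasure_eq_ennreal_measure[OF this] show ?thesis using TA by (simp add: ennreal_less_iff)
  qed
  finally have "(LINT x|lborel. (indicat_real A x - indicat_real T x)\<^sup>2) < e" .
  moreover have "indicat_real T \<in> L2 lborel" using T Tf by (auto simp: L2_real_iff sq)
  ultimately show "\<exists>h. h \<in> L2 lborel \<and> test_dense h \<and> (LINT x|lborel. (indicat_real A x - h x)\<^sup>2) < e"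
    using test_dense_open[OF T(1) Tf] by blast
qed

lemma test_dense_add:
  assumes L2: "f \<in> L2 lborel" "g \<in> L2 lborel" and d: "test_dense f" "test_dense g"
  shows "test_dense (\<lambda>x. f x + g x)"
  unfolding test_dense_def
proof (intro allI impI)
  fix e :: real assume "0 < e"
  then have "0 < e / 4" by simp
  then obtain \<phi> \<psi> where \<phi>: "test_function UNIV \<phi>" "(LINT x|lborel. (f x - \<phi> x)\<^sup>2) < e / 4"
    and \<psi>: "test_function UNIV \<psi>" "(LINT x|lborel. (g x - \<psi> x)\<^sup>2) < e / 4"
    using d unfolding test_dense_def by blast
  have "(LINT x|lborel. ((f x - \<phi> x) + (g x - \<psi> x))\<^sup>2)
      \<le> 2 * (LINT x|lborel. (f x - \<phi> x)\<^sup>2) + 2 * (LINT x|lborel. (g x - \<psi> x)\<^sup>2)"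
    by (rule L2_norm_add_le; intro L2_diff L2 test_function_L2[OF \<phi>(1)] test_function_L2[OF \<psi>(1)])
  then show "\<exists>\<phi>. test_function UNIV \<phi> \<and> (LINT x|lborel. (f x + g x - \<phi> x)\<^sup>2) < e"
    using \<phi> \<psi> by (intro exI[of _ "\<lambda>x. \<phi> x + \<psi> x"]) (auto simp: algebra_simps test_function_add)
qed

lemma test_dense_cmult:
  assumes "test_dense g" shows "test_dense (\<lambda>x. c * g x)"
  unfolding test_dense_def
proof (intro allI impI)
  fix e :: real assume e: "0 < e"
  have c: "0 < c\<^sup>2 + 1" by (simp add: add_nonneg_pos)
  then have "0 < e / (c\<^sup>2 + 1)" using e by simp
  then obtain \<phi> where \<phi>: "test_function UNIV \<phi>" "(LINT x|lborel. (g x - \<phi> x)\<^sup>2) < e / (c\<^sup>2 + 1)"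
    using assms unfolding test_dense_def by blast
  have "(LINT x|lborel. (c * g x - c * \<phi> x)\<^sup>2) = c\<^sup>2 * (LINT x|lborel. (g x - \<phi> x)\<^sup>2)"
    by (simp add: right_diff_distrib[symmetric] power_mult_distrib)
  also have "\<dots> \<le> (c\<^sup>2 + 1) * (LINT x|lborel. (g x - \<phi> x)\<^sup>2)" by (intro mult_right_mono) auto
  also have "\<dots> < e" using \<phi>(2) c by (simp add: field_simps)
  finally show "\<exists>\<phi>. test_function UNIV \<phi> \<and> (LINT x|lborel. (c * g x - \<phi> x)\<^sup>2) < e"
    using \<phi>(1) by (intro exI[of _ "\<lambda>x. c * \<phi> x"]) (auto intro: test_function_mult)
qed

text \<open>Square integrability stands inside the conclusion because the induction runs over all
  nonnegative measurable functions. The summands and the approximants are dominated by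
  \<open>g\<close>, so they inherit it.\<close>

lemma test_dense_nonneg:
  fixes g :: "real^'n::finite \<Rightarrow> real"
  assumes "g \<in> borel_measurable lborel" "\<And>x. 0 \<le> g x"
  shows "integrable lborel (\<lambda>x. (g x)\<^sup>2) \<longrightarrow> test_dense g"
  using assms
proof (induction rule: borel_measurable_induct_real)
  case (set A)
  have "indicat_real A x ^ 2 = indicat_real A x" for x by (simp add: indicator_def)
  then show ?case using test_dense_indicator[of A] set by (auto simp: integrable_indicator_iff)
next
  case (mult u c)
  show ?case
  proof (cases "c = 0")
    case True
    then show ?thesis using test_dense_test[OF test_function_zero] by simp
  next
    case False
    then show ?thesis using mult test_dense_cmult by (auto simp: power_mult_distrib)
  qed
next
  case (add u v)
  show ?case
  proof
    assume int: "integrable lborel (\<lambda>x. (v x + u x)\<^sup>2)"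
    have "u \<in> L2 lborel" "v \<in> L2 lborel"
      by (rule L2_dominated[where v = "\<lambda>x. v x + u x"]; use add int in \<open>auto simp: L2_real_iff\<close>)+
    then show "test_dense (\<lambda>x. v x + u x)" using add by (intro test_dense_add) (auto simp: L2_real_iff)
  qed
next
  case (seq U)
  show ?case
  proof
    assume int: "integrable lborel (\<lambda>x. (g x)\<^sup>2)"
    have le: "U n x \<le> g x" for n x
      using seq by (intro incseq_le[of "\<lambda>n. U n x"]) (auto simp: incseq_def le_fun_def)
    have L2: "g \<in> L2 lborel" using int assms by (simp add: L2_real_iff)
    have L2U: "U n \<in> L2 lborel" for n
      by (rule L2_dominated[OF L2]) (use seq le assms in auto)
    show "test_dense g"
      by (rule test_dense_lim_seq[OF L2 L2U]) (use seq le assms L2U in \<open>auto simp: L2_real_iff\<close>)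
  qed
qed

lemma test_dense_L2:
  fixes g :: "real^'n::finite \<Rightarrow> real"
  assumes "g \<in> L2 lborel" shows "test_dense g"
proof -
  have gm: "g \<in> borel_measurable lborel" using assms L2_measurable by blast
  have p: "(\<lambda>x. max 0 (g x)) \<in> L2 lborel" "(\<lambda>x. max 0 (- g x)) \<in> L2 lborel"
    by (rule L2_dominated[OF assms]; use gm in auto)+
  then have "test_dense (\<lambda>x. max 0 (g x))" "test_dense (\<lambda>x. max 0 (- g x))"
    using test_dense_nonneg[of "\<lambda>x. max 0 (g x)"] test_dense_nonneg[of "\<lambda>x. max 0 (- g x)"]
    by (auto simp: L2_real_iff)
  then have "test_dense (\<lambda>x. max 0 (g x) + (- 1) * max 0 (- g x))"
    by (intro test_dense_add test_dense_cmult L2_cmult p)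
  moreover have "(\<lambda>x. max 0 (g x) + (- 1) * max 0 (- g x)) = g" by (auto simp: fun_eq_iff max_def)
  ultimately show ?thesis by simp
qed

lemma L2_translation_continuous_test:
  fixes \<phi> :: "real^'n::finite \<Rightarrow> real"
  assumes \<phi>: "test_function UNIV \<phi>" and e: "0 < e"
  obtains d where "0 < d" "\<And>y. norm y < d \<Longrightarrow> (LINT x|lborel. (\<phi> (x - y) - \<phi> x)\<^sup>2) < e"
proof -
  obtain C where C: "compact C" "\<And>x. x \<notin> C \<Longrightarrow> \<phi> x = 0" by (rule test_functionE[OF \<phi>]) (rule that)
  obtain L where L: "0 \<le> L" "\<And>x y. \<bar>\<phi> x - \<phi> y\<bar> \<le> L * norm (x - y)"
    by (rule test_function_lipschitz[OF \<phi>]) (rule that)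
  obtain R where R: "0 < R" "C \<subseteq> cball 0 R"
    using compact_imp_bounded[OF C(1)] unfolding bounded_pos by (auto simp: subset_eq)
  define m where "m = measure lborel (cball (0::real^'n) (R + 1))"
  have m: "0 \<le> m" by (simp add: m_def)
  \<comment> \<open>The bound 1 keeps both \<open>x\<close> and \<open>x - y\<close> outside the
    support once \<open>norm x\<close> exceeds R + 1. The square root makes the squared increment,
    integrated over that ball, smaller than e; the added 1 avoids a zero denominator.\<close>
  define d where "d = min 1 (sqrt (e / (L\<^sup>2 * m + 1)))"
  have pos: "0 < L\<^sup>2 * m + 1" using m by (simp add: add_nonneg_pos)
  have d: "0 < d" using e pos by (simp add: d_def)
  have "(LINT x|lborel. (\<phi> (x - y) - \<phi> x)\<^sup>2) < e" if y: "norm y < d" for y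
  proof -
    have y1: "norm y < 1" and "norm y < sqrt (e / (L\<^sup>2 * m + 1))" using y by (auto simp: d_def)
    then have "(norm y)\<^sup>2 < (sqrt (e / (L\<^sup>2 * m + 1)))\<^sup>2" by (intro power_strict_mono) auto
    then have y2: "(norm y)\<^sup>2 < e / (L\<^sup>2 * m + 1)" using e pos by simp
    let ?w = "\<lambda>x. (L * norm y)\<^sup>2 * indicator (cball (0::real^'n) (R + 1)) x :: real"
    have b: "(\<phi> (x - y) - \<phi> x)\<^sup>2 \<le> ?w x" for x
    proof (cases "x \<in> cball 0 (R + 1)")
      case True
      have "\<bar>\<phi> (x - y) - \<phi> x\<bar> \<le> L * norm y" using L(2)[of "x - y" x] by simp
      then have "\<bar>\<phi> (x - y) - \<phi> x\<bar>\<^sup>2 \<le> (L * norm y)\<^sup>2" by (intro power_mono) auto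
      then show ?thesis using True by simp
    next
      case False
      then have "x \<notin> C" "x - y \<notin> C"
        using R y1 norm_triangle_ineq[of "x - y" y] by (auto simp: subset_eq)
      then show ?thesis using C(2) by simp
    qed
    have "integrable lborel ?w"
      using emeasure_bounded_finite[of "cball (0::real^'n) (R + 1)"] by auto
    moreover have "(\<lambda>x. (\<phi> (x - y) - \<phi> x)\<^sup>2) \<in> borel_measurable lborel"
      using smooth_borel[OF test_function_smooth[OF \<phi>]] by measurable
    ultimately have "integrable lborel (\<lambda>x. (\<phi> (x - y) - \<phi> x)\<^sup>2)"
      by (rule Bochner_Integration.integrable_bound) (use b in auto)
    then have "(LINT x|lborel. (\<phi> (x - y) - \<phi> x)\<^sup>2) \<le> (LINT x|lborel. ?w x)"
      by (rule integral_mono[OF _ \<open>integrable lborel ?w\<close> b])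
    also have "\<dots> = (norm y)\<^sup>2 * (L\<^sup>2 * m)" by (simp add: m_def power_mult_distrib)
    also have "\<dots> \<le> (norm y)\<^sup>2 * (L\<^sup>2 * m + 1)" by (intro mult_left_mono) auto
    also have "\<dots> < e" using y2 pos by (simp add: field_simps)
    finally show ?thesis .
  qed
  then show ?thesis using that d by blast
qed

lemma L2_translation_continuous:
  fixes g :: "real^'n::finite \<Rightarrow> real"
  assumes g: "g \<in> L2 lborel" and e: "0 < e"
  obtains d where "0 < d" "\<And>y. norm y < d \<Longrightarrow> (LINT x|lborel. (g (x - y) - g x)\<^sup>2) < e"
proof -
  \<comment> \<open>The three errors enter with factors 2, 4 and 4, which gives 10 e / 12 in
    total.\<close>
  obtain \<phi> where \<phi>: "test_function UNIV \<phi>" "(LINT x|lborel. (g x - \<phi> x)\<^sup>2) < e / 12"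
    using test_dense_L2[OF g] e unfolding test_dense_def by (metis zero_less_divide_iff zero_less_numeral)
  obtain d where d: "0 < d" "\<And>y. norm y < d \<Longrightarrow> (LINT x|lborel. (\<phi> (x - y) - \<phi> x)\<^sup>2) < e / 12"
    using L2_translation_continuous_test[OF \<phi>(1), of "e / 12"] e by auto
  have \<phi>2: "\<phi> \<in> L2 lborel" by (rule test_function_L2[OF \<phi>(1)])
  have sh: "(\<lambda>x. f (x - y)) \<in> L2 lborel" if "f \<in> L2 lborel" for f :: "real^'n \<Rightarrow> real" and y
    using L2_shift[OF that, of 1 "- y"] by simp
  have "(LINT x|lborel. (g (x - y) - g x)\<^sup>2) < e" if y: "norm y < d" for y
  proof -
    let ?a = "\<lambda>x. g (x - y) - \<phi> (x - y)" and ?b = "\<lambda>x. \<phi> (x - y) - \<phi> x" and ?c = "\<lambda>x. \<phi> x - g x"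
    have "(LINT x|lborel. (?a x + (?b x + ?c x))\<^sup>2)
        \<le> 2 * (LINT x|lborel. (?a x)\<^sup>2) + 2 * (LINT x|lborel. (?b x + ?c x)\<^sup>2)"
      by (rule L2_norm_add_le; intro L2_diff L2_add sh g \<phi>2)
    moreover have "(LINT x|lborel. (?b x + ?c x)\<^sup>2) \<le> 2 * (LINT x|lborel. (?b x)\<^sup>2) + 2 * (LINT x|lborel. (?c x)\<^sup>2)"
      by (rule L2_norm_add_le; intro L2_diff sh g \<phi>2)
    moreover have "(LINT x|lborel. (?a x)\<^sup>2) = (LINT x|lborel. (g x - \<phi> x)\<^sup>2)"
      using lborel_integral_shift[of "\<lambda>x. (g x - \<phi> x)\<^sup>2" y] L2_measurable[OF L2_diff[OF g \<phi>2]] by simp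
    moreover have "(LINT x|lborel. (?c x)\<^sup>2) = (LINT x|lborel. (g x - \<phi> x)\<^sup>2)"
      by (simp add: power2_commute)
    ultimately show ?thesis using \<phi>(2) d(2)[OF y] e by simp
  qed
  then show ?thesis using that d(1) by blast
qed

section \<open>Convolution and mollifiers\<close>

definition conv :: "(real^'n::finite \<Rightarrow> real) \<Rightarrow> (real^'n \<Rightarrow> real) \<Rightarrow> real^'n \<Rightarrow> real" where
  "conv g \<rho> x = (LINT z|lborel. g z * \<rho> (x - z))"

lemma conv_integrable:
  assumes "integrable lborel g" "test_function U \<rho>"
  shows "integrable lborel (\<lambda>z. g z * \<rho> (x - z))"
proof -
  obtain B where B: "\<And>x. \<bar>\<rho> x\<bar> \<le> B" by (rule test_function_bounded[OF assms(2)]) (rule that)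
  have "(\<lambda>z. \<rho> (x - z)) \<in> borel_measurable borel"
    using smooth_borel[OF test_function_smooth[OF assms(2)]] by measurable
  from test_function_integrable[OF _ assms(1) this B] show ?thesis by (simp add: mult.commute)
qed

text \<open>Differentiation under the integral: the remainder quotient of \<open>\<rho>\<close> is
  bounded by its Lipschitz constant plus a bound on its gradient, so a multiple of
  \<open>\<bar>g\<bar>\<close> dominates.\<close>

lemma conv_has_derivative:
  fixes g :: "real^'n::finite \<Rightarrow> real"
  assumes g: "integrable lborel g" and \<rho>: "test_function U \<rho>"
  shows "(conv g \<rho> has_derivative (\<lambda>v. (\<chi> i. conv g (partial i \<rho>) x) \<bullet> v)) (at x)"
proof -
  have [measurable]: "\<rho> \<in> borel_measurable borel" by (rule smooth_borel[OF test_function_smooth[OF \<rho>]])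
  have gm[measurable]: "g \<in> borel_measurable lborel" using g by auto
  obtain L where L: "0 \<le> L" "\<And>x y. \<bar>\<rho> x - \<rho> y\<bar> \<le> L * norm (x - y)"
    by (rule test_function_lipschitz[OF \<rho>]) (rule that)
  have D: "(\<rho> has_derivative (\<lambda>v. grad \<rho> x \<bullet> v)) (at x)" for x
    by (rule has_derivative_grad[OF smooth_differentiable[OF test_function_smooth[OF \<rho>]]])
  have pint: "integrable lborel (\<lambda>z. g z * partial i \<rho> (x - z))" for i
    by (rule conv_integrable[OF g test_function_partial[OF \<rho>]])
  have gr: "integrable lborel (\<lambda>z. g z * (grad \<rho> (x - z) \<bullet> v))"
    "(LINT z|lborel. g z * (grad \<rho> (x - z) \<bullet> v)) = (\<chi> i. conv g (partial i \<rho>) x) \<bullet> v" for v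
  proof -
    have eq: "(\<lambda>z. g z * (grad \<rho> (x - z) \<bullet> v)) = (\<lambda>z. \<Sum>i\<in>UNIV. v $ i * (g z * partial i \<rho> (x - z)))"
      by (auto simp: fun_eq_iff inner_vec_def grad_def sum_distrib_left algebra_simps)
    show "integrable lborel (\<lambda>z. g z * (grad \<rho> (x - z) \<bullet> v))"
      unfolding eq using pint by auto
    show "(LINT z|lborel. g z * (grad \<rho> (x - z) \<bullet> v)) = (\<chi> i. conv g (partial i \<rho>) x) \<bullet> v"
      unfolding eq using pint by (simp add: inner_vec_def conv_def mult.commute)
  qed
  obtain B where B: "\<And>i x. \<bar>partial i \<rho> x\<bar> \<le> B i"
  proof -
    have "\<exists>B. \<forall>x. \<bar>partial i \<rho> x\<bar> \<le> B" for i
      by (rule test_function_bounded[OF test_function_partial[OF \<rho>, of i]]) blast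
    then show ?thesis using that by metis
  qed
  have gb: "norm (grad \<rho> x) \<le> sum B UNIV" for x
    by (intro order_trans[OF norm_le_l1_cart] sum_mono) (simp add: grad_def B)
  let ?q = "\<lambda>v z. (\<rho> (x + v - z) - \<rho> (x - z) - grad \<rho> (x - z) \<bullet> v) / norm v"
  have qb: "\<bar>?q v z\<bar> \<le> L + sum B UNIV" if "v \<noteq> 0" for v z
  proof -
    have "\<bar>\<rho> (x + v - z) - \<rho> (x - z)\<bar> \<le> L * norm v" using L(2)[of "x + v - z" "x - z"] by simp
    moreover have "\<bar>grad \<rho> (x - z) \<bullet> v\<bar> \<le> sum B UNIV * norm v"
      using order_trans[OF Cauchy_Schwarz_ineq2 mult_right_mono[OF gb norm_ge_zero]] .
    ultimately have "\<bar>\<rho> (x + v - z) - \<rho> (x - z) - grad \<rho> (x - z) \<bullet> v\<bar> \<le> (L + sum B UNIV) * norm v"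
      unfolding distrib_right by linarith
    then show ?thesis using that by (simp add: field_simps)
  qed
  have qint: "(LINT z|lborel. g z * ?q v z) =
     (conv g \<rho> (x + v) - conv g \<rho> x - (\<chi> i. conv g (partial i \<rho>) x) \<bullet> v) / norm v" for v
  proof -
    have "(LINT z|lborel. g z * ?q v z) = (LINT z|lborel. (g z * \<rho> (x + v - z) - g z * \<rho> (x - z)
        - g z * (grad \<rho> (x - z) \<bullet> v)) / norm v)"
      by (rule Bochner_Integration.integral_cong) (auto simp: algebra_simps diff_divide_distrib)
    also have "\<dots> = (LINT z|lborel. g z * \<rho> (x + v - z) - g z * \<rho> (x - z)
        - g z * (grad \<rho> (x - z) \<bullet> v)) / norm v" by simp
    also have "\<dots> = (conv g \<rho> (x + v) - conv g \<rho> x - (\<chi> i. conv g (partial i \<rho>) x) \<bullet> v) / norm v"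
      using conv_integrable[OF g \<rho>] gr by (simp add: conv_def)
    finally show ?thesis .
  qed
  have "((\<lambda>v. LINT z|lborel. g z * ?q v z) \<longlongrightarrow> 0) (at 0)"
    unfolding tendsto_at_iff_sequentially comp_def
  proof (intro allI impI)
    fix X :: "nat \<Rightarrow> real^'n" assume X: "\<forall>i. X i \<in> UNIV - {0}" "X \<longlonglongrightarrow> 0"
    have "(\<lambda>n. LINT z|lborel. g z * ?q (X n) z) \<longlonglongrightarrow> (LINT z|lborel. g z * 0)"
    proof (rule integral_dominated_convergence[where w = "\<lambda>z. (L + sum B UNIV) * norm (g z)"])
      show "(\<lambda>z. g z * ?q (X n) z) \<in> borel_measurable lborel" for n
      proof -
        have "(\<lambda>z. g z * (\<rho> (x + X n - z) - \<rho> (x - z)) - g z * (grad \<rho> (x - z) \<bullet> X n)) \<in> borel_measurable lborel"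
          using borel_measurable_integrable[OF gr(1)] by measurable
        then have "(\<lambda>z. (g z * (\<rho> (x + X n - z) - \<rho> (x - z)) - g z * (grad \<rho> (x - z) \<bullet> X n)) / norm (X n)) \<in> borel_measurable lborel"
          by measurable
        then show ?thesis by (simp add: algebra_simps)
      qed
      show "AE z in lborel. (\<lambda>n. g z * ?q (X n) z) \<longlonglongrightarrow> g z * 0"
      proof (intro AE_I2 tendsto_mult tendsto_const)
        fix z
        have "((\<lambda>v. norm (\<rho> ((x - z) + v) - \<rho> (x - z) - grad \<rho> (x - z) \<bullet> v) / norm v) \<longlongrightarrow> 0) (at 0)"
          using D[of "x - z"] unfolding has_derivative_at by blast
        then have "(\<lambda>n. norm (\<rho> ((x - z) + X n) - \<rho> (x - z) - grad \<rho> (x - z) \<bullet> X n) / norm (X n)) \<longlonglongrightarrow> 0"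
          using X unfolding tendsto_at_iff_sequentially comp_def by blast
        then have "(\<lambda>n. \<bar>?q (X n) z\<bar>) \<longlonglongrightarrow> 0" by (simp add: algebra_simps abs_divide)
        then show "(\<lambda>n. ?q (X n) z) \<longlonglongrightarrow> 0" by (rule tendsto_rabs_zero_cancel)
      qed
      show "AE z in lborel. norm (g z * ?q (X n) z) \<le> (L + sum B UNIV) * norm (g z)" for n
      proof (intro AE_I2)
        fix z
        have "\<bar>g z\<bar> * \<bar>?q (X n) z\<bar> \<le> \<bar>g z\<bar> * (L + sum B UNIV)"
          using X(1) by (intro mult_left_mono qb) auto
        then show "norm (g z * ?q (X n) z) \<le> (L + sum B UNIV) * norm (g z)"
          by (simp only: real_norm_def abs_mult mult.commute)
      qed
    qed (use g in auto)
    then show "(\<lambda>n. LINT z|lborel. g z * ?q (X n) z) \<longlonglongrightarrow> 0" by simp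
  qed
  then have "((\<lambda>v. norm (conv g \<rho> (x + v) - conv g \<rho> x - (\<chi> i. conv g (partial i \<rho>) x) \<bullet> v) / norm v) \<longlongrightarrow> 0) (at 0)"
    unfolding qint by (drule_tac tendsto_rabs_zero) (simp add: abs_divide)
  then show ?thesis
    by (simp add: has_derivative_at bounded_linear_inner_right)
qed

lemma conv_partial:
  "integrable lborel g \<Longrightarrow> test_function U \<rho> \<Longrightarrow> partial i (conv g \<rho>) x = conv g (partial i \<rho>) x"
  using partial_eq[OF conv_has_derivative] by (simp add: inner_axis)

lemma conv_smooth:
  assumes g: "integrable lborel g" and \<rho>: "test_function U \<rho>" shows "smooth (conv g \<rho>)"
proof -
  have d: "conv g \<rho> differentiable (at x)" if "test_function U \<rho>" for \<rho> x
    using conv_has_derivative[OF g that] differentiable_def by blast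
  have "C_k k (conv g \<rho>)" for k
    using \<rho>
  proof (induction k arbitrary: \<rho>)
    case 0
    then show ?case
      using d by (auto intro!: continuous_at_imp_continuous_on differentiable_imp_continuous_within)
  next
    case (Suc k)
    have "partial i (conv g \<rho>) = conv g (partial i \<rho>)" for i
      by (rule ext) (rule conv_partial[OF g Suc.prems])
    then show ?case using Suc d by (simp add: test_function_partial)
  qed
  then show ?thesis by (simp add: smooth_def)
qed

definition rescale :: "real \<Rightarrow> (real^'n::finite \<Rightarrow> real) \<Rightarrow> real^'n \<Rightarrow> real" where
  "rescale \<epsilon> \<rho> x = \<rho> ((1 / \<epsilon>) *\<^sub>R x) / \<epsilon> ^ CARD('n)"

lemma conv_rescale:
  fixes g :: "real^'n::finite \<Rightarrow> real"
  assumes "0 < \<epsilon>" "g \<in> borel_measurable borel" "\<rho> \<in> borel_measurable borel"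
  shows "conv g (rescale \<epsilon> \<rho>) x = (LINT w|lborel. g (x - \<epsilon> *\<^sub>R w) * \<rho> w)"
proof -
  have m: "(\<lambda>z. g z * rescale \<epsilon> \<rho> (x - z)) \<in> borel_measurable borel"
    using assms unfolding rescale_def by measurable
  have "conv g (rescale \<epsilon> \<rho>) x
      = \<bar>- \<epsilon>\<bar> ^ DIM(real^'n) * (LINT w|lborel. g (x + (- \<epsilon>) *\<^sub>R w) * rescale \<epsilon> \<rho> (x - (x + (- \<epsilon>) *\<^sub>R w)))"
    unfolding conv_def using assms(1) by (intro lborel_integral_affine[OF m]) auto
  also have "\<dots> = (LINT w|lborel. g (x - \<epsilon> *\<^sub>R w) * \<rho> w)"
    using assms(1) by (simp add: rescale_def)
  finally show ?thesis .
qed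

lemma test_function_rescale:
  fixes \<rho> :: "real^'n::finite \<Rightarrow> real"
  assumes "test_function UNIV \<rho>" "0 < \<epsilon>" shows "test_function UNIV (rescale \<epsilon> \<rho>)"
proof -
  obtain C where C: "compact C" "\<And>x. x \<notin> C \<Longrightarrow> \<rho> x = 0" by (rule test_functionE[OF assms(1)]) (rule that)
  show ?thesis
  proof (rule test_functionI)
    show "compact ((\<lambda>x. \<epsilon> *\<^sub>R x) ` C)" using C(1) by (rule compact_scaling)
    show "rescale \<epsilon> \<rho> x = 0" if "x \<notin> (\<lambda>x. \<epsilon> *\<^sub>R x) ` C" for x
    proof -
      have "(1 / \<epsilon>) *\<^sub>R x \<notin> C" using that assms(2) by (auto simp: image_iff)
      then show ?thesis using C(2) by (simp add: rescale_def)
    qed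
    have "smooth (\<lambda>x. (1 / \<epsilon> ^ CARD('n)) * \<rho> ((1 / \<epsilon>) *\<^sub>R x + 0))"
      by (intro smooth_cmult smooth_affine test_function_smooth[OF assms(1)])
    then show "smooth (rescale \<epsilon> \<rho>)" by (simp add: rescale_def[abs_def])
  qed auto
qed

text \<open>Jensen's inequality for the probability density \<open>\<rho>\<close> and Tonelli reduce the estimate to
  the continuity of translations in L2.\<close>

lemma conv_L2_close:
  fixes g \<rho> :: "real^'n::finite \<Rightarrow> real"
  assumes \<rho>: "test_function UNIV \<rho>" "\<And>x. 0 \<le> \<rho> x" "(LINT x|lborel. \<rho> x) = 1"
    and R: "\<And>x. \<rho> x \<noteq> 0 \<Longrightarrow> norm x \<le> R" "0 < R"
    and g: "g \<in> L2 lborel" "integrable lborel g" and e: "0 < e"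
  obtains d where "0 < d" "\<And>\<epsilon>. 0 < \<epsilon> \<Longrightarrow> \<epsilon> < d \<Longrightarrow>
    integrable lborel (\<lambda>x. (conv g (rescale \<epsilon> \<rho>) x - g x)\<^sup>2) \<and>
    (LINT x|lborel. (conv g (rescale \<epsilon> \<rho>) x - g x)\<^sup>2) < e"
proof -
  have gm[measurable]: "g \<in> borel_measurable borel" using g(2) by auto
  have rm[measurable]: "\<rho> \<in> borel_measurable borel" by (rule smooth_borel[OF test_function_smooth[OF \<rho>(1)]])
  obtain B where B: "\<And>x. \<bar>\<rho> x\<bar> \<le> B" by (rule test_function_bounded[OF \<rho>(1)]) (rule that)
  have ri: "integrable lborel \<rho>" by (rule test_function_integrable_lborel[OF \<rho>(1)])
  obtain d where d: "0 < d" "\<And>y. norm y < d \<Longrightarrow> (LINT x|lborel. (g (x - y) - g x)\<^sup>2) < e / 2"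
    using L2_translation_continuous[OF g(1), of "e / 2"] e by auto
  \<comment> \<open>For \<open>w\<close> in the support of \<open>\<rho>\<close>, the bound d / R
    makes the translation by \<open>\<epsilon> *\<^sub>R w\<close> shorter than d.\<close>
  have "integrable lborel (\<lambda>x. (conv g (rescale \<epsilon> \<rho>) x - g x)\<^sup>2) \<and>
    (LINT x|lborel. (conv g (rescale \<epsilon> \<rho>) x - g x)\<^sup>2) < e" if \<epsilon>: "0 < \<epsilon>" "\<epsilon> < d / R" for \<epsilon>
  proof -
    let ?c = "conv g (rescale \<epsilon> \<rho>)"
    have cm[measurable]: "?c \<in> borel_measurable borel"
      by (rule smooth_borel[OF conv_smooth[OF g(2) test_function_rescale[OF \<rho>(1) \<epsilon>(1)]]])
    have sh: "(\<lambda>w. g (x - \<epsilon> *\<^sub>R w)) \<in> L2 lborel" for x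
      using L2_shift[OF g(1), of "- \<epsilon>" x] \<epsilon> by simp
    have shi: "integrable lborel (\<lambda>w. g (x - \<epsilon> *\<^sub>R w))" for x
      using lborel_integrable_shift[OF g(2), of "- \<epsilon>" x] \<epsilon> by simp
    have jensen: "integrable lborel (\<lambda>w. (g (x - \<epsilon> *\<^sub>R w) - g x)\<^sup>2 * \<rho> w) \<and>
      (?c x - g x)\<^sup>2 \<le> (LINT w|lborel. (g (x - \<epsilon> *\<^sub>R w) - g x)\<^sup>2 * \<rho> w)" for x
    proof -
      let ?a = "\<lambda>w. g (x - \<epsilon> *\<^sub>R w) - g x"
      define m where "m = ?c x - g x"
      have i0: "integrable lborel (\<lambda>w. g (x - \<epsilon> *\<^sub>R w) * \<rho> w)"
        using test_function_integrable[OF _ shi rm B] by (simp add: mult.commute)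
      have i1: "integrable lborel (\<lambda>w. ?a w * \<rho> w)"
        using i0 ri by (simp add: left_diff_distrib)
      have m: "m = (LINT w|lborel. ?a w * \<rho> w)"
        using i0 ri \<rho>(3) unfolding m_def conv_rescale[OF \<epsilon>(1) gm rm] by (simp add: left_diff_distrib)
      have i2: "integrable lborel (\<lambda>w. (?a w)\<^sup>2 * \<rho> w)"
      proof -
        have "integrable lborel (\<lambda>w. \<rho> w * (g (x - \<epsilon> *\<^sub>R w))\<^sup>2)"
          by (rule test_function_integrable[OF _ _ rm B]) (use sh in \<open>auto simp: L2_real_iff\<close>)
        then have "integrable lborel (\<lambda>w. \<rho> w * (g (x - \<epsilon> *\<^sub>R w))\<^sup>2 - 2 * g x * (g (x - \<epsilon> *\<^sub>R w) * \<rho> w) + (g x)\<^sup>2 * \<rho> w)"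
          using i0 ri by auto
        then show ?thesis by (simp add: power2_eq_square algebra_simps)
      qed
      \<comment> \<open>Jensen's inequality for the square is the nonnegativity of the variance of
        \<open>?a\<close> under the density \<open>\<rho>\<close>.\<close>
      have "0 \<le> (LINT w|lborel. (?a w - m)\<^sup>2 * \<rho> w)" using \<rho>(2) by simp
      also have "\<dots> = (LINT w|lborel. (?a w)\<^sup>2 * \<rho> w - 2 * m * (?a w * \<rho> w) + m\<^sup>2 * \<rho> w)"
        by (rule Bochner_Integration.integral_cong) (auto simp: power2_eq_square algebra_simps)
      also have "\<dots> = (LINT w|lborel. (?a w)\<^sup>2 * \<rho> w) - 2 * m * m + m\<^sup>2"
        using i1 i2 ri \<rho>(3) m by simp
      finally have "m\<^sup>2 \<le> (LINT w|lborel. (?a w)\<^sup>2 * \<rho> w)" by (simp add: power2_eq_square)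
      then show ?thesis using i2 by (simp add: m_def)
    qed
    have "(\<integral>\<^sup>+ x. ennreal ((?c x - g x)\<^sup>2) \<partial>lborel)
        \<le> (\<integral>\<^sup>+ x. \<integral>\<^sup>+ w. ennreal ((g (x - \<epsilon> *\<^sub>R w) - g x)\<^sup>2 * \<rho> w) \<partial>lborel \<partial>lborel)"
    proof (rule nn_integral_mono)
      fix x
      have "(\<integral>\<^sup>+ w. ennreal ((g (x - \<epsilon> *\<^sub>R w) - g x)\<^sup>2 * \<rho> w) \<partial>lborel)
          = ennreal (LINT w|lborel. (g (x - \<epsilon> *\<^sub>R w) - g x)\<^sup>2 * \<rho> w)"
        using jensen[of x] \<rho>(2) by (intro nn_integral_eq_integral) auto
      then show "ennreal ((?c x - g x)\<^sup>2) \<le> (\<integral>\<^sup>+ w. ennreal ((g (x - \<epsilon> *\<^sub>R w) - g x)\<^sup>2 * \<rho> w) \<partial>lborel)"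
        using jensen[of x] by (simp add: ennreal_leI)
    qed
    also have "\<dots> = (\<integral>\<^sup>+ w. \<integral>\<^sup>+ x. ennreal ((g (x - \<epsilon> *\<^sub>R w) - g x)\<^sup>2 * \<rho> w) \<partial>lborel \<partial>lborel)"
      by (rule lborel_pair.Fubini'[symmetric]) measurable
    also have "\<dots> \<le> (\<integral>\<^sup>+ w. ennreal (e / 2 * \<rho> w) \<partial>lborel)"
    proof (rule nn_integral_mono)
      fix w
      show "(\<integral>\<^sup>+ x. ennreal ((g (x - \<epsilon> *\<^sub>R w) - g x)\<^sup>2 * \<rho> w) \<partial>lborel) \<le> ennreal (e / 2 * \<rho> w)"
      proof (cases "\<rho> w = 0")
        case False
        have "norm (\<epsilon> *\<^sub>R w) \<le> \<epsilon> * R" using R(1)[OF False] \<epsilon>(1) by (simp add: mult_left_mono)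
        also have "\<dots> < d" using \<epsilon> R(2) by (simp add: field_simps)
        finally have w: "(LINT x|lborel. (g (x - \<epsilon> *\<^sub>R w) - g x)\<^sup>2) < e / 2" by (rule d(2))
        have L: "(\<lambda>x. g (x - \<epsilon> *\<^sub>R w) - g x) \<in> L2 lborel"
          using L2_shift[OF g(1), of 1 "- \<epsilon> *\<^sub>R w"] by (intro L2_diff g(1)) simp
        have "(\<integral>\<^sup>+ x. ennreal ((g (x - \<epsilon> *\<^sub>R w) - g x)\<^sup>2 * \<rho> w) \<partial>lborel)
            = ennreal (LINT x|lborel. (g (x - \<epsilon> *\<^sub>R w) - g x)\<^sup>2 * \<rho> w)"
          using L \<rho>(2) by (intro nn_integral_eq_integral) (auto simp: L2_real_iff)
        also have "\<dots> \<le> ennreal (e / 2 * \<rho> w)"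
          using mult_right_mono[OF less_imp_le[OF w] \<rho>(2)[of w]] by (intro ennreal_leI) simp
        finally show ?thesis .
      qed simp
    qed
    also have "\<dots> = ennreal (e / 2)"
      using ri \<rho> e by (subst nn_integral_eq_integral) auto
    finally have le: "(\<integral>\<^sup>+ x. ennreal ((?c x - g x)\<^sup>2) \<partial>lborel) \<le> ennreal (e / 2)" .
    have int: "integrable lborel (\<lambda>x. (?c x - g x)\<^sup>2)"
    proof (rule integrableI_bounded)
      show "(\<integral>\<^sup>+ x. ennreal (norm ((?c x - g x)\<^sup>2)) \<partial>lborel) < \<infinity>"
        using le_less_trans[OF le ennreal_less_top] by simp
    qed measurable
    have "ennreal (LINT x|lborel. (?c x - g x)\<^sup>2) \<le> ennreal (e / 2)"
      using le int by (subst (asm) nn_integral_eq_integral) auto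
    then have "(LINT x|lborel. (?c x - g x)\<^sup>2) \<le> e / 2" using e by (subst (asm) ennreal_le_iff) auto
    then show ?thesis using int e by simp
  qed
  then show ?thesis using that[of "d / R"] d(1) R(2) by simp
qed

section \<open>Boundary charts\<close>

text \<open>For orthogonal \<open>Q\<close> this is the inverse rotation. The chart coordinates of
  \<open>z\<close> are the horizontal part \<open>hor\<close> and the third component of
  \<open>unframe Q (z - p)\<close>.\<close>

definition unframe :: "real^3^3 \<Rightarrow> real^3 \<Rightarrow> real^3" where
  "unframe Q v = transpose Q *v v"

definition hor :: "real^3 \<Rightarrow> real^2" where
  "hor w = vector [w $ 1, w $ 2]"

definition emb :: "real^2 \<Rightarrow> real \<Rightarrow> real^3" where
  "emb y s = vector [y $ 1, y $ 2, s]"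

lemma vec3_eq_iff: "v = w \<longleftrightarrow> v $ 1 = w $ 1 \<and> v $ 2 = w $ 2 \<and> v $ 3 = w $ 3" for v w :: "'a^3"
  by (auto simp: vec_eq_iff forall_3)

lemma vec2_eq_iff: "v = w \<longleftrightarrow> v $ 1 = w $ 1 \<and> v $ 2 = w $ 2" for v w :: "'a^2"
  by (auto simp: vec_eq_iff forall_2)

lemma hor_nth [simp]: "hor w $ 1 = w $ 1" "hor w $ 2 = w $ 2"
  by (simp_all add: hor_def)

lemma emb_nth [simp]: "emb y s $ 1 = y $ 1" "emb y s $ 2 = y $ 2" "emb y s $ 3 = s"
  by (simp_all add: emb_def)

lemma hor_emb [simp]: "hor (emb y s) = y" by (simp add: vec2_eq_iff)

lemma emb_hor [simp]: "emb (hor w) (w $ 3) = w" by (simp add: vec3_eq_iff)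

lemma emb_diff: "emb y s - t *\<^sub>R v = emb (y - t *\<^sub>R hor v) (s - t * v $ 3)"
  by (simp add: vec3_eq_iff)

lemma linear_hor: "linear hor"
  by (rule linearI) (simp_all add: vec2_eq_iff)

lemma norm_hor_le: "norm (hor w) \<le> norm w"
  by (simp add: norm_vec_def L2_set_def sum_2 sum_3)

lemma inner_emb: "emb y s \<bullet> emb y' s' = y \<bullet> y' + s * s'"
  by (simp add: inner_vec_def sum_2 sum_3)

lemma frame_point_emb: "frame_point Q p y s = p + Q *v emb y s"
  by (simp add: frame_point_def emb_def)

lemma linear_unframe: "linear (unframe Q)"
  unfolding unframe_def by (rule matrix_vector_mul_linear)

lemma frame_inner: "(Q *v w) \<bullet> v = w \<bullet> unframe Q v"
  unfolding unframe_def transpose_matrix_vector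
  by (metis dot_lmul_matrix inner_commute)

context
  fixes Q :: "real^3^3"
  assumes Q: "orthogonal_matrix Q"
begin

lemma unframe_mult [simp]: "unframe Q (Q *v w) = w"
  using Q unfolding unframe_def orthogonal_matrix_def by (simp add: matrix_vector_mul_assoc del: transpose_matrix_vector)

lemma mult_unframe [simp]: "Q *v unframe Q w = w"
  using Q unfolding unframe_def orthogonal_matrix_def by (simp add: matrix_vector_mul_assoc del: transpose_matrix_vector)

lemma norm_frame [simp]: "norm (Q *v w) = norm w"
  by (simp add: norm_eq_sqrt_inner frame_inner)

lemma norm_unframe [simp]: "norm (unframe Q v) = norm v"
  by (metis mult_unframe norm_frame)

lemma frame_point_coordinates: "frame_point Q p (hor (unframe Q (z - p))) (unframe Q (z - p) $ 3) = z"
  by (simp add: frame_point_emb)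

lemma coordinates_frame_point: "unframe Q (frame_point Q p y s - p) = emb y s"
  by (simp add: frame_point_emb)

lemma frame_point_diff:
  "frame_point Q p y s - t *\<^sub>R a
    = frame_point Q p (y - t *\<^sub>R hor (unframe Q a)) (s - t * unframe Q a $ 3)"
proof -
  have "frame_point Q p y s - t *\<^sub>R a = p + Q *v (emb y s - t *\<^sub>R unframe Q a)"
    by (simp add: frame_point_emb matrix_vector_mult_diff_distrib matrix_vector_mult_scaleR)
  then show ?thesis by (simp add: emb_diff frame_point_emb)
qed

lemma cylinder_iff:
  "z \<in> cylinder Q p r h \<longleftrightarrow> hor (unframe Q (z - p)) \<in> ball 0 r \<and> \<bar>unframe Q (z - p) $ 3\<bar> < h"
proof
  assume "z \<in> cylinder Q p r h"
  then show "hor (unframe Q (z - p)) \<in> ball 0 r \<and> \<bar>unframe Q (z - p) $ 3\<bar> < h"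
    by (auto simp: cylinder_def coordinates_frame_point)
next
  assume "hor (unframe Q (z - p)) \<in> ball 0 r \<and> \<bar>unframe Q (z - p) $ 3\<bar> < h"
  then show "z \<in> cylinder Q p r h"
    unfolding cylinder_def using frame_point_coordinates[of p z, symmetric] by blast
qed

lemma frame_point_in_cylinder: "frame_point Q p y s \<in> cylinder Q p r h \<longleftrightarrow> y \<in> ball 0 r \<and> \<bar>s\<bar> < h"
  by (simp add: cylinder_iff coordinates_frame_point)

lemma continuous_unframe: "continuous_on S (\<lambda>z. unframe Q (z - p))"
  using linear_continuous_on[OF linear_linear[THEN iffD2, OF linear_unframe], of _ Q]
  by (intro continuous_on_compose2[of UNIV "unframe Q" S]) (auto intro: continuous_intros)

lemma continuous_hor_unframe: "continuous_on S (\<lambda>z. hor (unframe Q (z - p)))"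
  using linear_continuous_on[OF linear_linear[THEN iffD2, OF linear_hor]]
  by (intro continuous_on_compose2[of UNIV hor S, OF _ continuous_unframe]) auto

lemma open_cylinder: "open (cylinder Q p r h)"
proof -
  have "cylinder Q p r h = (\<lambda>z. hor (unframe Q (z - p))) -` ball 0 r \<inter> (\<lambda>z. unframe Q (z - p) $ 3) -` {-h<..<h}"
    by (auto simp: cylinder_iff abs_less_iff)
  moreover have "open ((\<lambda>z. hor (unframe Q (z - p))) -` ball 0 r)"
    by (intro open_vimage open_ball continuous_hor_unframe)
  moreover have "open ((\<lambda>z. unframe Q (z - p) $ 3) -` {-h<..<h})"
    by (intro open_vimage open_greaterThanLessThan continuous_intros continuous_unframe)
  ultimately show ?thesis by auto
qed

end

lemma emb_axis: "emb y s = y $ 1 *\<^sub>R axis 1 1 + y $ 2 *\<^sub>R axis 2 1 + s *\<^sub>R axis 3 1"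
  by (simp add: vec3_eq_iff axis_def)

lemma continuous_frame_point: 
  assumes "continuous_on S f" "continuous_on S g"
  shows "continuous_on S (\<lambda>x. frame_point Q p (f x) (g x))"
proof -
  have "continuous_on S (\<lambda>x. emb (f x) (g x))"
    unfolding emb_axis by (intro continuous_intros assms)
  then show ?thesis
    unfolding frame_point_emb
    by (intro continuous_intros continuous_on_compose2[OF linear_continuous_on[OF matrix_vector_mul_bounded_linear], of S _ UNIV]) auto
qed

section \<open>Lebesgue measure in chart coordinates\<close>

lemma prod_Basis_cart: "(\<Prod>b\<in>(Basis::(real^'n::finite) set). f b) = (\<Prod>i\<in>UNIV. f (axis i 1))"
proof -
  have B: "(Basis::(real^'n) set) = range (\<lambda>i. axis i 1)" by (auto simp: Basis_vec_def)
  have "inj (\<lambda>i::'n. axis i (1::real))" by (auto simp: inj_def axis_eq_axis)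
  then show ?thesis unfolding B by (rule prod.reindex_cong) auto
qed

lemma measurable_emb: "(\<lambda>(y, s). emb y s) \<in> borel_measurable (lborel \<Otimes>\<^sub>M lborel)"
proof -
  have "(\<lambda>z. emb (fst z) (snd z)) \<in> borel_measurable (borel \<Otimes>\<^sub>M borel)"
    unfolding borel_prod emb_axis by (intro borel_measurable_continuous_onI continuous_intros)
  then show ?thesis by (simp add: split_beta')
qed

lemma lborel_emb: "distr (lborel \<Otimes>\<^sub>M lborel) borel (\<lambda>(y, s). emb y s) = (lborel :: (real^3) measure)"
proof (rule lborel_eqI[symmetric])
  fix l u :: "real^3" assume lu: "\<And>b. b \<in> Basis \<Longrightarrow> l \<bullet> b \<le> u \<bullet> b"
  have le: "l $ i \<le> u $ i" for i using lu[of "axis i 1"] by (simp add: inner_axis)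
  note m = measurable_emb
  have [simp]: "(\<lambda>(y, s). emb y s) -` box l u = box (hor l) (hor u) \<times> box (l $ 3) (u $ 3)"
    by (auto simp: mem_box_cart forall_2 forall_3)
  have "emeasure (distr (lborel \<Otimes>\<^sub>M lborel) borel (\<lambda>(y, s). emb y s)) (box l u)
      = emeasure lborel (box (hor l) (hor u)) * emeasure lborel (box (l $ 3) (u $ 3))"
    by (subst emeasure_distr[OF m]) (auto simp: space_pair_measure lborel.emeasure_pair_measure_Times)
  also have "emeasure lborel (box (hor l) (hor u)) = ennreal (\<Prod>b\<in>Basis. (hor u - hor l) \<bullet> b)"
  proof (rule emeasure_lborel_box)
    fix b :: "real^2" assume "b \<in> Basis"
    then obtain i where "b = axis i 1" by (auto simp: Basis_vec_def)
    moreover from exhaust_2[of i] have "hor l $ i \<le> hor u $ i"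
      by (elim disjE) (simp_all only: hor_nth le)
    ultimately show "hor l \<bullet> b \<le> hor u \<bullet> b" by (simp only: inner_axis inner_real_def mult_1_right)
  qed
  also have "(\<Prod>b\<in>Basis. (hor u - hor l) \<bullet> b) = (u $ 1 - l $ 1) * (u $ 2 - l $ 2)"
    unfolding prod_Basis_cart UNIV_2 by (simp add: inner_axis)
  also have "emeasure lborel (box (l $ 3) (u $ 3)) = ennreal (u $ 3 - l $ 3)"
    using le[of 3] by simp
  also have "ennreal ((u $ 1 - l $ 1) * (u $ 2 - l $ 2)) * ennreal (u $ 3 - l $ 3)
      = ennreal ((u $ 1 - l $ 1) * (u $ 2 - l $ 2) * (u $ 3 - l $ 3))"
    using le by (intro ennreal_mult[symmetric] mult_nonneg_nonneg) auto
  also have "(u $ 1 - l $ 1) * (u $ 2 - l $ 2) * (u $ 3 - l $ 3) = (\<Prod>b\<in>Basis. (u - l) \<bullet> b)"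
    unfolding prod_Basis_cart UNIV_3 by (simp add: inner_axis mult.assoc)
  finally show "emeasure (distr (lborel \<Otimes>\<^sub>M lborel) borel (\<lambda>(y, s). emb y s)) (box l u)
      = ennreal (\<Prod>b\<in>Basis. (u - l) \<bullet> b)" .
qed simp

lemma lborel_orthogonal:
  fixes Q :: "real^3^3"
  assumes Q: "orthogonal_matrix Q" shows "distr lborel borel ((*v) Q) = lborel"
proof (rule lborel_eqI[symmetric])
  fix l u :: "real^3" assume lu: "\<And>b. b \<in> Basis \<Longrightarrow> l \<bullet> b \<le> u \<bullet> b"
  have m: "((*v) Q) \<in> borel_measurable lborel"
    using borel_measurable_continuous_onI[OF linear_continuous_on[OF matrix_vector_mul_bounded_linear]] by simp
  have [simp]: "((*v) Q) -` box l u = unframe Q ` box l u"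
    using Q by (auto simp: image_iff) (metis unframe_mult)
  have ot: "orthogonal_transformation (unframe Q)"
    using Q by (simp add: orthogonal_transformation linear_unframe)
  have box: "box l u \<in> lmeasurable" by simp
  have "open (((*v) Q) -` box l u)"
    by (intro open_vimage linear_continuous_on matrix_vector_mul_bounded_linear) auto
  then have b: "unframe Q ` box l u \<in> sets borel" by simp
  have "emeasure (distr lborel borel ((*v) Q)) (box l u) = emeasure lborel (unframe Q ` box l u)"
    by (subst emeasure_distr[OF m]) auto
  also have "\<dots> = emeasure lebesgue (unframe Q ` box l u)" using b by simp
  also have "\<dots> = ennreal (measure lebesgue (unframe Q ` box l u))"
    by (rule emeasure_eq_measure2[OF measurable_orthogonal_image[OF ot box]])
  also have "\<dots> = ennreal (measure lebesgue (box l u))"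
    by (simp add: measure_orthogonal_image[OF ot box])
  also have "\<dots> = ennreal (\<Prod>b\<in>Basis. (u - l) \<bullet> b)"
    using lu by (simp add: emeasure_eq_measure2[OF box, symmetric] emeasure_lborel_box_eq)
  finally show "emeasure (distr lborel borel ((*v) Q)) (box l u) = ennreal (\<Prod>b\<in>Basis. (u - l) \<bullet> b)" .
qed simp

lemma lborel_frame:
  fixes Q :: "real^3^3"
  assumes Q: "orthogonal_matrix Q"
  shows "distr (lborel \<Otimes>\<^sub>M lborel) borel (\<lambda>(y, s). frame_point Q p y s) = lborel"
proof -
  note m = measurable_emb
  have mQ: "((*v) Q) \<in> borel_measurable borel"
    by (intro borel_measurable_continuous_onI linear_continuous_on matrix_vector_mul_bounded_linear)
  have "lborel = distr lborel borel ((+) p)" by (rule lborel_distr_plus[symmetric])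
  also have "\<dots> = distr (distr lborel borel ((*v) Q)) borel ((+) p)" by (simp only: lborel_orthogonal[OF Q])
  also have "\<dots> = distr lborel borel (\<lambda>x. p + Q *v x)"
    using mQ by (subst distr_distr) (auto simp: comp_def)
  also have "\<dots> = distr (distr (lborel \<Otimes>\<^sub>M lborel) borel (\<lambda>(y, s). emb y s)) borel (\<lambda>x. p + Q *v x)"
    by (simp only: lborel_emb)
  also have "\<dots> = distr (lborel \<Otimes>\<^sub>M lborel) borel (\<lambda>(y, s). frame_point Q p y s)"
    using mQ m by (subst distr_distr) (auto simp: comp_def frame_point_emb split_beta')
  finally show ?thesis by (rule sym)
qed

lemma measurable_frame_point: "(\<lambda>(y, s). frame_point Q p y s) \<in> borel_measurable (lborel \<Otimes>\<^sub>M lborel)"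
proof -
  have "(\<lambda>z. frame_point Q p (fst z) (snd z)) \<in> borel_measurable (borel \<Otimes>\<^sub>M borel)"
    unfolding borel_prod
    by (intro borel_measurable_continuous_onI continuous_frame_point continuous_intros)
  then show ?thesis by (simp add: split_beta')
qed

lemma frame_Fubini:
  fixes f :: "real^3 \<Rightarrow> real"
  assumes Q: "orthogonal_matrix Q" and f: "integrable lborel f"
  shows "(LINT x|lborel. f x) = (LINT y|lborel. LINT s|lborel. f (frame_point Q p y s))"
    and "integrable (lborel \<Otimes>\<^sub>M lborel) (\<lambda>(y, s). f (frame_point Q p y s))"
proof -
  have fb: "f \<in> borel_measurable borel" using f by auto
  have "integrable (distr (lborel \<Otimes>\<^sub>M lborel) borel (\<lambda>(y, s). frame_point Q p y s)) f"
    using f by (simp add: lborel_frame[OF Q])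
  then show i: "integrable (lborel \<Otimes>\<^sub>M lborel) (\<lambda>(y, s). f (frame_point Q p y s))"
    by (subst (asm) integrable_distr_eq[OF measurable_frame_point]) (use fb in \<open>auto simp: split_beta'\<close>)
  have "(LINT x|lborel. f x) = (LINT x|distr (lborel \<Otimes>\<^sub>M lborel) borel (\<lambda>(y, s). frame_point Q p y s). f x)"
    by (simp add: lborel_frame[OF Q])
  also have "\<dots> = (LINT z|(lborel \<Otimes>\<^sub>M lborel). f (case z of (y, s) \<Rightarrow> frame_point Q p y s))"
    by (rule integral_distr[OF measurable_frame_point]) (use fb in auto)
  also have "\<dots> = (LINT y|lborel. LINT s|lborel. f (frame_point Q p y s))"
    using lborel_pair.integral_fst'[of "\<lambda>(y, s). f (frame_point Q p y s)"] i by (simp add: split_beta')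
  finally show "(LINT x|lborel. f x) = (LINT y|lborel. LINT s|lborel. f (frame_point Q p y s))" .
qed

text \<open>The difference of indicators carries the sign, so the fundamental theorem of calculus
  applies in either order of \<open>u\<close> and \<open>v\<close>. In a chart these are the heights
  of the boundary and of its translate on one vertical line.\<close>

lemma integral_indicator_diff:
  fixes f A :: "real \<Rightarrow> real"
  assumes A: "\<And>s. (A has_real_derivative f s) (at s)" and f: "\<And>s. isCont f s"
  shows "(LINT s|lborel. f s * (indicator {..<u} s - indicator {..<v} s)) = A u - A v"
proof -
  have *: "(LINT s|lborel. f s * (indicator {..<u} s - indicator {..<v} s)) = A u - A v"
    if "v \<le> u" for u v
  proof -
    have fm[measurable]: "f \<in> borel_measurable borel"
      using f by (intro borel_measurable_continuous_onI continuous_at_imp_continuous_on) auto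
    have "(LINT s|lborel. f s * (indicator {..<u} s - indicator {..<v} s))
        = (LINT s|lborel. f s * indicator {v..u} s)"
    proof (rule integral_cong_AE)
      show "AE s in lborel. f s * (indicator {..<u} s - indicator {..<v} s) = f s * indicator {v..u} s"
        using AE_lborel_singleton[of u]
        by eventually_elim (use that in \<open>auto simp: indicator_def\<close>)
    qed measurable
    also have "\<dots> = A u - A v" by (rule integral_FTC_Icc_real[OF that]) (use A f in auto)
    finally show ?thesis .
  qed
  show ?thesis
  proof (cases "v \<le> u")
    case False
    have "(LINT s|lborel. f s * (indicator {..<u} s - indicator {..<v} s))
        = - (LINT s|lborel. f s * (indicator {..<v} s - indicator {..<u} s))"
      by (subst integral_minus[symmetric]) (simp add: algebra_simps)
    then show ?thesis using *[of u v] False by simp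
  qed (rule *)
qed

section \<open>The divergence theorem in one chart\<close>

locale C11_graph =
  fixes \<Omega> :: "(real^3) set" and Q p r h \<gamma>
  assumes chart: "C11_chart \<Omega> Q p r h \<gamma>" and domain: "C11_domain \<Omega>" and bounded_\<Omega>: "bounded \<Omega>"
begin

lemma open_\<Omega>: "open \<Omega>" using domain by (simp add: C11_domain_def)

abbreviation "cyl \<equiv> cylinder Q p r h"
abbreviation "pt \<equiv> frame_point Q p"

definition surf :: "real^2 \<Rightarrow> real^3" where "surf y = pt y (\<gamma> y)"
text \<open>Left unnormalised: its direction is that of the outer normal and its length is the
  surface density.\<close>

definition normal :: "real^2 \<Rightarrow> real^3" where "normal y = Q *v emb (- grad \<gamma> y) 1"

lemma orth: "orthogonal_matrix Q" and r_pos: "0 < r" and h_pos: "0 < h"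
  and \<gamma>_C11: "C11_on (ball 0 r) \<gamma>"
  using chart by (auto simp: C11_chart_def)

lemma \<gamma>_bound: "y \<in> ball 0 r \<Longrightarrow> \<bar>\<gamma> y\<bar> < h"
  and pt_in_\<Omega>: "y \<in> ball 0 r \<Longrightarrow> \<bar>s\<bar> < h \<Longrightarrow> pt y s \<in> \<Omega> \<longleftrightarrow> s < \<gamma> y"
  and pt_in_frontier: "y \<in> ball 0 r \<Longrightarrow> \<bar>s\<bar> < h \<Longrightarrow> pt y s \<in> frontier \<Omega> \<longleftrightarrow> s = \<gamma> y"
  using chart by (auto simp: C11_chart_def)

lemma surf_frontier: "y \<in> ball 0 r \<Longrightarrow> surf y \<in> frontier \<Omega>"
  and surf_cyl: "y \<in> ball 0 r \<Longrightarrow> surf y \<in> cyl"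
  using \<gamma>_bound[of y] pt_in_frontier[of y "\<gamma> y"]
  by (auto simp: surf_def frame_point_in_cylinder[OF orth])

lemma \<gamma>_has_derivative:
  assumes "y \<in> ball 0 r" shows "(\<gamma> has_derivative (\<lambda>v. grad \<gamma> y \<bullet> v)) (at y)"
  using \<gamma>_C11 assms by (intro has_derivative_grad) (auto simp: C11_on_def)

lemma \<gamma>_continuous: "continuous_on (ball 0 r) \<gamma>"
  using \<gamma>_has_derivative has_derivative_continuous
  by (intro continuous_at_imp_continuous_on) blast

lemma grad_continuous: "continuous_on (ball 0 r) (grad \<gamma>)"
  using \<gamma>_C11 lipschitz_on_continuous_on by (auto simp: C11_on_def)

lemma grad_bounded: "\<exists>M\<ge>0. \<forall>y\<in>ball 0 r. norm (grad \<gamma> y) \<le> M"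
proof -
  obtain L where L: "L-lipschitz_on (ball 0 r) (grad \<gamma>)" using \<gamma>_C11 by (auto simp: C11_on_def)
  have L0: "0 \<le> L" using L by (rule lipschitz_on_nonneg)
  have "norm (grad \<gamma> y) \<le> norm (grad \<gamma> 0) + L * r" if y: "y \<in> ball 0 r" for y
  proof -
    have "dist (grad \<gamma> y) (grad \<gamma> 0) \<le> L * dist y 0"
      using L y r_pos by (intro lipschitz_onD) auto
    also have "\<dots> \<le> L * r" using y L0 by (intro mult_left_mono) (auto simp: dist_commute)
    finally show ?thesis using norm_triangle_sub[of "grad \<gamma> y" "grad \<gamma> 0"] by (simp add: dist_norm)
  qed
  moreover have "0 \<le> norm (grad \<gamma> 0) + L * r" using L0 r_pos by simp
  ultimately show ?thesis by blast
qed

text \<open>One bound on the slope is fixed for the whole chart. It gives the Lipschitz constant of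
  \<open>\<gamma>\<close>, the angle between axis and boundary, and the opening of the cone used for
  mollification.\<close>

definition M where "M = (SOME M. M \<ge> 0 \<and> (\<forall>y\<in>ball 0 r. norm (grad \<gamma> y) \<le> M))"

lemma M_nonneg: "0 \<le> M" and grad_le_M: "y \<in> ball 0 r \<Longrightarrow> norm (grad \<gamma> y) \<le> M"
  using someI_ex[OF grad_bounded[unfolded Bex_def]] by (auto simp: M_def)

lemma \<gamma>_lipschitz:
  assumes "y \<in> ball 0 r" "y' \<in> ball 0 r" shows "\<bar>\<gamma> y - \<gamma> y'\<bar> \<le> M * norm (y - y')"
proof -
  have on: "onorm (\<lambda>v. grad \<gamma> x \<bullet> v) \<le> M" if "x \<in> ball 0 r" for x
  proof (rule onorm_le)
    fix v
    have "norm (grad \<gamma> x \<bullet> v) \<le> norm (grad \<gamma> x) * norm v" by (simp add: Cauchy_Schwarz_ineq2)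
    also have "\<dots> \<le> M * norm v" by (rule mult_right_mono[OF grad_le_M[OF that] norm_ge_zero])
    finally show "norm (grad \<gamma> x \<bullet> v) \<le> M * norm v" .
  qed
  have "norm (\<gamma> y - \<gamma> y') \<le> M * norm (y - y')"
    by (rule differentiable_bound[OF convex_ball _ on assms])
      (use \<gamma>_has_derivative in \<open>auto intro: has_derivative_at_withinI\<close>)
  then show ?thesis by simp
qed

lemma surf_continuous: "continuous_on (ball 0 r) surf"
  unfolding surf_def by (intro continuous_frame_point continuous_intros \<gamma>_continuous)

lemma normal_continuous: "continuous_on (ball 0 r) normal"
proof -
  have "continuous_on (ball 0 r) (\<lambda>y. emb (- grad \<gamma> y) 1)"
    unfolding emb_axis by (intro continuous_intros grad_continuous)
  then show ?thesis
    unfolding normal_def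
    by (intro continuous_on_compose2[OF linear_continuous_on[OF matrix_vector_mul_bounded_linear], of "ball 0 r" _ UNIV]) auto
qed

lemma norm_normal: "norm (normal y) = sqrt (1 + (norm (grad \<gamma> y))\<^sup>2)"
  unfolding normal_def norm_frame[OF orth] norm_eq_sqrt_inner[of "emb _ _"] inner_emb
  by (simp add: power2_norm_eq_inner)

lemma inner_normal: "a \<bullet> normal y = unframe Q a $ 3 - grad \<gamma> y \<bullet> hor (unframe Q a)"
proof -
  have "a \<bullet> normal y = emb (- grad \<gamma> y) 1 \<bullet> emb (hor (unframe Q a)) (unframe Q a $ 3)"
    unfolding normal_def by (subst inner_commute) (simp add: frame_inner)
  then show ?thesis unfolding inner_emb by simp
qed

lemma graph_normal_eq: "graph_normal Q \<gamma> y = (1 / norm (normal y)) *\<^sub>R normal y"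
proof -
  have "vector [- grad \<gamma> y $ 1, - grad \<gamma> y $ 2, 1] = emb (- grad \<gamma> y) 1"
    by (simp add: vec3_eq_iff)
  then show ?thesis unfolding graph_normal_def norm_normal by (simp add: normal_def)
qed

lemma \<Omega>_borel: "\<Omega> \<in> sets borel" using open_\<Omega> by simp

text \<open>On the vertical line over \<open>y\<close>, the sets \<Omega> and \<Omega> + t a are the
  half lines below two heights. The chart describes them only inside the cylinder;
  \<open>supp\<close> places both relevant points there wherever \<open>F\<close> is
  nonzero.\<close>

lemma line_integral:
  assumes F: "test_function cyl F" and y: "y \<in> ball 0 r" and y': "y - t *\<^sub>R hor (unframe Q a) \<in> ball 0 r"
    and supp: "\<And>x. F x \<noteq> 0 \<Longrightarrow> x - t *\<^sub>R a \<in> cyl"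
    and A: "\<And>s. (A has_real_derivative F (pt y s)) (at s)"
  shows "(LINT s|lborel. F (pt y s) * (indicator \<Omega> (pt y s - t *\<^sub>R a) - indicator \<Omega> (pt y s)))
    = A (\<gamma> (y - t *\<^sub>R hor (unframe Q a)) + t * unframe Q a $ 3) - A (\<gamma> y)"
proof -
  let ?\<beta> = "\<gamma> (y - t *\<^sub>R hor (unframe Q a)) + t * unframe Q a $ 3"
  have "F (pt y s) * (indicator \<Omega> (pt y s - t *\<^sub>R a) - indicator \<Omega> (pt y s))
      = F (pt y s) * (indicator {..<?\<beta>} s - indicator {..<\<gamma> y} s)" for s
  proof (cases "F (pt y s) = 0")
    case False
    then have "pt y s \<in> cyl" using test_function_outside[OF F] by blast
    then have s: "\<bar>s\<bar> < h" by (simp add: frame_point_in_cylinder[OF orth])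
    have "pt y s - t *\<^sub>R a \<in> cyl" using supp False by blast
    then have s': "\<bar>s - t * unframe Q a $ 3\<bar> < h"
      unfolding frame_point_diff[OF orth] frame_point_in_cylinder[OF orth] by blast
    have "pt y s \<in> \<Omega> \<longleftrightarrow> s < \<gamma> y" by (rule pt_in_\<Omega>[OF y s])
    moreover have "pt y s - t *\<^sub>R a \<in> \<Omega> \<longleftrightarrow> s < ?\<beta>"
      unfolding frame_point_diff[OF orth] pt_in_\<Omega>[OF y' s'] by linarith
    ultimately show ?thesis by (simp add: indicator_def)
  qed simp
  moreover have "isCont (\<lambda>s. F (pt y s)) s" for s
  proof -
    have "continuous_on UNIV (\<lambda>s. F (pt y s))"
      by (intro continuous_on_compose2[OF smooth_continuous[OF test_function_smooth[OF F]], of UNIV _ UNIV]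
          continuous_frame_point continuous_intros) auto
    then show ?thesis by (simp add: continuous_on_eq_continuous_at)
  qed
  ultimately show ?thesis
    using integral_indicator_diff[of A "\<lambda>s. F (pt y s)" ?\<beta> "\<gamma> y"] A by (simp only:)
qed

lemma antiderivative:
  assumes F: "test_function cyl F"
  obtains A where "\<And>s. (A has_real_derivative F (pt y s)) (at s)"
proof -
  have "continuous_on UNIV (\<lambda>s. F (pt y s))"
    by (intro continuous_on_compose2[OF smooth_continuous[OF test_function_smooth[OF F]], of UNIV _ UNIV]
        continuous_frame_point continuous_intros) auto
  then have "\<And>s. isCont (\<lambda>s. F (pt y s)) s" by (simp add: continuous_on_eq_continuous_at)
  then have "\<exists>A. \<forall>s. - \<infinity> < ereal s \<longrightarrow> ereal s < \<infinity> \<longrightarrow> (A has_vector_derivative F (pt y s)) (at s)"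
    by (intro einterval_antiderivative) auto
  then show ?thesis using that by (auto simp: has_real_derivative_iff_has_vector_derivative)
qed

text \<open>Both sides are the derivative at \<open>t = 0\<close> of the integral of \<open>F\<close> over the translate \<open>\<Omega> + t a\<close>.\<close>

lemma chart_divergence:
  assumes F: "test_function cyl F"
  shows "(LINT x|lebesgue_on \<Omega>. grad F x \<bullet> a)
    = (LINT y|lebesgue_on (ball 0 r). F (surf y) * (a \<bullet> normal y))"
proof -
  define b c where "b = hor (unframe Q a)" and "c = unframe Q a $ 3"
  have FS: "smooth F" by (rule test_function_smooth[OF F])
  have Fm[measurable]: "F \<in> borel_measurable borel" by (rule smooth_borel[OF FS])
  have \<Omega>m[measurable]: "\<Omega> \<in> sets borel" by (rule \<Omega>_borel)
  have Fi: "integrable lborel F" by (rule test_function_integrable_lborel[OF F])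
  obtain B where B: "0 \<le> B" "\<And>x. \<bar>F x\<bar> \<le> B" by (rule test_function_bounded[OF F]) (rule that)
  obtain L where L: "0 \<le> L" "\<And>x y. \<bar>F x - F y\<bar> \<le> L * norm (x - y)"
    by (rule test_function_lipschitz[OF F]) (rule that)
  obtain K where K: "compact K" "K \<subseteq> cyl" "\<And>x. x \<notin> K \<Longrightarrow> F x = 0"
    by (rule test_functionE[OF F]) (rule that)
  obtain d where d: "0 < d" "(\<Union>x\<in>K. ball x d) \<subseteq> cyl"
    by (rule compact_subset_open_imp_ball_epsilon_subset[OF K(1) open_cylinder[OF orth] K(2)]) (rule that)
  \<comment> \<open>Shifts up to t0 move the support of F by less than d, hence keep it in the
    cylinder; the added 1 covers a = 0.\<close>
  define t0 where "t0 = d / (norm a + 1)"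
  have t0: "0 < t0" "t0 * norm a < d"
    using d(1) by (auto simp: t0_def field_simps add_pos_nonneg intro: add_nonneg_pos)
  define t where "t n = t0 / (real n + 1)" for n :: nat
  have t: "0 < t n" "t n \<le> t0" for n
    using t0 by (auto simp: t_def divide_le_eq intro!: divide_pos_pos)
  have t_lim: "t \<longlonglongrightarrow> 0"
  proof -
    have "(\<lambda>n. t0 * inverse (real (Suc n))) \<longlonglongrightarrow> 0"
      using tendsto_mult_right_zero[OF LIMSEQ_inverse_real_of_nat, of t0] by simp
    then show ?thesis by (simp add: t_def[abs_def] divide_inverse add.commute)
  qed
  have supp: "x - t n *\<^sub>R a \<in> cyl" if "F x \<noteq> 0" for x n
  proof -
    have "x \<in> K" using K(3) that by blast
    moreover have "x - t n *\<^sub>R a \<in> ball x d"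
    proof -
      have "t n * norm a \<le> t0 * norm a" using t by (intro mult_right_mono) auto
      then show ?thesis using t0 t[of n] by (simp add: dist_norm)
    qed
    ultimately show ?thesis using d(2) by blast
  qed
  define D where "D n x = F x * (indicator \<Omega> (x - t n *\<^sub>R a) - indicator \<Omega> x) / t n" for n x
  have Dint: "integrable lborel (D n)" for n
  proof -
    have "integrable lborel (\<lambda>x. (indicator \<Omega> (x - t n *\<^sub>R a) - indicator \<Omega> x) * F x)"
      by (rule test_function_integrable[OF _ Fi, of _ 1]) (auto simp: indicator_def)
    then show ?thesis unfolding D_def by (simp add: mult.commute)
  qed
  have lim1: "(\<lambda>n. LINT x|lborel. D n x) \<longlonglongrightarrow> (LINT x|lborel. indicator \<Omega> x * (grad F x \<bullet> a))"
  proof -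
    \<comment> \<open>A change of variables moves the translation from the indicator onto F, where
      it becomes a difference quotient.\<close>
    have eq: "(LINT x|lborel. D n x) = (LINT x|lborel. indicator \<Omega> x * ((F (x + t n *\<^sub>R a) - F x) / t n))" for n
    proof -
      have i1: "integrable lborel (\<lambda>x. F x * indicator \<Omega> (x - t n *\<^sub>R a))" "integrable lborel (\<lambda>x. F x * indicator \<Omega> x)"
        using test_function_integrable[OF _ Fi, of "\<lambda>x. indicator \<Omega> (x - t n *\<^sub>R a)" 1]
          test_function_integrable[OF _ Fi, of "indicator \<Omega>" 1] by (auto simp: mult.commute indicator_def)
      have i2: "integrable lborel (\<lambda>x. F (x + t n *\<^sub>R a) * indicator \<Omega> x)"
        using lborel_integrable_shift[OF i1(1), of 1 "t n *\<^sub>R a"] by (simp add: add.commute)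
      have "(LINT x|lborel. F x * indicator \<Omega> (x - t n *\<^sub>R a)) = (LINT x|lborel. F (x + t n *\<^sub>R a) * indicator \<Omega> x)"
        using lborel_integral_affine[of "\<lambda>x. F x * indicator \<Omega> (x - t n *\<^sub>R a)" 1 "t n *\<^sub>R a"]
        by (simp add: add.commute)
      then have "(LINT x|lborel. F x * indicator \<Omega> (x - t n *\<^sub>R a) - F x * indicator \<Omega> x)
          = (LINT x|lborel. F (x + t n *\<^sub>R a) * indicator \<Omega> x - F x * indicator \<Omega> x)"
        using i1 i2 by simp
      then have "(LINT x|lborel. F x * indicator \<Omega> (x - t n *\<^sub>R a) - F x * indicator \<Omega> x) / t n
          = (LINT x|lborel. F (x + t n *\<^sub>R a) * indicator \<Omega> x - F x * indicator \<Omega> x) / t n" by simp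
      then show ?thesis
        unfolding D_def by (simp add: algebra_simps flip: Bochner_Integration.integral_divide_zero)
    qed
    show ?thesis
      unfolding eq
    proof (rule integral_dominated_convergence[where w = "\<lambda>x. indicator \<Omega> x * (L * norm a)"])
      have "grad F x \<bullet> a = (\<Sum>i\<in>UNIV. partial i F x * a $ i)" for x
        by (simp add: inner_vec_def grad_def)
      moreover have "partial i F \<in> borel_measurable borel" for i
        by (rule smooth_borel[OF smooth_partial[OF FS]])
      ultimately show "(\<lambda>x. indicator \<Omega> x * (grad F x \<bullet> a)) \<in> borel_measurable lborel" by simp
      show "(\<lambda>x. indicator \<Omega> x * ((F (x + t n *\<^sub>R a) - F x) / t n)) \<in> borel_measurable lborel" for n
        by measurable
      show "integrable lborel (\<lambda>x. indicator \<Omega> x * (L * norm a))"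
        using emeasure_bounded_finite[OF bounded_\<Omega>] \<Omega>_borel by (intro integrable_mult_left) auto
      show "AE x in lborel. (\<lambda>n. indicator \<Omega> x * ((F (x + t n *\<^sub>R a) - F x) / t n)) \<longlonglongrightarrow> indicator \<Omega> x * (grad F x \<bullet> a)"
      proof (intro AE_I2 tendsto_mult tendsto_const)
        fix x
        have "((\<lambda>s. F (x + s *\<^sub>R a)) has_derivative (\<lambda>s. grad F x \<bullet> (s *\<^sub>R a))) (at 0)"
          by (rule has_derivative_compose[of "\<lambda>s. x + s *\<^sub>R a" "\<lambda>s. s *\<^sub>R a" 0 UNIV F])
            (auto intro!: derivative_eq_intros has_derivative_grad smooth_differentiable[OF FS])
        then have "((\<lambda>s. F (x + s *\<^sub>R a)) has_real_derivative grad F x \<bullet> a) (at 0)"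
          by (simp add: has_field_derivative_def mult.commute[of _ "grad F x \<bullet> a"])
        then have "((\<lambda>s. (F (x + s *\<^sub>R a) - F x) / s) \<longlongrightarrow> grad F x \<bullet> a) (at 0)"
          by (simp add: DERIV_def)
        moreover have "filterlim t (at 0) sequentially"
          using t_lim t(1) by (auto simp: filterlim_at intro!: always_eventually) (metis less_irrefl)
        ultimately show "(\<lambda>n. (F (x + t n *\<^sub>R a) - F x) / t n) \<longlonglongrightarrow> grad F x \<bullet> a"
          by (rule filterlim_compose)
      qed
      show "AE x in lborel. norm (indicator \<Omega> x * ((F (x + t n *\<^sub>R a) - F x) / t n)) \<le> indicator \<Omega> x * (L * norm a)" for n
      proof (intro AE_I2)
        fix x
        have "\<bar>F (x + t n *\<^sub>R a) - F x\<bar> \<le> L * (t n * norm a)" using L(2)[of "x + t n *\<^sub>R a" x] t(1)[of n] by simp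
        then have "\<bar>(F (x + t n *\<^sub>R a) - F x) / t n\<bar> \<le> L * norm a" using t(1)[of n] by (simp add: field_simps)
        then show "norm (indicator \<Omega> x * ((F (x + t n *\<^sub>R a) - F x) / t n)) \<le> indicator \<Omega> x * (L * norm a)"
          by (simp add: indicator_def)
      qed
    qed
  qed
  define H where "H n y = (LINT s|lborel. D n (pt y s))" for n y
  define g where "g y = indicator (ball 0 r) y * (F (surf y) * (a \<bullet> normal y))" for y
  have gm: "g \<in> borel_measurable borel"
  proof -
    have "continuous_on (ball 0 r) (\<lambda>y. F (surf y) * (a \<bullet> normal y))"
      by (intro continuous_intros normal_continuous continuous_on_compose2[OF smooth_continuous[OF FS], of "ball 0 r" _ UNIV]
          surf_continuous) auto
    then have "(\<lambda>y. indicator (ball 0 r) y *\<^sub>R (F (surf y) * (a \<bullet> normal y))) \<in> borel_measurable borel"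
      by (intro borel_measurable_continuous_on_indicator) auto
    then show ?thesis by (simp add: g_def[abs_def])
  qed
  have H: "(LINT x|lborel. D n x) = (LINT y|lborel. H n y)" for n
    unfolding H_def by (rule frame_Fubini(1)[OF orth Dint])
  \<comment> \<open>If the line over \<open>y\<close> or its translate misses the cylinder, F
    vanishes along the whole line. Near the rim of the disc this replaces the formula
    \<open>H_in\<close>.\<close>
  have H_out: "H n y = 0" if "y \<notin> ball 0 r \<or> y - t n *\<^sub>R b \<notin> ball 0 r" for n y
  proof -
    have "F (pt y s) = 0" for s
    proof (rule ccontr)
      assume F0: "F (pt y s) \<noteq> 0"
      then have "pt y s \<in> cyl" "pt y s - t n *\<^sub>R a \<in> cyl" using test_function_outside[OF F] supp by blast+
      then show False
        using that unfolding frame_point_diff[OF orth] frame_point_in_cylinder[OF orth] b_def by blast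
    qed
    then show ?thesis by (simp add: H_def D_def)
  qed
  have H_in: "H n y = (A (\<gamma> (y - t n *\<^sub>R b) + t n * c) - A (\<gamma> y)) / t n"
    if "y \<in> ball 0 r" "y - t n *\<^sub>R b \<in> ball 0 r" and A: "\<And>s. (A has_real_derivative F (pt y s)) (at s)" for n y A
    using line_integral[OF F that(1) _ supp A] that(2) unfolding b_def c_def by (simp add: H_def D_def)
  have lim2: "(\<lambda>n. LINT y|lborel. H n y) \<longlonglongrightarrow> (LINT y|lborel. g y)"
  proof (rule integral_dominated_convergence[where w = "\<lambda>y. indicator (ball 0 r) y * (B * (M * norm b + \<bar>c\<bar>))"])
    show "g \<in> borel_measurable lborel" using gm by simp
    show "H n \<in> borel_measurable lborel" for n
    proof -
      have "integrable lborel (H n)"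
        using lborel_pair.integrable_fst'[OF frame_Fubini(2)[OF orth Dint[of n], of p]] by (simp add: H_def[abs_def])
      then show ?thesis by auto
    qed
    show "integrable lborel (\<lambda>y. indicator (ball (0::real^2) r) y * (B * (M * norm b + \<bar>c\<bar>)))"
      using emeasure_bounded_finite[of "ball (0::real^2) r"] by (intro integrable_mult_left) auto
    show "AE y in lborel. (\<lambda>n. H n y) \<longlonglongrightarrow> g y"
    proof (rule AE_I2)
      fix y
      show "(\<lambda>n. H n y) \<longlonglongrightarrow> g y"
      proof (cases "y \<in> ball 0 r")
        case False
        then show ?thesis using H_out by (simp add: g_def)
      next
        case True
        obtain A where A: "\<And>s. (A has_real_derivative F (pt y s)) (at s)"
          by (rule antiderivative[OF F]) (rule that)
        \<comment> \<open>The height of the translated graph over y has derivative c - grad \<gamma>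
          y \<bullet> b at 0, and this number is \<open>a \<bullet> normal y\<close>.\<close>
        have "((\<lambda>s. \<gamma> (y - s *\<^sub>R b) + s * c) has_derivative (\<lambda>s. grad \<gamma> y \<bullet> (- (s *\<^sub>R b)) + s * c)) (at 0)"
          by (intro has_derivative_add has_derivative_compose[of "\<lambda>s. y - s *\<^sub>R b" "\<lambda>s. - (s *\<^sub>R b)" 0 UNIV \<gamma>])
            (auto intro!: derivative_eq_intros \<gamma>_has_derivative[OF True])
        then have "((\<lambda>s. \<gamma> (y - s *\<^sub>R b) + s * c) has_real_derivative (c - grad \<gamma> y \<bullet> b)) (at 0)"
          unfolding has_field_derivative_def
          by (rule has_derivative_eq_rhs) (simp add: fun_eq_iff algebra_simps)
        then have "((\<lambda>s. A (\<gamma> (y - s *\<^sub>R b) + s * c)) has_real_derivative F (pt y (\<gamma> y)) * (c - grad \<gamma> y \<bullet> b)) (at 0)"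
          using DERIV_chain2[of A "F (pt y (\<gamma> y))" "\<lambda>s. \<gamma> (y - s *\<^sub>R b) + s * c" 0] A by simp
        then have "((\<lambda>s. (A (\<gamma> (y - s *\<^sub>R b) + s * c) - A (\<gamma> y)) / s) \<longlongrightarrow> F (pt y (\<gamma> y)) * (c - grad \<gamma> y \<bullet> b)) (at 0)"
          by (simp add: DERIV_def)
        moreover have "filterlim t (at 0) sequentially"
          using t_lim t(1) by (auto simp: filterlim_at intro!: always_eventually) (metis less_irrefl)
        ultimately have l: "(\<lambda>n. (A (\<gamma> (y - t n *\<^sub>R b) + t n * c) - A (\<gamma> y)) / t n) \<longlonglongrightarrow> F (pt y (\<gamma> y)) * (c - grad \<gamma> y \<bullet> b)"
          by (rule filterlim_compose)
        have "(\<lambda>n. y - t n *\<^sub>R b) \<longlonglongrightarrow> y - 0 *\<^sub>R b" by (intro tendsto_intros t_lim)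
        then have "\<forall>\<^sub>F n in sequentially. y - t n *\<^sub>R b \<in> ball 0 r"
          using True by (intro topological_tendstoD) auto
        then have "\<forall>\<^sub>F n in sequentially. (A (\<gamma> (y - t n *\<^sub>R b) + t n * c) - A (\<gamma> y)) / t n = H n y"
          by eventually_elim (simp add: H_in[OF True _ A])
        from Lim_transform_eventually[OF l this] show ?thesis
          using True by (simp add: g_def surf_def inner_normal b_def c_def)
      qed
    qed
    show "AE y in lborel. norm (H n y) \<le> indicator (ball 0 r) y * (B * (M * norm b + \<bar>c\<bar>))" for n
    proof (rule AE_I2)
      fix y
      show "norm (H n y) \<le> indicator (ball 0 r) y * (B * (M * norm b + \<bar>c\<bar>))"
      proof (cases "y \<in> ball 0 r \<and> y - t n *\<^sub>R b \<in> ball 0 r")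
        case False
        then show ?thesis using H_out[of y n] B(1) M_nonneg by auto
      next
        case True
        obtain A where A: "\<And>s. (A has_real_derivative F (pt y s)) (at s)"
          by (rule antiderivative[OF F]) (rule that)
        let ?\<beta> = "\<gamma> (y - t n *\<^sub>R b) + t n * c"
        \<comment> \<open>Since B bounds the derivative of A, the Lipschitz bound on \<gamma> yields
          a majorant independent of n.\<close>
        have "norm (A ?\<beta> - A (\<gamma> y)) \<le> B * norm (?\<beta> - \<gamma> y)"
          by (rule field_differentiable_bound[of UNIV A "\<lambda>s. F (pt y s)"]) (use A B in auto)
        also have "\<dots> \<le> B * (t n * (M * norm b + \<bar>c\<bar>))"
        proof (rule mult_left_mono[OF _ B(1)])
          have "\<bar>\<gamma> (y - t n *\<^sub>R b) - \<gamma> y\<bar> \<le> M * (t n * norm b)"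
            using \<gamma>_lipschitz[of "y - t n *\<^sub>R b" y] True t(1)[of n] by simp
          moreover have "\<bar>t n * c\<bar> = t n * \<bar>c\<bar>" using t(1)[of n] by (simp add: abs_mult)
          ultimately show "norm (?\<beta> - \<gamma> y) \<le> t n * (M * norm b + \<bar>c\<bar>)"
            by (simp add: algebra_simps)
        qed
        finally have "norm (A ?\<beta> - A (\<gamma> y)) / t n \<le> B * (M * norm b + \<bar>c\<bar>)"
          using t(1)[of n] by (simp add: field_simps)
        then show ?thesis using True H_in[of y n A] A t(1)[of n] by (simp add: abs_divide)
      qed
    qed
  qed
  have "(LINT x|lborel. indicator \<Omega> x * (grad F x \<bullet> a)) = (LINT y|lborel. g y)"
    using LIMSEQ_unique[OF lim1] lim2 H by simp
  moreover have "(LINT x|lebesgue_on \<Omega>. grad F x \<bullet> a) = (LINT x|lborel. indicator \<Omega> x * (grad F x \<bullet> a))"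
  proof -
    have "grad F x \<bullet> a = (\<Sum>i\<in>UNIV. partial i F x * a $ i)" for x
      by (simp add: inner_vec_def grad_def)
    moreover have "partial i F \<in> borel_measurable borel" for i
      by (rule smooth_borel[OF smooth_partial[OF FS]])
    ultimately have [measurable]: "(\<lambda>x. grad F x \<bullet> a) \<in> borel_measurable borel" by simp
    have "(LINT x|lebesgue_on \<Omega>. grad F x \<bullet> a) = (LINT x|lebesgue_on \<Omega>. indicator \<Omega> x * (grad F x \<bullet> a))"
      by (rule Bochner_Integration.integral_cong) auto
    also have "\<dots> = (LINT x|lborel. indicator \<Omega> x * (grad F x \<bullet> a))"
      by (rule integral_lebesgue_on_lborel[OF \<Omega>_borel]) auto
    finally show ?thesis .
  qed
  moreover have "(LINT y|lebesgue_on (ball 0 r). F (surf y) * (a \<bullet> normal y)) = (LINT y|lborel. g y)"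
  proof -
    have "(LINT y|lebesgue_on (ball 0 r). F (surf y) * (a \<bullet> normal y)) = (LINT y|lebesgue_on (ball 0 r). g y)"
      by (rule Bochner_Integration.integral_cong) (auto simp: g_def)
    also have "\<dots> = (LINT y|lborel. g y)"
      by (rule integral_lebesgue_on_lborel) (simp, rule gm, simp add: g_def)
    finally show ?thesis .
  qed
  ultimately show ?thesis by simp
qed

end

section \<open>Outer normal and surface measure\<close>

context C11_graph
begin

lemma normal_nonzero: "norm (normal y) > 0"
  unfolding norm_normal by (simp add: add_pos_nonneg)

text \<open>\<open>k t\<close> is the signed height of the moving point above the graph, and its
  derivative at 0 is \<open>v \<bullet> normal y\<close>. The sign of this number is thus expressed
  through \<Omega> alone, independently of the chart.\<close>

lemma near_surf:
  assumes y: "y \<in> ball 0 r" and v: "v \<bullet> normal y \<noteq> 0"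
  shows "\<exists>d>0. \<forall>t. 0 < t \<and> t < d \<longrightarrow> (surf y + t *\<^sub>R v \<in> \<Omega> \<longleftrightarrow> v \<bullet> normal y < 0)"
proof -
  define b c where "b = hor (unframe Q v)" and "c = unframe Q v $ 3"
  define k where "k t = \<gamma> y + t * c - \<gamma> (y + t *\<^sub>R b)" for t
  have eq: "surf y + t *\<^sub>R v = pt (y + t *\<^sub>R b) (\<gamma> y + t * c)" for t
    using frame_point_diff[OF orth, of p y "\<gamma> y" "- t" v] by (simp add: surf_def b_def c_def)
  have "(k has_derivative (\<lambda>s. s * c - grad \<gamma> y \<bullet> (s *\<^sub>R b))) (at 0)"
    unfolding k_def
    by (intro has_derivative_diff has_derivative_compose[of "\<lambda>s. y + s *\<^sub>R b" "\<lambda>s. s *\<^sub>R b" 0 UNIV \<gamma>])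
      (auto intro!: derivative_eq_intros \<gamma>_has_derivative[OF y])
  then have k: "(k has_real_derivative v \<bullet> normal y) (at 0)"
    unfolding has_field_derivative_def inner_normal
    by (rule has_derivative_eq_rhs) (simp add: fun_eq_iff algebra_simps b_def c_def)
  have k0: "k 0 = 0" by (simp add: k_def)
  obtain d1 where d1: "d1 > 0" "\<And>t. 0 < t \<Longrightarrow> t < d1 \<Longrightarrow> (k t < 0 \<longleftrightarrow> v \<bullet> normal y < 0)"
  proof (cases "v \<bullet> normal y < 0")
    case True
    then show ?thesis using DERIV_neg_dec_right[OF k True] k0 that by auto
  next
    case False
    then have "v \<bullet> normal y > 0" using v by simp
    from DERIV_pos_inc_right[OF k this] obtain d where "0 < d" "\<forall>h>0. h < d \<longrightarrow> k 0 < k (0 + h)" by auto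
    then show ?thesis using k0 False by (intro that[of d]) (auto simp: not_less less_imp_le)
  qed
  have "\<forall>\<^sub>F t in at 0. y + t *\<^sub>R b \<in> ball 0 r"
  proof (rule topological_tendstoD)
    have "((\<lambda>t. y + t *\<^sub>R b) \<longlongrightarrow> y + 0 *\<^sub>R b) (at 0)" by (intro tendsto_intros)
    then show "((\<lambda>t. y + t *\<^sub>R b) \<longlongrightarrow> y) (at 0)" by simp
  qed (use y in auto)
  moreover have "\<forall>\<^sub>F t in at 0. \<gamma> y + t * c \<in> {-h<..<h}"
  proof (rule topological_tendstoD)
    have "((\<lambda>t. \<gamma> y + t * c) \<longlongrightarrow> \<gamma> y + 0 * c) (at 0)" by (intro tendsto_intros)
    then show "((\<lambda>t. \<gamma> y + t * c) \<longlongrightarrow> \<gamma> y) (at 0)" by simp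
  qed (use \<gamma>_bound[OF y] in auto)
  ultimately have "\<forall>\<^sub>F t in at 0. y + t *\<^sub>R b \<in> ball 0 r \<and> \<gamma> y + t * c \<in> {-h<..<h}"
    by (rule eventually_conj)
  then obtain d2 where d2: "d2 > 0"
    "\<And>t. t \<noteq> 0 \<Longrightarrow> \<bar>t\<bar> < d2 \<Longrightarrow> y + t *\<^sub>R b \<in> ball 0 r \<and> \<gamma> y + t * c \<in> {-h<..<h}"
    unfolding eventually_at by (auto simp: dist_real_def)
  have "surf y + t *\<^sub>R v \<in> \<Omega> \<longleftrightarrow> v \<bullet> normal y < 0" if "0 < t" "t < min d1 d2" for t
  proof -
    have "y + t *\<^sub>R b \<in> ball 0 r" "\<bar>\<gamma> y + t * c\<bar> < h" using d2(2)[of t] that by auto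
    from pt_in_\<Omega>[OF this] show ?thesis using d1(2)[of t] that by (simp add: eq k_def)
  qed
  then show ?thesis using d1(1) d2(1) by (intro exI[of _ "min d1 d2"]) auto
qed

end

text \<open>If the unit normals differed, the direction \<open>v = n' - n\<close> would point into
  \<Omega> according to the first chart and out of it according to the second.\<close>

lemma graph_normal_unique:
  assumes "C11_graph \<Omega> Q p r h \<gamma>" "C11_graph \<Omega> Q' p' r' h' \<gamma>'"
    and y: "y \<in> ball 0 r" "y' \<in> ball 0 r'"
    and eq: "frame_point Q p y (\<gamma> y) = frame_point Q' p' y' (\<gamma>' y')"
  shows "graph_normal Q \<gamma> y = graph_normal Q' \<gamma>' y'"
proof (rule ccontr)
  interpret c: C11_graph \<Omega> Q p r h \<gamma> by fact
  interpret c': C11_graph \<Omega> Q' p' r' h' \<gamma>' by fact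
  define n n' where "n = graph_normal Q \<gamma> y" and "n' = graph_normal Q' \<gamma>' y'"
  assume "graph_normal Q \<gamma> y \<noteq> graph_normal Q' \<gamma>' y'"
  then have ne: "n \<noteq> n'" by (simp add: n_def n'_def)
  have pos: "norm (c.normal y) > 0" "norm (c'.normal y') > 0"
    by (rule c.normal_nonzero c'.normal_nonzero)+
  have unit: "n \<bullet> n = 1" "n' \<bullet> n' = 1"
    using pos unfolding n_def n'_def c.graph_normal_eq c'.graph_normal_eq
    by (simp_all add: dot_square_norm power2_eq_square)
  have nn: "c.normal y = norm (c.normal y) *\<^sub>R n" "c'.normal y' = norm (c'.normal y') *\<^sub>R n'"
    using pos unfolding n_def n'_def c.graph_normal_eq c'.graph_normal_eq by auto
  have "0 < (n' - n) \<bullet> (n' - n)" using ne by simp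
  then have lt: "n \<bullet> n' < 1" using unit by (simp add: inner_diff_left inner_diff_right inner_commute)
  define v where "v = n' - n"
  have "v \<bullet> n < 0" "v \<bullet> n' > 0"
    unfolding v_def inner_diff_left using lt unit by (simp_all add: inner_commute)
  then have v: "v \<bullet> c.normal y < 0" "v \<bullet> c'.normal y' > 0"
    using pos by (subst nn; simp add: mult_less_0_iff zero_less_mult_iff)+
  obtain d where d: "d > 0" "\<And>t. 0 < t \<Longrightarrow> t < d \<Longrightarrow> c.surf y + t *\<^sub>R v \<in> \<Omega>"
    using c.near_surf[OF y(1), of v] v by auto
  obtain d' where d': "d' > 0" "\<And>t. 0 < t \<Longrightarrow> t < d' \<Longrightarrow> c'.surf y' + t *\<^sub>R v \<notin> \<Omega>"
    using c'.near_surf[OF y(2), of v] v by auto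
  have "c.surf y = c'.surf y'" using eq by (simp add: c.surf_def c'.surf_def)
  moreover have "0 < min d d' / 2" "min d d' / 2 < d" "min d d' / 2 < d'" using d(1) d'(1) by auto
  ultimately show False using d(2) d'(2) by metis
qed

text \<open>Off the boundary the description under \<open>THE\<close> is unsatisfiable, so the value
  is one fixed vector. This makes \<open>outer_normal\<close> a Borel function on the whole
  space.\<close>

lemma outer_normal_outside:
  assumes "x \<notin> frontier \<Omega>" shows "outer_normal \<Omega> x = (THE n. False)"
proof -
  have "x \<noteq> frame_point Q p y (\<gamma> y)" if "C11_chart \<Omega> Q p r h \<gamma>" "y \<in> ball 0 r" for Q p r h \<gamma> y
    using that assms by (auto simp: C11_chart_def)
  then have "(\<lambda>n. \<exists>Q p r h \<gamma> y. C11_chart \<Omega> Q p r h \<gamma> \<and> y \<in> ball 0 r \<and>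
     x = frame_point Q p y (\<gamma> y) \<and> n = graph_normal Q \<gamma> y) = (\<lambda>n. False)"
    by (intro ext) blast
  then show ?thesis unfolding outer_normal_def by presburger
qed

context C11_graph
begin

lemma chartI: "C11_chart \<Omega> Q' p' r' h' \<gamma>' \<Longrightarrow> C11_graph \<Omega> Q' p' r' h' \<gamma>'"
  using domain bounded_\<Omega> by (simp add: C11_graph_def)

lemma outer_normal_surf:
  assumes y: "y \<in> ball 0 r"
  shows "outer_normal \<Omega> (surf y) = (1 / norm (normal y)) *\<^sub>R normal y"
  unfolding outer_normal_def graph_normal_eq[symmetric]
proof (rule the_equality)
  show "\<exists>Q' p' r' h' \<gamma>' y'. C11_chart \<Omega> Q' p' r' h' \<gamma>' \<and> y' \<in> ball 0 r' \<and>
      surf y = frame_point Q' p' y' (\<gamma>' y') \<and> graph_normal Q \<gamma> y = graph_normal Q' \<gamma>' y'"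
    using chart y unfolding surf_def by blast
  fix n assume "\<exists>Q' p' r' h' \<gamma>' y'. C11_chart \<Omega> Q' p' r' h' \<gamma>' \<and> y' \<in> ball 0 r' \<and>
      surf y = frame_point Q' p' y' (\<gamma>' y') \<and> n = graph_normal Q' \<gamma>' y'"
  then obtain Q' p' r' h' \<gamma>' y' where *: "C11_chart \<Omega> Q' p' r' h' \<gamma>'" "y' \<in> ball 0 r'"
    "surf y = frame_point Q' p' y' (\<gamma>' y')" "n = graph_normal Q' \<gamma>' y'" by blast
  have "graph_normal Q \<gamma> y = graph_normal Q' \<gamma>' y'"
    by (rule graph_normal_unique[OF C11_graph_axioms chartI[OF *(1)] y *(2)])
      (use *(3) in \<open>simp add: surf_def\<close>)
  then show "n = graph_normal Q \<gamma> y" using *(4) by simp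
qed

lemma frontier_cyl:
  assumes "x \<in> frontier \<Omega>" "x \<in> cyl"
  shows "hor (unframe Q (x - p)) \<in> ball 0 r" "surf (hor (unframe Q (x - p))) = x"
proof -
  define y s where "y = hor (unframe Q (x - p))" and "s = unframe Q (x - p) $ 3"
  have x: "x = pt y s" by (simp add: y_def s_def frame_point_coordinates[OF orth])
  have ys: "y \<in> ball 0 r" "\<bar>s\<bar> < h" using assms(2) unfolding cylinder_iff[OF orth] y_def s_def by auto
  then have "s = \<gamma> y" using assms(1) pt_in_frontier[OF ys] x by simp
  then have "surf y = x" by (simp only: surf_def x)
  then show "surf (hor (unframe Q (x - p))) = x" unfolding y_def .
  show "hor (unframe Q (x - p)) \<in> ball 0 r" using ys(1) unfolding y_def .
qed

lemma outer_normal_continuous_chart: "continuous_on (frontier \<Omega> \<inter> cyl) (outer_normal \<Omega>)"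
proof -
  have "continuous_on (ball 0 r) (\<lambda>y. (1 / norm (normal y)) *\<^sub>R normal y)"
    using normal_nonzero by (intro continuous_intros normal_continuous) auto
  then have "continuous_on (frontier \<Omega> \<inter> cyl)
      (\<lambda>x. (1 / norm (normal (hor (unframe Q (x - p))))) *\<^sub>R normal (hor (unframe Q (x - p))))"
    by (rule continuous_on_compose2[OF _ continuous_hor_unframe[OF orth]]) (use frontier_cyl in auto)
  moreover have "outer_normal \<Omega> x
      = (1 / norm (normal (hor (unframe Q (x - p))))) *\<^sub>R normal (hor (unframe Q (x - p)))"
    if "x \<in> frontier \<Omega> \<inter> cyl" for x
    using outer_normal_surf[of "hor (unframe Q (x - p))"] frontier_cyl[of x] that by simp
  ultimately show ?thesis by (subst continuous_on_cong) auto
qed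

end

locale C11_bounded =
  fixes \<Omega> :: "(real^3) set"
  assumes domain: "C11_domain \<Omega>" and bounded_\<Omega>: "bounded \<Omega>"
begin

lemma open_\<Omega>: "open \<Omega>" using domain by (simp add: C11_domain_def)

lemma \<Omega>_borel: "\<Omega> \<in> sets borel" using open_\<Omega> by simp

lemma chartI: "C11_chart \<Omega> Q p r h \<gamma> \<Longrightarrow> C11_graph \<Omega> Q p r h \<gamma>"
  using domain bounded_\<Omega> by (simp add: C11_graph_def)

lemma chart_at:
  assumes "x \<in> frontier \<Omega>"
  obtains Q p r h \<gamma> where "C11_graph \<Omega> Q p r h \<gamma>" "x \<in> cylinder Q p r h"
  using assms domain chartI unfolding C11_domain_def by blast

lemma outer_normal_continuous: "continuous_on (frontier \<Omega>) (outer_normal \<Omega>)"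
  unfolding continuous_on_eq_continuous_within
proof
  fix x assume x: "x \<in> frontier \<Omega>"
  obtain Q p r h \<gamma> where c: "C11_graph \<Omega> Q p r h \<gamma>" "x \<in> cylinder Q p r h"
    by (rule chart_at[OF x]) (rule that)
  interpret c: C11_graph \<Omega> Q p r h \<gamma> by (rule c)
  have "continuous (at x within frontier \<Omega> \<inter> c.cyl) (outer_normal \<Omega>)"
    using c.outer_normal_continuous_chart x c(2) by (auto simp: continuous_on_eq_continuous_within)
  moreover have "at x within frontier \<Omega> \<inter> c.cyl = at x within frontier \<Omega>"
    by (rule at_within_nhd[of _ c.cyl]) (use c(2) open_cylinder[OF c.orth] in auto)
  ultimately show "continuous (at x within frontier \<Omega>) (outer_normal \<Omega>)"
    by (simp add: continuous_within)
qed

lemma outer_normal_borel: "outer_normal \<Omega> \<in> borel_measurable borel"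
proof -
  let ?c = "THE n::real^3. False"
  have "(\<lambda>x. indicator (frontier \<Omega>) x *\<^sub>R outer_normal \<Omega> x) \<in> borel_measurable borel"
    by (rule borel_measurable_continuous_on_indicator[OF _ outer_normal_continuous]) simp
  moreover have "(\<lambda>x. indicator (- frontier \<Omega>) x *\<^sub>R ?c) \<in> borel_measurable borel"
    by (intro borel_measurable_scaleR borel_measurable_indicator) auto
  ultimately have "(\<lambda>x. indicator (frontier \<Omega>) x *\<^sub>R outer_normal \<Omega> x + indicator (- frontier \<Omega>) x *\<^sub>R ?c)
     \<in> borel_measurable borel" by (rule borel_measurable_add)
  moreover have "(\<lambda>x. indicator (frontier \<Omega>) x *\<^sub>R outer_normal \<Omega> x + indicator (- frontier \<Omega>) x *\<^sub>R ?c) = outer_normal \<Omega>"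
    by (auto simp: fun_eq_iff indicator_def outer_normal_outside)
  ultimately show ?thesis by simp
qed

lemma norm_outer_normal: "x \<in> frontier \<Omega> \<Longrightarrow> norm (outer_normal \<Omega> x) = 1"
proof -
  assume x: "x \<in> frontier \<Omega>"
  obtain Q p r h \<gamma> where c: "C11_graph \<Omega> Q p r h \<gamma>" "x \<in> cylinder Q p r h"
    by (rule chart_at[OF x]) (rule that)
  interpret c: C11_graph \<Omega> Q p r h \<gamma> by (rule c)
  show ?thesis
    using c.outer_normal_surf[OF c.frontier_cyl(1)[OF x c(2)]] c.normal_nonzero
    by (simp add: c.frontier_cyl(2)[OF x c(2)])
qed

end

sublocale C11_graph \<subseteq> dom: C11_bounded \<Omega>
  using domain bounded_\<Omega> by unfold_locales

context C11_graph
begin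

text \<open>The area of the graph, pushed forward to the whole space so that different charts can be
  compared. It is unrelated to the penalty parameter of the eigenvalue problem.\<close>

definition \<tau> :: "(real^3) measure" where
  "\<tau> = distr (density (lebesgue_on (ball 0 r)) (\<lambda>y. ennreal (norm (normal y)))) borel surf"

lemma sets_\<tau> [simp]: "sets \<tau> = sets borel" and space_\<tau> [simp]: "space \<tau> = UNIV"
  by (simp_all add: \<tau>_def)

lemma surf_measurable: "surf \<in> borel_measurable (lebesgue_on (ball 0 r))"
  and normal_measurable: "normal \<in> borel_measurable (lebesgue_on (ball 0 r))"
  by (auto intro!: continuous_imp_measurable_on_sets_lebesgue surf_continuous normal_continuous)

lemma emeasure_\<tau>:
  assumes "A \<in> sets borel"
  shows "emeasure \<tau> A = (\<integral>\<^sup>+ y. ennreal (sqrt (1 + (norm (grad \<gamma> y))\<^sup>2)) * indicator A (surf y) \<partial>lebesgue_on (ball 0 r))"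
proof -
  have "emeasure \<tau> A = emeasure (density (lebesgue_on (ball 0 r)) (\<lambda>y. ennreal (norm (normal y)))) (surf -` A \<inter> ball 0 r)"
    unfolding \<tau>_def using surf_measurable assms by (subst emeasure_distr) auto
  also have "\<dots> = (\<integral>\<^sup>+ y. ennreal (norm (normal y)) * indicator (surf -` A \<inter> ball 0 r) y \<partial>lebesgue_on (ball 0 r))"
    using surf_measurable normal_measurable assms measurable_sets[OF surf_measurable, of A]
    by (subst emeasure_density) auto
  also have "\<dots> = (\<integral>\<^sup>+ y. ennreal (norm (normal y)) * indicator A (surf y) \<partial>lebesgue_on (ball 0 r))"
    by (rule nn_integral_cong) (auto simp: indicator_def)
  finally show ?thesis by (simp add: norm_normal)
qed

lemma finite_\<tau>: "finite_measure \<tau>"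
proof (rule finite_measureI)
  have "emeasure \<tau> (space \<tau>) \<le> (\<integral>\<^sup>+ y. ennreal (sqrt (1 + M\<^sup>2)) \<partial>lebesgue_on (ball (0::real^2) r))"
  proof -
    have "emeasure \<tau> (space \<tau>)
        = (\<integral>\<^sup>+ y. ennreal (sqrt (1 + (norm (grad \<gamma> y))\<^sup>2)) * indicator UNIV (surf y) \<partial>lebesgue_on (ball 0 r))"
      unfolding space_\<tau> by (rule emeasure_\<tau>) simp
    also have "\<dots> \<le> (\<integral>\<^sup>+ y. ennreal (sqrt (1 + M\<^sup>2)) \<partial>lebesgue_on (ball (0::real^2) r))"
      by (rule nn_integral_mono) (use grad_le_M in \<open>auto intro!: ennreal_leI power_mono\<close>)
    finally show ?thesis .
  qed
  also have "\<dots> < \<infinity>"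
    using emeasure_bounded_finite[of "ball (0::real^2) r"]
    by (simp add: emeasure_restrict_space ennreal_mult_less_top)
  finally show "emeasure \<tau> (space \<tau>) \<noteq> \<infinity>" by simp
qed

lemma AE_\<tau>: "AE x in \<tau>. x \<in> frontier \<Omega> \<and> x \<in> cyl"
proof -
  have "emeasure \<tau> (- (frontier \<Omega> \<inter> cyl)) = (\<integral>\<^sup>+ y. 0 \<partial>lebesgue_on (ball (0::real^2) r))"
  proof (subst emeasure_\<tau>)
    show "- (frontier \<Omega> \<inter> cyl) \<in> sets borel" using open_cylinder[OF orth, of p r h] by simp
    show "(\<integral>\<^sup>+ y. ennreal (sqrt (1 + (norm (grad \<gamma> y))\<^sup>2)) * indicator (- (frontier \<Omega> \<inter> cyl)) (surf y) \<partial>lebesgue_on (ball 0 r))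
        = (\<integral>\<^sup>+ y. 0 \<partial>lebesgue_on (ball (0::real^2) r))"
      by (rule nn_integral_cong) (use surf_frontier surf_cyl in \<open>simp del: Compl_Int\<close>)
  qed
  then have "- (frontier \<Omega> \<inter> cyl) \<in> null_sets \<tau>"
    using open_cylinder[OF orth, of p r h] by (intro null_setsI) auto
  then show ?thesis by (rule AE_I') auto
qed

lemma integral_\<tau>:
  assumes "f \<in> borel_measurable borel"
  shows "(LINT x|\<tau>. f x) = (LINT y|lebesgue_on (ball 0 r). norm (normal y) * f (surf y))"
proof -
  have "(\<lambda>y. f (surf y)) \<in> borel_measurable (lebesgue_on (ball 0 r))"
    by (rule measurable_compose[OF surf_measurable assms])
  then show ?thesis
    unfolding \<tau>_def using assms surf_measurable normal_measurable
    by (subst integral_distr; (subst integral_density)?; simp)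
qed

lemma chart_divergence_\<tau>:
  assumes F: "test_function cyl F"
  shows "(LINT x|lebesgue_on \<Omega>. grad F x \<bullet> a) = (LINT x|\<tau>. F x * (a \<bullet> outer_normal \<Omega> x))"
proof -
  have m: "(\<lambda>x. F x * (a \<bullet> outer_normal \<Omega> x)) \<in> borel_measurable borel"
    using smooth_borel[OF test_function_smooth[OF F]] dom.outer_normal_borel
    by (intro borel_measurable_times borel_measurable_inner) auto
  show ?thesis
    unfolding integral_\<tau>[OF m] chart_divergence[OF F]
  proof (rule Bochner_Integration.integral_cong[OF refl])
    fix y assume "y \<in> space (lebesgue_on (ball (0::real^2) r))"
    then have "y \<in> ball 0 r" by simp
    then show "F (surf y) * (a \<bullet> normal y) = norm (normal y) * (F (surf y) * (a \<bullet> outer_normal \<Omega> (surf y)))"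
      using normal_nonzero[of y] by (simp add: outer_normal_surf)
  qed
qed

text \<open>The component of \<open>normal y\<close> along the axis is exactly 1, and
  \<open>M\<close> bounds the length by which it is divided.\<close>

lemma axis_normal: "x \<in> frontier \<Omega> \<Longrightarrow> x \<in> cyl \<Longrightarrow> 1 / sqrt (1 + M\<^sup>2) \<le> (Q *v axis 3 1) \<bullet> outer_normal \<Omega> x"
proof -
  assume x: "x \<in> frontier \<Omega>" "x \<in> cyl"
  define y where "y = hor (unframe Q (x - p))"
  have y: "y \<in> ball 0 r" "surf y = x" using frontier_cyl[OF x] by (simp_all add: y_def)
  have 1: "(Q *v axis 3 1) \<bullet> normal y = 1"
    unfolding inner_normal unframe_mult[OF orth] by (simp add: axis_def inner_vec_def sum_2)
  have "(norm (grad \<gamma> y))\<^sup>2 \<le> M\<^sup>2" using grad_le_M[OF y(1)] by (intro power_mono) auto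
  then have "norm (normal y) \<le> sqrt (1 + M\<^sup>2)" unfolding norm_normal by simp
  then have "1 / sqrt (1 + M\<^sup>2) \<le> 1 / norm (normal y)" using normal_nonzero[of y] by (intro divide_left_mono mult_pos_pos) (auto simp: add_pos_nonneg)
  also have "\<dots> = (Q *v axis 3 1) \<bullet> outer_normal \<Omega> x"
    using outer_normal_surf[OF y(1)] y(2) 1 by simp
  finally show ?thesis .
qed

end

text \<open>The divergence theorem for fields supported in both cylinders identifies the measures
  \<open>(a \<bullet> \<nu>) \<tau>\<close> of the two charts; the weight is positive for \<open>a\<close> the axis of the first chart.\<close>

lemma chart_measures_agree:
  assumes "C11_graph \<Omega> Q p r h \<gamma>" "C11_graph \<Omega> Q' p' r' h' \<gamma>'"
    and A: "A \<in> sets borel" "A \<subseteq> cylinder Q p r h" "A \<subseteq> cylinder Q' p' r' h'"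
  shows "emeasure (C11_graph.\<tau> Q p r \<gamma>) A = emeasure (C11_graph.\<tau> Q' p' r' \<gamma>') A"
proof -
  interpret c: C11_graph \<Omega> Q p r h \<gamma> by fact
  interpret c': C11_graph \<Omega> Q' p' r' h' \<gamma>' by fact
  define V where "V = c.cyl \<inter> c'.cyl"
  have V: "open V" using open_cylinder[OF c.orth] open_cylinder[OF c'.orth] by (auto simp: V_def)
  then have Vb: "V \<in> sets borel" by simp
  \<comment> \<open>The density of the boundary flux along the axis of the first chart, positive on
    the boundary inside the first cylinder.\<close>
  define w where "w x = (Q *v axis 3 1) \<bullet> outer_normal \<Omega> x" for x
  have wb[measurable]: "w \<in> borel_measurable borel"
    unfolding w_def using c.dom.outer_normal_borel by (intro borel_measurable_inner) auto
  have w1: "w x > 0" if "x \<in> frontier \<Omega>" "x \<in> c.cyl" for x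
  proof -
    have "0 < 1 / sqrt (1 + c.M\<^sup>2)" by (simp add: add_pos_nonneg)
    then show ?thesis unfolding w_def by (rule less_le_trans[OF _ c.axis_normal[OF that]])
  qed
  have w2: "\<bar>w x\<bar> \<le> 1" if "x \<in> frontier \<Omega>" for x
    using Cauchy_Schwarz_ineq2[of "Q *v axis 3 1" "outer_normal \<Omega> x"] c.dom.norm_outer_normal[OF that]
    by (simp add: w_def norm_frame[OF c.orth])
  have wi: "integrable N w" if "finite_measure N" "sets N = sets borel" "AE x in N. x \<in> frontier \<Omega>" for N
  proof (rule finite_measure.integrable_const_bound[OF that(1), of _ 1])
    show "AE x in N. norm (w x) \<le> 1" using that(3) by eventually_elim (simp add: w2)
    show "w \<in> borel_measurable N" using wb by (simp add: measurable_cong_sets[OF that(2) refl])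
  qed
  have i1: "integrable c.\<tau> w" by (rule wi[OF c.finite_\<tau> c.sets_\<tau>]) (use c.AE_\<tau> in auto)
  have i2: "integrable c'.\<tau> w" by (rule wi[OF c'.finite_\<tau> c'.sets_\<tau>]) (use c'.AE_\<tau> in auto)
  have eq: "(LINT x|c.\<tau>. indicator B x * w x) = (LINT x|c'.\<tau>. indicator B x * w x)"
    if "B \<in> sets borel" "B \<subseteq> V" for B
  proof (rule test_functions_determine_measure[OF c.sets_\<tau> c'.sets_\<tau> i1 i2 V _ that])
    fix \<phi> assume \<phi>: "test_function V \<phi>"
    have "test_function c.cyl \<phi>" "test_function c'.cyl \<phi>"
      using test_function_mono[OF \<phi>] by (auto simp: V_def)
    then show "(LINT x|c.\<tau>. \<phi> x * w x) = (LINT x|c'.\<tau>. \<phi> x * w x)"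
      using c.chart_divergence_\<tau>[of \<phi> "Q *v axis 3 1"] c'.chart_divergence_\<tau>[of \<phi> "Q *v axis 3 1"]
      by (simp add: w_def)
  qed
  have val: "(\<integral>\<^sup>+ x. ennreal (indicator V x * w x) * indicator B x \<partial>N) = ennreal (LINT x|N. indicator (B \<inter> V) x * w x)"
    if N: "sets N = sets borel" "integrable N w" "AE x in N. x \<in> frontier \<Omega>" and B: "B \<in> sets borel" for N B
  proof -
    have "(\<integral>\<^sup>+ x. ennreal (indicator V x * w x) * indicator B x \<partial>N) = (\<integral>\<^sup>+ x. ennreal (indicator (B \<inter> V) x * w x) \<partial>N)"
      by (rule nn_integral_cong) (auto simp: indicator_def)
    also have "\<dots> = ennreal (LINT x|N. indicator (B \<inter> V) x * w x)"
    proof (rule nn_integral_eq_integral)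
      show "integrable N (\<lambda>x. indicator (B \<inter> V) x * w x)"
        by (rule test_function_integrable[OF N(1,2), of _ 1]) (use B Vb in \<open>auto simp: indicator_def\<close>)
      show "AE x in N. 0 \<le> indicator (B \<inter> V) x * w x"
        using N(3) by eventually_elim (auto simp: indicator_def V_def dest: w1 intro: less_imp_le)
    qed
    finally show ?thesis .
  qed
  have a1: "AE x in c.\<tau>. x \<in> frontier \<Omega>" and a2: "AE x in c'.\<tau>. x \<in> frontier \<Omega>"
    using c.AE_\<tau> c'.AE_\<tau> by auto
  have m: "(\<lambda>x. ennreal (indicator V x * w x)) \<in> borel_measurable N" if "sets N = sets borel" for N
    using wb Vb unfolding measurable_cong_sets[OF that refl] by measurable
  have D: "density c.\<tau> (\<lambda>x. ennreal (indicator V x * w x)) = density c'.\<tau> (\<lambda>x. ennreal (indicator V x * w x))"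
  proof (rule measure_eqI)
    fix B assume "B \<in> sets (density c.\<tau> (\<lambda>x. ennreal (indicator V x * w x)))"
    then have B: "B \<in> sets borel" by simp
    show "emeasure (density c.\<tau> (\<lambda>x. ennreal (indicator V x * w x))) B
        = emeasure (density c'.\<tau> (\<lambda>x. ennreal (indicator V x * w x))) B"
      using B Vb eq[of "B \<inter> V"]
      by (simp add: emeasure_density m val[OF c.sets_\<tau> i1 a1] val[OF c'.sets_\<tau> i2 a2])
  qed simp
  \<comment> \<open>Both weighted measures are known to coincide on V; dividing by the positive
    weight returns the unweighted ones.\<close>
  have recover: "(\<integral>\<^sup>+ x. ennreal (1 / w x) * indicator A x \<partial>density N (\<lambda>x. ennreal (indicator V x * w x))) = emeasure N A"
    if N: "sets N = sets borel" "AE x in N. x \<in> frontier \<Omega>" for N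
  proof -
    have mw: "(\<lambda>x. ennreal (1 / w x) * indicator A x) \<in> borel_measurable N"
      using A(1) wb unfolding measurable_cong_sets[OF N(1) refl] by measurable
    have "(\<integral>\<^sup>+ x. ennreal (1 / w x) * indicator A x \<partial>density N (\<lambda>x. ennreal (indicator V x * w x)))
        = (\<integral>\<^sup>+ x. ennreal (indicator V x * w x) * (ennreal (1 / w x) * indicator A x) \<partial>N)"
      by (rule nn_integral_density[OF m[OF N(1)] mw])
    also have "\<dots> = (\<integral>\<^sup>+ x. indicator A x \<partial>N)"
    proof (rule nn_integral_cong_AE)
      show "AE x in N. ennreal (indicator V x * w x) * (ennreal (1 / w x) * indicator A x) = indicator A x"
        using N(2)
      proof eventually_elim
        case (elim x)
        show ?case
        proof (cases "x \<in> A")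
          case True
          then have "x \<in> V" "w x > 0" using A w1[OF elim] by (auto simp: V_def)
          then show ?thesis using True by (simp flip: ennreal_mult')
        qed simp
      qed
    qed
    also have "\<dots> = emeasure N A" using A(1) N(1) by simp
    finally show ?thesis .
  qed
  show ?thesis using recover[OF c.sets_\<tau> a1] recover[OF c'.sets_\<tau> a2] D by simp
qed

text \<open>A device for gluing: with disjoint \<open>B k\<close> the result agrees with
  \<open>M k\<close> on subsets of \<open>B k\<close>.\<close>

lemma emeasure_finite_sum_measure:
  assumes M: "\<And>k. k \<in> K \<Longrightarrow> sets (M k) = sets borel" and B: "\<And>k. k \<in> K \<Longrightarrow> B k \<in> sets borel"
  defines "S \<equiv> measure_of UNIV (sets borel) (\<lambda>A. \<Sum>k\<in>K. emeasure (M k) (A \<inter> B k))"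
  shows "sets S = sets (borel :: 'a::topological_space measure)"
    and "A \<in> sets borel \<Longrightarrow> emeasure S A = (\<Sum>k\<in>K. emeasure (M k) (A \<inter> B k))"
proof -
  show "sets S = sets (borel :: 'a measure)"
    using sets.sigma_sets_eq[of "borel :: 'a measure"] by (simp add: S_def sets_measure_of)
  assume A: "A \<in> sets borel"
  show "emeasure S A = (\<Sum>k\<in>K. emeasure (M k) (A \<inter> B k))"
    unfolding S_def
  proof (rule emeasure_measure_of_sigma)
    show "sigma_algebra UNIV (sets (borel :: 'a measure))"
      using sets.sigma_algebra_axioms[of borel] by simp
    show "positive (sets borel) (\<lambda>A. \<Sum>k\<in>K. emeasure (M k) (A \<inter> B k))" by (simp add: positive_def)
    show "countably_additive (sets borel) (\<lambda>A. \<Sum>k\<in>K. emeasure (M k) (A \<inter> B k))"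
    proof (rule countably_additiveI)
      fix X :: "nat \<Rightarrow> 'a set" assume X: "range X \<subseteq> sets borel" "disjoint_family X"
      have "(\<Sum>i. \<Sum>k\<in>K. emeasure (M k) (X i \<inter> B k)) = (\<Sum>k\<in>K. \<Sum>i. emeasure (M k) (X i \<inter> B k))"
        by (rule suminf_sum) simp
      also have "\<dots> = (\<Sum>k\<in>K. emeasure (M k) ((\<Union>i. X i) \<inter> B k))"
      proof (rule sum.cong[OF refl])
        fix k assume k: "k \<in> K"
        have "(\<Sum>i. emeasure (M k) (X i \<inter> B k)) = emeasure (M k) (\<Union>i. X i \<inter> B k)"
          by (rule suminf_emeasure) (use X M[OF k] B[OF k] in \<open>auto simp: disjoint_family_on_def\<close>)
        also have "(\<Union>i. X i \<inter> B k) = (\<Union>i. X i) \<inter> B k" by blast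
        finally show "(\<Sum>i. emeasure (M k) (X i \<inter> B k)) = emeasure (M k) ((\<Union>i. X i) \<inter> B k)" .
      qed
      finally show "(\<Sum>i. \<Sum>k\<in>K. emeasure (M k) (X i \<inter> B k)) = (\<Sum>k\<in>K. emeasure (M k) ((\<Union>i. X i) \<inter> B k))" .
    qed
  qed (rule A)
qed

context C11_bounded
begin

lemma is_surface_measure_iff:
  "is_surface_measure \<Omega> \<sigma> \<longleftrightarrow> sets \<sigma> = sets borel \<and> emeasure \<sigma> (- frontier \<Omega>) = 0 \<and>
    (\<forall>Q p r h \<gamma>. C11_graph \<Omega> Q p r h \<gamma> \<longrightarrow>
      (\<forall>A\<in>sets borel. A \<subseteq> cylinder Q p r h \<longrightarrow> emeasure \<sigma> A = emeasure (C11_graph.\<tau> Q p r \<gamma>) A))"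
proof -
  have "emeasure (C11_graph.\<tau> Q p r \<gamma>) A =
      (\<integral>\<^sup>+ y. ennreal (sqrt (1 + (norm (grad \<gamma> y))\<^sup>2)) * indicator A (frame_point Q p y (\<gamma> y)) \<partial>lebesgue_on (ball 0 r))"
    if "C11_graph \<Omega> Q p r h \<gamma>" "A \<in> sets borel" for Q p r h \<gamma> A
    using C11_graph.emeasure_\<tau>[OF that] unfolding C11_graph.surf_def[OF that(1)] .
  moreover have "C11_graph \<Omega> Q p r h \<gamma> \<longleftrightarrow> C11_chart \<Omega> Q p r h \<gamma>" for Q p r h \<gamma>
    using chartI C11_graph.chart by blast
  ultimately show ?thesis unfolding is_surface_measure_def by (metis (no_types, lifting))
qed

lemma frontier_charts:
  obtains n :: nat and Q p r h \<gamma> where "\<And>k. k < n \<Longrightarrow> C11_graph \<Omega> (Q k) (p k) (r k) (h k) (\<gamma> k)"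
    "frontier \<Omega> \<subseteq> (\<Union>k<n. cylinder (Q k) (p k) (r k) (h k))"
proof -
  have "\<exists>Q p r h \<gamma>. C11_graph \<Omega> Q p r h \<gamma> \<and> x \<in> cylinder Q p r h" if "x \<in> frontier \<Omega>" for x
    by (rule chart_at[OF that]) blast
  then obtain Q p r h \<gamma> where c: "\<And>x. x \<in> frontier \<Omega> \<Longrightarrow> C11_graph \<Omega> (Q x) (p x) (r x) (h x) (\<gamma> x)"
    "\<And>x. x \<in> frontier \<Omega> \<Longrightarrow> x \<in> cylinder (Q x) (p x) (r x) (h x)" by metis
  have comp: "compact (frontier \<Omega>)"
    using bounded_\<Omega> by (simp add: compact_frontier_bounded)
  have op: "open (cylinder (Q x) (p x) (r x) (h x))" if "x \<in> frontier \<Omega>" for x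
    by (rule open_cylinder[OF C11_graph.orth[OF c(1)[OF that]]])
  have "\<exists>X\<subseteq>frontier \<Omega>. finite X \<and> frontier \<Omega> \<subseteq> (\<Union>x\<in>X. cylinder (Q x) (p x) (r x) (h x))"
    by (rule compactE_image[OF comp, of "frontier \<Omega>" "\<lambda>x. cylinder (Q x) (p x) (r x) (h x)"])
      (use op c(2) in blast)+
  then obtain X where X: "X \<subseteq> frontier \<Omega>" "finite X" "frontier \<Omega> \<subseteq> (\<Union>x\<in>X. cylinder (Q x) (p x) (r x) (h x))"
    by blast
  obtain f where f: "bij_betw f {0..<card X} X" using ex_bij_betw_nat_finite[OF X(2)] by blast
  then have im: "f ` {..<card X} = X" by (simp add: bij_betw_def atLeast0LessThan)
  show ?thesis
  proof (rule that[of "card X" "Q \<circ> f" "p \<circ> f" "r \<circ> f" "h \<circ> f" "\<gamma> \<circ> f"])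
    show "C11_graph \<Omega> ((Q \<circ> f) k) ((p \<circ> f) k) ((r \<circ> f) k) ((h \<circ> f) k) ((\<gamma> \<circ> f) k)" if "k < card X" for k
    proof -
    from that have "f k \<in> frontier \<Omega>" using im X(1) by blast
    then show ?thesis using c(1) by simp
    qed
    show "frontier \<Omega> \<subseteq> (\<Union>k<card X. cylinder ((Q \<circ> f) k) ((p \<circ> f) k) ((r \<circ> f) k) ((h \<circ> f) k))"
    proof
      fix x assume "x \<in> frontier \<Omega>"
      then obtain z where z: "z \<in> X" "x \<in> cylinder (Q z) (p z) (r z) (h z)" using X(3) by blast
      then obtain k where "k < card X" "z = f k" using im by blast
      then show "x \<in> (\<Union>k<card X. cylinder ((Q \<circ> f) k) ((p \<circ> f) k) ((r \<circ> f) k) ((h \<circ> f) k))"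
        using z(2) by auto
    qed
  qed
qed

text \<open>Finitely many cylinders covering the boundary are cut into disjoint pieces, and the area
  measures of the charts are summed over these. Agreement on overlaps makes the sum correct in every
  other chart; uniqueness holds because each candidate is prescribed on every piece.\<close>

lemma surface_measure_exists: "\<exists>!\<sigma>. is_surface_measure \<Omega> \<sigma>"
proof -
  obtain n :: nat and Q p r h \<gamma> where c: "\<And>k. k < n \<Longrightarrow> C11_graph \<Omega> (Q k) (p k) (r k) (h k) (\<gamma> k)"
    and cov: "frontier \<Omega> \<subseteq> (\<Union>k<n. cylinder (Q k) (p k) (r k) (h k))" by (rule frontier_charts) (rule that)
  define C where "C k = cylinder (Q k) (p k) (r k) (h k)" for k
  define B where "B k = C k - (\<Union>j<k. C j)" for k
  define T where "T k = C11_graph.\<tau> (Q k) (p k) (r k) (\<gamma> k)" for k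
  define S where "S = measure_of UNIV (sets borel) (\<lambda>A. \<Sum>k\<in>{..<n}. emeasure (T k) (A \<inter> B k))"
  have Cb: "C k \<in> sets borel" if "k < n" for k
    using open_cylinder[OF C11_graph.orth[OF c[OF that]]] by (simp add: C_def)
  have Bb: "B k \<in> sets borel" if "k < n" for k
    unfolding B_def using Cb that by (intro sets.Diff sets.finite_UN) auto
  have Ts: "sets (T k) = sets borel" if "k < n" for k
    unfolding T_def by (rule C11_graph.sets_\<tau>[OF c[OF that]])
  have disj: "disjoint_family_on B {..<n}"
    unfolding disjoint_family_on_def B_def by (auto simp: not_less_iff_gr_or_eq) (metis lessThan_iff linorder_neqE_nat)
  have UB: "(\<Union>k<n. B k) = (\<Union>k<n. C k)"
  proof
    show "(\<Union>k<n. C k) \<subseteq> (\<Union>k<n. B k)"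
    proof
      fix x assume "x \<in> (\<Union>k<n. C k)"
      then obtain k where k: "k < n" "x \<in> C k" by auto
      define l where "l = (LEAST k. x \<in> C k)"
      have "x \<in> C l" "l \<le> k" using LeastI[of "\<lambda>k. x \<in> C k", OF k(2)] Least_le[of "\<lambda>k. x \<in> C k", OF k(2)] by (simp_all add: l_def)
      moreover have "x \<notin> C j" if "j < l" for j using not_less_Least[of j "\<lambda>k. x \<in> C k"] that by (simp add: l_def)
      ultimately show "x \<in> (\<Union>k<n. B k)" using k by (auto simp: B_def intro!: bexI[of _ l])
    qed
  qed (auto simp: B_def)
  have S: "sets S = sets borel" "\<And>A. A \<in> sets borel \<Longrightarrow> emeasure S A = (\<Sum>k<n. emeasure (T k) (A \<inter> B k))"
    unfolding S_def by (rule emeasure_finite_sum_measure; use Ts Bb in auto)+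
  \<comment> \<open>Used twice: for the area measure of an arbitrary chart and for an arbitrary
    candidate in the uniqueness proof.\<close>
  have decomp: "emeasure \<sigma> A = (\<Sum>k<n. emeasure \<sigma> (A \<inter> B k))"
    if \<sigma>: "sets \<sigma> = sets borel" "AE x in \<sigma>. x \<in> frontier \<Omega>" and A: "A \<in> sets borel" for \<sigma> A
  proof -
    have "emeasure \<sigma> A = emeasure \<sigma> (\<Union>k<n. A \<inter> B k)"
    proof (rule emeasure_eq_AE)
      show "AE x in \<sigma>. x \<in> A \<longleftrightarrow> x \<in> (\<Union>k<n. A \<inter> B k)"
        using \<sigma>(2) by eventually_elim (use cov UB in \<open>auto simp: C_def\<close>)
      show "(\<Union>k<n. A \<inter> B k) \<in> sets \<sigma>" using A Bb \<sigma>(1) by (intro sets.finite_UN) auto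
    qed (use A \<sigma> in auto)
    also have "\<dots> = (\<Sum>k<n. emeasure \<sigma> (A \<inter> B k))"
    proof (rule sum_emeasure[symmetric])
      show "disjoint_family_on (\<lambda>k. A \<inter> B k) {..<n}"
        using disj unfolding disjoint_family_on_def by blast
    qed (use A Bb \<sigma>(1) in auto)
    finally show ?thesis .
  qed
  have isS: "is_surface_measure \<Omega> S"
    unfolding is_surface_measure_iff
  proof (intro conjI allI impI ballI)
    show "emeasure S (- frontier \<Omega>) = 0"
    proof (subst S(2))
      have "emeasure (T k) (- frontier \<Omega> \<inter> B k) = 0" if k: "k < n" for k
      proof -
        interpret ck: C11_graph \<Omega> "Q k" "p k" "r k" "h k" "\<gamma> k" by (rule c[OF k])
        have "AE x in T k. x \<notin> - frontier \<Omega> \<inter> B k" using ck.AE_\<tau> unfolding T_def by eventually_elim auto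
        then have "emeasure (T k) {x \<in> space (T k). x \<in> - frontier \<Omega> \<inter> B k} = 0"
          by (rule emeasure_eq_0_AE)
        moreover have "{x \<in> space (T k). x \<in> - frontier \<Omega> \<inter> B k} = - frontier \<Omega> \<inter> B k"
          by (auto simp: T_def)
        ultimately show ?thesis by (simp only:)
      qed
      then show "(\<Sum>k<n. emeasure (T k) (- frontier \<Omega> \<inter> B k)) = 0" by simp
    qed auto
  next
    fix Q' p' r' h' \<gamma>' A
    assume c': "C11_graph \<Omega> Q' p' r' h' \<gamma>'" and A: "A \<in> sets borel" "A \<subseteq> cylinder Q' p' r' h'"
    interpret c': C11_graph \<Omega> Q' p' r' h' \<gamma>' by (rule c')
    have "emeasure c'.\<tau> A = (\<Sum>k<n. emeasure c'.\<tau> (A \<inter> B k))"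
      by (rule decomp) (use c'.AE_\<tau> A in auto)
    also have "\<dots> = (\<Sum>k<n. emeasure (T k) (A \<inter> B k))"
      unfolding T_def
      by (intro sum.cong refl chart_measures_agree[OF c' c]) (use A Bb in \<open>auto simp: B_def C_def\<close>)
    finally show "emeasure S A = emeasure c'.\<tau> A" using S(2)[OF A(1)] by simp
  qed (rule S)
  have "\<sigma> = S" if \<sigma>: "is_surface_measure \<Omega> \<sigma>" for \<sigma>
  proof (rule measure_eqI)
    have \<sigma>s: "sets \<sigma> = sets borel" using \<sigma> by (simp add: is_surface_measure_def)
    then show "sets \<sigma> = sets S" using S by simp
    have ae: "AE x in \<sigma>. x \<in> frontier \<Omega>"
      by (rule AE_I[of _ _ "- frontier \<Omega>"]) (use \<sigma> \<sigma>s in \<open>auto simp: is_surface_measure_def\<close>)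
    fix A assume "A \<in> sets \<sigma>"
    then have A: "A \<in> sets borel" using \<sigma>s by simp
    have "emeasure \<sigma> (A \<inter> B k) = emeasure (T k) (A \<inter> B k)" if "k < n" for k
    proof -
      have "A \<inter> B k \<in> sets borel" "A \<inter> B k \<subseteq> cylinder (Q k) (p k) (r k) (h k)"
        using A Bb[OF that] by (auto simp: B_def C_def)
      then show ?thesis using \<sigma> c[OF that] unfolding is_surface_measure_iff T_def by blast
    qed
    then show "emeasure \<sigma> A = emeasure S A" using decomp[OF \<sigma>s ae A] S(2)[OF A] by simp
  qed
  then show ?thesis using isS by blast
qed

abbreviation "\<sigma> \<equiv> surface_measure \<Omega>"
abbreviation "\<nu> \<equiv> outer_normal \<Omega>"

lemma surface_measure: "is_surface_measure \<Omega> \<sigma>"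
  unfolding surface_measure_def by (rule theI'[OF surface_measure_exists])

lemma sets_\<sigma> [simp]: "sets \<sigma> = sets borel" and space_\<sigma> [simp]: "space \<sigma> = UNIV"
  using surface_measure sets_eq_imp_space_eq[of \<sigma> borel] by (auto simp: is_surface_measure_def)

lemma measurable_\<sigma> [simp]: "borel_measurable \<sigma> = borel_measurable borel"
  by (rule measurable_cong_sets) auto

lemma AE_frontier: "AE x in \<sigma>. x \<in> frontier \<Omega>"
  by (rule AE_I[of _ _ "- frontier \<Omega>"]) (use surface_measure in \<open>auto simp: is_surface_measure_def\<close>)

lemma emeasure_\<sigma>_chart:
  "C11_graph \<Omega> Q p r h \<gamma> \<Longrightarrow> A \<in> sets borel \<Longrightarrow> A \<subseteq> cylinder Q p r h \<Longrightarrow> emeasure \<sigma> A = emeasure (C11_graph.\<tau> Q p r \<gamma>) A"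
  using surface_measure unfolding is_surface_measure_iff by blast

lemma finite_\<sigma>: "finite_measure \<sigma>"
proof (rule finite_measureI)
  obtain n :: nat and Q p r h \<gamma> where c: "\<And>k. k < n \<Longrightarrow> C11_graph \<Omega> (Q k) (p k) (r k) (h k) (\<gamma> k)"
    and cov: "frontier \<Omega> \<subseteq> (\<Union>k<n. cylinder (Q k) (p k) (r k) (h k))" by (rule frontier_charts) (rule that)
  let ?C = "\<lambda>k. cylinder (Q k) (p k) (r k) (h k)"
  have Cb: "?C k \<in> sets borel" if "k < n" for k
    using open_cylinder[OF C11_graph.orth[OF c[OF that]]] by simp
  have "emeasure \<sigma> (space \<sigma>) = emeasure \<sigma> (frontier \<Omega>)"
    by (rule emeasure_eq_AE) (use AE_frontier in auto)
  also have "\<dots> \<le> emeasure \<sigma> (\<Union>k<n. ?C k)"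
    by (rule emeasure_mono[OF cov]) (use Cb in \<open>auto intro!: sets.finite_UN\<close>)
  also have "\<dots> \<le> (\<Sum>k<n. emeasure \<sigma> (?C k))"
    by (rule emeasure_subadditive_finite) (use Cb in auto)
  also have "\<dots> < \<infinity>"
  proof -
    have "emeasure \<sigma> (?C k) < \<infinity>" if "k < n" for k
      unfolding emeasure_\<sigma>_chart[OF c[OF that] Cb[OF that] order_refl]
      using finite_measure.emeasure_finite[OF C11_graph.finite_\<tau>[OF c[OF that]]] by (simp add: less_top)
    then show ?thesis by simp
  qed
  finally show "emeasure \<sigma> (space \<sigma>) \<noteq> \<infinity>" by simp
qed

text \<open>The two measures agree on Borel subsets of the cylinder, so they coincide after both
  receive its indicator as density.\<close>

lemma integral_\<sigma>_chart:
  fixes f :: "real^3 \<Rightarrow> real"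
  assumes c: "C11_graph \<Omega> Q p r h \<gamma>" and f: "f \<in> borel_measurable borel"
    and out: "\<And>x. x \<notin> cylinder Q p r h \<Longrightarrow> f x = 0"
  shows "(LINT x|\<sigma>. f x) = (LINT x|C11_graph.\<tau> Q p r \<gamma>. f x)"
proof -
  interpret c: C11_graph \<Omega> Q p r h \<gamma> by (rule c)
  have Cb: "c.cyl \<in> sets borel" using open_cylinder[OF c.orth] by simp
  have D: "density \<sigma> (indicator c.cyl) = density c.\<tau> (indicator c.cyl)"
  proof (rule measure_eqI)
    fix A assume "A \<in> sets (density \<sigma> (indicator c.cyl))"
    then have A: "A \<in> sets borel" by simp
    have "emeasure (density N (indicator c.cyl)) A = emeasure N (c.cyl \<inter> A)"
      if "sets N = sets borel" for N :: "(real^3) measure"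
      using A Cb that by (subst emeasure_density) (auto simp: nn_integral_indicator indicator_inter_arith[symmetric])
    then show "emeasure (density \<sigma> (indicator c.cyl)) A = emeasure (density c.\<tau> (indicator c.cyl)) A"
      using emeasure_\<sigma>_chart[OF c, of "c.cyl \<inter> A"] A Cb by simp
  qed simp
  have I: "(LINT x|N. f x) = (LINT x|density N (indicator c.cyl). f x)"
    if N: "sets N = sets borel" for N :: "(real^3) measure"
  proof -
    have "(LINT x|density N (\<lambda>x. ennreal (indicator c.cyl x)). f x) = (LINT x|N. indicator c.cyl x *\<^sub>R f x)"
      by (rule integral_density) (use f Cb in \<open>auto simp: measurable_cong_sets[OF N refl]\<close>)
    also have "\<dots> = (LINT x|N. f x)"
      by (rule Bochner_Integration.integral_cong) (use out in \<open>auto simp: indicator_def\<close>)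
    finally show ?thesis by (simp add: ennreal_indicator)
  qed
  show ?thesis using I[of \<sigma>] I[of c.\<tau>] D by simp
qed

end

section \<open>Divergence theorem and trace inequality\<close>

lemma partial_outside_support: "x \<notin> closure {x. f x \<noteq> 0} \<Longrightarrow> partial i f x = 0"
proof -
  assume x: "x \<notin> closure {x. f x \<noteq> 0}"
  have "partial i f x = partial i (\<lambda>x. 0) x"
    by (rule partial_cong_open[of "- closure {x. f x \<noteq> 0}"])
      (use x closure_subset[of "{x. f x \<noteq> 0}"] in auto)
  then show ?thesis by simp
qed

text \<open>The convolution of \<open>\<phi>\<close> with the indicator of a large ball is constant near the origin.\<close>

lemma integral_partial_test_function:
  fixes \<phi> :: "real^'n::finite \<Rightarrow> real"
  assumes \<phi>: "test_function U \<phi>"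
  shows "(LINT x|lborel. partial i \<phi> x) = 0"
proof -
  obtain C where C: "compact C" "\<And>x. x \<notin> C \<Longrightarrow> \<phi> x = 0" "\<And>i x. x \<notin> C \<Longrightarrow> partial i \<phi> x = 0"
    by (rule test_functionE[OF \<phi>]) (rule that)
  obtain R where R: "0 < R" "C \<subseteq> cball 0 R"
    using compact_imp_bounded[OF C(1)] unfolding bounded_pos by (auto simp: subset_eq)
  \<comment> \<open>For \<open>norm x < 1\<close> every z with x - z in C lies in this ball, so the
    convolution is the integral over the whole space.\<close>
  define g :: "real^'n \<Rightarrow> real" where "g = indicator (ball 0 (R + 2))"
  have g: "integrable lborel g"
    using emeasure_bounded_finite[of "ball (0::real^'n) (R + 2)"] by (simp add: g_def)
  have const: "conv g f x = (LINT z|lborel. f z)"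
    if x: "x \<in> ball 0 1" and f: "f \<in> borel_measurable borel" "\<And>z. z \<notin> C \<Longrightarrow> f z = 0" for x and f :: "real^'n \<Rightarrow> real"
  proof -
    have eq: "g z * f (x - z) = f (x - z)" for z
    proof (cases "x - z \<in> C")
      case True
      then have "norm (x - z) \<le> R" "norm x < 1" using R x by (auto simp: subset_eq)
      then have "norm z < R + 2" using norm_triangle_ineq4[of x "x - z"] by simp
      then show ?thesis by (simp add: g_def)
    qed (simp add: f)
    have "conv g f x = (LINT z|lborel. f (x - z))" by (simp only: conv_def eq)
    also have "\<dots> = (LINT z|lborel. f z)"
      using lborel_integral_affine[OF f(1), of "- 1" x] by simp
    finally show ?thesis .
  qed
  have "(LINT x|lborel. partial i \<phi> x) = conv g (partial i \<phi>) 0"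
    by (rule const[symmetric])
      (use C(3) smooth_borel[OF smooth_partial[OF test_function_smooth[OF \<phi>]]] in auto)
  also have "\<dots> = partial i (conv g \<phi>) 0" by (rule conv_partial[OF g \<phi>, symmetric])
  also have "\<dots> = partial i (\<lambda>x. LINT z|lborel. \<phi> z) 0"
    by (rule partial_cong_open[of "ball 0 1"])
      (use const[OF _ smooth_borel[OF test_function_smooth[OF \<phi>]]] C(2) in auto)
  finally show ?thesis by simp
qed

lemma smooth_integrable:
  assumes "bounded S" "S \<in> sets borel" "smooth f" shows "integrable (lebesgue_on S) f"
  by (rule L2_integrable[OF finite_lebesgue_on smooth_L2]) (use assms in auto)

lemma test_function_integral_partial:
  fixes \<phi> :: "real^'n::finite \<Rightarrow> real"
  assumes "open \<Omega>" "test_function \<Omega> \<phi>"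
  shows "(LINT x|lebesgue_on \<Omega>. partial i \<phi> x) = 0"
proof -
  have "partial i \<phi> x = 0" if "x \<notin> \<Omega>" for x
    using test_function_outside[OF test_function_partial[OF assms(2)] that] .
  then have "(LINT x|lebesgue_on \<Omega>. partial i \<phi> x) = (LINT x|lborel. partial i \<phi> x)"
    using assms by (intro integral_lebesgue_on_lborel smooth_borel smooth_partial test_function_smooth[OF assms(2)]) auto
  then show ?thesis using integral_partial_test_function[OF assms(2)] by simp
qed

lemma grad_inner: "grad f x \<bullet> a = (\<Sum>i\<in>UNIV. a $ i * partial i f x)"
  by (simp add: inner_vec_def grad_def mult.commute)

lemma smooth_grad_inner: "smooth f \<Longrightarrow> smooth (\<lambda>x. grad f x \<bullet> a)"
  unfolding grad_inner by (intro smooth_sum smooth_cmult smooth_partial)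

context C11_bounded
begin

lemma smooth_L2_domain: "smooth f \<Longrightarrow> f \<in> L2 (lebesgue_on \<Omega>)"
  by (rule smooth_L2[OF bounded_\<Omega> \<Omega>_borel])

lemma smooth_integrable_domain: "smooth f \<Longrightarrow> integrable (lebesgue_on \<Omega>) f"
  by (rule smooth_integrable[OF bounded_\<Omega> \<Omega>_borel])

lemma bounded_frontier: "bounded (frontier \<Omega>)"
  using bounded_\<Omega> by (simp add: compact_frontier_bounded compact_imp_bounded)

lemma L2_\<sigma>_bounded:
  fixes f :: "real^3 \<Rightarrow> real"
  assumes "f \<in> borel_measurable borel" "\<And>x. x \<in> frontier \<Omega> \<Longrightarrow> \<bar>f x\<bar> \<le> B"
  shows "f \<in> L2 \<sigma>"
proof -
  have "integrable \<sigma> (\<lambda>x. (f x)\<^sup>2)"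
  proof (rule finite_measure.integrable_const_bound[OF finite_\<sigma>, of _ "B\<^sup>2"])
    show "AE x in \<sigma>. norm ((f x)\<^sup>2) \<le> B\<^sup>2"
      using AE_frontier
    proof eventually_elim
      case (elim x)
      have "\<bar>f x\<bar>\<^sup>2 \<le> B\<^sup>2" by (rule power_mono[OF assms(2)[OF elim]]) simp
      then show ?case by simp
    qed
  qed (use assms in simp)
  then show ?thesis using assms by (simp add: L2_real_iff)
qed

lemma smooth_L2_\<sigma>: "smooth f \<Longrightarrow> f \<in> L2 \<sigma>"
  by (rule smooth_bounded_on[OF bounded_frontier]) (auto intro: L2_\<sigma>_bounded smooth_borel)

lemma inner_\<nu>_bound: "x \<in> frontier \<Omega> \<Longrightarrow> \<bar>a \<bullet> \<nu> x\<bar> \<le> norm a"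
  using Cauchy_Schwarz_ineq2[of a "\<nu> x"] norm_outer_normal[of x] by simp

lemma inner_\<nu>_borel: "(\<lambda>x. a \<bullet> \<nu> x) \<in> borel_measurable borel"
  using outer_normal_borel by (intro borel_measurable_inner) auto

lemma smooth_\<nu>_L2_\<sigma>:
  assumes "smooth f" shows "(\<lambda>x. f x * (a \<bullet> \<nu> x)) \<in> L2 \<sigma>"
proof -
  obtain B where B: "0 \<le> B" "\<And>x. x \<in> frontier \<Omega> \<Longrightarrow> \<bar>f x\<bar> \<le> B"
    by (rule smooth_bounded_on[OF bounded_frontier assms]) (rule that)
  show ?thesis
  proof (rule L2_\<sigma>_bounded[where B = "B * norm a"])
    show "(\<lambda>x. f x * (a \<bullet> \<nu> x)) \<in> borel_measurable borel"
      by (intro borel_measurable_times smooth_borel inner_\<nu>_borel assms)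
    show "\<bar>f x * (a \<bullet> \<nu> x)\<bar> \<le> B * norm a" if "x \<in> frontier \<Omega>" for x
      unfolding abs_mult by (intro mult_mono B inner_\<nu>_bound that) auto
  qed
qed

lemma frontier_disjoint: "x \<in> frontier \<Omega> \<Longrightarrow> x \<notin> \<Omega>"
  using open_\<Omega> by (simp add: frontier_def interior_open)

text \<open>The two kinds of pieces for which the divergence theorem, the trace inequality and the
  density of smooth functions are proved before summation.\<close>

definition localized :: "(real^3 \<Rightarrow> real) \<Rightarrow> bool" where
  "localized F \<longleftrightarrow> test_function \<Omega> F \<or>
    (\<exists>Q p r h \<gamma>. C11_graph \<Omega> Q p r h \<gamma> \<and> test_function (cylinder Q p r h) F)"

lemma localized_mult: "localized F \<Longrightarrow> smooth f \<Longrightarrow> localized (\<lambda>x. F x * f x)"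
  unfolding localized_def using test_function_mult(1) by blast

lemma localized_test: "localized F \<Longrightarrow> test_function UNIV F"
  unfolding localized_def using test_function_mono by blast

lemma localized_smooth: "localized F \<Longrightarrow> smooth F"
  using localized_test test_function_smooth by blast

text \<open>The sum is 1 on an open set around the closure, so the derivatives of the pieces sum to
  0 on \<Omega>.\<close>

definition localized_partition where
  "localized_partition X V \<psi> \<longleftrightarrow> finite X \<and> (\<forall>z\<in>X. localized (\<psi> z)) \<and> (\<forall>z x. 0 \<le> \<psi> z x) \<and>
    open V \<and> closure \<Omega> \<subseteq> V \<and> (\<forall>x\<in>V. (\<Sum>z\<in>X. \<psi> z x) = 1)"

lemma localized_partitionD:
  assumes "localized_partition X V \<psi>"
  shows "finite X" "\<And>z. z \<in> X \<Longrightarrow> localized (\<psi> z)" "\<And>z x. 0 \<le> \<psi> z x" "open V" "closure \<Omega> \<subseteq> V"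
    "\<And>x. x \<in> V \<Longrightarrow> (\<Sum>z\<in>X. \<psi> z x) = 1"
  using assms by (auto simp: localized_partition_def)

lemma boundary_partition: "\<exists>(X :: (real^3) set) V \<psi>. localized_partition X V \<psi>"
proof -
  define good where "good U \<longleftrightarrow> U = \<Omega> \<or> (\<exists>Q p r h \<gamma>. C11_graph \<Omega> Q p r h \<gamma> \<and> U = cylinder Q p r h)" for U
  have "\<exists>U. open U \<and> z \<in> U \<and> good U" if z: "z \<in> closure \<Omega>" for z
  proof (cases "z \<in> \<Omega>")
    case False
    then have "z \<in> frontier \<Omega>" using z open_\<Omega> by (simp add: frontier_def interior_open)
    then obtain Q p r h \<gamma> where "C11_graph \<Omega> Q p r h \<gamma>" "z \<in> cylinder Q p r h"
      by (rule chart_at) (rule that)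
    moreover from this have "open (cylinder Q p r h)" by (intro open_cylinder C11_graph.orth)
    ultimately show ?thesis unfolding good_def by (intro exI[of _ "cylinder Q p r h"]) blast
  next
    case True
    then show ?thesis using open_\<Omega> by (intro exI[of _ \<Omega>]) (simp add: good_def)
  qed
  then obtain U where U: "\<And>z. z \<in> closure \<Omega> \<Longrightarrow> open (U z) \<and> z \<in> U z"
    "\<And>z. z \<in> closure \<Omega> \<Longrightarrow> good (U z)"
    by metis
  have comp: "compact (closure \<Omega>)" using bounded_\<Omega> by (simp add: compact_closure)
  show ?thesis
  proof (rule smooth_partition[OF comp U(1)])
    fix X V and \<psi> :: "real^3 \<Rightarrow> real^3 \<Rightarrow> real"
    assume *: "finite X" "X \<subseteq> closure \<Omega>" "\<And>z. z \<in> X \<Longrightarrow> test_function (U z) (\<psi> z)"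
      "\<And>z x. 0 \<le> \<psi> z x \<and> \<psi> z x \<le> 1" "open V" "closure \<Omega> \<subseteq> V" "\<And>x. x \<in> V \<Longrightarrow> (\<Sum>z\<in>X. \<psi> z x) = 1"
    have "localized (\<psi> z)" if z: "z \<in> X" for z
    proof -
      have "good (U z)" using U(2) *(2) z by blast
      then consider "U z = \<Omega>" | Q p r h \<gamma> where "C11_graph \<Omega> Q p r h \<gamma>" "U z = cylinder Q p r h"
        unfolding good_def by blast
      then show ?thesis using *(3)[OF z] by cases (simp add: localized_def, unfold localized_def, metis)
    qed
    then have "localized_partition X V \<psi>" using * by (simp add: localized_partition_def)
    then show ?thesis by blast
  qed
qed

text \<open>For a piece supported in \<Omega> both sides vanish; for a boundary piece the chart
  formula is transferred to the global surface measure.\<close>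

lemma localized_divergence:
  assumes "localized F"
  shows "(LINT x|lebesgue_on \<Omega>. grad F x \<bullet> a) = (LINT x|\<sigma>. F x * (a \<bullet> \<nu> x))"
  using assms unfolding localized_def
proof (elim disjE exE conjE)
  assume F: "test_function \<Omega> F"
  have FS: "smooth F" by (rule test_function_smooth[OF F])
  have "(LINT x|lebesgue_on \<Omega>. grad F x \<bullet> a) = (\<Sum>i\<in>UNIV. a $ i * (LINT x|lebesgue_on \<Omega>. partial i F x))"
    unfolding grad_inner using smooth_integrable_domain[OF smooth_partial[OF FS]] by simp
  also have "\<dots> = 0" using test_function_integral_partial[OF open_\<Omega> F] by simp
  also have "0 = (LINT x|\<sigma>. F x * (a \<bullet> \<nu> x))"
  proof -
    have "AE x in \<sigma>. F x * (a \<bullet> \<nu> x) = 0"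
      using AE_frontier by eventually_elim (simp add: test_function_outside[OF F] frontier_disjoint)
    then show ?thesis by (simp add: integral_eq_zero_AE)
  qed
  finally show ?thesis .
next
  fix Q p r h \<gamma> assume c: "C11_graph \<Omega> Q p r h \<gamma>" and F: "test_function (cylinder Q p r h) F"
  have m: "(\<lambda>x. F x * (a \<bullet> \<nu> x)) \<in> borel_measurable borel"
    by (intro borel_measurable_times smooth_borel test_function_smooth[OF F] inner_\<nu>_borel)
  show ?thesis
    unfolding C11_graph.chart_divergence_\<tau>[OF c F]
    by (rule integral_\<sigma>_chart[OF c m, symmetric]) (simp add: test_function_outside[OF F])
qed

lemma divergence_theorem:
  assumes F: "smooth F"
  shows "(LINT x|lebesgue_on \<Omega>. grad F x \<bullet> a) = (LINT x|\<sigma>. F x * (a \<bullet> \<nu> x))"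
proof -
  obtain X :: "(real^3) set" and V \<psi> where "localized_partition X V \<psi>" using boundary_partition by blast
  note X = localized_partitionD[OF this]
  have s: "smooth (\<lambda>x. \<psi> z x * F x)" if "z \<in> X" for z
    by (intro smooth_mult localized_smooth X that F)
  have "grad F x \<bullet> a = (\<Sum>z\<in>X. grad (\<lambda>x. \<psi> z x * F x) x \<bullet> a)" if x: "x \<in> \<Omega>" for x
  proof -
    \<comment> \<open>F and the sum of its pieces agree on the open set V, hence so do their
      derivatives at x.\<close>
    have "partial i F x = partial i (\<lambda>x. \<Sum>z\<in>X. \<psi> z x * F x) x" for i
    proof (rule partial_cong_open[OF X(4)])
      show "x \<in> V" using x X(5) closure_subset[of \<Omega>] by blast
      show "F y = (\<Sum>z\<in>X. \<psi> z y * F y)" if "y \<in> V" for y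
        using X(6)[OF that] by (simp flip: sum_distrib_right)
    qed
    then have "partial i F x = (\<Sum>z\<in>X. partial i (\<lambda>x. \<psi> z x * F x) x)" for i
      using partial_sum[OF s] by simp
    then have "grad F x \<bullet> a = (\<Sum>i\<in>UNIV. \<Sum>z\<in>X. a $ i * partial i (\<lambda>x. \<psi> z x * F x) x)"
      by (simp add: grad_inner sum_distrib_left)
    also have "\<dots> = (\<Sum>z\<in>X. grad (\<lambda>x. \<psi> z x * F x) x \<bullet> a)"
      unfolding grad_inner by (rule sum.swap)
    finally show ?thesis .
  qed
  then have "(LINT x|lebesgue_on \<Omega>. grad F x \<bullet> a)
      = (LINT x|lebesgue_on \<Omega>. (\<Sum>z\<in>X. grad (\<lambda>x. \<psi> z x * F x) x \<bullet> a))"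
    by (intro Bochner_Integration.integral_cong) auto
  also have "\<dots> = (\<Sum>z\<in>X. (LINT x|lebesgue_on \<Omega>. grad (\<lambda>x. \<psi> z x * F x) x \<bullet> a))"
    by (intro Bochner_Integration.integral_sum smooth_integrable_domain smooth_grad_inner s)
  also have "\<dots> = (\<Sum>z\<in>X. (LINT x|\<sigma>. \<psi> z x * F x * (a \<bullet> \<nu> x)))"
    by (intro sum.cong refl localized_divergence localized_mult X F)
  also have "\<dots> = (LINT x|\<sigma>. (\<Sum>z\<in>X. \<psi> z x * F x * (a \<bullet> \<nu> x)))"
    by (intro Bochner_Integration.integral_sum[symmetric] L2_integrable[OF finite_\<sigma>] smooth_\<nu>_L2_\<sigma> s)
  also have "\<dots> = (LINT x|\<sigma>. F x * (a \<bullet> \<nu> x))"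
  proof (rule integral_cong_AE)
    show "AE x in \<sigma>. (\<Sum>z\<in>X. \<psi> z x * F x * (a \<bullet> \<nu> x)) = F x * (a \<bullet> \<nu> x)"
      using AE_frontier
    proof eventually_elim
      case (elim x)
      then have "x \<in> V" using X(5) by (auto simp: frontier_def)
      then show ?case using X(6) by (simp flip: sum_distrib_right)
    qed
  qed (use smooth_\<nu>_L2_\<sigma>[OF s] smooth_\<nu>_L2_\<sigma>[OF F] in \<open>auto intro!: borel_measurable_sum simp: L2_real_iff\<close>)
  finally show ?thesis .
qed

section \<open>The trace inequality\<close>

definition energy :: "(real^3 \<Rightarrow> real) \<Rightarrow> real^3 \<Rightarrow> real" where
  "energy f x = (f x)\<^sup>2 + (\<Sum>i\<in>UNIV. (partial i f x)\<^sup>2)"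

lemma smooth_energy: "smooth f \<Longrightarrow> smooth (energy f)"
  unfolding energy_def[abs_def] by (intro smooth_add smooth_sum smooth_power smooth_partial)

lemma energy_eq: "energy f x = (f x)\<^sup>2 + (norm (grad f x))\<^sup>2"
  unfolding energy_def power2_norm_eq_inner by (simp add: inner_vec_def grad_def power2_eq_square)

text \<open>On the support of \<open>F\<close> the axis of the chart makes a uniformly positive angle with the
  boundary, so that the divergence theorem along this axis controls the boundary integral.\<close>

lemma localized_trace_inequality:
  assumes F: "localized F" "\<And>x. 0 \<le> F x"
  shows "\<exists>C\<ge>0. \<forall>f. smooth f \<longrightarrow> (LINT x|\<sigma>. F x * (f x)\<^sup>2) \<le> C * (LINT x|lebesgue_on \<Omega>. energy f x)"
  using F(1) unfolding localized_def
proof (elim disjE exE conjE)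
  assume FO: "test_function \<Omega> F"
  have "(LINT x|\<sigma>. F x * (f x)\<^sup>2) = 0" for f
  proof -
    have "AE x in \<sigma>. F x * (f x)\<^sup>2 = 0"
      using AE_frontier by eventually_elim (simp add: test_function_outside[OF FO] frontier_disjoint)
    then show ?thesis by (rule integral_eq_zero_AE)
  qed
  then show ?thesis by (intro exI[of _ 0]) simp
next
  fix Q p r h \<gamma> assume c: "C11_graph \<Omega> Q p r h \<gamma>" and Fc: "test_function (cylinder Q p r h) F"
  interpret c: C11_graph \<Omega> Q p r h \<gamma> by (rule c)
  define a where "a = Q *v axis 3 1"
  have na: "norm a = 1" unfolding a_def norm_frame[OF c.orth] by simp
  \<comment> \<open>The reciprocal of the lower bound in \<open>axis_normal\<close>, so that
    \<open>k * (a \<bullet> \<nu> x)\<close> is at least 1 on the boundary inside the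
    cylinder.\<close>
  define k where "k = sqrt (1 + c.M\<^sup>2)"
  have k: "0 < k" by (simp add: k_def add_pos_nonneg)
  have FS: "smooth F" by (rule localized_smooth[OF F(1)])
  obtain B where B: "0 \<le> B" "\<And>x. \<bar>F x\<bar> \<le> B" by (rule test_function_bounded[OF Fc]) (rule that)
  obtain G where G: "0 \<le> G" "\<And>x. x \<in> \<Omega> \<Longrightarrow> \<bar>grad F x \<bullet> a\<bar> \<le> G"
    by (rule smooth_bounded_on[OF bounded_\<Omega> smooth_grad_inner[OF FS]]) (rule that)
  \<comment> \<open>The derivative of F f^2 along a has two parts: G controls the one that
    differentiates F, and B together with 2 p q \<le> p^2 + q^2 the one that differentiates
    f.\<close>
  have "(LINT x|\<sigma>. F x * (f x)\<^sup>2) \<le> k * (G + B) * (LINT x|lebesgue_on \<Omega>. energy f x)" if f: "smooth f" for f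
  proof -
    have FfS: "smooth (\<lambda>x. F x * (f x)\<^sup>2)" by (intro smooth_mult smooth_power FS f)
    have "(LINT x|\<sigma>. F x * (f x)\<^sup>2) \<le> (LINT x|\<sigma>. k * (F x * (f x)\<^sup>2 * (a \<bullet> \<nu> x)))"
    proof (rule integral_mono_AE)
      show "integrable \<sigma> (\<lambda>x. F x * (f x)\<^sup>2)" by (rule L2_integrable[OF finite_\<sigma> smooth_L2_\<sigma>[OF FfS]])
      show "integrable \<sigma> (\<lambda>x. k * (F x * (f x)\<^sup>2 * (a \<bullet> \<nu> x)))"
        by (intro integrable_mult_right L2_integrable[OF finite_\<sigma> smooth_\<nu>_L2_\<sigma>[OF FfS]])
      show "AE x in \<sigma>. F x * (f x)\<^sup>2 \<le> k * (F x * (f x)\<^sup>2 * (a \<bullet> \<nu> x))"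
        using AE_frontier
      proof eventually_elim
        case (elim x)
        show ?case
        proof (cases "x \<in> c.cyl")
          case True
          have "1 \<le> k * (a \<bullet> \<nu> x)"
            using c.axis_normal[OF elim True] k by (simp add: a_def k_def field_simps)
          then have "F x * (f x)\<^sup>2 * 1 \<le> F x * (f x)\<^sup>2 * (k * (a \<bullet> \<nu> x))" using F(2) by (intro mult_left_mono) auto
          then show ?thesis by (simp add: mult_ac)
        qed (simp add: test_function_outside[OF Fc])
      qed
    qed
    also have "\<dots> = k * (LINT x|lebesgue_on \<Omega>. grad (\<lambda>x. F x * (f x)\<^sup>2) x \<bullet> a)"
      by (simp add: divergence_theorem[OF FfS])
    also have "\<dots> \<le> k * (LINT x|lebesgue_on \<Omega>. (G + B) * energy f x)"
    proof (rule mult_left_mono[OF integral_mono])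
      show "integrable (lebesgue_on \<Omega>) (\<lambda>x. grad (\<lambda>x. F x * (f x)\<^sup>2) x \<bullet> a)"
        by (intro smooth_integrable_domain smooth_grad_inner FfS)
      show "integrable (lebesgue_on \<Omega>) (\<lambda>x. (G + B) * energy f x)"
        by (intro smooth_integrable_domain smooth_cmult smooth_energy f)
      fix x assume "x \<in> space (lebesgue_on \<Omega>)"
      then have x: "x \<in> \<Omega>" by simp
      have p: "partial i (\<lambda>x. F x * (f x)\<^sup>2) x = (f x)\<^sup>2 * partial i F x + F x * (2 * f x * partial i f x)" for i
        using FS f by (subst partial_mult)
          (auto simp: power2_eq_square smooth_differentiable smooth_mult partial_mult algebra_simps)
      have "grad (\<lambda>x. F x * (f x)\<^sup>2) x \<bullet> a = (f x)\<^sup>2 * (grad F x \<bullet> a) + F x * (2 * f x * (grad f x \<bullet> a))"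
        unfolding grad_inner p by (simp add: algebra_simps sum.distrib sum_distrib_left)
      also have "\<dots> \<le> (f x)\<^sup>2 * G + B * energy f x"
      proof (rule add_mono)
        show "(f x)\<^sup>2 * (grad F x \<bullet> a) \<le> (f x)\<^sup>2 * G" using G(2)[OF x] by (intro mult_left_mono) auto
        have "\<bar>grad f x \<bullet> a\<bar> \<le> norm (grad f x)" using Cauchy_Schwarz_ineq2[of "grad f x" a] na by simp
        then have "(grad f x \<bullet> a)\<^sup>2 \<le> (norm (grad f x))\<^sup>2" by (intro abs_le_square_iff[THEN iffD1]) simp
        moreover have "2 * f x * (grad f x \<bullet> a) \<le> (f x)\<^sup>2 + (grad f x \<bullet> a)\<^sup>2" by (rule sum_squares_bound)
        ultimately have "2 * f x * (grad f x \<bullet> a) \<le> energy f x" by (simp add: energy_eq)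
        then have "F x * (2 * f x * (grad f x \<bullet> a)) \<le> F x * energy f x" using F(2) by (rule mult_left_mono)
        also have "\<dots> \<le> B * energy f x"
          using B(2)[of x] by (intro mult_right_mono) (auto simp: energy_eq)
        finally show "F x * (2 * f x * (grad f x \<bullet> a)) \<le> B * energy f x" .
      qed
      also have "\<dots> \<le> G * energy f x + B * energy f x"
        using G(1) mult_left_mono[of "(f x)\<^sup>2" "energy f x" G] by (simp add: energy_eq mult.commute)
      finally show "grad (\<lambda>x. F x * (f x)\<^sup>2) x \<bullet> a \<le> (G + B) * energy f x" by (simp add: distrib_right)
    qed (use k in simp)
    finally show ?thesis by (simp add: mult.assoc)
  qed
  then show ?thesis using k G(1) B(1) by (intro exI[of _ "k * (G + B)"]) auto
qed

lemma trace_inequality: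
  obtains C where "0 \<le> C"
    "\<And>f. smooth f \<Longrightarrow> (LINT x|\<sigma>. (f x)\<^sup>2) \<le> C * (LINT x|lebesgue_on \<Omega>. energy f x)"
proof -
  obtain X :: "(real^3) set" and V \<psi> where "localized_partition X V \<psi>" using boundary_partition by blast
  note X = localized_partitionD[OF this]
  have "\<forall>z\<in>X. \<exists>C\<ge>0. \<forall>f. smooth f \<longrightarrow> (LINT x|\<sigma>. \<psi> z x * (f x)\<^sup>2) \<le> C * (LINT x|lebesgue_on \<Omega>. energy f x)"
    using localized_trace_inequality X(2,3) by blast
  then obtain C where C: "\<And>z. z \<in> X \<Longrightarrow> 0 \<le> C z"
    "\<And>z f. z \<in> X \<Longrightarrow> smooth f \<Longrightarrow> (LINT x|\<sigma>. \<psi> z x * (f x)\<^sup>2) \<le> C z * (LINT x|lebesgue_on \<Omega>. energy f x)"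
    by metis
  have "(LINT x|\<sigma>. (f x)\<^sup>2) \<le> (\<Sum>z\<in>X. C z) * (LINT x|lebesgue_on \<Omega>. energy f x)" if f: "smooth f" for f
  proof -
    have s: "smooth (\<lambda>x. \<psi> z x * (f x)\<^sup>2)" if "z \<in> X" for z
      by (intro smooth_mult smooth_power f localized_smooth X that)
    have "(LINT x|\<sigma>. (f x)\<^sup>2) = (LINT x|\<sigma>. (\<Sum>z\<in>X. \<psi> z x * (f x)\<^sup>2))"
    proof (rule integral_cong_AE)
      show "AE x in \<sigma>. (f x)\<^sup>2 = (\<Sum>z\<in>X. \<psi> z x * (f x)\<^sup>2)"
        using AE_frontier
      proof eventually_elim
        case (elim x)
        then have "x \<in> V" using X(5) by (auto simp: frontier_def)
        then show ?case using X(6) by (simp flip: sum_distrib_right)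
      qed
    qed (use smooth_borel[OF s] smooth_borel[OF f] in \<open>auto intro!: borel_measurable_sum\<close>)
    also have "\<dots> = (\<Sum>z\<in>X. (LINT x|\<sigma>. \<psi> z x * (f x)\<^sup>2))"
      by (intro Bochner_Integration.integral_sum L2_integrable[OF finite_\<sigma>] smooth_L2_\<sigma> s)
    also have "\<dots> \<le> (\<Sum>z\<in>X. C z * (LINT x|lebesgue_on \<Omega>. energy f x))"
      by (intro sum_mono C f)
    finally show ?thesis by (simp add: sum_distrib_right)
  qed
  then show ?thesis using that[of "\<Sum>z\<in>X. C z"] C(1) by (simp add: sum_nonneg)
qed

end

section \<open>Weak derivatives and density of smooth functions\<close>

locale bounded_open =
  fixes \<Omega> :: "(real^'n::finite) set"
  assumes open_set: "open \<Omega>" and bounded_set: "bounded \<Omega>"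
begin

abbreviation "\<mu> \<equiv> lebesgue_on \<Omega>"

lemma borel_set: "\<Omega> \<in> sets borel" using open_set by simp

lemma L2_smooth: "smooth f \<Longrightarrow> f \<in> L2 \<mu>"
  by (rule smooth_L2[OF bounded_set borel_set])

lemma L2_smooth_mult: "u \<in> L2 \<mu> \<Longrightarrow> smooth f \<Longrightarrow> (\<lambda>x. f x * u x) \<in> L2 \<mu>"
  by (rule L2_mult_smooth[OF bounded_set borel_set])

lemma L2_integrable_mult: "u \<in> L2 \<mu> \<Longrightarrow> smooth f \<Longrightarrow> integrable \<mu> (\<lambda>x. u x * f x)"
  by (rule L2_mult_integrable[OF _ L2_smooth])

lemma weak_partial_unique:
  assumes "v \<in> L2 \<mu>" "v' \<in> L2 \<mu>" "has_weak_partial \<Omega> i u v" "has_weak_partial \<Omega> i u v'"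
  shows "AE x in \<mu>. v x = v' x"
proof -
  have "AE x in \<mu>. v x - v' x = 0"
  proof (rule fundamental_lemma[OF bounded_set open_set L2_diff[OF assms(1,2)]])
    fix \<phi> assume \<phi>: "test_function \<Omega> \<phi>"
    have "(LINT x|\<mu>. (v x - v' x) * \<phi> x) = (LINT x|\<mu>. v x * \<phi> x) - (LINT x|\<mu>. v' x * \<phi> x)"
      using L2_integrable_mult[OF assms(1) test_function_smooth[OF \<phi>]]
        L2_integrable_mult[OF assms(2) test_function_smooth[OF \<phi>]]
      by (simp add: left_diff_distrib)
    then show "(LINT x|\<mu>. (v x - v' x) * \<phi> x) = 0"
      using assms(3,4) \<phi> unfolding has_weak_partial_def by simp
  qed
  then show ?thesis by eventually_elim simp
qed

text \<open>Turns the choice in \<open>weak_partial\<close> into a value: any weak derivative at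
  hand may replace it almost everywhere.\<close>

lemma weak_partial_AE:
  assumes "v \<in> L2 \<mu>" "has_weak_partial \<Omega> i u v"
  shows "AE x in \<mu>. weak_partial \<Omega> i u x = v x" "weak_partial \<Omega> i u \<in> L2 \<mu>"
proof -
  have "weak_partial \<Omega> i u \<in> L2 \<mu> \<and> has_weak_partial \<Omega> i u (weak_partial \<Omega> i u)"
    using someI_ex[of "\<lambda>v. v \<in> L2 \<mu> \<and> has_weak_partial \<Omega> i u v"] assms
    unfolding weak_partial_def by blast
  then show "AE x in \<mu>. weak_partial \<Omega> i u x = v x" "weak_partial \<Omega> i u \<in> L2 \<mu>"
    using weak_partial_unique assms by blast+
qed

lemma has_weak_partial_cong:
  assumes "has_weak_partial \<Omega> i u v" "u \<in> borel_measurable \<mu>" "u' \<in> borel_measurable \<mu>"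
    "AE x in \<mu>. u x = u' x"
  shows "has_weak_partial \<Omega> i u' v"
  unfolding has_weak_partial_def
proof (intro allI impI)
  fix \<phi> assume \<phi>: "test_function \<Omega> \<phi>"
  have m: "partial i \<phi> \<in> borel_measurable \<mu>"
    by (intro borel_measurable_lebesgue_on smooth_borel smooth_partial test_function_smooth[OF \<phi>])
  have "(LINT x|\<mu>. u' x * partial i \<phi> x) = (LINT x|\<mu>. u x * partial i \<phi> x)"
  proof (rule integral_cong_AE)
    show "AE x in \<mu>. u' x * partial i \<phi> x = u x * partial i \<phi> x"
      using assms(4) by eventually_elim simp
  qed (intro borel_measurable_times assms m)+
  then show "(LINT x|\<mu>. u' x * partial i \<phi> x) = - (LINT x|\<mu>. v x * \<phi> x)"
    using assms(1) \<phi> by (simp add: has_weak_partial_def)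
qed

lemma has_weak_partial_add:
  assumes "u \<in> L2 \<mu>" "v \<in> L2 \<mu>" "u' \<in> L2 \<mu>" "v' \<in> L2 \<mu>"
    "has_weak_partial \<Omega> i u v" "has_weak_partial \<Omega> i u' v'"
  shows "has_weak_partial \<Omega> i (\<lambda>x. u x + u' x) (\<lambda>x. v x + v' x)"
  unfolding has_weak_partial_def
proof (intro allI impI)
  fix \<phi> assume \<phi>: "test_function \<Omega> \<phi>"
  then have s: "smooth \<phi>" "smooth (partial i \<phi>)" by (auto intro: test_function_smooth smooth_partial)
  show "(LINT x|\<mu>. (u x + u' x) * partial i \<phi> x) = - (LINT x|\<mu>. (v x + v' x) * \<phi> x)"
    using assms(5,6) \<phi> L2_integrable_mult[OF assms(1) s(2)] L2_integrable_mult[OF assms(2) s(1)]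
      L2_integrable_mult[OF assms(3) s(2)] L2_integrable_mult[OF assms(4) s(1)]
    by (simp add: has_weak_partial_def distrib_right)
qed

lemma has_weak_partial_cmult:
  assumes "has_weak_partial \<Omega> i u v" shows "has_weak_partial \<Omega> i (\<lambda>x. c * u x) (\<lambda>x. c * v x)"
  using assms by (simp add: has_weak_partial_def mult.assoc)

lemma has_weak_partial_diff:
  assumes "u \<in> L2 \<mu>" "v \<in> L2 \<mu>" "u' \<in> L2 \<mu>" "v' \<in> L2 \<mu>"
    "has_weak_partial \<Omega> i u v" "has_weak_partial \<Omega> i u' v'"
  shows "has_weak_partial \<Omega> i (\<lambda>x. u x - u' x) (\<lambda>x. v x - v' x)"
  using has_weak_partial_add[OF assms(1,2) L2_cmult[OF assms(3), of "- 1"] L2_cmult[OF assms(4), of "- 1"] assms(5)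
      has_weak_partial_cmult[OF assms(6)]] by simp

lemma smooth_has_weak_partial:
  assumes f: "smooth f" shows "has_weak_partial \<Omega> i f (partial i f)"
  unfolding has_weak_partial_def
proof (intro allI impI)
  fix \<phi> assume \<phi>: "test_function \<Omega> \<phi>"
  then have s: "smooth \<phi>" "smooth (partial i \<phi>)" by (auto intro: test_function_smooth smooth_partial)
  have "(LINT x|\<mu>. f x * partial i \<phi> x + partial i f x * \<phi> x) = (LINT x|\<mu>. partial i (\<lambda>x. f x * \<phi> x) x)"
    using f s by (simp add: partial_mult smooth_differentiable)
  also have "\<dots> = 0"
    by (rule test_function_integral_partial[OF open_set test_function_mult(2)[OF \<phi> f]])
  finally show "(LINT x|\<mu>. f x * partial i \<phi> x) = - (LINT x|\<mu>. partial i f x * \<phi> x)"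
    using L2_integrable_mult[OF L2_smooth[OF f] s(2)] L2_integrable_mult[OF L2_smooth[OF smooth_partial[OF f]] s(1)]
    by simp
qed

text \<open>The hypothesis is tested with the product of \<open>\<psi>\<close> and the test
  function.\<close>

lemma has_weak_partial_smooth_mult:
  assumes u: "u \<in> L2 \<mu>" "v \<in> L2 \<mu>" "has_weak_partial \<Omega> i u v" and \<psi>: "smooth \<psi>"
  shows "has_weak_partial \<Omega> i (\<lambda>x. \<psi> x * u x) (\<lambda>x. \<psi> x * v x + partial i \<psi> x * u x)"
  unfolding has_weak_partial_def
proof (intro allI impI)
  fix \<phi> assume \<phi>: "test_function \<Omega> \<phi>"
  then have s: "smooth \<phi>" "smooth (partial i \<phi>)" by (auto intro: test_function_smooth smooth_partial)
  have p: "partial i (\<lambda>x. \<psi> x * \<phi> x) x = \<psi> x * partial i \<phi> x + partial i \<psi> x * \<phi> x" for x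
    using \<psi> s by (simp add: partial_mult smooth_differentiable)
  have i: "integrable \<mu> (\<lambda>x. u x * (\<psi> x * partial i \<phi> x))" "integrable \<mu> (\<lambda>x. u x * (partial i \<psi> x * \<phi> x))"
    "integrable \<mu> (\<lambda>x. v x * (\<psi> x * \<phi> x))"
    by (intro L2_integrable_mult u smooth_mult \<psi> s smooth_partial)+
  have "(LINT x|\<mu>. u x * partial i (\<lambda>x. \<psi> x * \<phi> x) x) = - (LINT x|\<mu>. v x * (\<psi> x * \<phi> x))"
    using u(3) test_function_mult(2)[OF \<phi> \<psi>] by (simp add: has_weak_partial_def)
  then have *: "(LINT x|\<mu>. u x * (\<psi> x * partial i \<phi> x)) + (LINT x|\<mu>. u x * (partial i \<psi> x * \<phi> x))
      = - (LINT x|\<mu>. v x * (\<psi> x * \<phi> x))"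
    using i(1,2) by (simp add: p distrib_left)
  have "(LINT x|\<mu>. (\<psi> x * v x + partial i \<psi> x * u x) * \<phi> x)
      = (LINT x|\<mu>. v x * (\<psi> x * \<phi> x) + u x * (partial i \<psi> x * \<phi> x))"
    by (rule Bochner_Integration.integral_cong) (auto simp: algebra_simps)
  also have "\<dots> = (LINT x|\<mu>. v x * (\<psi> x * \<phi> x)) + (LINT x|\<mu>. u x * (partial i \<psi> x * \<phi> x))"
    using i by simp
  finally show "(LINT x|\<mu>. \<psi> x * u x * partial i \<phi> x) = - (LINT x|\<mu>. (\<psi> x * v x + partial i \<psi> x * u x) * \<phi> x)"
    using * by (simp add: mult_ac)
qed

lemma L2_lborel_iff:
  fixes k :: "real^'n \<Rightarrow> real"
  assumes "k \<in> borel_measurable borel" "\<And>x. x \<notin> \<Omega> \<Longrightarrow> k x = 0"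
  shows "k \<in> L2 \<mu> \<longleftrightarrow> k \<in> L2 lborel"
proof -
  have "integrable \<mu> (\<lambda>x. (k x)\<^sup>2) \<longleftrightarrow> integrable lborel (\<lambda>x. (k x)\<^sup>2)"
    by (rule integrable_lebesgue_on_lborel[OF borel_set]) (simp_all add: assms borel_measurable_power)
  then show ?thesis by (simp add: L2_real_iff borel_measurable_lebesgue_on assms(1))
qed

lemma H1_norm_eq:
  assumes "\<And>i. d i \<in> L2 \<mu>" "\<And>i. has_weak_partial \<Omega> i u (d i)"
  shows "H1_norm \<Omega> u = sqrt ((LINT x|\<mu>. (u x)\<^sup>2) + (\<Sum>i\<in>UNIV. (LINT x|\<mu>. (d i x)\<^sup>2)))"
proof -
  have "(LINT x|\<mu>. (weak_partial \<Omega> i u x)\<^sup>2) = (LINT x|\<mu>. (d i x)\<^sup>2)" for i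
  proof (rule integral_cong_AE)
    show "AE x in \<mu>. (weak_partial \<Omega> i u x)\<^sup>2 = (d i x)\<^sup>2"
      using weak_partial_AE(1)[OF assms(1,2)[of i]] by eventually_elim simp
  qed (use weak_partial_AE(2)[OF assms(1,2)[of i]] assms(1) in \<open>auto simp: L2_real_iff\<close>)
  then show ?thesis by (simp add: H1_norm_def)
qed

text \<open>Approximation in H1 stated with given weak derivatives \<open>d\<close>, which bypasses
  the choice inside \<open>H1_norm\<close>.\<close>

definition H1_approx :: "(real^'n \<Rightarrow> real) \<Rightarrow> ('n \<Rightarrow> real^'n \<Rightarrow> real) \<Rightarrow> bool" where
  "H1_approx u d \<longleftrightarrow> (\<forall>e>0. \<exists>f. smooth f \<and> (LINT x|\<mu>. (f x - u x)\<^sup>2) < e \<and>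
     (\<forall>i. (LINT x|\<mu>. (partial i f x - d i x)\<^sup>2) < e))"

lemma H1_approx_sum:
  fixes X :: "'z set"
  assumes X: "finite X" and a: "\<And>z. z \<in> X \<Longrightarrow> H1_approx (u z) (d z)"
    and L2: "\<And>z. z \<in> X \<Longrightarrow> u z \<in> L2 \<mu>" "\<And>z i. z \<in> X \<Longrightarrow> d z i \<in> L2 \<mu>"
  shows "H1_approx (\<lambda>x. \<Sum>z\<in>X. u z x) (\<lambda>i x. \<Sum>z\<in>X. d z i x)"
  unfolding H1_approx_def
proof (intro allI impI)
  fix e :: real assume e: "0 < e"
  \<comment> \<open>The square of a sum of \<open>card X\<close> terms costs one factor
    \<open>card X\<close> and the sum of errors another; the added 1 covers an empty X.\<close>
  define e' where "e' = e / (real (card X) * real (card X) + 1)"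
  have pos: "0 < real (card X) * real (card X) + 1" by (simp add: add_nonneg_pos)
  have e': "0 < e'" "real (card X) * (real (card X) * e') < e"
    using e pos by (auto simp: e'_def field_simps)
  have "\<forall>z\<in>X. \<exists>f. smooth f \<and> (LINT x|\<mu>. (f x - u z x)\<^sup>2) < e' \<and>
     (\<forall>i. (LINT x|\<mu>. (partial i f x - d z i x)\<^sup>2) < e')"
    using a e'(1) unfolding H1_approx_def by blast
  from bchoice[OF this] obtain f where f': "\<forall>z\<in>X. smooth (f z) \<and> (LINT x|\<mu>. (f z x - u z x)\<^sup>2) < e' \<and>
     (\<forall>i. (LINT x|\<mu>. (partial i (f z) x - d z i x)\<^sup>2) < e')" by blast
  then have f: "\<And>z. z \<in> X \<Longrightarrow> smooth (f z)" "\<And>z. z \<in> X \<Longrightarrow> (LINT x|\<mu>. (f z x - u z x)\<^sup>2) < e'"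
    "\<And>z i. z \<in> X \<Longrightarrow> (LINT x|\<mu>. (partial i (f z) x - d z i x)\<^sup>2) < e'"
    by blast+
  have sum_bound: "(LINT x|\<mu>. ((\<Sum>z\<in>X. g z x) - (\<Sum>z\<in>X. v z x))\<^sup>2) < e"
    if g: "\<And>z. z \<in> X \<Longrightarrow> g z \<in> L2 \<mu>" "\<And>z. z \<in> X \<Longrightarrow> v z \<in> L2 \<mu>"
      "\<And>z. z \<in> X \<Longrightarrow> (LINT x|\<mu>. (g z x - v z x)\<^sup>2) < e'" for g v :: "'z \<Rightarrow> real^'n \<Rightarrow> real"
  proof -
    have "(LINT x|\<mu>. (\<Sum>z\<in>X. g z x - v z x)\<^sup>2) \<le> real (card X) * (\<Sum>z\<in>X. (LINT x|\<mu>. (g z x - v z x)\<^sup>2))"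
      by (rule L2_norm_sum_le[OF X]) (intro L2_diff g)
    also have "\<dots> \<le> real (card X) * (\<Sum>z\<in>X. e')"
      using g(3) by (intro mult_left_mono sum_mono) (auto intro: less_imp_le)
    also have "\<dots> < e" using e'(2) by simp
    finally show ?thesis by (simp add: sum_subtractf)
  qed
  have ps: "partial i (\<lambda>x. \<Sum>z\<in>X. f z x) x = (\<Sum>z\<in>X. partial i (f z) x)" for i x
    by (rule partial_sum) (rule f(1))
  show "\<exists>f. smooth f \<and> (LINT x|\<mu>. (f x - (\<Sum>z\<in>X. u z x))\<^sup>2) < e \<and>
     (\<forall>i. (LINT x|\<mu>. (partial i f x - (\<Sum>z\<in>X. d z i x))\<^sup>2) < e)"
  proof (intro exI conjI allI)
    show "smooth (\<lambda>x. \<Sum>z\<in>X. f z x)" by (intro smooth_sum f)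
    show "(LINT x|\<mu>. ((\<Sum>z\<in>X. f z x) - (\<Sum>z\<in>X. u z x))\<^sup>2) < e"
      by (rule sum_bound) (use f L2 L2_smooth in auto)
    show "(LINT x|\<mu>. (partial i (\<lambda>x. \<Sum>z\<in>X. f z x) x - (\<Sum>z\<in>X. d z i x))\<^sup>2) < e" for i
      unfolding ps
      by (rule sum_bound[of "\<lambda>z. partial i (f z)" "\<lambda>z. d z i"])
        (rule L2_smooth smooth_partial f L2 | assumption)+
  qed
qed

lemma integral_subset_le:
  fixes k :: "real^'n \<Rightarrow> real"
  assumes "integrable lborel k" "\<And>x. 0 \<le> k x"
  shows "(LINT x|\<mu>. k x) \<le> (LINT x|lborel. k x)"
proof -
  have kb: "k \<in> borel_measurable borel" using assms(1) by auto
  have "(LINT x|\<mu>. k x) = (LINT x|\<mu>. indicator \<Omega> x * k x)"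
    by (rule Bochner_Integration.integral_cong) auto
  also have "\<dots> = (LINT x|lborel. indicator \<Omega> x * k x)"
    by (rule integral_lebesgue_on_lborel[OF borel_set]) (use kb borel_set in auto)
  also have "\<dots> \<le> (LINT x|lborel. k x)"
  proof (rule integral_mono)
    show "integrable lborel (\<lambda>x. indicator \<Omega> x * k x)"
      by (rule test_function_integrable[OF _ assms(1), of _ 1]) (use borel_set in \<open>auto simp: indicator_def\<close>)
  qed (use assms in \<open>auto simp: indicator_def\<close>)
  finally show ?thesis .
qed

text \<open>For \<open>x\<close> near \<open>K\<close> the cone condition turns \<open>z \<mapsto> \<rho>\<^sub>\<epsilon>(x - z)\<close> into a test function on \<open>\<Omega>\<close>,
  so that differentiation commutes with the mollification of the extension by zero.\<close>

lemma H1_approx_mollify: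
  assumes u: "u \<in> L2 \<mu>" and d: "\<And>i. d i \<in> L2 \<mu>" and wd: "\<And>i. has_weak_partial \<Omega> i u (d i)"
    and \<psi>: "smooth \<psi>" "\<And>x. x \<notin> K \<Longrightarrow> \<psi> x = 0" "\<And>x i. x \<notin> K \<Longrightarrow> partial i \<psi> x = 0"
    and \<rho>: "test_function UNIV \<rho>" "\<And>x. 0 \<le> \<rho> x" "(LINT x|lborel. \<rho> x) = 1" "\<And>x. \<rho> x \<noteq> 0 \<Longrightarrow> norm x \<le> 2"
    and cone: "0 < e0" "\<And>\<epsilon> x w z. 0 < \<epsilon> \<Longrightarrow> \<epsilon> < e0 \<Longrightarrow> x \<in> \<Omega> \<Longrightarrow> w \<in> closure {x. \<rho> x \<noteq> 0} \<Longrightarrow>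
        z \<in> K \<Longrightarrow> norm (x - z) \<le> 2 * \<epsilon> \<Longrightarrow> x - \<epsilon> *\<^sub>R w \<in> \<Omega>"
  shows "H1_approx (\<lambda>x. \<psi> x * u x) (\<lambda>i x. \<psi> x * d i x + partial i \<psi> x * u x)"
  unfolding H1_approx_def
proof (intro allI impI)
  fix e :: real assume e: "0 < e"
  obtain uh where uh: "uh \<in> L2 lborel" "uh \<in> borel_measurable borel" "\<And>x. x \<notin> \<Omega> \<Longrightarrow> uh x = 0"
    "AE x in \<mu>. u x = uh x" by (rule L2_representative[OF borel_set u]) (rule that)
  have "\<exists>v. v \<in> L2 lborel \<and> v \<in> borel_measurable borel \<and> (\<forall>x. x \<notin> \<Omega> \<longrightarrow> v x = 0) \<and> (AE x in \<mu>. d i x = v x)" for i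
    by (rule L2_representative[OF borel_set d[of i]]) blast
  then obtain dh where dh: "\<And>i. dh i \<in> L2 lborel" "\<And>i. dh i \<in> borel_measurable borel"
    "\<And>i x. x \<notin> \<Omega> \<Longrightarrow> dh i x = 0" "\<And>i. AE x in \<mu>. d i x = dh i x" by metis
  \<comment> \<open>The extension by zero may jump across the boundary, so \<open>gd i\<close> acts
    as its derivative only against test functions supported in \<Omega>.\<close>
  define g where "g x = \<psi> x * uh x" for x
  define gd where "gd i x = \<psi> x * dh i x + partial i \<psi> x * uh x" for i x
  have ext: "(\<lambda>x. f x * v x) \<in> L2 lborel"
    if "smooth f" "v \<in> L2 lborel" "v \<in> borel_measurable borel" "\<And>x. x \<notin> \<Omega> \<Longrightarrow> v x = 0" for f v
  proof -
    have "v \<in> L2 \<mu>" using L2_lborel_iff[OF that(3,4)] that(2) by blast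
    then have "(\<lambda>x. f x * v x) \<in> L2 \<mu>" by (rule L2_smooth_mult[OF _ that(1)])
    moreover have "(\<lambda>x. f x * v x) \<in> borel_measurable borel"
      by (intro borel_measurable_times smooth_borel that)
    ultimately show ?thesis using L2_lborel_iff[of "\<lambda>x. f x * v x"] that(4) by simp
  qed
  have gL: "g \<in> L2 lborel" unfolding g_def[abs_def] by (intro ext \<psi> uh)
  have gdL: "gd i \<in> L2 lborel" for i
    unfolding gd_def[abs_def] by (intro L2_add ext \<psi> uh dh smooth_partial)
  have out: "g x = 0" "gd i x = 0" if "x \<notin> \<Omega> \<or> x \<notin> K" for i x
    using that uh(3) dh(3) \<psi>(2,3) by (auto simp: g_def gd_def)
  have L1: "integrable lborel k"
    if k: "k \<in> L2 lborel" "\<And>x. x \<notin> \<Omega> \<Longrightarrow> k x = 0" for k :: "real^'n \<Rightarrow> real"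
  proof -
    have kb: "k \<in> borel_measurable borel" using k(1) by (simp add: L2_real_iff)
    have "k \<in> L2 \<mu>" using L2_lborel_iff[OF kb k(2)] k(1) by blast
    then have "integrable \<mu> k" by (rule L2_integrable[OF finite_lebesgue_on[OF bounded_set borel_set]])
    then show ?thesis using integrable_lebesgue_on_lborel[OF borel_set kb] k(2) by blast
  qed
  have gI: "integrable lborel g" and gdI: "integrable lborel (gd i)" for i
    using L1[OF gL] L1[OF gdL] out by blast+
  have gm: "g \<in> borel_measurable borel" "gd i \<in> borel_measurable borel" for i
    using gI gdI[of i] by auto
  have AEg: "AE x in \<mu>. \<psi> x * u x = g x" using uh(4) by eventually_elim (simp add: g_def)
  have AEgd: "AE x in \<mu>. \<psi> x * d i x + partial i \<psi> x * u x = gd i x" for i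
    using uh(4) dh(4)[of i] by eventually_elim (simp add: gd_def)
  have m1: "(\<lambda>x. \<psi> x * u x) \<in> borel_measurable \<mu>" by (rule L2_measurable[OF L2_smooth_mult[OF u \<psi>(1)]])
  have m2: "(\<lambda>x. \<psi> x * d i x + partial i \<psi> x * u x) \<in> borel_measurable \<mu>" for i
    by (intro L2_measurable L2_add L2_smooth_mult u d \<psi> smooth_partial)
  have weak: "(LINT z|lborel. g z * partial i \<phi> z) = - (LINT z|lborel. gd i z * \<phi> z)"
    if \<phi>: "test_function \<Omega> \<phi>" for i \<phi>
  proof -
    have s: "smooth \<phi>" "smooth (partial i \<phi>)" using \<phi> by (auto intro: test_function_smooth smooth_partial)
    have "(LINT z|lborel. g z * partial i \<phi> z) = (LINT z|\<mu>. g z * partial i \<phi> z)"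
      by (rule integral_lebesgue_on_lborel[OF borel_set, symmetric]) (use gm smooth_borel[OF s(2)] out in auto)
    also have "\<dots> = (LINT z|\<mu>. (\<psi> z * u z) * partial i \<phi> z)"
    proof (rule integral_cong_AE)
      show "AE z in \<mu>. g z * partial i \<phi> z = (\<psi> z * u z) * partial i \<phi> z"
        using AEg by eventually_elim simp
    qed (intro borel_measurable_times[OF _ borel_measurable_lebesgue_on[OF smooth_borel[OF s(2)]]] m1
          borel_measurable_lebesgue_on gm)+
    also have "\<dots> = - (LINT z|\<mu>. (\<psi> z * d i z + partial i \<psi> z * u z) * \<phi> z)"
      using has_weak_partial_smooth_mult[OF u d wd \<psi>(1)] \<phi> by (simp add: has_weak_partial_def)
    also have "(LINT z|\<mu>. (\<psi> z * d i z + partial i \<psi> z * u z) * \<phi> z) = (LINT z|\<mu>. gd i z * \<phi> z)"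
    proof (rule integral_cong_AE)
      show "AE z in \<mu>. (\<psi> z * d i z + partial i \<psi> z * u z) * \<phi> z = gd i z * \<phi> z"
        using AEgd[of i] by eventually_elim simp
    qed (intro borel_measurable_times[OF _ borel_measurable_lebesgue_on[OF smooth_borel[OF s(1)]]] m2
          borel_measurable_lebesgue_on gm)+
    also have "\<dots> = (LINT z|lborel. gd i z * \<phi> z)"
      by (rule integral_lebesgue_on_lborel[OF borel_set]) (use gm smooth_borel[OF s(1)] out in auto)
    finally show ?thesis .
  qed
  have part: "partial i (conv g (rescale \<epsilon> \<rho>)) x = conv (gd i) (rescale \<epsilon> \<rho>) x"
    if \<epsilon>: "0 < \<epsilon>" "\<epsilon> < e0" and x: "x \<in> \<Omega>" for \<epsilon> x i
  proof -
    let ?r = "rescale \<epsilon> \<rho>"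
    have r: "test_function UNIV ?r" by (rule test_function_rescale[OF \<rho>(1) \<epsilon>(1)])
    have rS: "smooth ?r" by (rule test_function_smooth[OF r])
    have supp: "norm y \<le> 2 * \<epsilon>" if "?r y \<noteq> 0" for y
    proof -
      have "\<rho> ((1 / \<epsilon>) *\<^sub>R y) \<noteq> 0" using that by (simp add: rescale_def)
      from \<rho>(4)[OF this] show ?thesis using \<epsilon>(1) by (simp add: field_simps)
    qed
    have psupp: "norm y \<le> 2 * \<epsilon>" if "partial i ?r y \<noteq> 0" for y
    proof -
      have "y \<in> closure {x. ?r x \<noteq> 0}" using partial_outside_support[of y ?r i] that by blast
      moreover have "closure {x. ?r x \<noteq> 0} \<subseteq> cball 0 (2 * \<epsilon>)"
        by (rule closure_minimal) (use supp in auto)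
      ultimately show ?thesis by auto
    qed
    have "(LINT z|lborel. g z * partial i ?r (x - z)) = (LINT z|lborel. gd i z * ?r (x - z))"
    \<comment> \<open>For x near K the reflected kernel is a test function on \<Omega>. Otherwise
      both integrands vanish, since g and gd vanish off K and the rescaled kernel has radius at most
      2 \<epsilon>.\<close>
    proof (cases "\<exists>z\<in>K. norm (x - z) \<le> 2 * \<epsilon>")
      case True
      then obtain z0 where z0: "z0 \<in> K" "norm (x - z0) \<le> 2 * \<epsilon>" by blast
      let ?\<phi> = "\<lambda>z. ?r ((- 1) *\<^sub>R z + x)"
      let ?S = "closure {x. \<rho> x \<noteq> 0}"
      have \<phi>: "test_function \<Omega> ?\<phi>"
      proof (rule test_functionI)
        show "smooth ?\<phi>" by (rule smooth_affine[OF rS])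
        have "compact ?S" using \<rho>(1) by (simp add: test_function_def)
        then show "compact ((\<lambda>w. x - \<epsilon> *\<^sub>R w) ` ?S)"
          by (intro compact_continuous_image continuous_intros)
        show "(\<lambda>w. x - \<epsilon> *\<^sub>R w) ` ?S \<subseteq> \<Omega>" using cone(2)[OF \<epsilon> x _ z0] by auto
        show "?\<phi> z = 0" if z: "z \<notin> (\<lambda>w. x - \<epsilon> *\<^sub>R w) ` ?S" for z
        proof (rule ccontr)
          assume "?\<phi> z \<noteq> 0"
          then have "(1 / \<epsilon>) *\<^sub>R (x - z) \<in> ?S"
            using closure_subset[of "{x. \<rho> x \<noteq> 0}"] by (auto simp: rescale_def)
          moreover have "z = x - \<epsilon> *\<^sub>R ((1 / \<epsilon>) *\<^sub>R (x - z))" using \<epsilon>(1) by simp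
          ultimately show False using z by blast
        qed
      qed
      have "partial i ?\<phi> z = - partial i ?r (x - z)" for z
        using partial_affine[OF smooth_differentiable[OF rS], where c = "- 1" and x = z and b = x and i = i] by simp
      then show ?thesis using weak[OF \<phi>, of i] by simp
    next
      case False
      have zero: "g z * partial i ?r (x - z) = 0" "gd i z * ?r (x - z) = 0" for z
        using False out[of z] supp[of "x - z"] psupp[of "x - z"] by fastforce+
      show ?thesis unfolding zero ..
    qed
    then show ?thesis using conv_partial[OF gI r] by (simp add: conv_def)
  qed
  define good where "good k \<epsilon> \<longleftrightarrow> integrable lborel (\<lambda>x. (conv k (rescale \<epsilon> \<rho>) x - k x)\<^sup>2) \<and>
      (LINT x|lborel. (conv k (rescale \<epsilon> \<rho>) x - k x)\<^sup>2) < e" for k \<epsilon>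
  have close: "\<exists>c>0. \<forall>\<epsilon>. 0 < \<epsilon> \<longrightarrow> \<epsilon> < c \<longrightarrow> good k \<epsilon>" if "k \<in> L2 lborel" "integrable lborel k" for k
    by (rule conv_L2_close[OF \<rho>(1,2,3) \<rho>(4) _ that e]) (auto simp: good_def)
  obtain c where c: "0 < c" "\<And>\<epsilon>. 0 < \<epsilon> \<Longrightarrow> \<epsilon> < c \<Longrightarrow> good g \<epsilon>" using close[OF gL gI] by blast
  obtain b where b: "\<And>i. 0 < b i" "\<And>i \<epsilon>. 0 < \<epsilon> \<Longrightarrow> \<epsilon> < b i \<Longrightarrow> good (gd i) \<epsilon>"
    using close[OF gdL gdI] by metis
  \<comment> \<open>One \<epsilon> must serve the function, each of its derivatives, and the cone
    condition.\<close>
  define m where "m = Min (insert c (insert e0 (range b)))"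
  have "0 < m" using c(1) cone(1) b(1) by (auto simp: m_def)
  moreover have "m \<le> c" "m \<le> e0" "m \<le> b i" for i
    unfolding m_def by (rule Min_le; simp)+
  ultimately have m: "0 < m" "m \<le> c" "m \<le> e0" "m \<le> b i" for i by auto
  define \<epsilon> where "\<epsilon> = m / 2"
  have \<epsilon>: "0 < \<epsilon>" "\<epsilon> < c" "\<epsilon> < e0" "\<epsilon> < b i" for i using m(1,2,3) m(4)[of i] by (auto simp: \<epsilon>_def)
  let ?f = "conv g (rescale \<epsilon> \<rho>)"
  have rt: "test_function UNIV (rescale \<epsilon> \<rho>)" by (rule test_function_rescale[OF \<rho>(1) \<epsilon>(1)])
  have fS: "smooth ?f" by (rule conv_smooth[OF gI rt])
  have hS: "smooth (conv (gd i) (rescale \<epsilon> \<rho>))" for i by (rule conv_smooth[OF gdI rt])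
  show "\<exists>f. smooth f \<and> (LINT x|\<mu>. (f x - \<psi> x * u x)\<^sup>2) < e \<and>
     (\<forall>i. (LINT x|\<mu>. (partial i f x - (\<psi> x * d i x + partial i \<psi> x * u x))\<^sup>2) < e)"
  proof (intro exI conjI allI)
    show "smooth ?f" by (rule fS)
    have "(LINT x|\<mu>. (?f x - \<psi> x * u x)\<^sup>2) = (LINT x|\<mu>. (?f x - g x)\<^sup>2)"
    proof (rule integral_cong_AE)
      show "AE x in \<mu>. (?f x - \<psi> x * u x)\<^sup>2 = (?f x - g x)\<^sup>2" using AEg by eventually_elim simp
    qed (intro borel_measurable_power borel_measurable_diff m1 borel_measurable_lebesgue_on gm smooth_borel[OF fS])+
    also have "\<dots> \<le> (LINT x|lborel. (?f x - g x)\<^sup>2)"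
      by (rule integral_subset_le) (use c(2)[OF \<epsilon>(1,2)] in \<open>auto simp: good_def\<close>)
    also have "\<dots> < e" using c(2)[OF \<epsilon>(1,2)] by (simp add: good_def)
    finally show "(LINT x|\<mu>. (?f x - \<psi> x * u x)\<^sup>2) < e" .
    fix i
    let ?h = "conv (gd i) (rescale \<epsilon> \<rho>)"
    have "(LINT x|\<mu>. (partial i ?f x - (\<psi> x * d i x + partial i \<psi> x * u x))\<^sup>2) = (LINT x|\<mu>. (?h x - gd i x)\<^sup>2)"
    proof (rule integral_cong_AE)
      show "AE x in \<mu>. (partial i ?f x - (\<psi> x * d i x + partial i \<psi> x * u x))\<^sup>2 = (?h x - gd i x)\<^sup>2"
        using AEgd[of i] AE_space[of \<mu>]
        by eventually_elim (simp add: part[OF \<epsilon>(1,3)])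
    qed (intro borel_measurable_power borel_measurable_diff m2 borel_measurable_lebesgue_on gm
          smooth_borel[OF hS] smooth_borel[OF smooth_partial[OF fS]])+
    also have "\<dots> \<le> (LINT x|lborel. (?h x - gd i x)\<^sup>2)"
      by (rule integral_subset_le) (use b(2)[OF \<epsilon>(1) \<epsilon>(4)[of i]] in \<open>auto simp: good_def\<close>)
    also have "\<dots> < e" using b(2)[OF \<epsilon>(1) \<epsilon>(4)[of i]] by (simp add: good_def)
    finally show "(LINT x|\<mu>. (partial i ?f x - (\<psi> x * d i x + partial i \<psi> x * u x))\<^sup>2) < e" .
  qed
qed

end

text \<open>A normalised plateau. The centre is arbitrary because kernels near the boundary must be
  supported away from the origin.\<close>

lemma mollifier_exists:
  fixes z :: "real^'n::finite"
  assumes \<eta>: "0 < \<eta>"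
  obtains \<rho> where "test_function UNIV \<rho>" "\<And>x. 0 \<le> \<rho> x" "(LINT x|lborel. \<rho> x) = 1"
    "\<And>x. \<rho> x \<noteq> 0 \<Longrightarrow> x \<in> cball z \<eta>"
proof -
  define d where "d = \<eta> / (2 * real CARD('n))"
  have d: "0 < d" "2 * d * real CARD('n) = \<eta>" using \<eta> by (auto simp: d_def)
  define I where "I = (LINT x|lborel. plateau d z x)"
  have t: "test_function UNIV (plateau d z)"
    by (rule test_functionI[OF smooth_plateau, of "cball z \<eta>"]) (use plateau_support[OF d(1), of z] d in auto)
  have "I \<noteq> 0"
  proof
    assume "I = 0"
    then have "AE x in lborel. plateau d z x = 0"
      unfolding I_def
      by (subst (asm) integral_nonneg_eq_0_iff_AE[OF test_function_integrable_lborel[OF t]]) (auto simp: plateau_bounds)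
    then have ae: "AE x in lborel. x \<notin> ball z d"
    proof eventually_elim
      case (elim x)
      show ?case
      proof
        assume "x \<in> ball z d"
        then have "\<bar>x $ i - z $ i\<bar> \<le> d" for i
          using component_le_norm_cart[of "x - z" i] by (simp add: dist_norm norm_minus_commute)
        then show False using plateau_eq_1[of x z d] d(1) elim by simp
      qed
    qed
    then have "AE x in lebesgue. x \<notin> ball z d" by (rule AE_completion)
    then have "negligible (ball z d)"
      by (simp add: negligible_iff_null_sets AE_iff_null_sets)
    then show False using open_not_negligible[of "ball z d"] d(1) by simp
  qed
  moreover have "0 \<le> I" unfolding I_def by (simp add: plateau_bounds)
  ultimately have I: "0 < I" by simp
  show ?thesis
  proof (rule that[of "\<lambda>x. (1 / I) * plateau d z x"])
    show "test_function UNIV (\<lambda>x. (1 / I) * plateau d z x)" by (rule test_function_mult(2)[OF t smooth_const])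
    show "x \<in> cball z \<eta>" if "(1 / I) * plateau d z x \<noteq> 0" for x
      using that plateau_support[OF d(1), of z] d by auto
  qed (use I in \<open>auto simp: plateau_bounds I_def[symmetric]\<close>)
qed

sublocale C11_bounded \<subseteq> bo: bounded_open \<Omega>
  using open_\<Omega> bounded_\<Omega> by unfold_locales

context C11_bounded
begin

text \<open>In the interior a centred kernel samples only points close to the compact support. Near
  the boundary the kernel is centred at the outward axis vector, so that mollification at
  \<open>x\<close> samples \<open>u\<close> at points pushed into \<Omega>.\<close>

lemma localized_approx:
  assumes u: "u \<in> L2 (lebesgue_on \<Omega>)" "\<And>i. d i \<in> L2 (lebesgue_on \<Omega>)" "\<And>i. has_weak_partial \<Omega> i u (d i)"
    and \<psi>: "localized \<psi>"
  shows "bo.H1_approx (\<lambda>x. \<psi> x * u x) (\<lambda>i x. \<psi> x * d i x + partial i \<psi> x * u x)"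
  using \<psi> unfolding localized_def
proof (elim disjE exE conjE)
  assume \<psi>O: "test_function \<Omega> \<psi>"
  obtain K where K: "compact K" "K \<subseteq> \<Omega>" "\<And>x. x \<notin> K \<Longrightarrow> \<psi> x = 0" "\<And>i x. x \<notin> K \<Longrightarrow> partial i \<psi> x = 0"
    by (rule test_functionE[OF \<psi>O]) (rule that)
  obtain \<delta> where \<delta>: "0 < \<delta>" "(\<Union>x\<in>K. ball x \<delta>) \<subseteq> \<Omega>"
    by (rule compact_subset_open_imp_ball_epsilon_subset[OF K(1) open_\<Omega> K(2)]) (rule that)
  obtain \<rho> :: "real^3 \<Rightarrow> real" where \<rho>: "test_function UNIV \<rho>" "\<And>x. 0 \<le> \<rho> x" "(LINT x|lborel. \<rho> x) = 1"
    "\<And>x. \<rho> x \<noteq> 0 \<Longrightarrow> x \<in> cball 0 1"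
    by (rule mollifier_exists[of 1 0]) (simp, rule that)
  have S: "closure {x. \<rho> x \<noteq> 0} \<subseteq> cball 0 1" by (rule closure_minimal) (use \<rho>(4) in auto)
  show ?thesis
  proof (rule bo.H1_approx_mollify[OF u test_function_smooth[OF \<psi>O] K(3,4) \<rho>(1,2,3)])
    show "norm x \<le> 2" if "\<rho> x \<noteq> 0" for x using \<rho>(4)[OF that] by simp
    \<comment> \<open>The sampled point is within 3 \<epsilon> of z here and within 4 \<epsilon> in
      the boundary case, so this threshold keeps it within \<delta>.\<close>
    show "0 < \<delta> / 8" using \<delta>(1) by simp
    fix \<epsilon> x w z assume \<epsilon>: "0 < \<epsilon>" "\<epsilon> < \<delta> / 8" and w: "w \<in> closure {x. \<rho> x \<noteq> 0}"
      and z: "z \<in> K" "norm (x - z) \<le> 2 * \<epsilon>"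
    have "norm w \<le> 1" using S w by auto
    then have "norm (\<epsilon> *\<^sub>R w) \<le> \<epsilon>" using \<epsilon>(1) by (simp add: mult_left_le)
    moreover have "norm (z - (x - \<epsilon> *\<^sub>R w)) \<le> norm (x - z) + norm (\<epsilon> *\<^sub>R w)"
      using norm_triangle_ineq[of "z - x" "\<epsilon> *\<^sub>R w"] by (simp add: algebra_simps norm_minus_commute)
    ultimately have "norm (z - (x - \<epsilon> *\<^sub>R w)) < \<delta>" using \<epsilon> z(2) by linarith
    then have "x - \<epsilon> *\<^sub>R w \<in> ball z \<delta>" by (simp add: dist_norm)
    then show "x - \<epsilon> *\<^sub>R w \<in> \<Omega>" using \<delta>(2) z(1) by blast
  qed
next
  fix Q p r h \<gamma> assume c: "C11_graph \<Omega> Q p r h \<gamma>" and \<psi>c: "test_function (cylinder Q p r h) \<psi>"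
  interpret c: C11_graph \<Omega> Q p r h \<gamma> by (rule c)
  obtain K where K: "compact K" "K \<subseteq> c.cyl" "\<And>x. x \<notin> K \<Longrightarrow> \<psi> x = 0" "\<And>i x. x \<notin> K \<Longrightarrow> partial i \<psi> x = 0"
    by (rule test_functionE[OF \<psi>c]) (rule that)
  obtain \<delta> where \<delta>: "0 < \<delta>" "(\<Union>x\<in>K. ball x \<delta>) \<subseteq> c.cyl"
    by (rule compact_subset_open_imp_ball_epsilon_subset[OF K(1) open_cylinder[OF c.orth] K(2)]) (rule that)
  define a where "a = Q *v axis 3 1"
  \<comment> \<open>The radius is chosen so that M \<eta> \<le> 1 - \<eta>: for every w in the ball
    the rise of the graph is no larger than the vertical displacement.\<close>
  define \<eta> where "\<eta> = 1 / (c.M + 2)"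
  have M: "0 \<le> c.M" by (rule c.M_nonneg)
  have \<eta>: "0 < \<eta>" "\<eta> \<le> 1" "c.M * \<eta> \<le> 1 - \<eta>" using M by (auto simp: \<eta>_def field_simps)
  have na: "norm a = 1" unfolding a_def norm_frame[OF c.orth] by simp
  obtain \<rho> where \<rho>: "test_function UNIV \<rho>" "\<And>x. 0 \<le> \<rho> x" "(LINT x|lborel. \<rho> x) = 1"
    "\<And>x. \<rho> x \<noteq> 0 \<Longrightarrow> x \<in> cball a \<eta>"
    by (rule mollifier_exists[OF \<eta>(1), of a]) (rule that)
  have S: "closure {x. \<rho> x \<noteq> 0} \<subseteq> cball a \<eta>" by (rule closure_minimal) (use \<rho>(4) in auto)
  have wn: "norm w \<le> 2" if "w \<in> cball a \<eta>" for w
    using that \<eta>(2) na norm_triangle_sub[of w a] by (simp add: dist_norm norm_minus_commute)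
  show ?thesis
  proof (rule bo.H1_approx_mollify[OF u test_function_smooth[OF \<psi>c] K(3,4) \<rho>(1,2,3)])
    show "norm x \<le> 2" if "\<rho> x \<noteq> 0" for x using wn[OF \<rho>(4)[OF that]] .
    show "0 < \<delta> / 8" using \<delta>(1) by simp
    fix \<epsilon> x w z assume \<epsilon>: "0 < \<epsilon>" "\<epsilon> < \<delta> / 8" and x: "x \<in> \<Omega>" and w: "w \<in> closure {x. \<rho> x \<noteq> 0}"
      and z: "z \<in> K" "norm (x - z) \<le> 2 * \<epsilon>"
    have wa: "w \<in> cball a \<eta>" using S w by blast
    have "norm (\<epsilon> *\<^sub>R w) \<le> 2 * \<epsilon>" using \<epsilon>(1) wn[OF wa] by simp
    moreover have "norm (z - (x - \<epsilon> *\<^sub>R w)) \<le> norm (x - z) + norm (\<epsilon> *\<^sub>R w)"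
      using norm_triangle_ineq[of "z - x" "\<epsilon> *\<^sub>R w"] by (simp add: algebra_simps norm_minus_commute)
    ultimately have "norm (z - (x - \<epsilon> *\<^sub>R w)) < \<delta>" "norm (x - z) < \<delta>" using \<epsilon> z(2) by linarith+
    then have "x - \<epsilon> *\<^sub>R w \<in> ball z \<delta>" "x \<in> ball z \<delta>"
      by (simp_all add: dist_norm norm_minus_commute)
    then have cyl: "x - \<epsilon> *\<^sub>R w \<in> c.cyl" "x \<in> c.cyl" using \<delta>(2) z(1) by blast+
    define y s where "y = hor (unframe Q (x - p))" and "s = unframe Q (x - p) $ 3"
    define b t where "b = hor (unframe Q w)" and "t = unframe Q w $ 3"
    have x_eq: "x = c.pt y s" by (simp add: y_def s_def frame_point_coordinates[OF c.orth])
    have xw: "x - \<epsilon> *\<^sub>R w = c.pt (y - \<epsilon> *\<^sub>R b) (s - \<epsilon> * t)"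
      unfolding x_eq b_def t_def by (rule frame_point_diff[OF c.orth])
    have ys: "y \<in> ball 0 r" "\<bar>s\<bar> < h" using cyl(2) unfolding x_eq frame_point_in_cylinder[OF c.orth] by auto
    have ys': "y - \<epsilon> *\<^sub>R b \<in> ball 0 r" "\<bar>s - \<epsilon> * t\<bar> < h"
      using cyl(1) unfolding xw frame_point_in_cylinder[OF c.orth] by auto
    have diff: "unframe Q (w - a) = unframe Q w - axis 3 1"
      unfolding a_def linear_diff[OF linear_unframe] unframe_mult[OF c.orth] ..
    have nd: "norm (unframe Q w - axis 3 1) \<le> \<eta>"
      unfolding diff[symmetric] norm_unframe[OF c.orth] using wa by (simp add: dist_norm norm_minus_commute)
    have "hor (unframe Q w - axis 3 1) = b" by (simp add: vec2_eq_iff b_def axis_def)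
    then have b: "norm b \<le> \<eta>" using norm_hor_le[of "unframe Q w - axis 3 1"] nd by simp
    have "\<bar>t - 1\<bar> \<le> \<eta>"
      using component_le_norm_cart[of "unframe Q w - axis 3 1" 3] nd by (simp add: t_def axis_def)
    then have t: "1 - \<eta> \<le> t" by simp
    have "s < \<gamma> y" using x c.pt_in_\<Omega>[OF ys] by (simp add: x_eq)
    moreover have "\<bar>\<gamma> (y - \<epsilon> *\<^sub>R b) - \<gamma> y\<bar> \<le> c.M * (\<epsilon> * norm b)"
      using c.\<gamma>_lipschitz[OF ys'(1) ys(1)] \<epsilon>(1) by simp
    moreover have "c.M * (\<epsilon> * norm b) \<le> \<epsilon> * t"
    proof -
      have "c.M * norm b \<le> c.M * \<eta>" by (rule mult_left_mono[OF b M])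
      then have "c.M * norm b \<le> t" using \<eta>(3) t by linarith
      then have "\<epsilon> * (c.M * norm b) \<le> \<epsilon> * t" using \<epsilon>(1) by simp
      then show ?thesis by (simp add: mult_ac)
    qed
    \<comment> \<open>The point descends by \<epsilon> t, while the graph descends by at most M
      \<epsilon> norm b \<le> \<epsilon> t, so the point stays below it.\<close>
    ultimately have "s - \<epsilon> * t < \<gamma> (y - \<epsilon> *\<^sub>R b)" by linarith
    then show "x - \<epsilon> *\<^sub>R w \<in> \<Omega>" unfolding xw c.pt_in_\<Omega>[OF ys'] .
  qed
qed

lemma H1_density:
  assumes u: "u \<in> L2 (lebesgue_on \<Omega>)" "\<And>i. d i \<in> L2 (lebesgue_on \<Omega>)" "\<And>i. has_weak_partial \<Omega> i u (d i)"
  shows "bo.H1_approx u d"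
proof -
  obtain X :: "(real^3) set" and V \<psi> where "localized_partition X V \<psi>" using boundary_partition by blast
  note X = localized_partitionD[OF this]
  have S: "smooth (\<psi> z)" if "z \<in> X" for z by (rule localized_smooth[OF X(2)[OF that]])
  have "bo.H1_approx (\<lambda>x. \<Sum>z\<in>X. \<psi> z x * u x) (\<lambda>i x. \<Sum>z\<in>X. \<psi> z x * d i x + partial i (\<psi> z) x * u x)"
    by (rule bo.H1_approx_sum[OF X(1) localized_approx[OF u X(2)]])
      (use S u in \<open>auto intro!: bo.L2_smooth_mult L2_add smooth_partial\<close>)
  moreover have "(\<Sum>z\<in>X. \<psi> z x * u x) = u x" "(\<Sum>z\<in>X. \<psi> z x * d i x + partial i (\<psi> z) x * u x) = d i x"
    if x: "x \<in> \<Omega>" for x i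
  proof -
    have xV: "x \<in> V" using x X(5) closure_subset[of \<Omega>] by blast
    then show "(\<Sum>z\<in>X. \<psi> z x * u x) = u x" using X(6) by (simp flip: sum_distrib_right)
    have "(\<Sum>z\<in>X. partial i (\<psi> z) x) = partial i (\<lambda>x. \<Sum>z\<in>X. \<psi> z x) x"
      by (rule partial_sum[symmetric]) (rule S)
    also have "\<dots> = partial i (\<lambda>x. 1) x" by (rule partial_cong_open[OF X(4) xV]) (rule X(6))
    finally have "(\<Sum>z\<in>X. partial i (\<psi> z) x) = 0" by simp
    then show "(\<Sum>z\<in>X. \<psi> z x * d i x + partial i (\<psi> z) x * u x) = d i x"
      using X(6)[OF xV] by (simp add: sum.distrib flip: sum_distrib_right)
  qed
  then have "(LINT x|lebesgue_on \<Omega>. (f x - (\<Sum>z\<in>X. \<psi> z x * u x))\<^sup>2) = (LINT x|lebesgue_on \<Omega>. (f x - u x)\<^sup>2)"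
    "(LINT x|lebesgue_on \<Omega>. (f x - (\<Sum>z\<in>X. \<psi> z x * d i x + partial i (\<psi> z) x * u x))\<^sup>2) = (LINT x|lebesgue_on \<Omega>. (f x - d i x)\<^sup>2)"
    for f i by (auto intro!: Bochner_Integration.integral_cong)
  ultimately show ?thesis unfolding bo.H1_approx_def by simp
qed

end

section \<open>Traces\<close>

lemma L2_mult_bounded_AE:
  fixes u :: "'a \<Rightarrow> real"
  assumes "u \<in> L2 M" "b \<in> borel_measurable M" "AE x in M. \<bar>b x\<bar> \<le> B"
  shows "(\<lambda>x. b x * u x) \<in> L2 M" "(LINT x|M. (b x * u x)\<^sup>2) \<le> B\<^sup>2 * (LINT x|M. (u x)\<^sup>2)"
proof -
  have le: "AE x in M. (b x * u x)\<^sup>2 \<le> B\<^sup>2 * (u x)\<^sup>2"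
    using assms(3)
  proof eventually_elim
    case (elim x)
    have "\<bar>b x\<bar>\<^sup>2 \<le> B\<^sup>2" by (rule power_mono[OF elim]) simp
    then show ?case by (simp add: power_mult_distrib mult_right_mono)
  qed
  have int: "integrable M (\<lambda>x. (b x * u x)\<^sup>2)"
  proof (rule Bochner_Integration.integrable_bound)
    show "integrable M (\<lambda>x. B\<^sup>2 * (u x)\<^sup>2)" using assms(1) by (simp add: L2_real_iff)
    show "AE x in M. norm ((b x * u x)\<^sup>2) \<le> norm (B\<^sup>2 * (u x)\<^sup>2)" using le by eventually_elim simp
  qed (use assms in \<open>auto simp: L2_real_iff\<close>)
  then show "(\<lambda>x. b x * u x) \<in> L2 M" using assms by (auto simp: L2_real_iff)
  have "(LINT x|M. (b x * u x)\<^sup>2) \<le> (LINT x|M. B\<^sup>2 * (u x)\<^sup>2)"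
    by (rule integral_mono_AE[OF int _ le]) (use assms(1) in \<open>simp add: L2_real_iff\<close>)
  then show "(LINT x|M. (b x * u x)\<^sup>2) \<le> B\<^sup>2 * (LINT x|M. (u x)\<^sup>2)" by simp
qed

lemma L2_mult_bounded_tendsto:
  fixes u :: "'a \<Rightarrow> real"
  assumes "u \<in> L2 M" "\<And>n. f n \<in> L2 M" "(\<lambda>n. LINT x|M. (f n x - u x)\<^sup>2) \<longlonglongrightarrow> 0"
    "b \<in> borel_measurable M" "AE x in M. \<bar>b x\<bar> \<le> B"
  shows "(\<lambda>n. LINT x|M. (b x * f n x - b x * u x)\<^sup>2) \<longlonglongrightarrow> 0"
proof (rule tendsto_sandwich)
  show "\<forall>\<^sub>F n in sequentially. 0 \<le> (LINT x|M. (b x * f n x - b x * u x)\<^sup>2)" by simp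
  show "\<forall>\<^sub>F n in sequentially. (LINT x|M. (b x * f n x - b x * u x)\<^sup>2) \<le> B\<^sup>2 * (LINT x|M. (f n x - u x)\<^sup>2)"
    using L2_mult_bounded_AE(2)[OF L2_diff[OF assms(2,1)] assms(4,5)]
    by (simp add: right_diff_distrib)
  show "(\<lambda>n. B\<^sup>2 * (LINT x|M. (f n x - u x)\<^sup>2)) \<longlonglongrightarrow> 0"
    using tendsto_mult_left[OF assms(3), of "B\<^sup>2"] by simp
qed simp

text \<open>Carries explicit weak derivatives along, so that formulas can name them.\<close>

definition (in bounded_open) H1_deriv where
  "H1_deriv u d \<longleftrightarrow> u \<in> L2 \<mu> \<and> (\<forall>i. d i \<in> L2 \<mu>) \<and> (\<forall>i. has_weak_partial \<Omega> i u (d i))"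

lemma (in bounded_open) H1_derivD:
  assumes "H1_deriv u d"
  shows "u \<in> L2 \<mu>" "\<And>i. d i \<in> L2 \<mu>" "\<And>i. has_weak_partial \<Omega> i u (d i)"
  using assms by (auto simp: H1_deriv_def)

lemma (in bounded_open) sobolev_1_iff: "u \<in> sobolev 1 \<Omega> \<longleftrightarrow> (\<exists>d. H1_deriv u d)"
proof
  assume "u \<in> sobolev 1 \<Omega>"
  then have u: "u \<in> L2 \<mu>" "\<forall>i. \<exists>v. v \<in> L2 \<mu> \<and> has_weak_partial \<Omega> i u v" by auto
  then obtain d where "\<forall>i. d i \<in> L2 \<mu> \<and> has_weak_partial \<Omega> i u (d i)" by metis
  then show "\<exists>d. H1_deriv u d" using u(1) by (auto simp: H1_deriv_def)
qed (auto simp: H1_deriv_def)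

context C11_bounded
begin

text \<open>The H1 norm in \<open>has_trace\<close> involves chosen weak derivatives of
  \<open>f n - u\<close>; here its convergence is split into L2 convergence towards the given
  \<open>d\<close>.\<close>

lemma has_traceD:
  assumes "has_trace \<Omega> u g" "bo.H1_deriv u d"
  obtains f where "\<And>n. smooth (f n)" "(\<lambda>n. LINT x|lebesgue_on \<Omega>. (f n x - u x)\<^sup>2) \<longlonglongrightarrow> 0"
    "\<And>i. (\<lambda>n. LINT x|lebesgue_on \<Omega>. (partial i (f n) x - d i x)\<^sup>2) \<longlonglongrightarrow> 0"
    "(\<lambda>n. LINT x|\<sigma>. (f n x - g x)\<^sup>2) \<longlonglongrightarrow> 0"
proof -
  obtain f where f: "\<And>n. smooth (f n)" "(\<lambda>n. H1_norm \<Omega> (\<lambda>x. f n x - u x)) \<longlonglongrightarrow> 0"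
    "(\<lambda>n. LINT x|\<sigma>. (f n x - g x)\<^sup>2) \<longlonglongrightarrow> 0"
    using assms(1) unfolding has_trace_def by blast
  note d = bo.H1_derivD[OF assms(2)]
  let ?a = "\<lambda>n. LINT x|lebesgue_on \<Omega>. (f n x - u x)\<^sup>2"
  let ?b = "\<lambda>i n. LINT x|lebesgue_on \<Omega>. (partial i (f n) x - d i x)\<^sup>2"
  have eq: "H1_norm \<Omega> (\<lambda>x. f n x - u x) = sqrt (?a n + (\<Sum>i\<in>UNIV. ?b i n))" for n
    by (rule bo.H1_norm_eq[of "\<lambda>i x. partial i (f n) x - d i x"])
      (intro L2_diff bo.L2_smooth smooth_partial f d bo.has_weak_partial_diff bo.smooth_has_weak_partial)+
  have "(\<lambda>n. (sqrt (?a n + (\<Sum>i\<in>UNIV. ?b i n)))\<^sup>2) \<longlonglongrightarrow> 0\<^sup>2"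
    using f(2) unfolding eq by (rule tendsto_power)
  then have lim: "(\<lambda>n. ?a n + (\<Sum>i\<in>UNIV. ?b i n)) \<longlonglongrightarrow> 0"
    by (simp add: sum_nonneg)
  have 1: "?a \<longlonglongrightarrow> 0"
    by (rule tendsto_sandwich[OF _ _ tendsto_const lim]) (auto intro!: always_eventually sum_nonneg)
  have 2: "?b i \<longlonglongrightarrow> 0" for i
  proof (rule tendsto_sandwich[OF _ _ tendsto_const lim])
    have "?b i n \<le> (\<Sum>i\<in>UNIV. ?b i n)" for n by (rule member_le_sum) auto
    then show "\<forall>\<^sub>F n in sequentially. ?b i n \<le> ?a n + (\<Sum>i\<in>UNIV. ?b i n)"
      by (intro always_eventually allI order_trans[OF _ le_add_same_cancel2[THEN iffD2]]) auto
  qed simp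
  show ?thesis by (rule that[OF f(1) 1 2 f(3)])
qed

text \<open>Completeness for rapidly Cauchy sequences. On a finite measure the summable L2 distances
  bound the L1 norms of the increments, so the sequence converges almost everywhere; Fatou's lemma
  carries the L2 bound over to the limit.\<close>

lemma L2_\<sigma>_complete:
  fixes f :: "nat \<Rightarrow> real^3 \<Rightarrow> real"
  assumes f: "\<And>n. f n \<in> L2 \<sigma>" and bd: "\<And>n m. n \<le> m \<Longrightarrow> (LINT x|\<sigma>. (f n x - f m x)\<^sup>2) \<le> q n"
    and q: "summable (\<lambda>n. sqrt (q n))"
  obtains g where "g \<in> L2 \<sigma>" "(\<lambda>n. LINT x|\<sigma>. (f n x - g x)\<^sup>2) \<longlonglongrightarrow> 0"
proof -
  have fm: "f n \<in> borel_measurable \<sigma>" for n by (rule L2_measurable[OF f])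
  have fi: "integrable \<sigma> (f n)" for n by (rule L2_integrable[OF finite_\<sigma> f])
  have one: "(\<lambda>x. 1::real) \<in> L2 \<sigma>" by (rule smooth_L2_\<sigma>) simp
  have sym: "(LINT x|\<sigma>. (f n x - f m x)\<^sup>2) = (LINT x|\<sigma>. (f m x - f n x)\<^sup>2)" for n m
    by (simp add: power2_commute)
  have q0: "0 \<le> q n" for n using bd[of n n] by simp
  have ql: "q \<longlonglongrightarrow> 0"
    using tendsto_power[OF summable_LIMSEQ_zero[OF q], of 2] q0 by simp
  define S where "S = sqrt (LINT x|\<sigma>. 1\<^sup>2)"
  have S: "0 \<le> S" by (simp add: S_def)
  have l1: "(LINT x|\<sigma>. norm (f i x - f j x)) \<le> sqrt (LINT x|\<sigma>. (f i x - f j x)\<^sup>2) * S" for i j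
  proof -
    have "(\<lambda>x. \<bar>f i x - f j x\<bar>) \<in> L2 \<sigma>"
      by (rule L2_dominated[OF L2_diff[OF f[of i] f[of j]]]) (use L2_measurable[OF L2_diff[OF f[of i] f[of j]]] in auto)
    from L2_Cauchy_Schwarz[OF this one] show ?thesis by (simp add: S_def)
  qed
  have conv: "AE x in \<sigma>. convergent (\<lambda>n. f n x)"
  proof -
    let ?h = "\<lambda>n x. \<bar>f n x - f (Suc n) x\<bar>"
    have hm: "(\<lambda>x. ennreal (?h n x)) \<in> borel_measurable \<sigma>" for n
      using fm[of n] fm[of "Suc n"] by measurable
    have "(\<integral>\<^sup>+ x. ennreal (?h n x) \<partial>\<sigma>) \<le> ennreal (sqrt (q n) * S)" for n
    proof -
      have "(\<integral>\<^sup>+ x. ennreal (?h n x) \<partial>\<sigma>) = ennreal (LINT x|\<sigma>. ?h n x)"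
        by (rule nn_integral_eq_integral) (use fi in auto)
      also have "(LINT x|\<sigma>. ?h n x) \<le> sqrt (q n) * S"
        using bd[of n "Suc n"] S order_trans[OF l1[of n "Suc n"] mult_right_mono[of _ "sqrt (q n)" S]] by simp
      finally show ?thesis by (simp add: ennreal_leI)
    qed
    then have "(\<Sum>n. \<integral>\<^sup>+ x. ennreal (?h n x) \<partial>\<sigma>) \<le> (\<Sum>n. ennreal (sqrt (q n) * S))"
      by (intro suminf_le summableI)
    also have "\<dots> = ennreal (\<Sum>n. sqrt (q n) * S)"
      by (rule suminf_ennreal2) (use q0 S q in \<open>auto intro: summable_mult2\<close>)
    finally have "(\<integral>\<^sup>+ x. (\<Sum>n. ennreal (?h n x)) \<partial>\<sigma>) \<le> ennreal (\<Sum>n. sqrt (q n) * S)"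
      by (subst nn_integral_suminf[OF hm])
    from le_less_trans[OF this ennreal_less_top]
    have "(\<integral>\<^sup>+ x. (\<Sum>n. ennreal (?h n x)) \<partial>\<sigma>) \<noteq> \<infinity>" by simp
    moreover have "(\<lambda>x. \<Sum>n. ennreal (?h n x)) \<in> borel_measurable \<sigma>"
      by (rule borel_measurable_suminf_order) (rule hm)
    ultimately have "AE x in \<sigma>. (\<Sum>n. ennreal (?h n x)) \<noteq> \<infinity>"
      by (intro nn_integral_noteq_infinite)
    then show ?thesis
    proof eventually_elim
      case (elim x)
      have "summable (\<lambda>n. ?h n x)" by (rule summable_suminf_not_top) (use elim in auto)
      then have "summable (\<lambda>n. f (Suc n) x - f n x)"
        by (subst (asm) abs_minus_commute) (rule summable_rabs_cancel)
      then have "(\<lambda>n. \<Sum>k<n. f (Suc k) x - f k x) \<longlonglongrightarrow> (\<Sum>k. f (Suc k) x - f k x)"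
        by (rule summable_LIMSEQ)
      moreover have "(\<Sum>k<n. f (Suc k) x - f k x) = f n x - f 0 x" for n
        by (rule sum_lessThan_telescope)
      ultimately have "(\<lambda>n. f n x - f 0 x) \<longlonglongrightarrow> (\<Sum>k. f (Suc k) x - f k x)" by simp
      from tendsto_add[OF this tendsto_const, of "f 0 x"]
      have "(\<lambda>n. f n x) \<longlonglongrightarrow> (\<Sum>k. f (Suc k) x - f k x) + f 0 x" by simp
      then show ?case by (auto simp: convergent_def)
    qed
  qed
  define g where "g x = lim (\<lambda>i. f i x)" for x
  have gm: "g \<in> borel_measurable \<sigma>" unfolding g_def[abs_def] by (rule borel_measurable_lim_metric) (rule fm)
  have lim: "AE x in \<sigma>. (\<lambda>i. f i x) \<longlonglongrightarrow> g x"
    using conv by eventually_elim (simp add: g_def convergent_LIMSEQ_iff)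
  have bound: "integrable \<sigma> (\<lambda>x. (f n x - g x)\<^sup>2) \<and> (LINT x|\<sigma>. (f n x - g x)\<^sup>2) \<le> q n" for n
  proof -
    have "(\<integral>\<^sup>+ x. ennreal ((f n x - g x)\<^sup>2) \<partial>\<sigma>) = (\<integral>\<^sup>+ x. liminf (\<lambda>i. ennreal ((f n x - f i x)\<^sup>2)) \<partial>\<sigma>)"
    proof (rule nn_integral_cong_AE)
      show "AE x in \<sigma>. ennreal ((f n x - g x)\<^sup>2) = liminf (\<lambda>i. ennreal ((f n x - f i x)\<^sup>2))"
        using lim
      proof eventually_elim
        case (elim x)
        have "(\<lambda>i. ennreal ((f n x - f i x)\<^sup>2)) \<longlonglongrightarrow> ennreal ((f n x - g x)\<^sup>2)"
          by (intro tendsto_ennrealI tendsto_intros elim)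
        from lim_imp_Liminf[OF _ this] show ?case by simp
      qed
    qed
    also have "\<dots> \<le> liminf (\<lambda>i. \<integral>\<^sup>+ x. ennreal ((f n x - f i x)\<^sup>2) \<partial>\<sigma>)"
      by (rule nn_integral_liminf) (use fm in measurable)
    also have "\<dots> \<le> liminf (\<lambda>i. ennreal (q n))"
    proof (rule Liminf_mono)
      show "\<forall>\<^sub>F i in sequentially. (\<integral>\<^sup>+ x. ennreal ((f n x - f i x)\<^sup>2) \<partial>\<sigma>) \<le> ennreal (q n)"
        using eventually_ge_at_top[of n]
      proof eventually_elim
        case (elim i)
        have "(\<integral>\<^sup>+ x. ennreal ((f n x - f i x)\<^sup>2) \<partial>\<sigma>) = ennreal (LINT x|\<sigma>. (f n x - f i x)\<^sup>2)"
          using L2_diff[OF f[of n] f[of i]] by (intro nn_integral_eq_integral) (auto simp: L2_real_iff)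
        then show ?case using bd[OF elim] by (simp add: ennreal_leI)
      qed
    qed
    also have "\<dots> = ennreal (q n)" by (rule Liminf_const) simp
    finally have le: "(\<integral>\<^sup>+ x. ennreal ((f n x - g x)\<^sup>2) \<partial>\<sigma>) \<le> ennreal (q n)" .
    have int: "integrable \<sigma> (\<lambda>x. (f n x - g x)\<^sup>2)"
    proof (rule integrableI_bounded)
      show "(\<lambda>x. (f n x - g x)\<^sup>2) \<in> borel_measurable \<sigma>" using fm gm by measurable
      show "(\<integral>\<^sup>+ x. ennreal (norm ((f n x - g x)\<^sup>2)) \<partial>\<sigma>) < \<infinity>"
        using le_less_trans[OF le ennreal_less_top] by simp
    qed
    have "ennreal (LINT x|\<sigma>. (f n x - g x)\<^sup>2) \<le> ennreal (q n)"
      using le int by (subst (asm) nn_integral_eq_integral) auto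
    then show ?thesis using int q0[of n] by (subst (asm) ennreal_le_iff) auto
  qed
  have "(\<lambda>x. f 0 x - g x) \<in> L2 \<sigma>" using bound[of 0] fm[of 0] gm by (auto simp: L2_real_iff)
  from L2_diff[OF f[of 0] this] have gL: "g \<in> L2 \<sigma>" by simp
  have "(\<lambda>n. LINT x|\<sigma>. (f n x - g x)\<^sup>2) \<longlonglongrightarrow> 0"
    by (rule tendsto_sandwich[OF _ _ tendsto_const ql]) (use bound in \<open>auto intro!: always_eventually\<close>)
  then show ?thesis using that gL by blast
qed

text \<open>Smooth functions converging to u in H1 are Cauchy in L2 of the boundary by the trace
  inequality applied to their differences.\<close>

lemma trace_exists:
  assumes H: "bo.H1_deriv u d" shows "\<exists>g. has_trace \<Omega> u g"
proof -
  note d = bo.H1_derivD[OF H]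
  obtain C where C: "0 \<le> C"
    "\<And>f. smooth f \<Longrightarrow> (LINT x|\<sigma>. (f x)\<^sup>2) \<le> C * (LINT x|lebesgue_on \<Omega>. energy f x)"
    by (rule trace_inequality) (rule that)
  \<comment> \<open>The squared errors decay like (1/4)^n so that their square roots, of order
    (1/2)^n, are summable.\<close>
  have "\<forall>n. \<exists>f. smooth f \<and> (LINT x|lebesgue_on \<Omega>. (f x - u x)\<^sup>2) < (1/4) ^ n \<and>
     (\<forall>i. (LINT x|lebesgue_on \<Omega>. (partial i f x - d i x)\<^sup>2) < (1/4::real) ^ n)"
    using H1_density[OF d] unfolding bo.H1_approx_def by simp
  from choice[OF this] obtain f where f': "\<forall>n. smooth (f n) \<and> (LINT x|lebesgue_on \<Omega>. (f n x - u x)\<^sup>2) < (1/4) ^ n \<and>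
     (\<forall>i. (LINT x|lebesgue_on \<Omega>. (partial i (f n) x - d i x)\<^sup>2) < (1/4::real) ^ n)" by blast
  then have f: "\<And>n. smooth (f n)" "\<And>n. (LINT x|lebesgue_on \<Omega>. (f n x - u x)\<^sup>2) < (1/4) ^ n"
    "\<And>n i. (LINT x|lebesgue_on \<Omega>. (partial i (f n) x - d i x)\<^sup>2) < (1/4::real) ^ n"
    by blast+
  have pw: "(\<lambda>n. (1/4::real) ^ n) \<longlonglongrightarrow> 0" by (rule LIMSEQ_realpow_zero) auto
  have diff: "(LINT x|lebesgue_on \<Omega>. (g n x - g m x)\<^sup>2) \<le> 4 * (1/4) ^ n"
    if nm: "n \<le> m" and g: "\<And>n. g n \<in> L2 (lebesgue_on \<Omega>)" "v \<in> L2 (lebesgue_on \<Omega>)"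
      "\<And>n. (LINT x|lebesgue_on \<Omega>. (g n x - v x)\<^sup>2) < (1/4) ^ n"
    for n m :: nat and g :: "nat \<Rightarrow> real^3 \<Rightarrow> real" and v
  proof -
    have "(LINT x|lebesgue_on \<Omega>. ((g n x - v x) + (v x - g m x))\<^sup>2)
        \<le> 2 * (LINT x|lebesgue_on \<Omega>. (g n x - v x)\<^sup>2) + 2 * (LINT x|lebesgue_on \<Omega>. (v x - g m x)\<^sup>2)"
      by (rule L2_norm_add_le; intro L2_diff g)
    moreover have "(LINT x|lebesgue_on \<Omega>. (v x - g m x)\<^sup>2) = (LINT x|lebesgue_on \<Omega>. (g m x - v x)\<^sup>2)"
      by (simp add: power2_commute)
    moreover have "(1/4::real) ^ m \<le> (1/4) ^ n" using nm by (intro power_decreasing) auto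
    moreover have "(LINT x|lebesgue_on \<Omega>. ((g n x - v x) + (v x - g m x))\<^sup>2) = (LINT x|lebesgue_on \<Omega>. (g n x - g m x)\<^sup>2)"
      by simp
    ultimately show ?thesis using g(3)[of n] g(3)[of m] by linarith
  qed
  have bd: "(LINT x|\<sigma>. (f n x - f m x)\<^sup>2) \<le> C * (16 * (1/4) ^ n)" if nm: "n \<le> m" for n m
  proof -
    have s: "smooth (\<lambda>x. f n x - f m x)" by (intro smooth_diff f)
    have p: "partial i (\<lambda>x. f n x - f m x) x = partial i (f n) x - partial i (f m) x" for i x
      by (intro partial_diff f)
    have "(LINT x|lebesgue_on \<Omega>. energy (\<lambda>x. f n x - f m x) x)
        = (LINT x|lebesgue_on \<Omega>. (f n x - f m x)\<^sup>2) + (\<Sum>i\<in>UNIV. (LINT x|lebesgue_on \<Omega>. (partial i (f n) x - partial i (f m) x)\<^sup>2))"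
      unfolding energy_def p
    proof (subst Bochner_Integration.integral_add)
      show "integrable (lebesgue_on \<Omega>) (\<lambda>x. (f n x - f m x)\<^sup>2)"
        "integrable (lebesgue_on \<Omega>) (\<lambda>x. \<Sum>i\<in>UNIV. (partial i (f n) x - partial i (f m) x)\<^sup>2)"
        by (intro smooth_integrable_domain smooth_power smooth_diff smooth_sum smooth_partial f)+
      have "(LINT x|lebesgue_on \<Omega>. (\<Sum>i\<in>UNIV. (partial i (f n) x - partial i (f m) x)\<^sup>2))
          = (\<Sum>i\<in>UNIV. (LINT x|lebesgue_on \<Omega>. (partial i (f n) x - partial i (f m) x)\<^sup>2))"
        by (rule Bochner_Integration.integral_sum)
          (intro smooth_integrable_domain smooth_power smooth_diff smooth_partial f)
      then show "(LINT x|lebesgue_on \<Omega>. (f n x - f m x)\<^sup>2) + (LINT x|lebesgue_on \<Omega>. (\<Sum>i\<in>UNIV. (partial i (f n) x - partial i (f m) x)\<^sup>2))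
        = (LINT x|lebesgue_on \<Omega>. (f n x - f m x)\<^sup>2)
          + (\<Sum>i\<in>UNIV. (LINT x|lebesgue_on \<Omega>. (partial i (f n) x - partial i (f m) x)\<^sup>2))" by simp
    qed
    also have "\<dots> \<le> 4 * (1/4) ^ n + (\<Sum>i\<in>(UNIV::3 set). 4 * (1/4) ^ n)"
    proof (intro add_mono sum_mono)
      show "(LINT x|lebesgue_on \<Omega>. (f n x - f m x)\<^sup>2) \<le> 4 * (1/4) ^ n"
        by (rule diff[OF nm, of f u, OF smooth_L2_domain[OF f(1)] d(1) f(2)])
      show "(LINT x|lebesgue_on \<Omega>. (partial i (f n) x - partial i (f m) x)\<^sup>2) \<le> 4 * (1/4) ^ n" for i
        by (rule diff[OF nm, of "\<lambda>n. partial i (f n)" "d i", OF smooth_L2_domain[OF smooth_partial[OF f(1)]] d(2) f(3)])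
    qed
    \<comment> \<open>The function and its three partial derivatives contribute 4 (1/4)^n
      each.\<close>
    also have "\<dots> = 16 * (1/4) ^ n" by simp
    finally have "(LINT x|lebesgue_on \<Omega>. energy (\<lambda>x. f n x - f m x) x) \<le> 16 * (1/4) ^ n" .
    then show ?thesis by (rule order_trans[OF C(2)[OF s] mult_left_mono[OF _ C(1)]])
  qed
  have "sqrt (C * (16 * (1/4) ^ n)) = sqrt (16 * C) * (1/2) ^ n" for n
    by (simp add: real_sqrt_mult real_sqrt_power real_sqrt_divide power_divide)
  then have q: "summable (\<lambda>n. sqrt (C * (16 * (1/4) ^ n)))"
    by (simp add: summable_mult summable_geometric)
  obtain g where g: "g \<in> L2 \<sigma>" "(\<lambda>n. LINT x|\<sigma>. (f n x - g x)\<^sup>2) \<longlonglongrightarrow> 0"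
    using L2_\<sigma>_complete[OF smooth_L2_\<sigma>[OF f(1)] bd q] by blast
  have eq: "H1_norm \<Omega> (\<lambda>x. f n x - u x) = sqrt ((LINT x|lebesgue_on \<Omega>. (f n x - u x)\<^sup>2)
      + (\<Sum>i\<in>UNIV. (LINT x|lebesgue_on \<Omega>. (partial i (f n) x - d i x)\<^sup>2)))" for n
    by (rule bo.H1_norm_eq[of "\<lambda>i x. partial i (f n) x - d i x"])
      (intro L2_diff bo.L2_smooth smooth_partial f d bo.has_weak_partial_diff bo.smooth_has_weak_partial)+
  have "(\<lambda>n. LINT x|lebesgue_on \<Omega>. (f n x - u x)\<^sup>2) \<longlonglongrightarrow> 0"
    by (rule tendsto_sandwich[OF _ _ tendsto_const pw]) (use f(2) in \<open>auto intro!: always_eventually less_imp_le\<close>)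
  moreover have "(\<lambda>n. LINT x|lebesgue_on \<Omega>. (partial i (f n) x - d i x)\<^sup>2) \<longlonglongrightarrow> 0" for i
    by (rule tendsto_sandwich[OF _ _ tendsto_const pw]) (use f(3) in \<open>auto intro!: always_eventually less_imp_le\<close>)
  ultimately have "(\<lambda>n. sqrt ((LINT x|lebesgue_on \<Omega>. (f n x - u x)\<^sup>2)
      + (\<Sum>i\<in>UNIV. (LINT x|lebesgue_on \<Omega>. (partial i (f n) x - d i x)\<^sup>2)))) \<longlonglongrightarrow> sqrt (0 + (\<Sum>i\<in>(UNIV::3 set). 0))"
    by (intro tendsto_intros)
  then have "(\<lambda>n. H1_norm \<Omega> (\<lambda>x. f n x - u x)) \<longlonglongrightarrow> 0" unfolding eq by simp
  moreover have "u \<in> sobolev 1 \<Omega>" using H bo.sobolev_1_iff by blast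
  ultimately show ?thesis using g f(1) unfolding has_trace_def by blast
qed

lemma bdry_trace: "bo.H1_deriv u d \<Longrightarrow> has_trace \<Omega> u (bdry_trace \<Omega> u)"
  unfolding bdry_trace_def by (rule someI_ex[OF trace_exists])

lemma trace_L2: "has_trace \<Omega> u g \<Longrightarrow> g \<in> L2 \<sigma>"
  by (simp add: has_trace_def)

lemma \<nu>_nth_borel: "(\<lambda>x. \<nu> x $ i) \<in> borel_measurable borel"
  using inner_\<nu>_borel[of "axis i 1"] by (simp add: inner_axis')

lemma smooth_\<nu>_measurable: "smooth \<psi> \<Longrightarrow> (\<lambda>x. \<psi> x * (\<nu> x $ i)) \<in> borel_measurable \<sigma>"
  using \<nu>_nth_borel smooth_borel[of \<psi>] by simp

lemma smooth_\<nu>_bounded: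
  assumes "smooth \<psi>" shows "\<exists>B. AE x in \<sigma>. \<bar>\<psi> x * (\<nu> x $ i)\<bar> \<le> B"
proof -
  obtain B where B: "0 \<le> B" "\<And>x. x \<in> frontier \<Omega> \<Longrightarrow> \<bar>\<psi> x\<bar> \<le> B"
    by (rule smooth_bounded_on[OF bounded_frontier assms]) (rule that)
  have "AE x in \<sigma>. \<bar>\<psi> x * (\<nu> x $ i)\<bar> \<le> B"
    using AE_frontier
  proof eventually_elim
    case (elim x)
    have "\<bar>\<nu> x $ i\<bar> \<le> 1" using component_le_norm_cart[of "\<nu> x" i] norm_outer_normal[OF elim] by simp
    then have "\<bar>\<psi> x\<bar> * \<bar>\<nu> x $ i\<bar> \<le> B * 1" by (intro mult_mono B elim) auto
    then show ?case by (simp add: abs_mult)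
  qed
  then show ?thesis by blast
qed

lemma smooth_\<nu>_mult_L2:
  assumes "smooth \<psi>" "g \<in> L2 \<sigma>" shows "(\<lambda>x. \<psi> x * (\<nu> x $ i) * g x) \<in> L2 \<sigma>"
  using smooth_\<nu>_bounded[OF assms(1), of i] L2_mult_bounded_AE(1)[OF assms(2) smooth_\<nu>_measurable[OF assms(1)]]
  by blast

text \<open>The divergence theorem for u \<psi> u' along \<open>axis i 1\<close>. Both factors are
  approximated by smooth functions, and each term passes to the limit as an integral of a product of
  two L2 convergent sequences, the bounded weight being absorbed into the second.\<close>

lemma Green:
  assumes H: "bo.H1_deriv u d" "bo.H1_deriv u' d'" and g: "has_trace \<Omega> u g" "has_trace \<Omega> u' g'"
    and \<psi>: "smooth \<psi>"
  shows "(LINT x|lebesgue_on \<Omega>. d i x * (\<psi> x * u' x) + u x * (\<psi> x * d' i x) + u x * (partial i \<psi> x * u' x))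
    = (LINT x|\<sigma>. g x * (\<psi> x * (\<nu> x $ i) * g' x))"
proof -
  let ?L = "lebesgue_on \<Omega>"
  note d = bo.H1_derivD[OF H(1)] and d' = bo.H1_derivD[OF H(2)]
  obtain f where f: "\<And>n. smooth (f n)" "(\<lambda>n. LINT x|?L. (f n x - u x)\<^sup>2) \<longlonglongrightarrow> 0"
    "\<And>i. (\<lambda>n. LINT x|?L. (partial i (f n) x - d i x)\<^sup>2) \<longlonglongrightarrow> 0"
    "(\<lambda>n. LINT x|\<sigma>. (f n x - g x)\<^sup>2) \<longlonglongrightarrow> 0"
    using has_traceD[OF g(1) H(1)] by blast
  obtain k where k: "\<And>n. smooth (k n)" "(\<lambda>n. LINT x|?L. (k n x - u' x)\<^sup>2) \<longlonglongrightarrow> 0"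
    "\<And>i. (\<lambda>n. LINT x|?L. (partial i (k n) x - d' i x)\<^sup>2) \<longlonglongrightarrow> 0"
    "(\<lambda>n. LINT x|\<sigma>. (k n x - g' x)\<^sup>2) \<longlonglongrightarrow> 0"
    using has_traceD[OF g(2) H(2)] by blast
  have lim: "(\<lambda>n. LINT x|?L. a n x * (b x * c n x)) \<longlonglongrightarrow> (LINT x|?L. v x * (b x * w x))"
    if bS: "smooth b" and "v \<in> L2 ?L" "w \<in> L2 ?L" "\<And>n. smooth (a n)" "\<And>n. smooth (c n)"
      "(\<lambda>n. LINT x|?L. (a n x - v x)\<^sup>2) \<longlonglongrightarrow> 0" "(\<lambda>n. LINT x|?L. (c n x - w x)\<^sup>2) \<longlonglongrightarrow> 0"
    for a b c and v w :: "real^3 \<Rightarrow> real"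
  proof -
    obtain B where B: "\<And>x. x \<in> \<Omega> \<Longrightarrow> \<bar>b x\<bar> \<le> B"
      using smooth_bounded_on[OF bounded_\<Omega> bS] by metis
    have "AE x in ?L. \<bar>b x\<bar> \<le> B" by (rule AE_I2) (use B in simp)
    then have "(\<lambda>n. LINT x|?L. (b x * c n x - b x * w x)\<^sup>2) \<longlonglongrightarrow> 0"
      by (intro L2_mult_bounded_tendsto that smooth_L2_domain borel_measurable_lebesgue_on smooth_borel)
    then show ?thesis
      by (intro L2_mult_tendsto that smooth_L2_domain smooth_mult bo.L2_smooth_mult)
  qed
  have int: "integrable ?L (\<lambda>x. v x * (b x * w x))"
    if "smooth b" "v \<in> L2 ?L" "w \<in> L2 ?L" for b and v w :: "real^3 \<Rightarrow> real"
    by (intro L2_mult_integrable bo.L2_smooth_mult that)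
  have eq: "(LINT x|?L. partial i (f n) x * (\<psi> x * k n x)) + (LINT x|?L. f n x * (\<psi> x * partial i (k n) x))
      + (LINT x|?L. f n x * (partial i \<psi> x * k n x)) = (LINT x|\<sigma>. f n x * (\<psi> x * (\<nu> x $ i) * k n x))" for n
  proof -
    have s: "smooth (\<lambda>x. f n x * (\<psi> x * k n x))" by (intro smooth_mult f k \<psi>)
    have p: "partial i (\<lambda>x. f n x * (\<psi> x * k n x)) x
       = partial i (f n) x * (\<psi> x * k n x) + f n x * (\<psi> x * partial i (k n) x) + f n x * (partial i \<psi> x * k n x)" for x
      using f(1)[of n] k(1)[of n] \<psi> by (simp add: partial_mult smooth_differentiable smooth_mult algebra_simps)
    have "(LINT x|?L. grad (\<lambda>x. f n x * (\<psi> x * k n x)) x \<bullet> axis i 1)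
        = (LINT x|?L. partial i (f n) x * (\<psi> x * k n x) + f n x * (\<psi> x * partial i (k n) x) + f n x * (partial i \<psi> x * k n x))"
      by (simp add: inner_axis grad_def p)
    also have "\<dots> = (LINT x|?L. partial i (f n) x * (\<psi> x * k n x)) + (LINT x|?L. f n x * (\<psi> x * partial i (k n) x))
      + (LINT x|?L. f n x * (partial i \<psi> x * k n x))"
      by (subst Bochner_Integration.integral_add; (subst Bochner_Integration.integral_add)?;
          intro refl Bochner_Integration.integrable_add smooth_integrable_domain smooth_mult smooth_partial f k \<psi>)
    finally show ?thesis
      using divergence_theorem[OF s, of "axis i 1"] by (simp add: inner_axis' mult_ac)
  qed
  have "(\<lambda>n. (LINT x|?L. partial i (f n) x * (\<psi> x * k n x)) + (LINT x|?L. f n x * (\<psi> x * partial i (k n) x))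
      + (LINT x|?L. f n x * (partial i \<psi> x * k n x)))
    \<longlonglongrightarrow> (LINT x|?L. d i x * (\<psi> x * u' x)) + (LINT x|?L. u x * (\<psi> x * d' i x)) + (LINT x|?L. u x * (partial i \<psi> x * u' x))"
    by (intro tendsto_add lim \<psi> d d' f k smooth_partial)
  moreover have "(\<lambda>n. LINT x|\<sigma>. f n x * (\<psi> x * (\<nu> x $ i) * k n x)) \<longlonglongrightarrow> (LINT x|\<sigma>. g x * (\<psi> x * (\<nu> x $ i) * g' x))"
  proof -
    note m = smooth_\<nu>_measurable[OF \<psi>, of i]
    obtain B where b: "AE x in \<sigma>. \<bar>\<psi> x * (\<nu> x $ i)\<bar> \<le> B" using smooth_\<nu>_bounded[OF \<psi>] by blast
    show ?thesis
      by (rule L2_mult_tendsto[OF trace_L2[OF g(1)] L2_mult_bounded_AE(1)[OF trace_L2[OF g(2)] m b] smooth_L2_\<sigma>[OF f(1)]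
            L2_mult_bounded_AE(1)[OF smooth_L2_\<sigma>[OF k(1)] m b] f(4)
            L2_mult_bounded_tendsto[OF trace_L2[OF g(2)] smooth_L2_\<sigma>[OF k(1)] k(4) m b]])
  qed
  ultimately have "(LINT x|?L. d i x * (\<psi> x * u' x)) + (LINT x|?L. u x * (\<psi> x * d' i x)) + (LINT x|?L. u x * (partial i \<psi> x * u' x))
      = (LINT x|\<sigma>. g x * (\<psi> x * (\<nu> x $ i) * g' x))"
    unfolding eq by (rule LIMSEQ_unique)
  then show ?thesis
    by (subst Bochner_Integration.integral_add; (subst Bochner_Integration.integral_add)?)
      (auto intro!: Bochner_Integration.integrable_add int \<psi> d d' smooth_partial)
qed

end

section \<open>Curl and divergence\<close>

lemma smooth_line_derivative:
  assumes "smooth f"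
  shows "((\<lambda>t. f (x + t *\<^sub>R axis i 1)) has_real_derivative partial i f (x + t *\<^sub>R axis i 1)) (at t)"
proof -
  have "((\<lambda>t. f (x + t *\<^sub>R axis i 1)) has_derivative (\<lambda>s. grad f (x + t *\<^sub>R axis i 1) \<bullet> (s *\<^sub>R axis i 1))) (at t)"
    by (rule has_derivative_compose[of "\<lambda>t. x + t *\<^sub>R axis i 1" "\<lambda>s. s *\<^sub>R axis i 1" t UNIV f])
      (auto intro!: derivative_eq_intros has_derivative_grad smooth_differentiable[OF assms])
  then show ?thesis
    unfolding has_field_derivative_def
    by (rule has_derivative_eq_rhs) (simp add: fun_eq_iff inner_axis grad_def)
qed

text \<open>The mean value theorem is used twice: in direction i for the difference of two parallel
  segments, then in direction j for \<open>partial i f\<close>.\<close>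

lemma second_difference:
  fixes f :: "real^'n::finite \<Rightarrow> real"
  assumes f: "smooth f" and h: "0 < h"
  shows "\<exists>p. norm (p - x) \<le> 2 * h \<and>
    f (x + h *\<^sub>R axis i 1 + h *\<^sub>R axis j 1) - f (x + h *\<^sub>R axis i 1) - f (x + h *\<^sub>R axis j 1) + f x
      = h * (h * partial j (partial i f) p)"
proof -
  let ?g = "\<lambda>t. f (x + h *\<^sub>R axis j 1 + t *\<^sub>R axis i 1) - f (x + t *\<^sub>R axis i 1)"
  have "DERIV ?g t :> partial i f (x + h *\<^sub>R axis j 1 + t *\<^sub>R axis i 1) - partial i f (x + t *\<^sub>R axis i 1)" for t
    by (intro DERIV_diff smooth_line_derivative f)
  then obtain a where a: "0 < a" "a < h" "?g h - ?g 0
      = (h - 0) * (partial i f (x + h *\<^sub>R axis j 1 + a *\<^sub>R axis i 1) - partial i f (x + a *\<^sub>R axis i 1))"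
    using MVT2[OF h, of ?g "\<lambda>t. partial i f (x + h *\<^sub>R axis j 1 + t *\<^sub>R axis i 1) - partial i f (x + t *\<^sub>R axis i 1)"]
    by blast
  let ?k = "\<lambda>t. partial i f (x + a *\<^sub>R axis i 1 + t *\<^sub>R axis j 1)"
  have "DERIV ?k t :> partial j (partial i f) (x + a *\<^sub>R axis i 1 + t *\<^sub>R axis j 1)" for t
    by (rule smooth_line_derivative[OF smooth_partial[OF f]])
  then obtain b where b: "0 < b" "b < h" "?k h - ?k 0
      = (h - 0) * partial j (partial i f) (x + a *\<^sub>R axis i 1 + b *\<^sub>R axis j 1)"
    using MVT2[OF h, of ?k "\<lambda>t. partial j (partial i f) (x + a *\<^sub>R axis i 1 + t *\<^sub>R axis j 1)"] by blast
  have "norm ((x + a *\<^sub>R axis i 1 + b *\<^sub>R axis j 1) - x) \<le> norm (a *\<^sub>R axis i (1::real)) + norm (b *\<^sub>R axis j (1::real))"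
    using norm_triangle_ineq[of "a *\<^sub>R axis i (1::real)" "b *\<^sub>R axis j 1"] by (simp add: algebra_simps)
  also have "\<dots> \<le> 2 * h" using a b by simp
  finally show ?thesis
    using a(3) b(3) by (intro exI[of _ "x + a *\<^sub>R axis i 1 + b *\<^sub>R axis j 1"]) (simp add: algebra_simps)
qed

text \<open>The second difference is symmetric in i and j, so the two mixed derivatives take equal
  values at points arbitrarily close to x, and continuity does the rest. The lemma serves to show
  that a gradient has zero curl.\<close>

lemma partial_commute:
  fixes f :: "real^'n::finite \<Rightarrow> real"
  assumes f: "smooth f"
  shows "partial i (partial j f) x = partial j (partial i f) x"
proof (rule ccontr)
  let ?A = "partial i (partial j f)" and ?B = "partial j (partial i f)"
  assume "?A x \<noteq> ?B x"
  then have e: "0 < \<bar>?A x - ?B x\<bar> / 2" by simp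
  have "isCont ?A x" "isCont ?B x"
    using smooth_continuous[OF smooth_partial[OF smooth_partial[OF f]], of UNIV]
    by (auto simp: continuous_on_eq_continuous_at)
  then obtain d1 d2 where d: "0 < d1" "\<And>y. norm (y - x) < d1 \<Longrightarrow> \<bar>?A y - ?A x\<bar> < \<bar>?A x - ?B x\<bar> / 2"
    "0 < d2" "\<And>y. norm (y - x) < d2 \<Longrightarrow> \<bar>?B y - ?B x\<bar> < \<bar>?A x - ?B x\<bar> / 2"
    using e unfolding continuous_at_eps_delta by (metis dist_norm dist_real_def)
  define h where "h = min d1 d2 / 4"
  have h: "0 < h" "2 * h < d1" "2 * h < d2" using d(1,3) by (auto simp: h_def)
  obtain p where p: "norm (p - x) \<le> 2 * h"
    "f (x + h *\<^sub>R axis j 1 + h *\<^sub>R axis i 1) - f (x + h *\<^sub>R axis j 1) - f (x + h *\<^sub>R axis i 1) + f x = h * (h * ?A p)"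
    using second_difference[OF f h(1), of x j i] by blast
  obtain q where q: "norm (q - x) \<le> 2 * h"
    "f (x + h *\<^sub>R axis i 1 + h *\<^sub>R axis j 1) - f (x + h *\<^sub>R axis i 1) - f (x + h *\<^sub>R axis j 1) + f x = h * (h * ?B q)"
    using second_difference[OF f h(1), of x i j] by blast
  have "h * (h * ?A p) = h * (h * ?B q)" using p(2) q(2) by (simp add: algebra_simps)
  then have "?A p = ?B q" using h(1) by simp
  moreover have "\<bar>?A p - ?A x\<bar> < \<bar>?A x - ?B x\<bar> / 2" "\<bar>?B q - ?B x\<bar> < \<bar>?A x - ?B x\<bar> / 2"
    using d(2)[of p] d(4)[of q] p(1) q(1) h by auto
  \<comment> \<open>A number closer to a than half their distance cannot also be that close to
    b.\<close>
  moreover have "False" if "s = t" "\<bar>s - a\<bar> < \<bar>a - b\<bar> / 2" "\<bar>t - b\<bar> < \<bar>a - b\<bar> / 2" for a b s t :: real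
    using that by (simp add: abs_if split: if_splits)
  ultimately show False by blast
qed

section \<open>Vector fields, weak curl and weak divergence\<close>

lemma L2_vec_iff: "u \<in> L2 M \<longleftrightarrow> (\<forall>k. (\<lambda>x. u x $ k) \<in> L2 M)" for u :: "'a \<Rightarrow> real^'n::finite"
proof
  assume u: "u \<in> L2 M"
  have n: "(\<lambda>x. norm (u x)) \<in> L2 M" using u by (auto simp: L2_def)
  show "\<forall>k. (\<lambda>x. u x $ k) \<in> L2 M"
  proof
    fix k
    have "(\<lambda>x. u x \<bullet> axis k 1) \<in> borel_measurable M" using L2_measurable[OF u] by measurable
    then show "(\<lambda>x. u x $ k) \<in> L2 M"
      by (intro L2_dominated[OF n]) (simp_all add: inner_axis component_le_norm_cart)
  qed
next
  assume u: "\<forall>k. (\<lambda>x. u x $ k) \<in> L2 M"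
  have "u \<in> borel_measurable M"
    unfolding borel_measurable_euclidean_space[of u]
    using u by (auto simp: Basis_vec_def inner_axis L2_real_iff)
  moreover have "integrable M (\<lambda>x. \<Sum>k\<in>UNIV. (u x $ k)\<^sup>2)" using u by (auto simp: L2_real_iff)
  moreover have "(norm v)\<^sup>2 = (\<Sum>k\<in>UNIV. (v $ k)\<^sup>2)" for v :: "real^'n"
    unfolding power2_norm_eq_inner by (simp add: inner_vec_def power2_eq_square)
  ultimately show "u \<in> L2 M" by (simp add: L2_def)
qed

lemma L2_vec_nth: "u \<in> L2 M \<Longrightarrow> (\<lambda>x. u x $ k) \<in> L2 M" for u :: "'a \<Rightarrow> real^'n::finite"
  using L2_vec_iff by blast

lemma integral_inner_L2:
  fixes u v :: "'a \<Rightarrow> real^'n::finite"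
  assumes "u \<in> L2 M" "v \<in> L2 M"
  shows "(LINT x|M. u x \<bullet> v x) = (\<Sum>k\<in>UNIV. (LINT x|M. u x $ k * v x $ k))"
  unfolding inner_vec_def inner_real_def
  by (rule Bochner_Integration.integral_sum) (intro L2_mult_integrable L2_vec_nth assms)

lemma norm_square_inner: "(norm v)\<^sup>2 = v \<bullet> v" for v :: "real^'n::finite"
  by (rule power2_norm_eq_inner)

lemma curl_axis:
  "curl (\<lambda>x. \<phi> x *\<^sub>R axis 1 1) x = vector [0, partial 3 \<phi> x, - partial 2 \<phi> x]"
  "curl (\<lambda>x. \<phi> x *\<^sub>R axis 2 1) x = vector [- partial 3 \<phi> x, 0, partial 1 \<phi> x]"
  "curl (\<lambda>x. \<phi> x *\<^sub>R axis 3 1) x = vector [partial 2 \<phi> x, - partial 1 \<phi> x, 0]"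
  by (simp_all add: curl_def axis_def)

lemma inner_vector_3: "u \<bullet> vector [a, b, c] = u $ 1 * a + u $ 2 * b + u $ 3 * c" for u :: "real^3"
  by (simp add: inner_vec_def sum_3)

lemma test_field_axis: "test_function \<Omega> \<phi> \<Longrightarrow> test_field \<Omega> (\<lambda>x. \<phi> x *\<^sub>R axis k 1)"
  unfolding test_field_def by (simp add: axis_def)

lemma curl_grad: "smooth f \<Longrightarrow> curl (grad f) x = 0"
  by (simp add: curl_def grad_def vec3_eq_iff partial_commute[of f] cong: if_cong)

context C11_bounded
begin

abbreviation "\<mu> \<equiv> lebesgue_on \<Omega>"

definition "smooth_field F \<longleftrightarrow> (\<forall>k. smooth (\<lambda>x. F x $ k))" for F :: "real^3 \<Rightarrow> real^3"

lemma test_field_smooth: "test_field \<Omega> \<phi> \<Longrightarrow> smooth_field \<phi>"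
  by (auto simp: test_field_def smooth_field_def intro: test_function_smooth)

lemma smooth_field_L2: "smooth_field F \<Longrightarrow> F \<in> L2 \<mu>"
  unfolding L2_vec_iff smooth_field_def using smooth_L2_domain by blast

lemma smooth_field_curl: "smooth_field F \<Longrightarrow> smooth_field (curl F)"
  unfolding smooth_field_def curl_def forall_3
  by (auto intro!: smooth_diff smooth_partial)

lemma smooth_field_axis: "smooth \<phi> \<Longrightarrow> smooth_field (\<lambda>x. \<phi> x *\<^sub>R axis k 1)"
  unfolding smooth_field_def by (auto simp: axis_def)

lemma smooth_field_grad: "smooth \<phi> \<Longrightarrow> smooth_field (grad \<phi>)"
  unfolding smooth_field_def grad_def by (auto intro: smooth_partial)

lemma smooth_has_weak_curl:
  assumes F: "smooth_field F" shows "has_weak_curl \<Omega> F (curl F)"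
  unfolding has_weak_curl_def
proof (intro allI impI)
  fix \<phi> assume \<phi>: "test_field \<Omega> \<phi>"
  let ?F = "\<lambda>k x. F x $ k" and ?\<phi> = "\<lambda>k x. \<phi> x $ k"
  have FS: "smooth (?F k)" for k using F by (simp add: smooth_field_def)
  have \<phi>t: "test_function \<Omega> (?\<phi> k)" for k using \<phi> by (simp add: test_field_def)
  have \<phi>S: "smooth (?\<phi> k)" for k by (rule test_function_smooth[OF \<phi>t])
  have ibp: "(LINT x|\<mu>. ?F j x * partial i (?\<phi> k) x) = - (LINT x|\<mu>. partial i (?F j) x * ?\<phi> k x)" for i j k
    using bo.smooth_has_weak_partial[OF FS] \<phi>t unfolding has_weak_partial_def by blast
  have int: "integrable \<mu> (\<lambda>x. ?F j x * partial i (?\<phi> k) x)" "integrable \<mu> (\<lambda>x. partial i (?F j) x * ?\<phi> k x)" for i j k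
    by (intro smooth_integrable_domain smooth_mult smooth_partial FS \<phi>S)+
  have "(LINT x|\<mu>. F x \<bullet> curl \<phi> x) = (LINT x|\<mu>.
      (?F 1 x * partial 2 (?\<phi> 3) x - ?F 1 x * partial 3 (?\<phi> 2) x) + ((?F 2 x * partial 3 (?\<phi> 1) x - ?F 2 x * partial 1 (?\<phi> 3) x)
      + (?F 3 x * partial 1 (?\<phi> 2) x - ?F 3 x * partial 2 (?\<phi> 1) x)))"
    by (rule Bochner_Integration.integral_cong) (auto simp: curl_def inner_vector_3 algebra_simps)
  also have "\<dots> = ((LINT x|\<mu>. ?F 1 x * partial 2 (?\<phi> 3) x) - (LINT x|\<mu>. ?F 1 x * partial 3 (?\<phi> 2) x))
      + (((LINT x|\<mu>. ?F 2 x * partial 3 (?\<phi> 1) x) - (LINT x|\<mu>. ?F 2 x * partial 1 (?\<phi> 3) x))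
      + ((LINT x|\<mu>. ?F 3 x * partial 1 (?\<phi> 2) x) - (LINT x|\<mu>. ?F 3 x * partial 2 (?\<phi> 1) x)))"
    by (simp add: int)
  also have "\<dots> = ((LINT x|\<mu>. partial 3 (?F 1) x * ?\<phi> 2 x) - (LINT x|\<mu>. partial 2 (?F 1) x * ?\<phi> 3 x))
      + (((LINT x|\<mu>. partial 1 (?F 2) x * ?\<phi> 3 x) - (LINT x|\<mu>. partial 3 (?F 2) x * ?\<phi> 1 x))
      + ((LINT x|\<mu>. partial 2 (?F 3) x * ?\<phi> 1 x) - (LINT x|\<mu>. partial 1 (?F 3) x * ?\<phi> 2 x)))"
    unfolding ibp by simp
  also have "\<dots> = (LINT x|\<mu>. (partial 3 (?F 1) x * ?\<phi> 2 x - partial 2 (?F 1) x * ?\<phi> 3 x)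
      + ((partial 1 (?F 2) x * ?\<phi> 3 x - partial 3 (?F 2) x * ?\<phi> 1 x)
      + (partial 2 (?F 3) x * ?\<phi> 1 x - partial 1 (?F 3) x * ?\<phi> 2 x)))"
    by (simp add: int)
  also have "\<dots> = (LINT x|\<mu>. curl F x \<bullet> \<phi> x)"
    by (rule Bochner_Integration.integral_cong)
      (auto simp: curl_def inner_commute[of "vector _"] inner_vector_3 algebra_simps)
  finally show "(LINT x|\<mu>. F x \<bullet> curl \<phi> x) = (LINT x|\<mu>. curl F x \<bullet> \<phi> x)" .
qed

lemma test_field_has_weak_div:
  assumes \<phi>: "smooth_field F" shows "has_weak_div \<Omega> F (\<lambda>x. \<Sum>k\<in>UNIV. partial k (\<lambda>y. F y $ k) x)"
  unfolding has_weak_div_def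
proof (intro allI impI)
  fix \<phi> assume \<phi>: "test_function \<Omega> \<phi>"
  have FS: "smooth (\<lambda>y. F y $ k)" for k using assms by (simp add: smooth_field_def)
  have "(LINT x|\<mu>. F x \<bullet> grad \<phi> x) = (\<Sum>k\<in>UNIV. (LINT x|\<mu>. F x $ k * partial k \<phi> x))"
    by (subst integral_inner_L2)
      (use assms \<phi> in \<open>auto intro!: smooth_field_L2 smooth_field_grad test_function_smooth simp: grad_def\<close>)
  also have "\<dots> = (\<Sum>k\<in>UNIV. - (LINT x|\<mu>. partial k (\<lambda>y. F y $ k) x * \<phi> x))"
    using bo.smooth_has_weak_partial[OF FS] \<phi> unfolding has_weak_partial_def by simp
  also have "\<dots> = - (LINT x|\<mu>. (\<Sum>k\<in>UNIV. partial k (\<lambda>y. F y $ k) x * \<phi> x))"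
    by (subst Bochner_Integration.integral_sum)
      (auto intro!: smooth_integrable_domain smooth_mult smooth_partial FS test_function_smooth[OF \<phi>] simp: sum_negf)
  finally show "(LINT x|\<mu>. F x \<bullet> grad \<phi> x) = - (LINT x|\<mu>. (\<Sum>k\<in>UNIV. partial k (\<lambda>y. F y $ k) x) * \<phi> x)"
    by (simp add: sum_distrib_right)
qed

lemma weak_curl_unique:
  assumes L2: "w \<in> L2 \<mu>" "w' \<in> L2 \<mu>" and w: "has_weak_curl \<Omega> u w" "has_weak_curl \<Omega> u w'"
  shows "AE x in \<mu>. w x = w' x"
proof -
  have comp: "AE x in \<mu>. w x $ k = w' x $ k" for k
  proof -
    have "AE x in \<mu>. w x $ k - w' x $ k = 0"
    proof (rule fundamental_lemma[OF bounded_\<Omega> open_\<Omega> L2_diff[OF L2_vec_nth[OF L2(1)] L2_vec_nth[OF L2(2)]]])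
      fix \<phi> assume \<phi>: "test_function \<Omega> \<phi>"
      have "(LINT x|\<mu>. w x \<bullet> (\<phi> x *\<^sub>R axis k 1)) = (LINT x|\<mu>. w' x \<bullet> (\<phi> x *\<^sub>R axis k 1))"
        using w[unfolded has_weak_curl_def, rule_format, OF test_field_axis[OF \<phi>, of k]] by (rule trans[OF sym])
      then have "(LINT x|\<mu>. w x $ k * \<phi> x) = (LINT x|\<mu>. w' x $ k * \<phi> x)"
        by (simp add: inner_axis mult.commute)
      then show "(LINT x|\<mu>. (w x $ k - w' x $ k) * \<phi> x) = 0"
        using bo.L2_integrable_mult[OF L2_vec_nth[OF L2(1)] test_function_smooth[OF \<phi>], of k]
          bo.L2_integrable_mult[OF L2_vec_nth[OF L2(2)] test_function_smooth[OF \<phi>], of k]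
        by (simp add: left_diff_distrib)
    qed
    then show ?thesis by eventually_elim simp
  qed
  show ?thesis
    using comp[of 1] comp[of 2] comp[of 3] by eventually_elim (simp add: vec3_eq_iff)
qed

lemma weak_curl_props:
  assumes "w \<in> L2 \<mu>" "has_weak_curl \<Omega> u w"
  shows "weak_curl \<Omega> u \<in> L2 \<mu>" "has_weak_curl \<Omega> u (weak_curl \<Omega> u)" "AE x in \<mu>. weak_curl \<Omega> u x = w x"
proof -
  have *: "weak_curl \<Omega> u \<in> L2 \<mu> \<and> has_weak_curl \<Omega> u (weak_curl \<Omega> u)"
    using someI_ex[of "\<lambda>w. w \<in> L2 \<mu> \<and> has_weak_curl \<Omega> u w"] assms unfolding weak_curl_def by blast
  then show "weak_curl \<Omega> u \<in> L2 \<mu>" "has_weak_curl \<Omega> u (weak_curl \<Omega> u)" by blast+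
  show "AE x in \<mu>. weak_curl \<Omega> u x = w x"
    by (rule weak_curl_unique) (use * assms in blast)+
qed

lemma weak_div_props:
  assumes "d \<in> L2 \<mu>" "has_weak_div \<Omega> u d"
  shows "weak_div \<Omega> u \<in> L2 \<mu>" "has_weak_div \<Omega> u (weak_div \<Omega> u)"
  using someI_ex[of "\<lambda>d. d \<in> L2 \<mu> \<and> has_weak_div \<Omega> u d"] assms unfolding weak_div_def by blast+

text \<open>The scalar identity behind each component of the curl; \<open>a\<close> and
  \<open>b\<close> are the two field components that occur in it.\<close>

lemma curl_component_AE:
  assumes L2: "a \<in> L2 \<mu>" "b \<in> L2 \<mu>" "p \<in> L2 \<mu>" "q \<in> L2 \<mu>" "w \<in> L2 \<mu>"
    and wp: "has_weak_partial \<Omega> i a p" "has_weak_partial \<Omega> j b q"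
    and eq: "\<And>\<phi>. test_function \<Omega> \<phi> \<Longrightarrow> (LINT x|\<mu>. a x * partial i \<phi> x - b x * partial j \<phi> x) = (LINT x|\<mu>. w x * \<phi> x)"
  shows "AE x in \<mu>. w x = q x - p x"
proof -
  have "AE x in \<mu>. w x - (q x - p x) = 0"
  proof (rule fundamental_lemma[OF bounded_\<Omega> open_\<Omega>])
    show "(\<lambda>x. w x - (q x - p x)) \<in> L2 \<mu>" by (intro L2_diff L2)
    fix \<phi> assume \<phi>: "test_function \<Omega> \<phi>"
    have S: "smooth \<phi>" "smooth (partial i \<phi>)" "smooth (partial j \<phi>)"
      using \<phi> by (auto intro: test_function_smooth smooth_partial)
    have "(LINT x|\<mu>. w x * \<phi> x) = (LINT x|\<mu>. a x * partial i \<phi> x) - (LINT x|\<mu>. b x * partial j \<phi> x)"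
      using eq[OF \<phi>] bo.L2_integrable_mult[OF L2(1) S(2)] bo.L2_integrable_mult[OF L2(2) S(3)] by simp
    also have "\<dots> = (LINT x|\<mu>. q x * \<phi> x) - (LINT x|\<mu>. p x * \<phi> x)"
      using wp \<phi> by (simp add: has_weak_partial_def)
    finally show "(LINT x|\<mu>. (w x - (q x - p x)) * \<phi> x) = 0"
      using bo.L2_integrable_mult[OF L2(3) S(1)] bo.L2_integrable_mult[OF L2(4) S(1)] bo.L2_integrable_mult[OF L2(5) S(1)]
      by (simp add: left_diff_distrib)
  qed
  then show ?thesis by eventually_elim simp
qed

text \<open>\<open>D j i\<close> stands for the weak derivative of the component \<open>u\<^sub>j\<close> in direction \<open>i\<close>.\<close>

definition H1_field :: "(real^3 \<Rightarrow> real^3) \<Rightarrow> (3 \<Rightarrow> 3 \<Rightarrow> real^3 \<Rightarrow> real) \<Rightarrow> bool" where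
  "H1_field u D \<longleftrightarrow> (\<forall>j. bo.H1_deriv (\<lambda>x. u x $ j) (D j))"

definition curl_of :: "(3 \<Rightarrow> 3 \<Rightarrow> real^3 \<Rightarrow> real) \<Rightarrow> real^3 \<Rightarrow> real^3" where
  "curl_of D x = vector [D 3 2 x - D 2 3 x, D 1 3 x - D 3 1 x, D 2 1 x - D 1 2 x]"

lemma H1_fieldD:
  assumes "H1_field u D"
  shows "bo.H1_deriv (\<lambda>x. u x $ j) (D j)" "(\<lambda>x. u x $ j) \<in> L2 \<mu>" "D j i \<in> L2 \<mu>"
    "has_weak_partial \<Omega> i (\<lambda>x. u x $ j) (D j i)" "u \<in> L2 \<mu>"
  using assms bo.H1_derivD[of "\<lambda>x. u x $ j" "D j"] bo.H1_derivD(1)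
  unfolding H1_field_def L2_vec_iff[of u] by blast+

text \<open>Test fields \<open>\<phi> x *\<^sub>R axis k 1\<close> isolate the components, and the
  weak partial derivatives identify each of them.\<close>

lemma weak_curl_AE:
  assumes H: "H1_field u D" and w: "w \<in> L2 \<mu>" "has_weak_curl \<Omega> u w"
  shows "AE x in \<mu>. w x = curl_of D x"
proof -
  have wk: "(\<lambda>x. w x $ k) \<in> L2 \<mu>" for k by (rule L2_vec_nth[OF w(1)])
  have eq: "(LINT x|\<mu>. u x \<bullet> curl (\<lambda>x. \<phi> x *\<^sub>R axis k 1) x) = (LINT x|\<mu>. w x $ k * \<phi> x)"
    if "test_function \<Omega> \<phi>" for \<phi> k
    using w(2) test_field_axis[OF that, of k] unfolding has_weak_curl_def by (simp add: inner_axis mult.commute)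
  have "AE x in \<mu>. w x $ 1 = D 3 2 x - D 2 3 x"
    using eq[of _ 1] by (intro curl_component_AE[OF H1_fieldD(2)[OF H] H1_fieldD(2)[OF H] H1_fieldD(3)[OF H] H1_fieldD(3)[OF H] wk
        H1_fieldD(4)[OF H, of 3 2] H1_fieldD(4)[OF H, of 2 3]]) (simp add: curl_axis inner_vector_3)
  moreover have "AE x in \<mu>. w x $ 2 = D 1 3 x - D 3 1 x"
    using eq[of _ 2] by (intro curl_component_AE[OF H1_fieldD(2)[OF H] H1_fieldD(2)[OF H] H1_fieldD(3)[OF H] H1_fieldD(3)[OF H] wk
        H1_fieldD(4)[OF H, of 1 3] H1_fieldD(4)[OF H, of 3 1]]) (simp add: curl_axis inner_vector_3)
  moreover have "AE x in \<mu>. w x $ 3 = D 2 1 x - D 1 2 x"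
    using eq[of _ 3] by (intro curl_component_AE[OF H1_fieldD(2)[OF H] H1_fieldD(2)[OF H] H1_fieldD(3)[OF H] H1_fieldD(3)[OF H] wk
        H1_fieldD(4)[OF H, of 2 1] H1_fieldD(4)[OF H, of 1 2]]) (simp add: curl_axis inner_vector_3)
  ultimately show ?thesis by eventually_elim (simp add: vec3_eq_iff curl_of_def)
qed

lemma weak_div_AE:
  assumes H: "H1_field u D" and u: "\<And>\<phi>. test_function \<Omega> \<phi> \<Longrightarrow> (LINT x|\<mu>. u x \<bullet> grad \<phi> x) = 0"
  shows "AE x in \<mu>. (\<Sum>k\<in>UNIV. D k k x) = 0"
proof (rule fundamental_lemma[OF bounded_\<Omega> open_\<Omega>])
  show "(\<lambda>x. \<Sum>k\<in>UNIV. D k k x) \<in> L2 \<mu>" by (intro L2_sum H1_fieldD(3)[OF H])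
  fix \<phi> assume \<phi>: "test_function \<Omega> \<phi>"
  have S: "smooth \<phi>" by (rule test_function_smooth[OF \<phi>])
  have "0 = (\<Sum>k\<in>UNIV. (LINT x|\<mu>. u x $ k * grad \<phi> x $ k))"
    unfolding u[OF \<phi>, symmetric]
    by (rule integral_inner_L2[OF H1_fieldD(5)[OF H] smooth_field_L2[OF smooth_field_grad[OF S]]])
  also have "\<dots> = (\<Sum>k\<in>UNIV. - (LINT x|\<mu>. D k k x * \<phi> x))"
    using H1_fieldD(4)[OF H] \<phi> unfolding has_weak_partial_def grad_def by simp
  also have "\<dots> = - (LINT x|\<mu>. (\<Sum>k\<in>UNIV. D k k x * \<phi> x))"
    by (subst Bochner_Integration.integral_sum) (auto intro!: bo.L2_integrable_mult H1_fieldD(3)[OF H] S simp: sum_negf)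
  finally show "(LINT x|\<mu>. (\<Sum>k\<in>UNIV. D k k x) * \<phi> x) = 0" by (simp add: sum_distrib_right)
qed

lemma H1_deriv_diff: "bo.H1_deriv u d \<Longrightarrow> bo.H1_deriv v e \<Longrightarrow> bo.H1_deriv (\<lambda>x. u x - v x) (\<lambda>i x. d i x - e i x)"
  unfolding bo.H1_deriv_def by (auto intro!: L2_diff bo.has_weak_partial_diff)

lemma H1_deriv_cong:
  assumes "bo.H1_deriv u d" "v \<in> L2 \<mu>" "AE x in \<mu>. v x = u x" shows "bo.H1_deriv v d"
  using assms bo.has_weak_partial_cong[of _ u _ v] unfolding bo.H1_deriv_def
  by (auto simp: L2_measurable eq_commute)

text \<open>The components of the curl are differences of first derivatives, which lie in H1 when
  the field is in H2. This gives \<open>curl E\<close> a trace.\<close>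

lemma H2_curl_H1:
  assumes H: "H1_field u D" and D: "\<And>j i. \<exists>e. bo.H1_deriv (D j i) e"
    and w: "w \<in> L2 \<mu>" "AE x in \<mu>. w x = curl_of D x"
  shows "\<exists>D'. H1_field w D'"
proof -
  obtain e where e: "\<And>j i. bo.H1_deriv (D j i) (e j i)" using D by metis
  have wk: "(\<lambda>x. w x $ k) \<in> L2 \<mu>" for k by (rule L2_vec_nth[OF w(1)])
  have ae: "AE x in \<mu>. w x $ 1 = D 3 2 x - D 2 3 x" "AE x in \<mu>. w x $ 2 = D 1 3 x - D 3 1 x"
    "AE x in \<mu>. w x $ 3 = D 2 1 x - D 1 2 x"
    using w(2) by (eventually_elim, simp add: curl_of_def)+
  have "\<exists>d. bo.H1_deriv (\<lambda>x. w x $ k) d" for k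
  proof -
    consider "k = 1" | "k = 2" | "k = 3" using exhaust_3 by blast
    then show ?thesis
    proof cases
      case 1 then show ?thesis using H1_deriv_cong[OF H1_deriv_diff[OF e e] wk ae(1)] by blast
    next
      case 2 then show ?thesis using H1_deriv_cong[OF H1_deriv_diff[OF e e] wk ae(2)] by blast
    next
      case 3 then show ?thesis using H1_deriv_cong[OF H1_deriv_diff[OF e e] wk ae(3)] by blast
    qed
  qed
  then show ?thesis unfolding H1_field_def by metis
qed

text \<open>Makes test fields admissible in the eigenvalue equation. A test field approximates
  itself; what remains is that the curl chosen for the zero field vanishes almost
  everywhere.\<close>

lemma test_field_X_N:
  assumes \<phi>: "test_field \<Omega> \<phi>" shows "\<phi> \<in> X_N \<Omega>"
proof -
  have S: "smooth_field \<phi>" by (rule test_field_smooth[OF \<phi>])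
  have L: "\<phi> \<in> L2 \<mu>" by (rule smooth_field_L2[OF S])
  have "(\<lambda>x. \<Sum>k\<in>UNIV. partial k (\<lambda>y. \<phi> y $ k) x) \<in> L2 \<mu>"
    using S by (intro smooth_L2_domain smooth_sum smooth_partial) (auto simp: smooth_field_def)
  then have div: "\<phi> \<in> H_div \<Omega>" using L test_field_has_weak_div[OF S] unfolding H_div_def by blast
  have curl: "\<phi> \<in> H_curl \<Omega>"
    using L smooth_field_L2[OF smooth_field_curl[OF S]] smooth_has_weak_curl[OF S] unfolding H_curl_def by blast
  have "H_curl_norm \<Omega> (\<lambda>x. \<phi> x - \<phi> x) = 0"
  proof -
    have "has_weak_curl \<Omega> (\<lambda>x. 0) (\<lambda>x. 0)" by (simp add: has_weak_curl_def)
    moreover have "(\<lambda>x. 0 :: real^3) \<in> L2 \<mu>" by (simp add: L2_def)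
    ultimately have "AE x in \<mu>. weak_curl \<Omega> (\<lambda>x. 0) x = 0" by (rule weak_curl_props(3)[rotated])
    then have "AE x in \<mu>. (norm (weak_curl \<Omega> (\<lambda>x. 0) x))\<^sup>2 = 0" by eventually_elim simp
    then have "(LINT x|\<mu>. (norm (weak_curl \<Omega> (\<lambda>x. 0) x))\<^sup>2) = 0" by (rule integral_eq_zero_AE)
    then show ?thesis by (simp add: H_curl_norm_def)
  qed
  then have "\<forall>\<epsilon>>0. \<exists>\<psi>. test_field \<Omega> \<psi> \<and> H_curl_norm \<Omega> (\<lambda>x. \<phi> x - \<psi> x) < \<epsilon>"
    using \<phi> by (intro allI impI exI[of _ \<phi>]) simp
  then show ?thesis using curl div by (simp add: X_N_def H0_curl_def)
qed

text \<open>The weak form of the boundary condition \<open>\<nu> \<times> E = 0\<close>.\<close>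

lemma H0_curl_smooth:
  assumes E: "E \<in> H0_curl \<Omega>" and F: "smooth_field F"
  shows "(LINT x|\<mu>. E x \<bullet> curl F x) = (LINT x|\<mu>. weak_curl \<Omega> E x \<bullet> F x)"
proof -
  let ?W = "weak_curl \<Omega> E"
  obtain w where w: "E \<in> L2 \<mu>" "w \<in> L2 \<mu>" "has_weak_curl \<Omega> E w"
    using E by (auto simp: H0_curl_def H_curl_def)
  note W = weak_curl_props[OF w(2,3)]
  have "\<forall>n. \<exists>\<psi>. test_field \<Omega> \<psi> \<and> H_curl_norm \<Omega> (\<lambda>x. E x - \<psi> x) < inverse (real (Suc n))"
    using E by (auto simp: H0_curl_def)
  from choice[OF this] obtain \<psi> where \<psi>: "\<And>n. test_field \<Omega> (\<psi> n)"
    "\<And>n. H_curl_norm \<Omega> (\<lambda>x. E x - \<psi> n x) < inverse (real (Suc n))" by blast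
  have S: "smooth_field (\<psi> n)" for n by (rule test_field_smooth[OF \<psi>(1)])
  have \<psi>L: "\<psi> n \<in> L2 \<mu>" "curl (\<psi> n) \<in> L2 \<mu>" for n
    by (intro smooth_field_L2 smooth_field_curl S)+
  have dL: "(\<lambda>x. E x - \<psi> n x) \<in> L2 \<mu>" "(\<lambda>x. ?W x - curl (\<psi> n) x) \<in> L2 \<mu>" for n
    using w(1) W(1) \<psi>L[of n] unfolding L2_vec_iff by (auto intro: L2_diff)
  have dcurl: "has_weak_curl \<Omega> (\<lambda>x. E x - \<psi> n x) (\<lambda>x. ?W x - curl (\<psi> n) x)" for n
    unfolding has_weak_curl_def
  proof (intro allI impI)
    fix \<phi> assume \<phi>: "test_field \<Omega> \<phi>"
    have \<phi>L: "\<phi> \<in> L2 \<mu>" "curl \<phi> \<in> L2 \<mu>"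
      by (intro smooth_field_L2 smooth_field_curl test_field_smooth[OF \<phi>])+
    have int: "integrable \<mu> (\<lambda>x. a x \<bullet> b x)" if "a \<in> L2 \<mu>" "b \<in> L2 \<mu>" for a b :: "real^3 \<Rightarrow> real^3"
      unfolding inner_vec_def inner_real_def
      by (intro Bochner_Integration.integrable_sum L2_mult_integrable L2_vec_nth that)
    show "(LINT x|\<mu>. (E x - \<psi> n x) \<bullet> curl \<phi> x) = (LINT x|\<mu>. (?W x - curl (\<psi> n) x) \<bullet> \<phi> x)"
      using W(2) smooth_has_weak_curl[OF S[of n]] \<phi>
      by (simp add: inner_diff_left int w(1) W(1) \<psi>L \<phi>L has_weak_curl_def)
  qed
  let ?a = "\<lambda>n. LINT x|\<mu>. (norm (E x - \<psi> n x))\<^sup>2" and ?b = "\<lambda>n. LINT x|\<mu>. (norm (?W x - curl (\<psi> n) x))\<^sup>2"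
  have norm: "H_curl_norm \<Omega> (\<lambda>x. E x - \<psi> n x) = sqrt (?a n + ?b n)" for n
  proof -
    note p = weak_curl_props[OF dL(2) dcurl, of n]
    have "(LINT x|\<mu>. (norm (weak_curl \<Omega> (\<lambda>x. E x - \<psi> n x) x))\<^sup>2) = ?b n"
    proof (rule integral_cong_AE)
      show "AE x in \<mu>. (norm (weak_curl \<Omega> (\<lambda>x. E x - \<psi> n x) x))\<^sup>2 = (norm (?W x - curl (\<psi> n) x))\<^sup>2"
        using p(3) by eventually_elim simp
    qed (use p(1) dL(2)[of n] in \<open>auto simp: L2_def\<close>)
    then show ?thesis by (simp add: H_curl_norm_def)
  qed
  have nn: "0 \<le> ?a n" "0 \<le> ?b n" for n by simp_all
  have "(\<lambda>n. sqrt (?a n + ?b n)) \<longlonglongrightarrow> 0"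
    using \<psi>(2) nn unfolding norm
    by (intro tendsto_sandwich[OF _ _ tendsto_const LIMSEQ_inverse_real_of_nat])
      (auto intro!: always_eventually less_imp_le)
  then have "(\<lambda>n. (sqrt (?a n + ?b n))\<^sup>2) \<longlonglongrightarrow> 0\<^sup>2" by (rule tendsto_power)
  then have ab: "(\<lambda>n. ?a n + ?b n) \<longlonglongrightarrow> 0" using nn by simp
  have comp: "(\<lambda>n. LINT x|\<mu>. (v n x $ k - u x $ k)\<^sup>2) \<longlonglongrightarrow> 0"
    if "\<And>n. (\<lambda>x. u x - v n x) \<in> L2 \<mu>" "\<And>n. (LINT x|\<mu>. (norm (u x - v n x))\<^sup>2) \<le> ?a n + ?b n"
    for u and v :: "nat \<Rightarrow> real^3 \<Rightarrow> real^3" and k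
  proof (rule tendsto_sandwich[OF _ _ tendsto_const ab])
    have "(LINT x|\<mu>. (v n x $ k - u x $ k)\<^sup>2) \<le> (LINT x|\<mu>. (norm (u x - v n x))\<^sup>2)" for n
    proof (rule integral_mono)
      show "integrable \<mu> (\<lambda>x. (v n x $ k - u x $ k)\<^sup>2)"
        using L2_vec_nth[OF that(1)[of n], of k] by (simp add: L2_real_iff power2_commute)
      show "integrable \<mu> (\<lambda>x. (norm (u x - v n x))\<^sup>2)" using that(1)[of n] by (simp add: L2_def)
      show "(v n x $ k - u x $ k)\<^sup>2 \<le> (norm (u x - v n x))\<^sup>2" for x
        using power_mono[OF component_le_norm_cart[of "u x - v n x" k], of 2] by (simp add: power2_commute)
    qed
    then show "\<forall>\<^sub>F n in sequentially. (LINT x|\<mu>. (v n x $ k - u x $ k)\<^sup>2) \<le> ?a n + ?b n"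
      using that(2) order_trans by (intro always_eventually) blast
  qed simp
  have inner_lim: "(\<lambda>n. LINT x|\<mu>. v n x \<bullet> G x) \<longlonglongrightarrow> (LINT x|\<mu>. u x \<bullet> G x)"
    if "\<And>n. (\<lambda>x. u x - v n x) \<in> L2 \<mu>" "\<And>n. (LINT x|\<mu>. (norm (u x - v n x))\<^sup>2) \<le> ?a n + ?b n"
      "u \<in> L2 \<mu>" "\<And>n. v n \<in> L2 \<mu>" "G \<in> L2 \<mu>" for u v and G :: "real^3 \<Rightarrow> real^3"
    unfolding integral_inner_L2[OF that(3,5)] integral_inner_L2[OF that(4,5)]
    by (intro tendsto_sum L2_mult_tendsto[OF L2_vec_nth[OF that(3)] L2_vec_nth[OF that(5)] L2_vec_nth[OF that(4)]
          L2_vec_nth[OF that(5)] comp[OF that(1,2)]]) simp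
  have FL: "F \<in> L2 \<mu>" "curl F \<in> L2 \<mu>" by (intro smooth_field_L2 smooth_field_curl F)+
  have "(\<lambda>n. LINT x|\<mu>. \<psi> n x \<bullet> curl F x) \<longlonglongrightarrow> (LINT x|\<mu>. E x \<bullet> curl F x)"
    by (rule inner_lim[OF dL(1) _ w(1) \<psi>L(1) FL(2)]) (use nn in simp)
  moreover have "(\<lambda>n. LINT x|\<mu>. curl (\<psi> n) x \<bullet> F x) \<longlonglongrightarrow> (LINT x|\<mu>. ?W x \<bullet> F x)"
    by (rule inner_lim[OF dL(2) _ W(1) \<psi>L(2) FL(1)]) (use nn in simp)
  \<comment> \<open>For the approximants the identity is the weak curl of F tested with
    \<open>\<psi> n\<close>, with no boundary term; F itself may be nonzero on the boundary.\<close>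
  moreover have "(LINT x|\<mu>. \<psi> n x \<bullet> curl F x) = (LINT x|\<mu>. curl (\<psi> n) x \<bullet> F x)" for n
    using smooth_has_weak_curl[OF F] \<psi>(1)[of n] unfolding has_weak_curl_def by (simp add: inner_commute)
  ultimately show ?thesis using LIMSEQ_unique by fastforce
qed

end

section \<open>The Maxwell stress tensor\<close>

text \<open>The scalar triple product \<open>a \<bullet> (b \<times> c)\<close>.\<close>

definition triple :: "real^3 \<Rightarrow> real^3 \<Rightarrow> real^3 \<Rightarrow> real" where
  "triple a b c = a $ 1 * (b $ 2 * c $ 3 - b $ 3 * c $ 2) + a $ 2 * (b $ 3 * c $ 1 - b $ 1 * c $ 3)
    + a $ 3 * (b $ 1 * c $ 2 - b $ 2 * c $ 1)"

context C11_bounded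
begin

lemma H1_deriv_smooth: "smooth f \<Longrightarrow> bo.H1_deriv f (\<lambda>i. partial i f)"
  unfolding bo.H1_deriv_def
  using bo.smooth_has_weak_partial[of f] smooth_L2_domain[of f] smooth_L2_domain[OF smooth_partial[of f]] by blast

lemma has_trace_smooth:
  assumes f: "smooth f" shows "has_trace \<Omega> f f"
proof -
  have "H1_norm \<Omega> (\<lambda>x. f x - f x) = 0"
    using bo.H1_norm_eq[of "\<lambda>i x. 0" "\<lambda>x. 0"] by (simp add: has_weak_partial_def)
  moreover have "f \<in> sobolev 1 \<Omega>" using H1_deriv_smooth[OF f] bo.sobolev_1_iff by blast
  ultimately show ?thesis
    using smooth_L2_\<sigma>[OF f] f unfolding has_trace_def by (intro conjI exI[of _ "\<lambda>n. f"]) auto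
qed

lemma Green_single:
  assumes H: "bo.H1_deriv u d" and g: "has_trace \<Omega> u g" and \<psi>: "smooth \<psi>"
  shows "(LINT x|\<mu>. d i x * \<psi> x + u x * partial i \<psi> x) = (LINT x|\<sigma>. g x * (\<psi> x * \<nu> x $ i))"
  using Green[OF H H1_deriv_smooth[OF smooth_const[of 1]] g has_trace_smooth[OF smooth_const[of 1]] \<psi>, of i]
  by simp

lemma smooth_\<nu>_nth_L2: "smooth \<psi> \<Longrightarrow> (\<lambda>x. \<psi> x * \<nu> x $ i) \<in> L2 \<sigma>"
  using smooth_\<nu>_L2_\<sigma>[of \<psi> "axis i 1"] by (simp add: inner_axis')

lemma \<nu>_mult_L2: "g \<in> L2 \<sigma> \<Longrightarrow> (\<lambda>x. g x * \<nu> x $ i) \<in> L2 \<sigma>"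
  using smooth_\<nu>_mult_L2[of "\<lambda>_. 1" g i] by (simp add: mult.commute)

lemma vec_trace_has_trace:
  assumes "H1_field u D" shows "has_trace \<Omega> (\<lambda>x. u x $ k) (\<lambda>x. vec_trace \<Omega> u x $ k)"
proof -
  have "(\<lambda>x. vec_trace \<Omega> u x $ k) = bdry_trace \<Omega> (\<lambda>x. u x $ k)" by (simp add: vec_trace_def)
  then show ?thesis using bdry_trace[OF H1_fieldD(1)[OF assms]] by simp
qed

lemma vec_trace_L2: "H1_field u D \<Longrightarrow> (\<lambda>x. vec_trace \<Omega> u x $ k) \<in> L2 \<sigma>"
  by (rule trace_L2[OF vec_trace_has_trace])

lemma AE_\<sigma>_zero:
  assumes "integrable \<sigma> f" "\<And>\<psi>. smooth \<psi> \<Longrightarrow> (LINT x|\<sigma>. \<psi> x * f x) = 0"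
  shows "AE x in \<sigma>. f x = 0"
  using test_functions_zero_AE[OF sets_\<sigma> assms(1) open_UNIV] assms(2) test_function_smooth by auto

text \<open>The volume identity holds for weights that do not vanish on the boundary. Green's
  formula therefore leaves only a boundary integral against an arbitrary smooth
  \<open>\<psi>\<close>, which forces its density to vanish.\<close>

lemma tangential_trace_component:
  assumes a: "bo.H1_deriv a d" "has_trace \<Omega> a g" and b: "bo.H1_deriv b e" "has_trace \<Omega> b k"
    and w: "w \<in> L2 \<mu>" "AE x in \<mu>. w x = e j x - d i x"
    and eq: "\<And>\<psi>. smooth \<psi> \<Longrightarrow> (LINT x|\<mu>. a x * partial i \<psi> x - b x * partial j \<psi> x) = (LINT x|\<mu>. w x * \<psi> x)"
  shows "AE x in \<sigma>. g x * \<nu> x $ i = k x * \<nu> x $ j"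
proof -
  have gk: "(\<lambda>x. g x * \<nu> x $ i) \<in> L2 \<sigma>" "(\<lambda>x. k x * \<nu> x $ j) \<in> L2 \<sigma>"
    by (intro \<nu>_mult_L2 trace_L2[OF a(2)] trace_L2[OF b(2)])+
  note ad = bo.H1_derivD[OF a(1)] and be = bo.H1_derivD[OF b(1)]
  have "AE x in \<sigma>. g x * \<nu> x $ i - k x * \<nu> x $ j = 0"
  proof (rule AE_\<sigma>_zero)
    show "integrable \<sigma> (\<lambda>x. g x * \<nu> x $ i - k x * \<nu> x $ j)"
      by (rule L2_integrable[OF finite_\<sigma> L2_diff[OF gk]])
    fix \<psi> :: "real^3 \<Rightarrow> real" assume \<psi>: "smooth \<psi>"
    have int: "integrable \<mu> (\<lambda>x. d i x * \<psi> x)" "integrable \<mu> (\<lambda>x. a x * partial i \<psi> x)"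
      "integrable \<mu> (\<lambda>x. e j x * \<psi> x)" "integrable \<mu> (\<lambda>x. b x * partial j \<psi> x)"
      by (intro bo.L2_integrable_mult ad be \<psi> smooth_partial)+
    have w': "(LINT x|\<mu>. w x * \<psi> x) = (LINT x|\<mu>. e j x * \<psi> x - d i x * \<psi> x)"
    proof (rule integral_cong_AE)
      show "AE x in \<mu>. w x * \<psi> x = e j x * \<psi> x - d i x * \<psi> x"
        using w(2) by eventually_elim (simp add: left_diff_distrib)
      show "(\<lambda>x. w x * \<psi> x) \<in> borel_measurable \<mu>"
        using bo.L2_integrable_mult[OF w(1) \<psi>] by (rule borel_measurable_integrable)
      show "(\<lambda>x. e j x * \<psi> x - d i x * \<psi> x) \<in> borel_measurable \<mu>"
        using int by (intro borel_measurable_diff borel_measurable_integrable)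
    qed
    have bi: "integrable \<sigma> (\<lambda>x. g x * (\<psi> x * \<nu> x $ i))" "integrable \<sigma> (\<lambda>x. k x * (\<psi> x * \<nu> x $ j))"
      by (intro L2_mult_integrable trace_L2[OF a(2)] trace_L2[OF b(2)] smooth_\<nu>_nth_L2 \<psi>)+
    have "(LINT x|\<sigma>. \<psi> x * (g x * \<nu> x $ i - k x * \<nu> x $ j))
        = (LINT x|\<sigma>. g x * (\<psi> x * \<nu> x $ i) - k x * (\<psi> x * \<nu> x $ j))"
      by (rule Bochner_Integration.integral_cong) (auto simp: algebra_simps)
    also have "\<dots> = (LINT x|\<sigma>. g x * (\<psi> x * \<nu> x $ i)) - (LINT x|\<sigma>. k x * (\<psi> x * \<nu> x $ j))"
      by (rule Bochner_Integration.integral_diff[OF bi])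
    also have "\<dots> = (LINT x|\<mu>. d i x * \<psi> x + a x * partial i \<psi> x) - (LINT x|\<mu>. e j x * \<psi> x + b x * partial j \<psi> x)"
      using Green_single[OF a \<psi>] Green_single[OF b \<psi>] by simp
    also have "\<dots> = (LINT x|\<mu>. a x * partial i \<psi> x - b x * partial j \<psi> x) - (LINT x|\<mu>. w x * \<psi> x)"
      unfolding w' using int by simp
    also have "\<dots> = 0" using eq[OF \<psi>] by simp
    finally show "(LINT x|\<sigma>. \<psi> x * (g x * \<nu> x $ i - k x * \<nu> x $ j)) = 0" .
  qed
  then show ?thesis by eventually_elim simp
qed

lemma tangential_trace_zero:
  assumes H: "H1_field u D" and w: "w \<in> L2 \<mu>" "AE x in \<mu>. w x = curl_of D x"
    and eq: "\<And>F. smooth_field F \<Longrightarrow> (LINT x|\<mu>. u x \<bullet> curl F x) = (LINT x|\<mu>. w x \<bullet> F x)"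
  defines "t \<equiv> vec_trace \<Omega> u"
  shows "AE x in \<sigma>. t x $ 2 * \<nu> x $ 3 = t x $ 3 * \<nu> x $ 2 \<and> t x $ 3 * \<nu> x $ 1 = t x $ 1 * \<nu> x $ 3 \<and>
    t x $ 1 * \<nu> x $ 2 = t x $ 2 * \<nu> x $ 1"
proof -
  note tr = vec_trace_has_trace[OF H, folded t_def] and h = H1_fieldD(1)[OF H]
  have wk: "(\<lambda>x. w x $ k) \<in> L2 \<mu>" for k by (rule L2_vec_nth[OF w(1)])
  have ae: "AE x in \<mu>. w x $ 1 = D 3 2 x - D 2 3 x" "AE x in \<mu>. w x $ 2 = D 1 3 x - D 3 1 x"
    "AE x in \<mu>. w x $ 3 = D 2 1 x - D 1 2 x"
    using w(2) by (eventually_elim, simp add: curl_of_def)+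
  have eq': "(LINT x|\<mu>. u x \<bullet> curl (\<lambda>x. \<psi> x *\<^sub>R axis k 1) x) = (LINT x|\<mu>. w x $ k * \<psi> x)" if "smooth \<psi>" for \<psi> k
    using eq[OF smooth_field_axis[OF that, of k]] by (simp add: inner_axis mult.commute)
  have "AE x in \<sigma>. t x $ 2 * \<nu> x $ 3 = t x $ 3 * \<nu> x $ 2"
    using eq'[of _ 1] by (intro tangential_trace_component[OF h tr h tr wk ae(1)]) (simp add: curl_axis inner_vector_3)
  moreover have "AE x in \<sigma>. t x $ 3 * \<nu> x $ 1 = t x $ 1 * \<nu> x $ 3"
    using eq'[of _ 2] by (intro tangential_trace_component[OF h tr h tr wk ae(2)]) (simp add: curl_axis inner_vector_3)
  moreover have "AE x in \<sigma>. t x $ 1 * \<nu> x $ 2 = t x $ 2 * \<nu> x $ 1"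
    using eq'[of _ 3] by (intro tangential_trace_component[OF h tr h tr wk ae(3)]) (simp add: curl_axis inner_vector_3)
  ultimately show ?thesis by eventually_elim blast
qed

text \<open>Orthogonality to the gradients of all smooth functions, including those free on the
  boundary, reduces by Green's formula and zero divergence to a boundary integral of
  \<open>\<psi>\<close> times the normal trace.\<close>

lemma normal_trace_zero:
  assumes H: "H1_field u D" and div: "AE x in \<mu>. (\<Sum>k\<in>UNIV. D k k x) = 0"
    and eq: "\<And>\<psi>. smooth \<psi> \<Longrightarrow> (LINT x|\<mu>. u x \<bullet> grad \<psi> x) = 0"
  shows "AE x in \<sigma>. vec_trace \<Omega> u x \<bullet> \<nu> x = 0"
proof (rule AE_\<sigma>_zero)
  let ?t = "vec_trace \<Omega> u"
  have "(\<lambda>x. \<Sum>k\<in>UNIV. ?t x $ k * \<nu> x $ k) \<in> L2 \<sigma>" by (intro L2_sum \<nu>_mult_L2 vec_trace_L2[OF H])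
  then show "integrable \<sigma> (\<lambda>x. ?t x \<bullet> \<nu> x)"
    using L2_integrable[OF finite_\<sigma>] by (simp add: inner_vec_def)
  fix \<psi> :: "real^3 \<Rightarrow> real" assume \<psi>: "smooth \<psi>"
  have int: "integrable \<mu> (\<lambda>x. D k k x * \<psi> x)" "integrable \<mu> (\<lambda>x. u x $ k * partial k \<psi> x)" for k
    by (intro bo.L2_integrable_mult H1_fieldD[OF H] \<psi> smooth_partial)+
  have "(LINT x|\<sigma>. \<psi> x * (?t x \<bullet> \<nu> x)) = (LINT x|\<sigma>. (\<Sum>k\<in>UNIV. ?t x $ k * (\<psi> x * \<nu> x $ k)))"
    by (rule Bochner_Integration.integral_cong) (auto simp: inner_vec_def sum_distrib_left mult_ac)
  also have "\<dots> = (\<Sum>k\<in>UNIV. (LINT x|\<sigma>. ?t x $ k * (\<psi> x * \<nu> x $ k)))"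
    by (rule Bochner_Integration.integral_sum) (intro L2_mult_integrable vec_trace_L2[OF H] smooth_\<nu>_nth_L2 \<psi>)
  also have "\<dots> = (\<Sum>k\<in>UNIV. (LINT x|\<mu>. D k k x * \<psi> x + u x $ k * partial k \<psi> x))"
    using Green_single[OF H1_fieldD(1)[OF H] vec_trace_has_trace[OF H] \<psi>] by simp
  also have "\<dots> = (\<Sum>k\<in>UNIV. (LINT x|\<mu>. D k k x * \<psi> x)) + (\<Sum>k\<in>UNIV. (LINT x|\<mu>. u x $ k * grad \<psi> x $ k))"
    using int by (simp add: sum.distrib grad_def)
  also have "(\<Sum>k\<in>UNIV. (LINT x|\<mu>. u x $ k * grad \<psi> x $ k)) = 0"
    using integral_inner_L2[OF H1_fieldD(5)[OF H] smooth_field_L2[OF smooth_field_grad[OF \<psi>]]] eq[OF \<psi>] by simp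
  also have "(\<Sum>k\<in>UNIV. (LINT x|\<mu>. D k k x * \<psi> x)) = (LINT x|\<mu>. (\<Sum>k\<in>UNIV. D k k x * \<psi> x))"
    by (rule Bochner_Integration.integral_sum[symmetric]) (rule int)
  also have "\<dots> = 0"
  proof (rule integral_eq_zero_AE)
    show "AE x in \<mu>. (\<Sum>k\<in>UNIV. D k k x * \<psi> x) = 0"
      using div by eventually_elim (simp flip: sum_distrib_right)
  qed
  finally show "(LINT x|\<sigma>. \<psi> x * (?t x \<bullet> \<nu> x)) = 0" by simp
qed

text \<open>The identity \<open>\<partial>\<^sub>j (T\<^sub>i\<^sub>j x\<^sub>i) = x \<bullet> div T + tr T\<close> for \<open>T\<^sub>i\<^sub>j = u\<^sub>i u\<^sub>j - \<delta>\<^sub>i\<^sub>j |u|\<^sup>2 / 2\<close>, integrated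
  over \<open>\<Omega>\<close>; for divergence free \<open>u\<close> one has \<open>div T = curl u \<times> u\<close>.\<close>

lemma stress_identity:
  assumes H: "H1_field u D" and div: "AE x in \<mu>. (\<Sum>k\<in>UNIV. D k k x) = 0"
    and c: "AE x in \<mu>. c x = curl_of D x" and cL: "c \<in> L2 \<mu>"
  defines "t \<equiv> vec_trace \<Omega> u"
  shows "integrable \<mu> (\<lambda>x. triple x (c x) (u x) - 1/2 * (norm (u x))\<^sup>2)"
    and "integrable \<sigma> (\<lambda>x. (t x \<bullet> x) * (t x \<bullet> \<nu> x) - 1/2 * (norm (t x))\<^sup>2 * (x \<bullet> \<nu> x))"
    and "(LINT x|\<mu>. triple x (c x) (u x) - 1/2 * (norm (u x))\<^sup>2)
      = (LINT x|\<sigma>. (t x \<bullet> x) * (t x \<bullet> \<nu> x) - 1/2 * (norm (t x))\<^sup>2 * (x \<bullet> \<nu> x))"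
proof -
  note tr = vec_trace_has_trace[OF H, folded t_def] and h = H1_fieldD[OF H] and tL = vec_trace_L2[OF H, folded t_def]
  define G where "G i j k x = D i k x * (x $ j * u x $ i) + u x $ i * (x $ j * D i k x)
    + u x $ i * (partial k (\<lambda>x. x $ j) x * u x $ i)" for i j k x
  \<comment> \<open>\<open>L i j\<close> expands the derivative in direction j of x_i u_i u_j. The
    sum of the following \<open>L'\<close> is the divergence of \<open>|u|^2 x\<close>.
    \<open>R\<close> and \<open>R'\<close> are the corresponding boundary integrands.\<close>
  define L where "L i j x = D i j x * (x $ i * u x $ j) + u x $ i * (x $ i * D j j x)
    + u x $ i * (partial j (\<lambda>x. x $ i) x * u x $ j)" for i j x
  define L' where "L' i k x = D k i x * (x $ i * u x $ k) + u x $ k * (x $ i * D k i x)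
    + u x $ k * (partial i (\<lambda>x. x $ i) x * u x $ k)" for i k x
  define R where "R i j x = t x $ i * (x $ i * (\<nu> x $ j) * t x $ j)" for i j x
  define R' where "R' i k x = t x $ k * (x $ i * (\<nu> x $ i) * t x $ k)" for i k x
  have eqs: "(LINT x|\<mu>. L i j x) = (LINT x|\<sigma>. R i j x)" "(LINT x|\<mu>. L' i j x) = (LINT x|\<sigma>. R' i j x)" for i j
    unfolding L_def R_def L'_def R'_def by (rule Green[OF h(1) h(1) tr tr smooth_coord])+
  have iL: "integrable \<mu> (L i j)" "integrable \<mu> (L' i j)" for i j
    unfolding L_def[abs_def] L'_def[abs_def]
    by (intro Bochner_Integration.integrable_add L2_mult_integrable bo.L2_smooth_mult h smooth_coord smooth_partial)+
  have iR: "integrable \<sigma> (R i j)" "integrable \<sigma> (R' i j)" for i j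
    unfolding R_def[abs_def] R'_def[abs_def]
    by (intro L2_mult_integrable tL smooth_\<nu>_mult_L2 smooth_coord)+
  let ?left = "\<lambda>x. (\<Sum>i\<in>UNIV. \<Sum>j\<in>UNIV. L i j x) - 1/2 * (\<Sum>i\<in>UNIV. \<Sum>j\<in>UNIV. L' i j x)"
  let ?right = "\<lambda>x. (\<Sum>i\<in>UNIV. \<Sum>j\<in>UNIV. R i j x) - 1/2 * (\<Sum>i\<in>UNIV. \<Sum>j\<in>UNIV. R' i j x)"
  have sums: "integrable M (\<lambda>x. (\<Sum>i\<in>UNIV. \<Sum>j\<in>UNIV. f i j x) - 1/2 * (\<Sum>i\<in>UNIV. \<Sum>j\<in>UNIV. g i j x))"
    "(LINT x|M. (\<Sum>i\<in>UNIV. \<Sum>j\<in>UNIV. f i j x) - 1/2 * (\<Sum>i\<in>UNIV. \<Sum>j\<in>UNIV. g i j x))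
      = (\<Sum>i\<in>UNIV. \<Sum>j\<in>UNIV. (LINT x|M. f i j x)) - 1/2 * (\<Sum>i\<in>UNIV. \<Sum>j\<in>UNIV. (LINT x|M. g i j x))"
    if "\<And>i j. integrable M (f i j)" "\<And>i j. integrable M (g i j)" for M :: "(real^3) measure" and f g :: "3 \<Rightarrow> 3 \<Rightarrow> real^3 \<Rightarrow> real"
    using that by (simp_all add: Bochner_Integration.integral_sum Bochner_Integration.integrable_sum)
  have left: "AE x in \<mu>. triple x (c x) (u x) - 1/2 * (norm (u x))\<^sup>2 = ?left x"
    using div c
  proof eventually_elim
    case (elim x)
    \<comment> \<open>Zero divergence removes the terms in D j j. The other derivative terms form x
      \<bullet> (curl u \<times> u), and the undifferentiated ones leave |u|^2 - 3/2 |u|^2.\<close>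
    have d3: "D 3 3 x = - D 1 1 x - D 2 2 x" using elim(1) by (simp add: sum_3)
    show ?case
      unfolding elim(2) L_def L'_def norm_square_inner triple_def curl_of_def sum_3 inner_vec_def partial_coord
      by (simp add: d3 field_simps)
  qed
  have right: "(t x \<bullet> x) * (t x \<bullet> \<nu> x) - 1/2 * (norm (t x))\<^sup>2 * (x \<bullet> \<nu> x) = ?right x" for x
    unfolding R_def R'_def norm_square_inner sum_3 inner_vec_def by (simp add: field_simps)
  have m: "(\<lambda>x. triple x (c x) (u x) - 1/2 * (norm (u x))\<^sup>2) \<in> borel_measurable \<mu>"
  proof -
    have [measurable]: "(\<lambda>x. c x $ k) \<in> borel_measurable \<mu>" "(\<lambda>x. u x $ k) \<in> borel_measurable \<mu>"
      "(\<lambda>x. x $ k) \<in> borel_measurable \<mu>" for k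
      using L2_measurable[OF L2_vec_nth[OF cL]] L2_measurable[OF h(2)] L2_measurable[OF smooth_L2_domain[OF smooth_coord]] by auto
    show ?thesis unfolding triple_def norm_square_inner inner_vec_def inner_real_def by measurable
  qed
  show "integrable \<mu> (\<lambda>x. triple x (c x) (u x) - 1/2 * (norm (u x))\<^sup>2)"
    by (rule Bochner_Integration.integrable_cong_AE_imp[OF sums(1)[of \<mu> L L', OF iL] m]) (use left in \<open>auto simp: eq_commute\<close>)
  show "integrable \<sigma> (\<lambda>x. (t x \<bullet> x) * (t x \<bullet> \<nu> x) - 1/2 * (norm (t x))\<^sup>2 * (x \<bullet> \<nu> x))"
    unfolding right by (rule sums(1)[OF iR])
  have "(LINT x|\<mu>. triple x (c x) (u x) - 1/2 * (norm (u x))\<^sup>2) = (LINT x|\<mu>. ?left x)"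
    by (rule integral_cong_AE[OF m borel_measurable_integrable[OF sums(1)[OF iL]] left])
  also have "\<dots> = (LINT x|\<sigma>. ?right x)" unfolding sums(2)[OF iL] sums(2)[OF iR] eqs ..
  finally show "(LINT x|\<mu>. triple x (c x) (u x) - 1/2 * (norm (u x))\<^sup>2)
      = (LINT x|\<sigma>. (t x \<bullet> x) * (t x \<bullet> \<nu> x) - 1/2 * (norm (t x))\<^sup>2 * (x \<bullet> \<nu> x))"
    unfolding right .
qed

text \<open>The hypotheses say that e \<times> n = 0, and expanding e \<times> (e \<times> n) = 0
  gives (e \<bullet> n) e = (e \<bullet> e) n. Neither vector has to be nonzero.\<close>

lemma parallel_vectors:
  fixes e n x :: "real^3"
  assumes "e $ 2 * n $ 3 = e $ 3 * n $ 2" "e $ 3 * n $ 1 = e $ 1 * n $ 3" "e $ 1 * n $ 2 = e $ 2 * n $ 1"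
  shows "(e \<bullet> x) * (e \<bullet> n) = (e \<bullet> e) * (x \<bullet> n)"
proof -
  have gen: "(a * k + b * l + c * m) * a = (a * a + b * b + c * c) * k"
    if "a * l = b * k" "a * m = c * k" for a b c k l m :: real
  proof -
    have "(a * k + b * l + c * m) * a = a * a * k + b * (a * l) + c * (a * m)" by (simp add: algebra_simps)
    also have "\<dots> = (a * a + b * b + c * c) * k" unfolding that by (simp add: algebra_simps)
    finally show ?thesis .
  qed
  have "(e \<bullet> n) * e $ 1 = (e \<bullet> e) * n $ 1"
    using gen[OF assms(3) assms(2)[symmetric]] by (simp add: inner_vec_def sum_3)
  moreover have "(e \<bullet> n) * e $ 2 = (e \<bullet> e) * n $ 2"
    using gen[OF assms(3)[symmetric] assms(1)] by (simp add: inner_vec_def sum_3 add.commute add.left_commute)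
  moreover have "(e \<bullet> n) * e $ 3 = (e \<bullet> e) * n $ 3"
    using gen[OF assms(2) assms(1)[symmetric]] by (simp add: inner_vec_def sum_3 add.commute add.left_commute)
  ultimately have "(e \<bullet> n) * e $ i = (e \<bullet> e) * n $ i" for i
    using exhaust_3[of i] by auto
  then have "(\<Sum>i\<in>UNIV. (e \<bullet> n) * e $ i * x $ i) = (\<Sum>i\<in>UNIV. (e \<bullet> e) * n $ i * x $ i)" by simp
  then show ?thesis
    by (simp add: inner_vec_def[of e x] inner_vec_def[of x n] sum_distrib_left sum_distrib_right mult_ac)
qed

text \<open>The stress identity for \<open>curl E\<close> plus \<open>lam\<close> times the one for
  \<open>E\<close>: each field is, up to a factor, the curl of the other, and this makes the volume
  terms with x cancel.\<close>

lemma eigenvalue_identity: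
  fixes E :: "real^3 \<Rightarrow> real^3"
  assumes eig: "maxwell_eigenpair \<tau> \<Omega> lam E" and one: "(LINT x|\<mu>. (norm (E x))\<^sup>2) = 1"
    and H2: "\<forall>i. (\<lambda>x. E x $ i) \<in> sobolev 2 \<Omega>"
  shows "lam = 1 / 2 * (LINT x|\<sigma>.
       ((norm (vec_trace \<Omega> (weak_curl \<Omega> E) x))\<^sup>2 - lam * (norm (vec_trace \<Omega> E x))\<^sup>2) * (x \<bullet> \<nu> x))"
proof -
  let ?W = "weak_curl \<Omega> E"
  have XN: "E \<in> X_N \<Omega>" and dv0: "AE x in \<mu>. weak_div \<Omega> E x = 0"
    and weq: "\<And>\<phi>. \<phi> \<in> X_N \<Omega> \<Longrightarrow> (LINT x|\<mu>. ?W x \<bullet> weak_curl \<Omega> \<phi> x)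
        + \<tau> * (LINT x|\<mu>. weak_div \<Omega> E x * weak_div \<Omega> \<phi> x) = lam * (LINT x|\<mu>. E x \<bullet> \<phi> x)"
    using eig by (auto simp: maxwell_eigenpair_def X_N_div0_def)
  \<comment> \<open>The penalty term drops out because E has zero divergence.\<close>
  have weq': "(LINT x|\<mu>. ?W x \<bullet> weak_curl \<Omega> \<phi> x) = lam * (LINT x|\<mu>. E x \<bullet> \<phi> x)" if "\<phi> \<in> X_N \<Omega>" for \<phi>
  proof -
    have "AE x in \<mu>. weak_div \<Omega> E x * weak_div \<Omega> \<phi> x = 0" using dv0 by eventually_elim simp
    then have "(LINT x|\<mu>. weak_div \<Omega> E x * weak_div \<Omega> \<phi> x) = 0" by (rule integral_eq_zero_AE)
    then show ?thesis using weq[OF that] by simp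
  qed
  have H0: "E \<in> H0_curl \<Omega>" using XN by (simp add: X_N_def)
  then obtain w where w: "E \<in> L2 \<mu>" "w \<in> L2 \<mu>" "has_weak_curl \<Omega> E w"
    by (auto simp: H0_curl_def H_curl_def)
  note W = weak_curl_props(1,2)[OF w(2,3)]
  obtain dv where dv: "dv \<in> L2 \<mu>" "has_weak_div \<Omega> E dv" using XN by (auto simp: X_N_def H_div_def)
  note Div = weak_div_props[OF dv]
  have "\<forall>j i. \<exists>v. v \<in> sobolev 1 \<Omega> \<and> has_weak_partial \<Omega> i (\<lambda>x. E x $ j) v"
    using H2 by (auto simp: numeral_2_eq_2)
  then obtain D where D: "\<And>j i. D j i \<in> sobolev 1 \<Omega>" "\<And>j i. has_weak_partial \<Omega> i (\<lambda>x. E x $ j) (D j i)"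
    by metis
  have D1: "\<exists>e. bo.H1_deriv (D j i) e" for j i using D(1) bo.sobolev_1_iff by blast
  have HE: "H1_field E D"
    unfolding H1_field_def bo.H1_deriv_def using L2_vec_nth[OF w(1)] D(2) D1 bo.H1_derivD(1) by blast
  have cE: "AE x in \<mu>. ?W x = curl_of D x" by (rule weak_curl_AE[OF HE W])
  obtain D' where HW: "H1_field ?W D'" using H2_curl_H1[OF HE D1 W(1) cE] by blast
  have divE: "AE x in \<mu>. (\<Sum>k\<in>UNIV. D k k x) = 0"
  proof (rule weak_div_AE[OF HE])
    fix \<phi> assume \<phi>: "test_function \<Omega> \<phi>"
    have "AE x in \<mu>. weak_div \<Omega> E x * \<phi> x = 0" using dv0 by eventually_elim simp
    then have "(LINT x|\<mu>. weak_div \<Omega> E x * \<phi> x) = 0" by (rule integral_eq_zero_AE)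
    then show "(LINT x|\<mu>. E x \<bullet> grad \<phi> x) = 0" using Div(2) \<phi> by (simp add: has_weak_div_def)
  qed
  have smooth_eq: "(LINT x|\<mu>. E x \<bullet> curl F x) = (LINT x|\<mu>. ?W x \<bullet> F x)" if "smooth_field F" for F
    by (rule H0_curl_smooth[OF H0 that])
  have grad0: "(LINT x|\<mu>. ?W x \<bullet> grad \<psi> x) = 0" if "smooth \<psi>" for \<psi>
    using smooth_eq[OF smooth_field_grad[OF that]] curl_grad[OF that] by simp
  have divW: "AE x in \<mu>. (\<Sum>k\<in>UNIV. D' k k x) = 0"
    by (rule weak_div_AE[OF HW]) (rule grad0[OF test_function_smooth])
  have lamE: "(\<lambda>x. lam *\<^sub>R E x) \<in> L2 \<mu>"
    unfolding L2_vec_iff using L2_vec_nth[OF w(1)] by (auto intro: L2_cmult)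
  \<comment> \<open>Testing the eigenvalue equation with test fields is the weak form of curl W =
    lam E.\<close>
  have "has_weak_curl \<Omega> ?W (\<lambda>x. lam *\<^sub>R E x)"
    unfolding has_weak_curl_def
  proof (intro allI impI)
    fix \<phi> assume \<phi>: "test_field \<Omega> \<phi>"
    have S: "smooth_field \<phi>" by (rule test_field_smooth[OF \<phi>])
    note p = weak_curl_props[OF smooth_field_L2[OF smooth_field_curl[OF S]] smooth_has_weak_curl[OF S]]
    have "(LINT x|\<mu>. ?W x \<bullet> curl \<phi> x) = (LINT x|\<mu>. ?W x \<bullet> weak_curl \<Omega> \<phi> x)"
    proof (rule integral_cong_AE)
      show "AE x in \<mu>. ?W x \<bullet> curl \<phi> x = ?W x \<bullet> weak_curl \<Omega> \<phi> x" using p(3) by eventually_elim simp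
    qed (intro borel_measurable_inner L2_measurable[OF W(1)] L2_measurable[OF p(1)]
        L2_measurable[OF smooth_field_L2[OF smooth_field_curl[OF S]]])+
    also have "\<dots> = lam * (LINT x|\<mu>. E x \<bullet> \<phi> x)" by (rule weq'[OF test_field_X_N[OF \<phi>]])
    finally show "(LINT x|\<mu>. ?W x \<bullet> curl \<phi> x) = (LINT x|\<mu>. lam *\<^sub>R E x \<bullet> \<phi> x)" by simp
  qed
  then have cW: "AE x in \<mu>. lam *\<^sub>R E x = curl_of D' x" by (rule weak_curl_AE[OF HW lamE])
  \<comment> \<open>The eigenvalue equation is tested with E itself, and E is normalised.\<close>
  have WW: "(LINT x|\<mu>. (norm (?W x))\<^sup>2) = lam"
    using weq'[OF XN] one by (simp add: norm_square_inner)
  let ?e = "vec_trace \<Omega> E" and ?w = "vec_trace \<Omega> ?W"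
  note sE = stress_identity[OF HE divE cE W(1)] and sW = stress_identity[OF HW divW cW lamE]
  have iE: "integrable \<mu> (\<lambda>x. (norm (E x))\<^sup>2)" and iW: "integrable \<mu> (\<lambda>x. (norm (?W x))\<^sup>2)"
    using w(1) W(1) by (auto simp: L2_def)
  have nt: "AE x in \<sigma>. ?w x \<bullet> \<nu> x = 0"
    by (rule normal_trace_zero[OF HW divW]) (rule grad0)
  have tt: "AE x in \<sigma>. ?e x $ 2 * \<nu> x $ 3 = ?e x $ 3 * \<nu> x $ 2 \<and> ?e x $ 3 * \<nu> x $ 1 = ?e x $ 1 * \<nu> x $ 3 \<and>
    ?e x $ 1 * \<nu> x $ 2 = ?e x $ 2 * \<nu> x $ 1"
    by (rule tangential_trace_zero[OF HE W(1) cE]) (rule smooth_eq)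
  let ?B = "\<lambda>t x. (t x \<bullet> x) * (t x \<bullet> \<nu> x) - 1/2 * (norm (t x))\<^sup>2 * (x \<bullet> \<nu> x)"
  have "(LINT x|\<sigma>. ?B ?w x) + lam * (LINT x|\<sigma>. ?B ?e x)
      = (LINT x|\<mu>. (triple x (lam *\<^sub>R E x) (?W x) - 1/2 * (norm (?W x))\<^sup>2)
          + lam * (triple x (?W x) (E x) - 1/2 * (norm (E x))\<^sup>2))"
    using sE sW by simp
  \<comment> \<open>The triple products cancel: x \<bullet> (lam E \<times> W) and lam times x
    \<bullet> (W \<times> E) are opposite.\<close>
  also have "\<dots> = (LINT x|\<mu>. - 1/2 * (norm (?W x))\<^sup>2 - lam / 2 * (norm (E x))\<^sup>2)"
    by (rule Bochner_Integration.integral_cong) (auto simp: triple_def algebra_simps)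
  also have "\<dots> = - lam" using iE iW WW one by simp
  finally have bal: "(LINT x|\<sigma>. ?B ?w x) + lam * (LINT x|\<sigma>. ?B ?e x) = - lam" .
  have "(LINT x|\<sigma>. ?B ?w x) + lam * (LINT x|\<sigma>. ?B ?e x) = (LINT x|\<sigma>. ?B ?w x + lam * ?B ?e x)"
    using sE(2) sW(2) by simp
  also have "\<dots> = (LINT x|\<sigma>. - 1/2 * (((norm (?w x))\<^sup>2 - lam * (norm (?e x))\<^sup>2) * (x \<bullet> \<nu> x)))"
  proof (rule integral_cong_AE)
    show "AE x in \<sigma>. ?B ?w x + lam * ?B ?e x = - 1/2 * (((norm (?w x))\<^sup>2 - lam * (norm (?e x))\<^sup>2) * (x \<bullet> \<nu> x))"
      using nt tt
    proof eventually_elim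
      case (elim x)
      \<comment> \<open>For E the first term of \<open>?B\<close> is |e|^2 (x \<bullet> \<nu>),
        which turns the coefficient -1/2 into +1/2; for W the first term vanishes. Hence the
        opposite signs in the final integrand.\<close>
      have "(?e x \<bullet> x) * (?e x \<bullet> \<nu> x) = (norm (?e x))\<^sup>2 * (x \<bullet> \<nu> x)"
        unfolding norm_square_inner using elim(2) by (intro parallel_vectors) auto
      then show ?case using elim(1) by (simp add: algebra_simps)
    qed
    show "(\<lambda>x. ?B ?w x + lam * ?B ?e x) \<in> borel_measurable \<sigma>"
      using sE(2) sW(2) by (intro borel_measurable_integrable) auto
    have [measurable]: "?e \<in> borel_measurable borel" "?w \<in> borel_measurable borel" "\<nu> \<in> borel_measurable borel"
      using L2_measurable[of ?e \<sigma>] L2_measurable[of ?w \<sigma>] vec_trace_L2[OF HE] vec_trace_L2[OF HW]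
        outer_normal_borel by (auto simp: L2_vec_iff)
    show "(\<lambda>x. - 1/2 * (((norm (?w x))\<^sup>2 - lam * (norm (?e x))\<^sup>2) * (x \<bullet> \<nu> x))) \<in> borel_measurable \<sigma>"
      unfolding measurable_\<sigma> by measurable
  qed
  also have "\<dots> = - 1/2 * (LINT x|\<sigma>. ((norm (?w x))\<^sup>2 - lam * (norm (?e x))\<^sup>2) * (x \<bullet> \<nu> x))"
    by (rule integral_mult_right_zero)
  finally show ?thesis using bal by simp
qed

end

theorem theorem4p19:
  fixes \<Omega> :: "(real^3) set" and E :: "real^3 \<Rightarrow> real^3" and lam \<tau> :: real
  assumes "bounded \<Omega>" and "C11_domain \<Omega>"
    and "\<tau> > 0"
    and "maxwell_eigenpair \<tau> \<Omega> lam E"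
    and "(LINT x|lebesgue_on \<Omega>. (norm (E x))\<^sup>2) = 1"
    and "\<forall>i. (\<lambda>x. E x $ i) \<in> sobolev 2 \<Omega>"
  shows "lam = 1 / 2 *
    (LINT x|surface_measure \<Omega>.
       ((norm (vec_trace \<Omega> (weak_curl \<Omega> E) x))\<^sup>2 - lam * (norm (vec_trace \<Omega> E x))\<^sup>2)
       * (x \<bullet> outer_normal \<Omega> x))"
proof -
  interpret C11_bounded \<Omega> using assms(1,2) by unfold_locales
  show ?thesis by (rule eigenvalue_identity[OF assms(4-6)])
qed

end
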